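(* Let $c>2$ and let $\omega$ be the matrix multiplication exponent. Suppose that (i) $\omega=2$, (ii) NSETH holds, and (iii) there exists a fine-grained reduction from (all-pairs CFL reachability, $n^{c}$) to (s-t CFL reachability, $n^{c'}$) for some $c'>2$. Then there is no fine-grained reduction from (Triangle Collection, $n^3$) or from ($\Delta$ Matching Triangles, $n^3$) to (CFL reachability, $n^c$), where CFL reachability may be either the s-t or the all-pairs version.
   Context: CFL reachability: given a fixed context-free grammar $G$ with start nonterminal $S$ and a directed graph on $n$ vertices with edges labeled by terminals, a path is an $S$-path if its label word is in $\mathcal{L}(G)$; s-t CFL reachability asks whether there is an $S$-path from given $s$ to given $t$, all-pairs CFL reachability asks this for all pairs of vertices. Triangle Collection: given an $n$-vertex graph with colored vertices, decide whether for every triple of distinct colors there is a triangle whose vertices have these colors. $\Delta$ Matching Triangles: given an $n$-vertex graph with colored vertices and an integer $\Delta$, decide whether there is a triple of colors with at least $\Delta$ triangles whose vertices are colored by this triple. NSETH: there is no $\epsilon>0$ such that for every $k$, $k$-SAT on $n$ variables can be solved co-nondeterministically in time $\mathcal{O}(2^{(1-\epsilon)n})$. $\omega$ is the infimum of $c$ such that $n\times n$ matrices can be multiplied in $\mathcal{O}(n^c)$ time. For problems $P,Q$ with time bounds $t_P,t_Q$, a fine-grained reduction from $(P,t_P)$ to $(Q,t_Q)$ is an algorithm mapping an instance $I$ of $P$ to an instance $J$ of $Q$ such that $I$ is a YES-instance iff $J$ is, for every $\epsilon>0$ there is $\delta>0$ with $t_Q(|J|)^{1-\epsilon}=\mathcal{O}(t_P(|I|)^{1-\delta})$,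 and the reduction runs in time $\mathcal{O}(t_P(|I|)^{1-\gamma})$ for some $\gamma>0$. *)

theory Defs
  imports
    Complex_Main
    "HOL-Library.Landau_Symbols"
    "HOL-Library.Going_To_Filter"
    "HOL-Library.Log_Nat"
    "Jordan_Normal_Form.Matrix"
begin

section \<open>Machine model\<close>

text \<open>
  A random access machine with logarithmic costs, programmed in a structured language.
  The memory is an integer array with indirect addressing; addresses range over all integers so
  that addressing is total. Up to polylogarithmic factors, which the exponents below absorb,
  the model agrees with the word RAM with words of logarithmic length.
\<close>

type_synonym mem = "int \<Rightarrow> int"

datatype exp =
    Const int
  | Load exp
  | Add exp exp
  | Sub exp exp
  | Mult exp exp
  | Quot exp exp
  | Less exp exp

fun val :: "exp \<Rightarrow> mem \<Rightarrow> int" where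
  "val (Const k) m = k"
| "val (Load e) m = m (val e m)"
| "val (Add e1 e2) m = val e1 m + val e2 m"
| "val (Sub e1 e2) m = val e1 m - val e2 m"
| "val (Mult e1 e2) m = val e1 m * val e2 m"
| "val (Quot e1 e2) m = val e1 m div val e2 m"
| "val (Less e1 e2) m = (if val e1 m < val e2 m then 1 else 0)"

definition len :: "int \<Rightarrow> nat" where
  "len k = 1 + floorlog 2 (nat \<bar>k\<bar>)"

text \<open>Every operation is charged the lengths of its operands; the length of the
  value of an expression is charged where that value is used.\<close>

fun exp_cost :: "exp \<Rightarrow> mem \<Rightarrow> nat" where
  "exp_cost (Const k) m = 1"
| "exp_cost (Load e) m = exp_cost e m + len (val e m) + len (m (val e m))"
| "exp_cost (Add e1 e2) m = exp_cost e1 m + exp_cost e2 m + len (val e1 m) + len (val e2 m)"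
| "exp_cost (Sub e1 e2) m = exp_cost e1 m + exp_cost e2 m + len (val e1 m) + len (val e2 m)"
| "exp_cost (Mult e1 e2) m = exp_cost e1 m + exp_cost e2 m + len (val e1 m) + len (val e2 m)"
| "exp_cost (Quot e1 e2) m = exp_cost e1 m + exp_cost e2 m + len (val e1 m) + len (val e2 m)"
| "exp_cost (Less e1 e2) m = exp_cost e1 m + exp_cost e2 m + len (val e1 m) + len (val e2 m)"

text \<open>\<open>Store a e\<close> writes the value of \<open>e\<close> to address \<open>a\<close>; \<open>Guess a\<close> writes a
  nondeterministically chosen bit to address \<open>a\<close>.\<close>

datatype com =
    Skip
  | Store exp exp
  | Guess exp
  | Seq com com
  | If exp com com
  | While exp com

fun deterministic :: "com \<Rightarrow> bool" where
  "deterministic Skip = True"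
| "deterministic (Store a e) = True"
| "deterministic (Guess a) = False"
| "deterministic (Seq c1 c2) = (deterministic c1 \<and> deterministic c2)"
| "deterministic (If e c1 c2) = (deterministic c1 \<and> deterministic c2)"
| "deterministic (While e c) = deterministic c"

text \<open>\<open>step s t s'\<close>: a single step of cost \<open>t\<close>. Exactly the configurations
  with program \<open>Skip\<close> are halted.\<close>

inductive step :: "com \<times> mem \<Rightarrow> nat \<Rightarrow> com \<times> mem \<Rightarrow> bool" where
  Store: "step (Store a e, m)
            (exp_cost a m + exp_cost e m + len (val a m) + len (val e m))
            (Skip, m(val a m := val e m))"
| Guess: "b \<in> {0, 1} \<Longrightarrow>
          step (Guess a, m) (exp_cost a m + len (val a m) + 1) (Skip, m(val a m := b))"
| Seq_Skip: "step (Seq Skip c, m) 1 (c, m)"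
| Seq: "step (c1, m) t (c1', m') \<Longrightarrow> step (Seq c1 c2, m) t (Seq c1' c2, m')"
| If_True: "val e m \<noteq> 0 \<Longrightarrow> step (If e c1 c2, m) (exp_cost e m + len (val e m)) (c1, m)"
| If_False: "val e m = 0 \<Longrightarrow> step (If e c1 c2, m) (exp_cost e m + len (val e m)) (c2, m)"
| While: "step (While e c, m) 1 (If e (Seq c (While e c)) Skip, m)"

inductive steps :: "com \<times> mem \<Rightarrow> nat \<Rightarrow> com \<times> mem \<Rightarrow> bool" where
  refl: "steps s 0 s"
| step: "step s t s' \<Longrightarrow> steps s' t' s'' \<Longrightarrow> steps s (t + t') s''"

text \<open>Lists are input and output as their length at address 0 followed by their entries.\<close>

definition init_mem :: "int list \<Rightarrow> mem" where
  "init_mem xs = (\<lambda>a. if a = 0 then int (length xs)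
                      else if 1 \<le> a \<and> a \<le> int (length xs) then xs ! nat (a - 1)
                      else 0)"

definition holds_output :: "mem \<Rightarrow> int list \<Rightarrow> bool" where
  "holds_output m ys \<longleftrightarrow> m 0 = int (length ys) \<and> (\<forall>i<length ys. m (int i + 1) = ys ! i)"

text \<open>Every step has positive cost, so a bound on the cost of all partial computations
  also expresses that all computations halt.\<close>

definition time_bounded :: "com \<Rightarrow> int list \<Rightarrow> nat \<Rightarrow> bool" where
  "time_bounded c xs T \<longleftrightarrow> (\<forall>t s. steps (c, init_mem xs) t s \<longrightarrow> t \<le> T)"

definition computes :: "com \<Rightarrow> int list \<Rightarrow> int list \<Rightarrow> bool" where
  "computes c xs ys \<longleftrightarrow> (\<forall>t m. steps (c, init_mem xs) t (Skip, m) \<longrightarrow> holds_output m ys)"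

definition accepts :: "com \<Rightarrow> int list \<Rightarrow> bool" where
  "accepts c xs \<longleftrightarrow> (\<exists>t m. steps (c, init_mem xs) t (Skip, m) \<and> m 0 \<noteq> 0)"


section \<open>Decision problems and fine-grained reductions\<close>

text \<open>\<open>isize\<close> is the parameter \<open>n\<close> in which running times are measured (such as
  the number of vertices), not the length of the encoding.\<close>

record 'i problem =
  instances :: "'i set"
  encode :: "'i \<Rightarrow> int list"
  isize :: "'i \<Rightarrow> nat"
  yes :: "'i \<Rightarrow> bool"

definition in_bigo_time :: "'i problem \<Rightarrow> ('i \<Rightarrow> real) \<Rightarrow> ('i \<Rightarrow> real) \<Rightarrow> bool" where
  "in_bigo_time P f g \<longleftrightarrow> f \<in> O[(isize P) going_to at_top within instances P](g)"

definition conondet_solvable :: "'i problem \<Rightarrow> (nat \<Rightarrow> real) \<Rightarrow> bool" where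
  "conondet_solvable P t \<longleftrightarrow>
     (\<exists>c T.
        (\<forall>I\<in>instances P. time_bounded c (encode P I) (T I) \<and>
                        (accepts c (encode P I) \<longleftrightarrow> \<not> yes P I)) \<and>
        in_bigo_time P (\<lambda>I. real (T I)) (\<lambda>I. t (isize P I)))"

definition fine_grained_reduction ::
  "'i problem \<Rightarrow> (nat \<Rightarrow> real) \<Rightarrow> 'j problem \<Rightarrow> (nat \<Rightarrow> real) \<Rightarrow> bool" where
  "fine_grained_reduction P tP Q tQ \<longleftrightarrow>
     (\<exists>c f T. deterministic c \<and>
        (\<forall>I\<in>instances P. f I \<in> instances Q \<and> (yes P I \<longleftrightarrow> yes Q (f I)) \<and>
                        time_bounded c (encode P I) (T I) \<and>
                        computes c (encode P I) (encode Q (f I))) \<and>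
        (\<forall>\<epsilon>>0. \<exists>\<delta>>0. in_bigo_time P (\<lambda>I. tQ (isize Q (f I)) powr (1 - \<epsilon>))
                                    (\<lambda>I. tP (isize P I) powr (1 - \<delta>))) \<and>
        (\<exists>\<gamma>>0. in_bigo_time P (\<lambda>I. real (T I)) (\<lambda>I. tP (isize P I) powr (1 - \<gamma>))))"


section \<open>Satisfiability and NSETH\<close>

text \<open>Literals are as in the DIMACS format: variable \<open>i \<in> {1..n}\<close> is the literal
  \<open>i\<close> and its negation is \<open>-i\<close>. Clauses are not repeated, so that formulas
  on \<open>n\<close> variables have polynomial size for fixed \<open>k\<close>.\<close>

type_synonym cnf = "int list list"

definition is_kcnf :: "nat \<Rightarrow> nat \<Rightarrow> cnf \<Rightarrow> bool" where
  "is_kcnf k n F \<longleftrightarrow> distinct F \<and>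
     (\<forall>C\<in>set F. length C \<le> k \<and> (\<forall>l\<in>set C. l \<noteq> 0 \<and> \<bar>l\<bar> \<le> int n))"

definition lit_true :: "(nat \<Rightarrow> bool) \<Rightarrow> int \<Rightarrow> bool" where
  "lit_true \<alpha> l \<longleftrightarrow> (if l > 0 then \<alpha> (nat l) else \<not> \<alpha> (nat (- l)))"

definition satisfiable :: "cnf \<Rightarrow> bool" where
  "satisfiable F \<longleftrightarrow> (\<exists>\<alpha>. \<forall>C\<in>set F. \<exists>l\<in>set C. lit_true \<alpha> l)"

definition kSAT :: "nat \<Rightarrow> (nat \<times> cnf) problem" where
  "kSAT k = \<lparr>
     instances = {(n, F). is_kcnf k n F},
     encode = (\<lambda>(n, F). int n # int (length F) # concat (map (\<lambda>C. int (length C) # C) F)),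
     isize = fst,
     yes = (\<lambda>(n, F). satisfiable F)\<rparr>"

definition NSETH :: bool where
  "NSETH \<longleftrightarrow>
     \<not> (\<exists>\<epsilon>::real. \<epsilon> > 0 \<and> (\<forall>k. conondet_solvable (kSAT k) (\<lambda>n. 2 powr ((1 - \<epsilon>) * real n))))"


section \<open>The matrix multiplication exponent\<close>

text \<open>Integer matrices with polynomially bounded entries, that is, with entries of
  \<open>O(log n)\<close> bits.\<close>

definition matmul_in_time :: "real \<Rightarrow> bool" where
  "matmul_in_time c \<longleftrightarrow>
     (\<forall>d::nat. \<exists>P T. deterministic P \<and>
        (\<forall>n. \<forall>A\<in>carrier_mat n n. \<forall>B\<in>carrier_mat n n.
           (\<forall>i<n. \<forall>j<n. \<bar>A $$ (i, j)\<bar> \<le> int n ^ d \<and> \<bar>B $$ (i, j)\<bar> \<le> int n ^ d) \<longrightarrow>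
           (let xs = int n # concat (mat_to_list A) @ concat (mat_to_list B)
            in time_bounded P xs (T n) \<and> computes P xs (concat (mat_to_list (A * B))))) \<and>
        (\<lambda>n. real (T n)) \<in> O(\<lambda>n. real n powr c))"

definition matmul_exponent :: real where
  "matmul_exponent = Inf {c. matmul_in_time c}"


section \<open>Context-free grammars and CFL reachability\<close>

datatype 'n sym = Nt 'n | Tm nat

text \<open>The terminal alphabet is \<open>{0..<num_terms}\<close>.\<close>

record 'n cfg =
  num_terms :: nat
  prods :: "('n \<times> 'n sym list) set"
  start :: 'n

definition wf_cfg :: "'n cfg \<Rightarrow> bool" where
  "wf_cfg G \<longleftrightarrow> finite (prods G) \<and>
     (\<forall>(A, w)\<in>prods G. \<forall>a. Tm a \<in> set w \<longrightarrow> a < num_terms G)"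

inductive derives1 :: "'n cfg \<Rightarrow> 'n sym list \<Rightarrow> 'n sym list \<Rightarrow> bool" for G where
  "(A, w) \<in> prods G \<Longrightarrow> derives1 G (u @ [Nt A] @ v) (u @ w @ v)"

definition cfg_language :: "'n cfg \<Rightarrow> nat list set" where
  "cfg_language G = {w. (derives1 G)\<^sup>*\<^sup>* [Nt (start G)] (map Tm w)}"

text \<open>A labeled digraph \<open>(n, E)\<close> has the vertices \<open>{0..<n}\<close>, and \<open>(u, a, v) \<in> E\<close> is an
  edge from \<open>u\<close> to \<open>v\<close> with label \<open>a\<close>. It is encoded by its labeled adjacency matrix.\<close>

type_synonym lgraph = "nat \<times> (nat \<times> nat \<times> nat) set"

definition wf_lgraph :: "'n cfg \<Rightarrow> lgraph \<Rightarrow> bool" where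
  "wf_lgraph G = (\<lambda>(n, E). E \<subseteq> {0..<n} \<times> {0..<num_terms G} \<times> {0..<n})"

definition encode_lgraph :: "'n cfg \<Rightarrow> lgraph \<Rightarrow> int list" where
  "encode_lgraph G = (\<lambda>(n, E).
     [if (u, a, v) \<in> E then 1 else 0. u \<leftarrow> [0..<n], v \<leftarrow> [0..<n], a \<leftarrow> [0..<num_terms G]])"

text \<open>As usual in CFL reachability, paths may repeat vertices and edges.\<close>

inductive path :: "(nat \<times> nat \<times> nat) set \<Rightarrow> nat \<Rightarrow> nat list \<Rightarrow> nat \<Rightarrow> bool" for E where
  Nil: "path E u [] u"
| Cons: "(u, a, v) \<in> E \<Longrightarrow> path E v w x \<Longrightarrow> path E u (a # w) x"

definition S_reachable :: "'n cfg \<Rightarrow> lgraph \<Rightarrow> nat \<Rightarrow> nat \<Rightarrow> bool" where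
  "S_reachable G g u v \<longleftrightarrow> (\<exists>w\<in>cfg_language G. path (snd g) u w v)"

definition st_CFL_reachability :: "'n cfg \<Rightarrow> (lgraph \<times> nat \<times> nat) problem" where
  "st_CFL_reachability G = \<lparr>
     instances = {(g, s, t). wf_lgraph G g \<and> s < fst g \<and> t < fst g},
     encode = (\<lambda>(g, s, t). int (fst g) # int s # int t # encode_lgraph G g),
     isize = (\<lambda>(g, s, t). fst g),
     yes = (\<lambda>(g, s, t). S_reachable G g s t)\<rparr>"

definition all_pairs_CFL_reachability :: "'n cfg \<Rightarrow> lgraph problem" where
  "all_pairs_CFL_reachability G = \<lparr>
     instances = {g. wf_lgraph G g},
     encode = (\<lambda>g. int (fst g) # encode_lgraph G g),
     isize = fst,
     yes = (\<lambda>g. \<forall>u<fst g. \<forall>v<fst g. S_reachable G g u v)\<rparr>"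


section \<open>Triangle problems on vertex-colored graphs\<close>

text \<open>Undirected simple graphs with vertices \<open>{0..<verts_num}\<close>; colors are named by
  numbers below the number of vertices, which suffices for any coloring.\<close>

record cgraph =
  verts_num :: nat
  adj :: "(nat \<times> nat) set"
  color :: "nat \<Rightarrow> nat"

definition wf_cgraph :: "cgraph \<Rightarrow> bool" where
  "wf_cgraph g \<longleftrightarrow>
     adj g \<subseteq> {0..<verts_num g} \<times> {0..<verts_num g} \<and> sym (adj g) \<and> irrefl (adj g) \<and>
     (\<forall>v<verts_num g. color g v < verts_num g)"

definition colors :: "cgraph \<Rightarrow> nat set" where
  "colors g = color g ` {0..<verts_num g}"

definition encode_cgraph :: "cgraph \<Rightarrow> int list" where
  "encode_cgraph g =
     int (verts_num g) # [int (color g v). v \<leftarrow> [0..<verts_num g]] @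
     [if (u, v) \<in> adj g then 1 else 0. u \<leftarrow> [0..<verts_num g], v \<leftarrow> [0..<verts_num g]]"

definition colored_triangles :: "cgraph \<Rightarrow> nat \<Rightarrow> nat \<Rightarrow> nat \<Rightarrow> nat set set" where
  "colored_triangles g a b c =
     {{x, y, z} | x y z. (x, y) \<in> adj g \<and> (y, z) \<in> adj g \<and> (x, z) \<in> adj g \<and>
                         color g x = a \<and> color g y = b \<and> color g z = c}"

definition Triangle_Collection :: "cgraph problem" where
  "Triangle_Collection = \<lparr>
     instances = {g. wf_cgraph g},
     encode = encode_cgraph,
     isize = verts_num,
     yes = (\<lambda>g. \<forall>a\<in>colors g. \<forall>b\<in>colors g. \<forall>c\<in>colors g.
                  distinct [a, b, c] \<longrightarrow> colored_triangles g a b c \<noteq> {})\<rparr>"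

text \<open>The bound on \<open>\<Delta>\<close> lets it fit into \<open>O(log n)\<close> bits, so that reading it has
  polylogarithmic cost; a graph has at most \<open>n ^ 3\<close> triangles.\<close>

definition Delta_Matching_Triangles :: "(cgraph \<times> int) problem" where
  "Delta_Matching_Triangles = \<lparr>
     instances = {(g, \<Delta>). wf_cgraph g \<and> \<bar>\<Delta>\<bar> \<le> int (verts_num g) ^ 3},
     encode = (\<lambda>(g, \<Delta>). \<Delta> # encode_cgraph g),
     isize = (\<lambda>(g, \<Delta>). verts_num g),
     yes = (\<lambda>(g, \<Delta>). \<exists>a\<in>colors g. \<exists>b\<in>colors g. \<exists>c\<in>colors g.
                       \<Delta> \<le> int (card (colored_triangles g a b c)))\<rparr>"

end

theory Submission
  imports Defs
begin

text \<open>Unsatisfiability of a \<open>k\<close>-CNF with \<open>n\<close> variables reduces to Triangle Collection and, with the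
  opposite answer, to \<open>\<Delta>\<close> Matching Triangles, on graphs with \<open>N = 2\<^bsup>n/3\<^esup> poly(n)\<close> vertices. On the other
  hand, if \<open>\<omega> = 2\<close> then both answers to a CFL reachability instance with \<open>n'\<close> vertices have certificates
  checkable in time \<open>n'\<^bsup>2+o(1)\<^esup>\<close>: for reachability, the order in which facts \<open>A(u, v)\<close> are
  derived and the rule instance used for each; for unreachability, a set of facts containing all
  edges and closed under the rules, where closure is tested by Boolean matrix
  multiplication. A fine-grained reduction to (CFL reachability, \<open>n\<^sup>c\<close>) with \<open>c > 2\<close> makes \<open>n'\<^bsup>2+\<eta>\<^esup>\<close>
  at most \<open>N\<^bsup>3(1-\<delta>)\<^esup>\<close> for some \<open>\<eta>, \<delta> > 0\<close>. Chaining the two reductions with the certificate checker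
  decides unsatisfiability nondeterministically in time \<open>2\<^bsup>(1-\<epsilon>)n\<^esup>\<close>, which contradicts NSETH.\<close>

section \<open>Running times of machine programs\<close>

text \<open>Unsatisfiable formulas are YES-instances of Triangle Collection, so there a positive
  answer of the CFL instance is certified; they are NO-instances of Matching Triangles, so there a
  negative one is. The exponent 3 fits because N^3 is 2^n up to polynomial factors. NSETH asks for
  one saving that serves all k. It exists because the reduction, and with it \<open>\<gamma>\<close>
  and \<open>\<delta>\<close>, is fixed before k; the polynomial factors, whose degree grows with k,
  are absorbed by a part of the saving. The obstacle is that two unknown programs, the reduction and
  the matrix multiplication, must run inside one machine program under logarithmic costs. They may
  leave numbers beyond any bound set by the surrounding program, so each is confined to one residue
  class of the addresses modulo 8. All other code is written in a small language whose judgements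
  count elementary commands, each priced at a constant times the length of a bound B on the data.
  This logarithmic factor is paid from the slack in the exponents. Soundness and time concern all
  runs, completeness a single run; hence two judgements.\<close>

lemma len_ge_1 [simp]: "1 \<le> len k"
  by (simp add: len_def)

text \<open>\<open>len\<close> adds 1 to the number of binary digits so that even 0 has positive
  length; this is the source of the \<open>Suc\<close>. Lengths of sums and products are estimated
  by passing to powers of two.\<close>

lemma len_le_iff: "len k \<le> Suc n \<longleftrightarrow> \<bar>k\<bar> < 2 ^ n"
proof -
  have "floorlog 2 (nat \<bar>k\<bar>) \<le> n \<longleftrightarrow> nat \<bar>k\<bar> < 2 ^ n"
    by (simp add: floorlog_le_iff)
  also have "\<dots> \<longleftrightarrow> \<bar>k\<bar> < 2 ^ n"
    by (simp add: nat_less_iff)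
  finally show ?thesis by (simp add: len_def)
qed

lemma abs_less_len: "\<bar>k\<bar> < 2 ^ (len k - 1)"
  using len_le_iff[of k "len k - 1"] len_ge_1[of k] by linarith

lemma len_mono: "\<bar>a\<bar> \<le> \<bar>b\<bar> \<Longrightarrow> len a \<le> len b"
  using len_le_iff[of a "len b - 1"] abs_less_len[of b] len_ge_1[of b] by linarith

lemma len_add: "len (a + b) \<le> len a + len b"
proof -
  have "\<bar>a + b\<bar> < 2 ^ (len a - 1) + 2 ^ (len b - 1)"
    using abs_less_len[of a] abs_less_len[of b] by linarith
  also have "\<dots> \<le> 2 ^ (len a + len b - 2) + 2 ^ (len a + len b - 2)"
    by (intro add_mono power_increasing) (use len_ge_1[of a] len_ge_1[of b] in linarith)+
  also have "\<dots> = 2 ^ Suc (len a + len b - 2)" by simp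
  also have "Suc (len a + len b - 2) = len a + len b - 1"
    using len_ge_1[of a] len_ge_1[of b] by linarith
  finally show ?thesis
    using len_le_iff[of "a + b" "len a + len b - 1"] len_ge_1[of a] by linarith
qed

lemma len_minus [simp]: "len (- a) = len a"
  by (simp add: len_def)

lemma len_diff: "len (a - b) \<le> len a + len b"
  using len_add[of a "- b"] by simp

lemma len_mult: "len (a * b) \<le> len a + len b"
proof -
  have "\<bar>a * b\<bar> \<le> 2 ^ (len a - 1) * 2 ^ (len b - 1)"
    unfolding abs_mult using abs_less_len[of a] abs_less_len[of b]
    by (intro mult_mono) auto
  also have "\<dots> = 2 ^ (len a + len b - 2)"
    using len_ge_1[of a] len_ge_1[of b] by (simp add: power_add[symmetric] del: len_ge_1)
  also have "\<dots> < 2 ^ (len a + len b - 1)"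
    using len_ge_1[of a] len_ge_1[of b] by (intro power_strict_increasing) linarith+
  finally show ?thesis
    using len_le_iff[of "a * b" "len a + len b - 1"] len_ge_1[of a] by linarith
qed

text \<open>\<open>div\<close> rounds downwards, which can increase the absolute value of a negative
  quotient q of a by b > 0. Still -a > b * (-q - 1) >= -q - 1, and integrality gives -a >= -q.
  Negative divisors are reduced to positive ones by negating both arguments.\<close>

lemma abs_div_le:
  fixes a b :: int
  shows "\<bar>a div b\<bar> \<le> \<bar>a\<bar>"
proof -
  have pos: "\<bar>a div b\<bar> \<le> \<bar>a\<bar>" if "b > 0" for a b :: int
  proof -
    define q r where "q = a div b" and "r = a mod b"
    have a: "a = b * q + r" by (simp add: q_def r_def)
    have r: "0 \<le> r" "r < b" using that by (simp_all add: r_def)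
    have "\<bar>q\<bar> \<le> \<bar>a\<bar>"
    proof (cases "q \<ge> 0")
      case True
      then have "1 * q \<le> b * q" using that by (intro mult_right_mono) auto
      then show ?thesis using a r True by linarith
    next
      case False
      then have "1 * (- q - 1) \<le> b * (- q - 1)" using that by (intro mult_right_mono) auto
      then show ?thesis using a r False by (simp add: algebra_simps)
    qed
    then show ?thesis unfolding q_def .
  qed
  consider "b > 0" | "b = 0" | "b < 0" by linarith
  then show ?thesis
  proof cases
    case 3
    then show ?thesis using pos[of "- b" "- a"] by simp
  qed (use pos in auto)
qed

lemma len_div: "len (a div b) \<le> len a + len b"
  using len_mono[OF abs_div_le[of a b]] by simp

lemma step_pos: "step s t s' \<Longrightarrow> 0 < t"
proof (induction rule: step.induct)
  case (Store a e m)
  then show ?case using len_ge_1[of "val a m"] by linarith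
next
  case (If_True e m c1 c2)
  then show ?case using len_ge_1[of "val e m"] by linarith
next
  case (If_False e m c1 c2)
  then show ?case using len_ge_1[of "val e m"] by linarith
qed auto

inductive_cases step_SkipE: "step (Skip, m) t s"
inductive_cases step_StoreE: "step (Store a e, m) t s"
inductive_cases step_GuessE: "step (Guess a, m) t s"
inductive_cases step_SeqE: "step (Seq c1 c2, m) t s"
inductive_cases step_IfE: "step (If e c1 c2, m) t s"
inductive_cases step_WhileE: "step (While e c, m) t s"

lemma step_Guess_iff:
  "step (Guess a, m) t s \<longleftrightarrow>
     (\<exists>b\<in>{0, 1}. t = exp_cost a m + len (val a m) + 1 \<and> s = (Skip, m(val a m := b)))"
  using step.Guess[of _ a m] by (auto elim!: step_GuessE)

inductive_cases steps_SkipE: "steps (Skip, m) t s"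

lemma steps_Skip_iff: "steps (Skip, m) t s \<longleftrightarrow> t = 0 \<and> s = (Skip, m)"
  by (auto intro: steps.refl elim: steps_SkipE step_SkipE)

lemma steps_single: "step s t s' \<Longrightarrow> steps s t s'"
  using steps.step[OF _ steps.refl, of s t s'] by simp

lemma step_progress: "c \<noteq> Skip \<Longrightarrow> \<exists>t s'. step (c, m) t s'"
proof (induction c)
  case (Seq c1 c2)
  show ?case
  proof (cases "c1 = Skip")
    case True
    then show ?thesis using step.Seq_Skip by blast
  next
    case False
    then show ?thesis using Seq.IH(1) step.Seq by (metis prod.exhaust)
  qed
next
  case (If e c1 c2)
  show ?case by (cases "val e m = 0") (use step.If_True step.If_False in blast)+
qed (blast intro: step.Store step.Guess step.While)+

text \<open>A demonic judgement over all runs. Since each step has positive cost, the bound on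
  partial runs excludes divergence, so this is total correctness with a time bound.\<close>

definition tri :: "com \<Rightarrow> mem \<Rightarrow> nat \<Rightarrow> (mem \<Rightarrow> bool) \<Rightarrow> bool" where
  "tri c m T Q \<longleftrightarrow>
     (\<forall>t s. steps (c, m) t s \<longrightarrow> t \<le> T) \<and> (\<forall>t m'. steps (c, m) t (Skip, m') \<longrightarrow> Q m')"

lemma tri_mono: "tri c m T Q \<Longrightarrow> T \<le> T' \<Longrightarrow> (\<And>m'. Q m' \<Longrightarrow> Q' m') \<Longrightarrow> tri c m T' Q'"
  unfolding tri_def by (meson le_trans)

text \<open>Induction on the time budget: unless the program is \<open>Skip\<close> there is a next
  step, and it uses up a positive part of the budget.\<close>

lemma tri_halts:
  assumes "tri c m T Q"
  obtains t m' where "steps (c, m) t (Skip, m')" "Q m'"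
proof -
  have "\<exists>t m'. steps (c, m) t (Skip, m')"
    using assms
  proof (induction T arbitrary: c m rule: less_induct)
    case (less T)
    show ?case
    proof (cases "c = Skip")
      case True
      then show ?thesis using steps.refl by blast
    next
      case False
      then obtain t c' m' where st: "step (c, m) t (c', m')"
        using step_progress by (metis prod.exhaust)
      have "t \<le> T" using less.prems steps_single[OF st] unfolding tri_def by blast
      have "tri c' m' (T - t) Q"
        unfolding tri_def
      proof (intro conjI allI impI)
        fix t' s assume "steps (c', m') t' s"
        then have "t + t' \<le> T" using less.prems steps.step[OF st] unfolding tri_def by blast
        then show "t' \<le> T - t" by simp
      next
        fix t' m'' assume "steps (c', m') t' (Skip, m'')"
        then show "Q m''" using less.prems steps.step[OF st] unfolding tri_def by blast
      qed
      moreover have "T - t < T" using step_pos[OF st] \<open>t \<le> T\<close> by simp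
      ultimately obtain t' m'' where "steps (c', m') t' (Skip, m'')"
        using less.IH by blast
      then show ?thesis using steps.step[OF st] by blast
    qed
  qed
  then show thesis using that assms unfolding tri_def by blast
qed

lemma tri_step:
  assumes "c \<noteq> Skip"
    and "\<And>t c' m'. step (c, m) t (c', m') \<Longrightarrow> t \<le> T1 \<and> tri c' m' T2 Q"
  shows "tri c m (T1 + T2) Q"
  unfolding tri_def
proof (intro conjI allI impI)
  fix t s assume "steps (c, m) t s"
  then show "t \<le> T1 + T2"
  proof cases
    case (step t s' t')
    obtain c' m' where s': "s' = (c', m')" by force
    have "t \<le> T1" "t' \<le> T2"
      using assms(2)[of t c' m'] step unfolding s' tri_def by blast+
    then show ?thesis using step by simp
  qed simp
next
  fix t m'' assume "steps (c, m) t (Skip, m'')"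
  then show "Q m''"
  proof cases
    case (step t s' t')
    obtain c' m' where s': "s' = (c', m')" by force
    show ?thesis using assms(2)[of t c' m'] step unfolding s' tri_def by blast
  qed (use assms(1) in simp)
qed

lemma tri_Skip: "Q m \<Longrightarrow> tri Skip m 0 Q"
  unfolding tri_def steps_Skip_iff by simp

lemma tri_Store:
  assumes "Q (m(val a m := val e m))"
  shows "tri (Store a e) m (exp_cost a m + exp_cost e m + len (val a m) + len (val e m)) Q"
proof -
  have "tri (Store a e) m (exp_cost a m + exp_cost e m + len (val a m) + len (val e m) + 0) Q"
    by (rule tri_step) (auto elim!: step_StoreE intro: tri_Skip assms)
  then show ?thesis by simp
qed

lemma tri_Guess:
  assumes "\<And>b. b \<in> {0, 1} \<Longrightarrow> Q (m(val a m := b))"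
  shows "tri (Guess a) m (exp_cost a m + len (val a m) + 1) Q"
proof -
  have "tri (Guess a) m (exp_cost a m + len (val a m) + 1 + 0) Q"
    by (rule tri_step) (auto elim!: step_GuessE intro: tri_Skip assms)
  then show ?thesis by simp
qed

lemma tri_If:
  assumes "val e m \<noteq> 0 \<Longrightarrow> tri c1 m T Q" "val e m = 0 \<Longrightarrow> tri c2 m T Q"
  shows "tri (If e c1 c2) m (exp_cost e m + len (val e m) + T) Q"
  by (rule tri_step) (auto elim!: step_IfE intro: assms)

lemma tri_While:
  assumes "val e m \<noteq> 0 \<Longrightarrow> tri (Seq c (While e c)) m T Q" "val e m = 0 \<Longrightarrow> Q m"
  shows "tri (While e c) m (1 + (exp_cost e m + len (val e m) + T)) Q"
proof (rule tri_step)
  fix t c' m' assume "step (While e c, m) t (c', m')"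
  then show "t \<le> 1 \<and> tri c' m' (exp_cost e m + len (val e m) + T) Q"
    using tri_mono[OF tri_Skip] assms by (auto elim!: step_WhileE intro!: tri_If)
qed simp

lemma steps_SeqD:
  assumes "steps (Seq c1 c2, m) t s"
  shows "(\<exists>c1' m'. s = (Seq c1' c2, m') \<and> steps (c1, m) t (c1', m')) \<or>
         (\<exists>t1 m1 t2. steps (c1, m) t1 (Skip, m1) \<and> steps (c2, m1) t2 s \<and> t = t1 + 1 + t2)"
  using assms
proof (induction "(Seq c1 c2, m)" t s arbitrary: c1 m rule: steps.induct)
  case refl
  then show ?case using steps.refl by blast
next
  case (step t s' t' s'')
  consider (1) "c1 = Skip" "t = 1" "s' = (c2, m)"
    | (2) c1' m' where "s' = (Seq c1' c2, m')" "step (c1, m) t (c1', m')"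
    using step(1) by (auto elim: step_SeqE)
  then show ?case
  proof cases
    case 1
    then have "steps (c1, m) 0 (Skip, m)" "steps (c2, m) t' s''" "t + t' = 0 + 1 + t'"
      using step(2) steps.refl by simp_all
    then show ?thesis by blast
  next
    case (2 c1' m')
    from step(3)[OF 2(1)] show ?thesis
    proof (elim disjE exE conjE)
      fix c1'' m''
      assume *: "s'' = (Seq c1'' c2, m'')" "steps (c1', m') t' (c1'', m'')"
      then show ?thesis using steps.step[OF 2(2) *(2)] by blast
    next
      fix t1 m1 t2
      assume *: "steps (c1', m') t1 (Skip, m1)" "steps (c2, m1) t2 s''" "t' = t1 + 1 + t2"
      have "t + t' = (t + t1) + 1 + t2" using * by simp
      then show ?thesis using steps.step[OF 2(2) *(1)] *(2) by blast
    qed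
  qed
qed

lemma steps_SeqI:
  assumes "steps (c1, m) t1 (Skip, m1)" "steps (c2, m1) t2 s"
  shows "steps (Seq c1 c2, m) (t1 + 1 + t2) s"
  using assms
proof (induction "(c1, m)" t1 "(Skip, m1)" arbitrary: c1 m rule: steps.induct)
  case refl
  then show ?case using steps.step[OF step.Seq_Skip] by simp
next
  case (step t s' t')
  obtain c' m' where s': "s' = (c', m')" by force
  have "steps (Seq c' c2, m') (t' + 1 + t2) s" using step s' by blast
  from steps.step[OF step.Seq[OF step(1)[unfolded s']] this] show ?case by (simp add: add.assoc)
qed

lemma tri_Seq:
  assumes "tri c1 m T1 R" "\<And>m'. R m' \<Longrightarrow> tri c2 m' T2 Q"
  shows "tri (Seq c1 c2) m (T1 + 1 + T2) Q"
  unfolding tri_def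
proof (intro conjI allI impI)
  fix t s assume "steps (Seq c1 c2, m) t s"
  from steps_SeqD[OF this] show "t \<le> T1 + 1 + T2"
  proof
    assume "\<exists>c1' m'. s = (Seq c1' c2, m') \<and> steps (c1, m) t (c1', m')"
    then show ?thesis using assms(1) unfolding tri_def by fastforce
  next
    assume "\<exists>t1 m1 t2. steps (c1, m) t1 (Skip, m1) \<and> steps (c2, m1) t2 s \<and> t = t1 + 1 + t2"
    then obtain t1 m1 t2 where *: "steps (c1, m) t1 (Skip, m1)" "steps (c2, m1) t2 s"
      "t = t1 + 1 + t2" by blast
    then have "t1 \<le> T1" "R m1" using assms(1) unfolding tri_def by blast+
    moreover from this have "t2 \<le> T2" using assms(2) *(2) unfolding tri_def by blast
    ultimately show ?thesis using * by simp
  qed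
next
  fix t m' assume "steps (Seq c1 c2, m) t (Skip, m')"
  from steps_SeqD[OF this] show "Q m'" using assms unfolding tri_def by blast
qed

section \<open>Confining a program to a residue class of the addresses\<close>

fun relocate_exp :: "int \<Rightarrow> exp \<Rightarrow> exp" where
  "relocate_exp r (Const k) = Const k"
| "relocate_exp r (Load e) = Load (Add (Mult (Const 8) (relocate_exp r e)) (Const r))"
| "relocate_exp r (Add e1 e2) = Add (relocate_exp r e1) (relocate_exp r e2)"
| "relocate_exp r (Sub e1 e2) = Sub (relocate_exp r e1) (relocate_exp r e2)"
| "relocate_exp r (Mult e1 e2) = Mult (relocate_exp r e1) (relocate_exp r e2)"
| "relocate_exp r (Quot e1 e2) = Quot (relocate_exp r e1) (relocate_exp r e2)"
| "relocate_exp r (Less e1 e2) = Less (relocate_exp r e1) (relocate_exp r e2)"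

text \<open>The map a -> 8 a + r is injective, and its images for different r < 8 are disjoint, so
  programs relocated to different classes cannot disturb each other. Evaluating the map is the only
  overhead.\<close>

fun relocate :: "int \<Rightarrow> com \<Rightarrow> com" where
  "relocate r Skip = Skip"
| "relocate r (Store a e) =
     Store (Add (Mult (Const 8) (relocate_exp r a)) (Const r)) (relocate_exp r e)"
| "relocate r (Guess a) = Guess (Add (Mult (Const 8) (relocate_exp r a)) (Const r))"
| "relocate r (Seq c1 c2) = Seq (relocate r c1) (relocate r c2)"
| "relocate r (If e c1 c2) = If (relocate_exp r e) (relocate r c1) (relocate r c2)"
| "relocate r (While e c) = While (relocate_exp r e) (relocate r c)"

lemma val_relocate_exp: "val (relocate_exp r e) m = val e (\<lambda>a. m (8 * a + r))"
  by (induction e) auto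

lemma len_affine: "0 \<le> r \<Longrightarrow> r < 8 \<Longrightarrow> len (8 * v + r) \<le> 9 + len v"
  using len_add[of "8 * v" r] len_mult[of 8 v] len_le_iff[of r 3] len_le_iff[of 8 4] by simp

text \<open>The constant 30 originates here. Computing \<open>8 * v + r\<close> adds charges of at
  most 25 + 3 l, where l is the length of v, and this is at most 28 l because l is positive.\<close>

lemma relocate_cost_arith:
  fixes c c' l :: nat
  assumes "l8 \<le> 5 + l" "lr \<le> 4" "l5 \<le> 5" "la \<le> 9 + l" "1 \<le> l" "c' \<le> 30 * c"
  shows "1 + c' + l5 + l + 1 + l8 + lr + la + x \<le> 30 * (c + l + x)"
proof -
  have "1 + c' + l5 + l + 1 + l8 + lr + la + x \<le> 30 * c + (25 + 3 * l) + x"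
    using assms by simp
  also have "\<dots> \<le> 30 * c + 30 * l + 30 * x"
    using assms by simp
  finally show ?thesis by simp
qed

lemma exp_cost_relocate_exp:
  assumes r: "0 \<le> r" "r < 8"
  shows "exp_cost (relocate_exp r e) m \<le> 30 * exp_cost e (\<lambda>a. m (8 * a + r))"
proof (induction e)
  case (Load e)
  let ?v = "val e (\<lambda>a. m (8 * a + r))"
  have "len (8 * ?v) \<le> 5 + len ?v" using len_mult[of 8 ?v] len_le_iff[of 8 4] by simp
  moreover have "len r \<le> 4" using len_le_iff[of r 3] r by simp
  moreover have "len 8 \<le> 5" using len_le_iff[of 8 4] by simp
  ultimately show ?case
    unfolding relocate_exp.simps exp_cost.simps val.simps val_relocate_exp
    using relocate_cost_arith[OF _ _ _ len_affine[OF r, of ?v] len_ge_1[of ?v] Load.IH]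
    by simp
qed (simp_all add: val_relocate_exp)

lemma exp_cost_relocate_addr:
  assumes r: "0 \<le> r" "r < 8"
  shows "exp_cost (Add (Mult (Const 8) (relocate_exp r a)) (Const r)) m +
           len (8 * val a (\<lambda>a. m (8 * a + r)) + r)
         \<le> 30 * (exp_cost a (\<lambda>a. m (8 * a + r)) + len (val a (\<lambda>a. m (8 * a + r))))"
proof -
  let ?v = "val a (\<lambda>a. m (8 * a + r))"
  have "len (8 * ?v) \<le> 5 + len ?v" using len_mult[of 8 ?v] len_le_iff[of 8 4] by simp
  moreover have "len r \<le> 4" using len_le_iff[of r 3] r by simp
  moreover have "len 8 \<le> 5" using len_le_iff[of 8 4] by simp
  ultimately show ?thesis
    unfolding exp_cost.simps val.simps val_relocate_exp
    using relocate_cost_arith[OF _ _ _ len_affine[OF r, of ?v] len_ge_1[of ?v]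
        exp_cost_relocate_exp[OF r, of a m], of _ _ _ 0]
    by simp
qed

lemma affine_upd:
  fixes m :: mem and r :: int
  shows "(\<lambda>a. (m(8 * x + r := y)) (8 * a + r)) = (\<lambda>a. m (8 * a + r))(x := y)"
  by (auto simp: fun_eq_iff)

text \<open>A backward simulation, as suits a judgement over all runs: every step of the relocated
  program stems from a step of the original one. The existence of halting runs later follows from
  \<open>tri_halts\<close>.\<close>

lemma step_relocateD:
  assumes r: "0 \<le> r" "r < 8" and "step (relocate r c, m) t s"
  shows "\<exists>c' m' t'. s = (relocate r c', m') \<and>
           step (c, \<lambda>a. m (8 * a + r)) t' (c', \<lambda>a. m' (8 * a + r)) \<and> t \<le> 30 * t' \<and>
           (\<forall>a. a mod 8 \<noteq> r \<longrightarrow> m' a = m a)"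
  using assms(3)
proof (induction c arbitrary: t s)
  case Skip
  then show ?case by (auto elim: step_SkipE)
next
  case (Store a e)
  let ?m = "\<lambda>a. m (8 * a + r)"
  from Store have s: "s = (Skip, m(8 * val a ?m + r := val e ?m))"
    and t: "t = exp_cost (Add (Mult (Const 8) (relocate_exp r a)) (Const r)) m +
      exp_cost (relocate_exp r e) m + len (8 * val a ?m + r) + len (val e ?m)"
    unfolding relocate.simps by (auto elim!: step_StoreE simp: val_relocate_exp)
  have "step (Store a e, ?m) (exp_cost a ?m + exp_cost e ?m + len (val a ?m) + len (val e ?m))
          (Skip, \<lambda>a'. (m(8 * val a ?m + r := val e ?m)) (8 * a' + r))"
    unfolding affine_upd by (rule step.Store)
  moreover have "t \<le> 30 * (exp_cost a ?m + exp_cost e ?m + len (val a ?m) + len (val e ?m))"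
    using exp_cost_relocate_addr[OF r, of a m] exp_cost_relocate_exp[OF r, of e m]
    unfolding t by simp
  moreover have "\<forall>a'. a' mod 8 \<noteq> r \<longrightarrow> (m(8 * val a ?m + r := val e ?m)) a' = m a'"
    using r by (auto simp: mod_pos_pos_trivial)
  ultimately show ?case unfolding s using relocate.simps(1) by metis
next
  case (Guess a)
  let ?m = "\<lambda>a. m (8 * a + r)"
  obtain b where b: "b \<in> {0, 1}"
    and t: "t = exp_cost (Add (Mult (Const 8) (relocate_exp r a)) (Const r)) m +
      len (val (Add (Mult (Const 8) (relocate_exp r a)) (Const r)) m) + 1"
    and s: "s = (Skip, m(val (Add (Mult (Const 8) (relocate_exp r a)) (Const r)) m := b))"
    using Guess unfolding relocate.simps step_Guess_iff by blast
  have "step (Guess a, ?m) (exp_cost a ?m + len (val a ?m) + 1)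
          (Skip, \<lambda>a'. (m(8 * val a ?m + r := b)) (8 * a' + r))"
    unfolding affine_upd using b by (rule step.Guess)
  moreover have "t \<le> 30 * (exp_cost a ?m + len (val a ?m) + 1)"
    using exp_cost_relocate_addr[OF r, of a m] unfolding t by (simp add: val_relocate_exp)
  moreover have "\<forall>a'. a' mod 8 \<noteq> r \<longrightarrow> (m(8 * val a ?m + r := b)) a' = m a'"
    using r by (auto simp: mod_pos_pos_trivial)
  ultimately show ?case
    unfolding s val.simps val_relocate_exp using relocate.simps(1) by metis
next
  case (Seq c1 c2)
  consider (1) "relocate r c1 = Skip" "t = 1" "s = (relocate r c2, m)"
    | (2) c1' m' where "s = (Seq c1' (relocate r c2), m')" "step (relocate r c1, m) t (c1', m')"
    using Seq.prems by (auto elim: step_SeqE)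
  then show ?case
  proof cases
    case 1
    then have "c1 = Skip" by (cases c1) auto
    then show ?thesis using 1 step.Seq_Skip
      by (intro exI[of _ c2] exI[of _ m] exI[of _ 1]) simp
  next
    case (2 c1' m')
    then obtain c'' m'' t' where *: "(c1', m') = (relocate r c'', m'')"
      "step (c1, \<lambda>a. m (8 * a + r)) t' (c'', \<lambda>a. m'' (8 * a + r))" "t \<le> 30 * t'"
      "\<forall>a. a mod 8 \<noteq> r \<longrightarrow> m'' a = m a"
      using Seq.IH(1) by blast
    show ?thesis using 2 * step.Seq[OF *(2)]
      by (intro exI[of _ "Seq c'' c2"] exI[of _ m''] exI[of _ t']) simp
  qed
next
  case (If e c1 c2)
  let ?m = "\<lambda>a. m (8 * a + r)"
  have *: "exp_cost (relocate_exp r e) m + len (val e ?m) \<le> 30 * (exp_cost e ?m + len (val e ?m))"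
    using exp_cost_relocate_exp[OF r, of e m] by simp
  from If.prems show ?case
    unfolding relocate.simps
    apply (elim step_IfE)
    subgoal
      apply (rule exI[of _ c1], rule exI[of _ m], rule exI)
      by (intro conjI) (use * in \<open>auto simp: val_relocate_exp intro!: step.If_True\<close>)
    subgoal
      apply (rule exI[of _ c2], rule exI[of _ m], rule exI)
      by (intro conjI) (use * in \<open>auto simp: val_relocate_exp intro!: step.If_False\<close>)
    done
next
  case (While e c)
  then show ?case
    unfolding relocate.simps
    apply (elim step_WhileE)
    subgoal
      apply (rule exI[of _ "If e (Seq c (While e c)) Skip"], rule exI[of _ m], rule exI[of _ 1])
      using step.While[of e c] by simp
    done
qed

lemma steps_relocateD:
  assumes r: "0 \<le> r" "r < 8" and "steps (relocate r c, m) t s"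
  shows "\<exists>c' m' t'. s = (relocate r c', m') \<and>
           steps (c, \<lambda>a. m (8 * a + r)) t' (c', \<lambda>a. m' (8 * a + r)) \<and> t \<le> 30 * t' \<and>
           (\<forall>a. a mod 8 \<noteq> r \<longrightarrow> m' a = m a)"
  using assms(3)
proof (induction "(relocate r c, m)" t s arbitrary: c m rule: steps.induct)
  case refl
  then show ?case
    by (intro exI[of _ c] exI[of _ m] exI[of _ 0]) (auto intro: steps.refl)
next
  case (step t s' t' s'')
  obtain c1 m1 t1 where 1: "s' = (relocate r c1, m1)"
    "step (c, \<lambda>a. m (8 * a + r)) t1 (c1, \<lambda>a. m1 (8 * a + r))" "t \<le> 30 * t1"
    "\<forall>a. a mod 8 \<noteq> r \<longrightarrow> m1 a = m a"
    using step_relocateD[OF r step(1)] by blast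
  obtain c2 m2 t2 where 2: "s'' = (relocate r c2, m2)"
    "steps (c1, \<lambda>a. m1 (8 * a + r)) t2 (c2, \<lambda>a. m2 (8 * a + r))" "t' \<le> 30 * t2"
    "\<forall>a. a mod 8 \<noteq> r \<longrightarrow> m2 a = m1 a"
    using step(3)[OF 1(1)] by blast
  show ?case using 1 2 steps.step[OF 1(2) 2(2)]
    by (intro exI[of _ c2] exI[of _ m2] exI[of _ "t1 + t2"]) auto
qed

lemma relocate_eq_Skip: "relocate r c = Skip \<longleftrightarrow> c = Skip"
  by (cases c) auto

lemma tri_relocate:
  assumes r: "0 \<le> r" "r < 8" and "tri c (\<lambda>a. m (8 * a + r)) T Q"
  shows "tri (relocate r c) m (30 * T)
           (\<lambda>m'. Q (\<lambda>a. m' (8 * a + r)) \<and> (\<forall>a. a mod 8 \<noteq> r \<longrightarrow> m' a = m a))"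
  unfolding tri_def
proof (intro conjI[of "All _"] allI[of "\<lambda>t. All _"] allI impI)
  fix t s assume "steps (relocate r c, m) t s"
  from steps_relocateD[OF r this] show "t \<le> 30 * T"
    using assms(3) unfolding tri_def by (meson le_trans mult_le_mono2)
next
  fix t m' assume "steps (relocate r c, m) t (Skip, m')"
  from steps_relocateD[OF r this] obtain c' t' where
    "Skip = relocate r c'" "steps (c, \<lambda>a. m (8 * a + r)) t' (c', \<lambda>a. m' (8 * a + r))"
    "\<forall>a. a mod 8 \<noteq> r \<longrightarrow> m' a = m a" by blast
  moreover from this have "c' = Skip" using relocate_eq_Skip by metis
  ultimately show "Q (\<lambda>a. m' (8 * a + r)) \<and> (\<forall>a. a mod 8 \<noteq> r \<longrightarrow> m' a = m a)"
    using assms(3) unfolding tri_def by blast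
qed

section \<open>A language with registers and arrays\<close>

declare split_paired_All [simp del] split_paired_Ex [simp del]

lemma len_le_bound: "\<bar>x\<bar> \<le> B \<Longrightarrow> len x \<le> len B"
  by (rule len_mono) linarith

datatype aop = Plus | Minus | Times | Div | Lt

datatype hexp = Num int | Var nat | Arr nat hexp | Bop aop hexp hexp

text \<open>Loops are counted, so that their running time is a product of the number of rounds and
  the time of one round. \<open>Foreign r c\<close> runs given machine code \<open>c\<close> inside
  array \<open>r\<close>; it stands for the reduction and for the matrix multiplication.\<close>

datatype hcom =
    HSkip
  | Asg nat hexp
  | Upd nat hexp hexp
  | Flip nat
  | HSeq hcom hcom  (infixr ";;" 60)
  | HIf hexp hcom hcom
  | For nat hexp hcom
  | Foreign nat com

type_synonym hstate = "(nat \<Rightarrow> int) \<times> (nat \<Rightarrow> int \<Rightarrow> int)"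

fun aop_val :: "aop \<Rightarrow> int \<Rightarrow> int \<Rightarrow> int" where
  "aop_val Plus x y = x + y"
| "aop_val Minus x y = x - y"
| "aop_val Times x y = x * y"
| "aop_val Div x y = x div y"
| "aop_val Lt x y = (if x < y then 1 else 0)"

fun hval :: "hexp \<Rightarrow> hstate \<Rightarrow> int" where
  "hval (Num k) s = k"
| "hval (Var x) s = fst s x"
| "hval (Arr r e) s = snd s r (hval e s)"
| "hval (Bop f e1 e2) s = aop_val f (hval e1 s) (hval e2 s)"

text \<open>Registers live at the negative multiples of 8, array \<open>r \<in> {1..7}\<close> occupies the residue
  class of \<open>r\<close> modulo 8. The arrays from 4 on are private to the program, so that their entries
  can be kept below the global bound \<open>B\<close>; the others are shared with foreign programs.\<close>

definition reg_addr :: "nat \<Rightarrow> int" where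
  "reg_addr x = - 8 * (int x + 1)"

fun aop_exp :: "aop \<Rightarrow> exp \<Rightarrow> exp \<Rightarrow> exp" where
  "aop_exp Plus = Add"
| "aop_exp Minus = Sub"
| "aop_exp Times = Mult"
| "aop_exp Div = Quot"
| "aop_exp Lt = Less"

definition arr_addr :: "nat \<Rightarrow> exp \<Rightarrow> exp" where
  "arr_addr r e = Add (Mult (Const 8) e) (Const (int r))"

fun compile_exp :: "hexp \<Rightarrow> exp" where
  "compile_exp (Num k) = Const k"
| "compile_exp (Var x) = Load (Const (reg_addr x))"
| "compile_exp (Arr r e) = Load (arr_addr r (compile_exp e))"
| "compile_exp (Bop f e1 e2) = aop_exp f (compile_exp e1) (compile_exp e2)"

fun compile :: "hcom \<Rightarrow> com" where
  "compile HSkip = Skip"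
| "compile (Asg x e) = Store (Const (reg_addr x)) (compile_exp e)"
| "compile (Upd r e1 e2) = Store (arr_addr r (compile_exp e1)) (compile_exp e2)"
| "compile (Flip x) = Guess (Const (reg_addr x))"
| "compile (p ;; q) = Seq (compile p) (compile q)"
| "compile (HIf e p q) = If (compile_exp e) (compile p) (compile q)"
| "compile (For x e p) =
     Seq (Store (Const (reg_addr x)) (Const 0))
       (While (Less (Load (Const (reg_addr x))) (compile_exp e))
         (Seq (compile p)
           (Store (Const (reg_addr x)) (Add (Load (Const (reg_addr x))) (Const 1)))))"
| "compile (Foreign r c) = relocate (int r) c"

definition rep :: "mem \<Rightarrow> hstate \<Rightarrow> bool" where
  "rep m s \<longleftrightarrow> (\<forall>x. m (reg_addr x) = fst s x) \<and>
     (\<forall>r a. 0 < r \<longrightarrow> r < 8 \<longrightarrow> m (8 * a + int r) = snd s r a)"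

definition bnd :: "int \<Rightarrow> hstate \<Rightarrow> bool" where
  "bnd B s \<longleftrightarrow> (\<forall>x. \<bar>fst s x\<bar> \<le> B) \<and> (\<forall>r a. 4 \<le> r \<longrightarrow> \<bar>snd s r a\<bar> \<le> B)"

text \<open>The arrays 1 to 3 may hold arbitrarily long numbers, so each read from them carries the
  obligation that the value is at most \<open>B\<close>. Expressions are evaluated strictly, hence
  reads under a false guard are obligations too.\<close>

fun safe :: "int \<Rightarrow> hexp \<Rightarrow> hstate \<Rightarrow> bool" where
  "safe B (Num k) s = True"
| "safe B (Var x) s = True"
| "safe B (Arr r e) s = (safe B e s \<and> (4 \<le> r \<or> \<bar>snd s r (hval e s)\<bar> \<le> B))"
| "safe B (Bop f e1 e2) s = (safe B e1 s \<and> safe B e2 s)"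

fun wf_exp :: "hexp \<Rightarrow> bool" where
  "wf_exp (Num k) = True"
| "wf_exp (Var x) = True"
| "wf_exp (Arr r e) = (0 < r \<and> r < 8 \<and> wf_exp e)"
| "wf_exp (Bop f e1 e2) = (wf_exp e1 \<and> wf_exp e2)"

fun wf_com :: "hcom \<Rightarrow> bool" where
  "wf_com HSkip = True"
| "wf_com (Asg x e) = wf_exp e"
| "wf_com (Upd r e1 e2) = (0 < r \<and> r < 8 \<and> wf_exp e1 \<and> wf_exp e2)"
| "wf_com (Flip x) = True"
| "wf_com (p ;; q) = (wf_com p \<and> wf_com q)"
| "wf_com (HIf e p q) = (wf_exp e \<and> wf_com p \<and> wf_com q)"
| "wf_com (For x e p) = (wf_exp e \<and> wf_com p)"
| "wf_com (Foreign r c) = (0 < r \<and> r < 8)"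

text \<open>Chosen such that the weight times \<open>len B\<close> bounds both the cost of an
  evaluation and the length of its result. In the array case the factor 4 pays for evaluating the
  index \<open>e\<close> and for the lengths of \<open>e\<close>, \<open>8 * e\<close> and
  \<open>8 * e + r\<close>.\<close>

fun exp_weight :: "hexp \<Rightarrow> nat" where
  "exp_weight (Num k) = 1 + len k"
| "exp_weight (Var x) = 2 + len (reg_addr x)"
| "exp_weight (Arr r e) = 3 + 3 * len 8 + 2 * len (int r) + 4 * exp_weight e"
| "exp_weight (Bop f e1 e2) = 2 * (exp_weight e1 + exp_weight e2)"

text \<open>A maximum and not a sum: this is the price of a single elementary command, while the
  number of commands executed is counted in \<open>htri\<close>. It depends on the program text
  only, so \<open>weight p * len B\<close> is logarithmic in \<open>B\<close>.\<close>

fun weight :: "hcom \<Rightarrow> nat" where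
  "weight HSkip = 1"
| "weight (Asg x e) = 1 + len (reg_addr x) + 2 * exp_weight e"
| "weight (Upd r e1 e2) = 2 * exp_weight (Arr r e1) + 2 * exp_weight e2"
| "weight (Flip x) = 2 + len (reg_addr x)"
| "weight (p ;; q) = max (weight p) (weight q)"
| "weight (HIf e p q) = max (2 * exp_weight e) (max (weight p) (weight q))"
| "weight (For x e p) = max (weight p) (10 * exp_weight (Var x) + 4 * exp_weight e)"
| "weight (Foreign r c) = 1"

lemma val_compile_exp:
  assumes "rep m s" "wf_exp e"
  shows "val (compile_exp e) m = hval e s"
  using assms(2)
proof (induction e)
  case (Bop f e1 e2)
  then show ?case by (cases f) auto
qed (use assms(1) in \<open>auto simp: rep_def arr_addr_def\<close>)

lemma exp_weight_pos: "0 < exp_weight e"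
  by (induction e) auto

lemma weight_pos: "0 < weight p"
  by (induction p) (auto simp: exp_weight_pos)

lemma le_times_len: "k \<le> k * len B"
  using mult_le_mono2[OF len_ge_1, of k B] by simp

text \<open>Cost and length go through one induction, because an operation is charged the lengths of
  its operands, and these are intermediate values that may exceed \<open>B\<close>.\<close>

lemma compile_exp_cost:
  assumes "rep m s" "bnd B s" "wf_exp e" "safe B e s"
  shows "exp_cost (compile_exp e) m \<le> exp_weight e * len B"
    and "len (hval e s) \<le> exp_weight e * len B"
  using assms(3, 4)
proof (induction e)
  case (Num k)
  have "1 + len k \<le> (1 + len k) * len B" by (rule le_times_len)
  then have *: "1 \<le> (1 + len k) * len B" "len k \<le> (1 + len k) * len B"
    by linarith+
  { case 1 show ?case using * by simp }
  { case 2 show ?case using * by simp }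
next
  case (Var x)
  have l: "len (fst s x) \<le> len B"
    using assms(2) by (intro len_le_bound) (simp add: bnd_def)
  have "1 + len (reg_addr x) + len B \<le> (1 + len (reg_addr x)) * len B + len B"
    using le_times_len[of "1 + len (reg_addr x)" B] by linarith
  then have *: "1 + len (reg_addr x) + len B \<le> (2 + len (reg_addr x)) * len B"
    by (simp add: algebra_simps)
  { case 1 show ?case using * l assms(1) by (simp add: rep_def) }
  { case 2 show ?case using * l by simp }
next
  case (Arr r e)
  let ?v = "hval e s"
  have wf: "wf_exp e" "0 < r" "r < 8" and sf: "safe B e s"
    if "wf_exp (Arr r e)" "safe B (Arr r e) s" using that by auto
  { assume wfs: "wf_exp (Arr r e)" "safe B (Arr r e) s"
    note IH = Arr.IH(1)[OF wf(1)[OF wfs] sf[OF wfs]] Arr.IH(2)[OF wf(1)[OF wfs] sf[OF wfs]]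
    have l: "len (snd s r ?v) \<le> len B"
      using assms(2) wfs by (intro len_le_bound) (auto simp: bnd_def)
    have v: "val (compile_exp e) m = ?v" using val_compile_exp assms(1) wf(1)[OF wfs] .
    have m: "m (8 * ?v + int r) = snd s r ?v"
      using assms(1) wf(2,3)[OF wfs] by (simp add: rep_def)
    have c: "exp_cost (compile_exp (Arr r e)) m =
        2 + len 8 + len ?v + len (8 * ?v) + len (int r) + len (8 * ?v + int r)
          + len (snd s r ?v) + exp_cost (compile_exp e) m"
      by (simp add: arr_addr_def v m)
    have "len (8 * ?v) \<le> len 8 + len ?v" by (rule len_mult)
    moreover have "len (8 * ?v + int r) \<le> len (8 * ?v) + len (int r)" by (rule len_add)
    ultimately have "exp_cost (compile_exp (Arr r e)) m \<le>
        2 + 3 * len 8 + 2 * len (int r) + 4 * (exp_weight e * len B) + len B"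
      unfolding c using l IH by simp
    also have "\<dots> \<le> (2 + 3 * len 8 + 2 * len (int r)) * len B + 4 * (exp_weight e * len B) + len B"
      using le_times_len[of "2 + 3 * len 8 + 2 * len (int r)" B] by linarith
    also have "\<dots> = exp_weight (Arr r e) * len B" by (simp add: algebra_simps)
    finally have "exp_cost (compile_exp (Arr r e)) m \<le> exp_weight (Arr r e) * len B" .
    moreover have "len (hval (Arr r e) s) \<le> exp_weight (Arr r e) * len B"
    proof -
      have "1 * len B \<le> exp_weight (Arr r e) * len B" by (intro mult_right_mono) auto
      then show ?thesis unfolding hval.simps using l by linarith
    qed
    ultimately have "exp_cost (compile_exp (Arr r e)) m \<le> exp_weight (Arr r e) * len B"
      "len (hval (Arr r e) s) \<le> exp_weight (Arr r e) * len B" . }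
  note * = this
  { case 1 show ?case using *(1) 1 . }
  { case 2 show ?case using *(2) 2 . }
next
  case (Bop f e1 e2)
  { assume "wf_exp (Bop f e1 e2)" "safe B (Bop f e1 e2) s"
    then have wf: "wf_exp e1" "wf_exp e2" "safe B e1 s" "safe B e2 s" by auto
    note IH = Bop.IH(1)[OF wf(1,3)] Bop.IH(2)[OF wf(1,3)] Bop.IH(3)[OF wf(2,4)] Bop.IH(4)[OF wf(2,4)]
    note v = val_compile_exp[OF assms(1) wf(1)] val_compile_exp[OF assms(1) wf(2)]
    have "exp_cost (compile_exp (Bop f e1 e2)) m =
        exp_cost (compile_exp e1) m + exp_cost (compile_exp e2) m + len (hval e1 s) + len (hval e2 s)"
      by (cases f) (simp_all add: v)
    also have "\<dots> \<le> exp_weight (Bop f e1 e2) * len B"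
      using IH by (simp add: algebra_simps)
    finally have 1: "exp_cost (compile_exp (Bop f e1 e2)) m \<le> exp_weight (Bop f e1 e2) * len B" .
    have "len (aop_val f (hval e1 s) (hval e2 s)) \<le> len (hval e1 s) + len (hval e2 s)"
    proof (cases f)
      case Lt
      have "len (if hval e1 s < hval e2 s then 1 else 0) \<le> 2" by (simp add: len_def floorlog_def)
      then show ?thesis using Lt len_ge_1[of "hval e1 s"] len_ge_1[of "hval e2 s"]
        unfolding Lt aop_val.simps by linarith
    qed (simp_all add: len_add len_diff len_mult len_div)
    also have "\<dots> \<le> exp_weight (Bop f e1 e2) * len B"
      using IH by (simp add: algebra_simps)
    finally have "len (hval (Bop f e1 e2) s) \<le> exp_weight (Bop f e1 e2) * len B" by simp
    note 1 this }
  note * = this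
  { case 1 show ?case using *(1) 1 . }
  { case 2 show ?case using *(2) 2 . }
qed

lemma rep_reg_upd:
  assumes "rep m s"
  shows "rep (m(reg_addr x := v)) ((fst s)(x := v), snd s)"
proof -
  have "8 * a + int r \<noteq> reg_addr x" if "0 < r" "r < 8" for r a
    using that unfolding reg_addr_def by presburger
  moreover have "reg_addr y = reg_addr x \<longleftrightarrow> y = x" for y by (simp add: reg_addr_def)
  ultimately show ?thesis using assms by (auto simp: rep_def)
qed

lemma rep_arr_upd:
  assumes "rep m s" "0 < r" "r < 8"
  shows "rep (m(8 * a + int r := v)) (fst s, (snd s)(r := (snd s r)(a := v)))"
proof -
  have "reg_addr x \<noteq> 8 * a + int r" for x
    using assms(2,3) unfolding reg_addr_def by presburger
  moreover have "8 * b + int r' = 8 * a + int r \<longleftrightarrow> b = a \<and> r' = r" if "r' < 8" for b r'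
  proof -
    have "(8 * b + int r') div 8 = b" "(8 * a + int r) div 8 = a" using that assms(3) by simp_all
    then show ?thesis by (metis add_left_cancel of_nat_eq_iff)
  qed
  ultimately show ?thesis using assms by (auto simp: rep_def)
qed

lemma bnd_reg_upd: "bnd B s \<Longrightarrow> \<bar>v\<bar> \<le> B \<Longrightarrow> bnd B ((fst s)(x := v), snd s)"
  by (auto simp: bnd_def)

lemma bnd_arr_upd:
  "bnd B s \<Longrightarrow> (4 \<le> r \<Longrightarrow> \<bar>v\<bar> \<le> B) \<Longrightarrow> bnd B (fst s, (snd s)(r := (snd s r)(a := v)))"
  by (auto simp: bnd_def)

text \<open>\<open>htri B U p s n Q\<close>: the program \<open>p\<close>, started in \<open>s\<close>, takes at most \<open>n\<close> units of cost \<open>U\<close>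
  each and ends in \<open>Q\<close>, provided that a unit pays for every elementary command of \<open>p\<close> on data
  bounded by \<open>B\<close>. \<open>hcan\<close> is its angelic counterpart.\<close>

definition htri ::
  "int \<Rightarrow> nat \<Rightarrow> hcom \<Rightarrow> hstate \<Rightarrow> nat \<Rightarrow> (hstate \<Rightarrow> bool) \<Rightarrow> bool" where
  "htri B U p s n Q \<longleftrightarrow>
     (wf_com p \<longrightarrow> weight p * len B \<le> U \<longrightarrow> bnd B s \<longrightarrow>
      (\<forall>m. rep m s \<longrightarrow> tri (compile p) m (n * U) (\<lambda>m'. \<exists>s'. rep m' s' \<and> bnd B s' \<and> Q s')))"

definition hcan :: "int \<Rightarrow> nat \<Rightarrow> hcom \<Rightarrow> hstate \<Rightarrow> (hstate \<Rightarrow> bool) \<Rightarrow> bool" where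
  "hcan B U p s Q \<longleftrightarrow>
     (wf_com p \<longrightarrow> weight p * len B \<le> U \<longrightarrow> bnd B s \<longrightarrow>
      (\<forall>m. rep m s \<longrightarrow>
         (\<exists>t m' s'. steps (compile p, m) t (Skip, m') \<and> rep m' s' \<and> bnd B s' \<and> Q s')))"

lemma htriD:
  "htri B U p s n Q \<Longrightarrow> wf_com p \<Longrightarrow> weight p * len B \<le> U \<Longrightarrow> bnd B s \<Longrightarrow> rep m s \<Longrightarrow>
   tri (compile p) m (n * U) (\<lambda>m'. \<exists>s'. rep m' s' \<and> bnd B s' \<and> Q s')"
  unfolding htri_def by blast

lemma htri_mono:
  assumes "htri B U p s n Q" "n \<le> n'" "\<And>s'. bnd B s' \<Longrightarrow> Q s' \<Longrightarrow> Q' s'"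
  shows "htri B U p s n' Q'"
  unfolding htri_def
proof (intro impI allI)
  fix m assume "wf_com p" "weight p * len B \<le> U" "bnd B s" "rep m s"
  from htriD[OF assms(1) this] show
    "tri (compile p) m (n' * U) (\<lambda>m'. \<exists>s'. rep m' s' \<and> bnd B s' \<and> Q' s')"
    by (rule tri_mono) (use assms(2,3) in auto)
qed

lemma hcan_mono:
  assumes "hcan B U p s Q" "\<And>s'. bnd B s' \<Longrightarrow> Q s' \<Longrightarrow> Q' s'"
  shows "hcan B U p s Q'"
  using assms unfolding hcan_def by blast

text \<open>If all runs halt in \<open>Q\<close> and some run halts, then one halts in
  \<open>Q\<close>. Thus angelic rules are required only for guesses and for the constructs that
  enclose them.\<close>

lemma hcan_if_htri:
  assumes "htri B U p s n Q"
  shows "hcan B U p s Q"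
  unfolding hcan_def
proof (intro impI allI)
  fix m assume "wf_com p" "weight p * len B \<le> U" "bnd B s" "rep m s"
  from tri_halts[OF htriD[OF assms this]]
  show "\<exists>t m' s'. steps (compile p, m) t (Skip, m') \<and> rep m' s' \<and> bnd B s' \<and> Q s'" by blast
qed

lemma htri_bnd: "(bnd B s \<Longrightarrow> htri B U p s n Q) \<Longrightarrow> htri B U p s n Q"
  unfolding htri_def by blast

lemma htri_HSkip: "Q s \<Longrightarrow> htri B U HSkip s 0 Q"
  unfolding htri_def by (auto intro!: tri_Skip simp del: split_paired_Ex)

lemma htri_Asg:
  assumes "safe B e s" "\<bar>hval e s\<bar> \<le> B" "Q ((fst s)(x := hval e s), snd s)"
  shows "htri B U (Asg x e) s 1 Q"
  unfolding htri_def
proof (intro impI allI)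
  fix m assume wf: "wf_com (Asg x e)" and U: "weight (Asg x e) * len B \<le> U" and b: "bnd B s"
    and r: "rep m s"
  have w: "wf_exp e" using wf by simp
  note c = compile_exp_cost[OF r b w assms(1)]
  have "1 + len (reg_addr x) \<le> (1 + len (reg_addr x)) * len B" by (rule le_times_len)
  then have "1 + len (reg_addr x) + 2 * (exp_weight e * len B) \<le> U"
    using U by (simp add: algebra_simps)
  then show "tri (compile (Asg x e)) m (1 * U) (\<lambda>m'. \<exists>s'. rep m' s' \<and> bnd B s' \<and> Q s')"
    unfolding compile.simps
    using c rep_reg_upd[OF r] bnd_reg_upd[OF b assms(2)] assms(3) val_compile_exp[OF r w]
    by (intro tri_mono[OF tri_Store[where Q = "\<lambda>m'. \<exists>s'. rep m' s' \<and> bnd B s' \<and> Q s'"]]) auto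
qed

lemma htri_Upd:
  assumes "safe B e1 s" "safe B e2 s" "4 \<le> r \<Longrightarrow> \<bar>hval e2 s\<bar> \<le> B"
    "Q (fst s, (snd s)(r := (snd s r)(hval e1 s := hval e2 s)))"
  shows "htri B U (Upd r e1 e2) s 1 Q"
  unfolding htri_def
proof (intro impI allI)
  fix m assume wf: "wf_com (Upd r e1 e2)" and U: "weight (Upd r e1 e2) * len B \<le> U"
    and b: "bnd B s" and rp: "rep m s"
  have w: "wf_exp e1" "wf_exp e2" and r: "0 < r" "r < 8" using wf by auto
  note c = compile_exp_cost[OF rp b w(1) assms(1)] compile_exp_cost[OF rp b w(2) assms(2)]
  note v = val_compile_exp[OF rp w(1)] val_compile_exp[OF rp w(2)]
  let ?v = "hval e1 s"
  have cc: "exp_cost (arr_addr r (compile_exp e1)) m =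
      2 + len 8 + len ?v + len (8 * ?v) + len (int r) + exp_cost (compile_exp e1) m"
    by (simp add: arr_addr_def v)
  have "len (8 * ?v) \<le> len 8 + len ?v" by (rule len_mult)
  moreover have "len (8 * ?v + int r) \<le> len (8 * ?v) + len (int r)" by (rule len_add)
  ultimately have "exp_cost (arr_addr r (compile_exp e1)) m + len (8 * ?v + int r) \<le>
      2 + 3 * len 8 + 2 * len (int r) + 4 * (exp_weight e1 * len B)"
    unfolding cc using c by simp
  also have "\<dots> \<le> (2 + 3 * len 8 + 2 * len (int r)) * len B + 4 * (exp_weight e1 * len B)"
    using le_times_len[of "2 + 3 * len 8 + 2 * len (int r)" B] by linarith
  also have "\<dots> \<le> exp_weight (Arr r e1) * len B" by (simp add: algebra_simps)
  finally have "exp_cost (arr_addr r (compile_exp e1)) m + len (8 * ?v + int r)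
      + exp_cost (compile_exp e2) m + len (hval e2 s) \<le> U"
    using c U by (simp add: algebra_simps)
  moreover have "val (arr_addr r (compile_exp e1)) m = 8 * ?v + int r"
    by (simp add: arr_addr_def v)
  moreover have "rep (m(8 * ?v + int r := hval e2 s)) (fst s, (snd s)(r := (snd s r)(?v := hval e2 s)))"
    by (rule rep_arr_upd[OF rp r])
  moreover have "bnd B (fst s, (snd s)(r := (snd s r)(?v := hval e2 s)))"
    using b assms(3) by (rule bnd_arr_upd)
  ultimately show "tri (compile (Upd r e1 e2)) m (1 * U) (\<lambda>m'. \<exists>s'. rep m' s' \<and> bnd B s' \<and> Q s')"
    unfolding compile.simps using assms(4) v
    by (intro tri_mono[OF tri_Store[where Q = "\<lambda>m'. \<exists>s'. rep m' s' \<and> bnd B s' \<and> Q s'"]]) auto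
qed

lemma htri_Flip:
  assumes "1 \<le> B" "\<And>b. b \<in> {0, 1} \<Longrightarrow> Q ((fst s)(x := b), snd s)"
  shows "htri B U (Flip x) s 1 Q"
  unfolding htri_def
proof (intro impI allI)
  fix m assume U: "weight (Flip x) * len B \<le> U" and b: "bnd B s" and r: "rep m s"
  have "2 + len (reg_addr x) \<le> (2 + len (reg_addr x)) * len B" by (rule le_times_len)
  then have "2 + len (reg_addr x) \<le> U" using U by simp
  moreover have "\<exists>s'. rep (m(reg_addr x := c)) s' \<and> bnd B s' \<and> Q s'" if "c \<in> {0, 1}" for c
  proof -
    have "\<bar>c\<bar> \<le> B" using that assms(1) by auto
    then show ?thesis using rep_reg_upd[OF r] bnd_reg_upd[OF b] assms(2)[OF that] by blast
  qed
  ultimately show "tri (compile (Flip x)) m (1 * U) (\<lambda>m'. \<exists>s'. rep m' s' \<and> bnd B s' \<and> Q s')"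
    unfolding compile.simps
    by (intro tri_mono[OF tri_Guess[where Q = "\<lambda>m'. \<exists>s'. rep m' s' \<and> bnd B s' \<and> Q s'"]]) simp_all
qed

lemma hcan_Flip:
  assumes "1 \<le> B" "b \<in> {0, 1}" "Q ((fst s)(x := b), snd s)"
  shows "hcan B U (Flip x) s Q"
  unfolding hcan_def
proof (intro impI allI)
  fix m assume b: "bnd B s" and r: "rep m s"
  have "steps (compile (Flip x), m) (exp_cost (Const (reg_addr x)) m + len (reg_addr x) + 1)
          (Skip, m(reg_addr x := b))"
    using steps_single[OF step.Guess[OF assms(2), of "Const (reg_addr x)" m]]
    unfolding compile.simps val.simps .
  moreover have "\<bar>b\<bar> \<le> B" using assms(1,2) by auto
  ultimately show "\<exists>t m' s'. steps (compile (Flip x), m) t (Skip, m') \<and> rep m' s' \<and> bnd B s' \<and> Q s'"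
    using rep_reg_upd[OF r] bnd_reg_upd[OF b] assms(3) by blast
qed

lemma weight_len_le:
  "max a b * len B \<le> U \<Longrightarrow> a * len B \<le> U" "max a b * len B \<le> U \<Longrightarrow> b * len B \<le> U"
  using mult_le_mono1[of a "max a b" "len B"] mult_le_mono1[of b "max a b" "len B"] by linarith+

lemma unit_pos: "weight p * len B \<le> U \<Longrightarrow> 1 \<le> U"
  using weight_pos[of p] len_ge_1[of B] by (cases U) (auto simp: Suc_le_eq)

lemma htri_HSeq:
  assumes "htri B U p s n1 R" "\<And>s'. bnd B s' \<Longrightarrow> R s' \<Longrightarrow> htri B U q s' n2 Q"
  shows "htri B U (p ;; q) s (n1 + n2 + 1) Q"
  unfolding htri_def
proof (intro impI allI)
  fix m assume wf: "wf_com (p ;; q)" and U: "weight (p ;; q) * len B \<le> U" and b: "bnd B s"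
    and r: "rep m s"
  have 1: "tri (compile p) m (n1 * U) (\<lambda>m'. \<exists>s'. rep m' s' \<and> bnd B s' \<and> R s')"
    using htriD[OF assms(1) _ weight_len_le(1)[OF U[unfolded weight.simps]] b r] wf by simp
  have 2: "tri (compile q) m' (n2 * U) (\<lambda>m'. \<exists>s'. rep m' s' \<and> bnd B s' \<and> Q s')"
    if "\<exists>s'. rep m' s' \<and> bnd B s' \<and> R s'" for m'
    using that htriD[OF assms(2) _ weight_len_le(2)[OF U[unfolded weight.simps]]] wf by auto
  have "n1 * U + 1 + n2 * U \<le> (n1 + n2 + 1) * U" using unit_pos[OF U] by (simp add: algebra_simps)
  then show "tri (compile (p ;; q)) m ((n1 + n2 + 1) * U) (\<lambda>m'. \<exists>s'. rep m' s' \<and> bnd B s' \<and> Q s')"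
    unfolding compile.simps by - (rule tri_mono[OF tri_Seq[OF 1 2]], auto)
qed

lemma hcan_HSeq:
  assumes "hcan B U p s R" "\<And>s'. bnd B s' \<Longrightarrow> R s' \<Longrightarrow> hcan B U q s' Q"
  shows "hcan B U (p ;; q) s Q"
  unfolding hcan_def
proof (intro impI allI)
  fix m assume wf: "wf_com (p ;; q)" and U: "weight (p ;; q) * len B \<le> U" and b: "bnd B s"
    and r: "rep m s"
  obtain t m1 s1 where 1: "steps (compile p, m) t (Skip, m1)" "rep m1 s1" "bnd B s1" "R s1"
    using assms(1) wf b r weight_len_le(1)[OF U[unfolded weight.simps]]
    unfolding hcan_def wf_com.simps by blast
  obtain t' m2 s2 where 2: "steps (compile q, m1) t' (Skip, m2)" "rep m2 s2" "bnd B s2" "Q s2"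
    using assms(2)[OF 1(3,4)] wf 1 weight_len_le(2)[OF U[unfolded weight.simps]]
    unfolding hcan_def wf_com.simps by blast
  show "\<exists>t m' s'. steps (compile (p ;; q), m) t (Skip, m') \<and> rep m' s' \<and> bnd B s' \<and> Q s'"
    using steps_SeqI[OF 1(1) 2(1)] 2 unfolding compile.simps by blast
qed

lemma htri_HIf:
  assumes "safe B e s" "hval e s \<noteq> 0 \<Longrightarrow> htri B U p s n Q" "hval e s = 0 \<Longrightarrow> htri B U q s n Q"
  shows "htri B U (HIf e p q) s (n + 1) Q"
  unfolding htri_def
proof (intro impI allI)
  fix m assume wf: "wf_com (HIf e p q)" and U: "weight (HIf e p q) * len B \<le> U" and b: "bnd B s"
    and r: "rep m s"
  have w: "wf_exp e" using wf by simp
  note c = compile_exp_cost[OF r b w assms(1)]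
  have "2 * (exp_weight e * len B) \<le> U" using weight_len_le(1)[OF U[unfolded weight.simps]] by simp
  then have "exp_cost (compile_exp e) m + len (hval e s) + n * U \<le> (n + 1) * U"
    using c by (simp add: algebra_simps)
  then show "tri (compile (HIf e p q)) m ((n + 1) * U) (\<lambda>m'. \<exists>s'. rep m' s' \<and> bnd B s' \<and> Q s')"
    unfolding compile.simps
    using assms(2,3) wf b r val_compile_exp[OF r w]
      weight_len_le(1)[OF weight_len_le(2)[OF U[unfolded weight.simps]]]
      weight_len_le(2)[OF weight_len_le(2)[OF U[unfolded weight.simps]]]
    unfolding htri_def
    by (intro tri_mono[OF tri_If[where T = "n * U"]]) auto
qed

text \<open>The factor 30 is the overhead of relocation. The foreign cost \<open>T\<close> is
  counted in units of \<open>U\<close> although it is a plain cost; this wastes a logarithmic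
  factor, which the slack in the exponent of the reduction covers. Nothing is known about the size
  of the numbers left behind, whence \<open>r < 4\<close>.\<close>

lemma htri_Foreign:
  assumes "snd s r = init_mem xs" "time_bounded c xs T" "r < 4"
    "\<And>t m'. steps (c, init_mem xs) t (Skip, m') \<Longrightarrow> Q (fst s, (snd s)(r := m'))"
  shows "htri B U (Foreign r c) s (30 * T) Q"
  unfolding htri_def
proof (intro impI allI)
  fix m assume wf: "wf_com (Foreign r c)" and U: "weight (Foreign r c) * len B \<le> U" and b: "bnd B s"
    and rp: "rep m s"
  have r: "0 < r" "r < 8" using wf by auto
  have m: "(\<lambda>a. m (8 * a + int r)) = init_mem xs"
    using rp r assms(1) by (simp add: rep_def fun_eq_iff)
  have "tri c (\<lambda>a. m (8 * a + int r)) T (\<lambda>m'. \<exists>t. steps (c, init_mem xs) t (Skip, m'))"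
    unfolding m using assms(2) by (auto simp: tri_def time_bounded_def)
  from tri_relocate[OF _ _ this]
  have *: "tri (relocate (int r) c) m (30 * T)
     (\<lambda>m'. (\<exists>t. steps (c, init_mem xs) t (Skip, \<lambda>a. m' (8 * a + int r))) \<and>
           (\<forall>a. a mod 8 \<noteq> int r \<longrightarrow> m' a = m a))" using r by simp
  show "tri (compile (Foreign r c)) m (30 * T * U) (\<lambda>m'. \<exists>s'. rep m' s' \<and> bnd B s' \<and> Q s')"
    unfolding compile.simps
  proof (rule tri_mono[OF *])
    show "30 * T \<le> 30 * T * U" using unit_pos[OF U] by (cases U) auto
    fix m' assume 1: "(\<exists>t. steps (c, init_mem xs) t (Skip, \<lambda>a. m' (8 * a + int r))) \<and>
           (\<forall>a. a mod 8 \<noteq> int r \<longrightarrow> m' a = m a)"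
    let ?s = "(fst s, (snd s)(r := \<lambda>a. m' (8 * a + int r)))"
    have "reg_addr x mod 8 \<noteq> int r" for x using r by (simp add: reg_addr_def)
    moreover have "(8 * a + int r') mod 8 = int r'" if "r' < 8" for a r' using that by simp
    ultimately have "rep m' ?s" using 1 rp by (auto simp: rep_def)
    moreover have "bnd B ?s" using b assms(3) by (auto simp: bnd_def)
    ultimately show "\<exists>s'. rep m' s' \<and> bnd B s' \<and> Q s'" using assms(4) 1 by blast
  qed
qed

text \<open>The increment of the counter belongs to the compiled loop and not to the body, so the
  body has to establish the invariant for the state with the counter already advanced. The 5 units
  per round pay for test, increment and sequencing.\<close>

lemma htri_For:
  assumes I0: "I 0 ((fst s)(x := 0), snd s)"
    and body: "\<And>i s. i < n \<Longrightarrow> I i s \<Longrightarrow> fst s x = int i \<Longrightarrow> bnd B s \<Longrightarrow>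
      htri B U p s b (\<lambda>s'. fst s' x = int i \<and> I (Suc i) ((fst s')(x := int i + 1), snd s'))"
    and e: "\<And>i s. i \<le> n \<Longrightarrow> I i s \<Longrightarrow> bnd B s \<Longrightarrow> safe B e s \<and> hval e s = int n"
    and n: "int n \<le> B"
    and Q: "\<And>s'. I n s' \<Longrightarrow> fst s' x = int n \<Longrightarrow> bnd B s' \<Longrightarrow> Q s'"
  shows "htri B U (For x e p) s (n * (b + 5) + 4) Q"
  unfolding htri_def
proof (intro impI allI)
  fix m assume wf: "wf_com (For x e p)" and U: "weight (For x e p) * len B \<le> U" and bs: "bnd B s"
    and r: "rep m s"
  have U1: "1 \<le> U" using unit_pos[OF U] .
  have w: "wf_exp e" "wf_com p" using wf by auto
  have Up: "weight p * len B \<le> U" using weight_len_le(1)[OF U[unfolded weight.simps]] .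
  have Ux: "(10 * exp_weight (Var x) + 4 * exp_weight e) * len B \<le> U"
    using weight_len_le(2)[OF U[unfolded weight.simps]] .
  have wx: "2 + len (reg_addr x) \<le> exp_weight (Var x) * len B"
    by (simp only: exp_weight.simps le_times_len)
  let ?test = "Less (Load (Const (reg_addr x))) (compile_exp e)"
  let ?inc = "Store (Const (reg_addr x)) (Add (Load (Const (reg_addr x))) (Const 1))"
  let ?Q = "\<lambda>m'. \<exists>s'. rep m' s' \<and> bnd B s' \<and> Q s'"
  have test: "exp_cost ?test m + len (val ?test m) \<le> U"
    if "rep m s" "bnd B s" "safe B e s" for m s
  proof -
    note c = compile_exp_cost[OF that(1,2) w(1) that(3)]
    have cx: "exp_cost (compile_exp (Var x)) m \<le> exp_weight (Var x) * len B"
      "len (hval (Var x) s) \<le> exp_weight (Var x) * len B"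
      using compile_exp_cost[OF that(1,2), of "Var x"] by auto
    have "len (val ?test m) \<le> 2" by (simp add: len_def floorlog_def)
    moreover have "2 \<le> exp_weight (Var x) * len B"
      using wx by linarith
    moreover have "m (reg_addr x) = fst s x" using that(1) by (simp add: rep_def)
    ultimately show ?thesis
      using c cx Ux val_compile_exp[OF that(1) w(1)]
      by (simp add: algebra_simps del: exp_weight.simps)
  qed
  have inc: "exp_cost (Const (reg_addr x)) m + exp_cost (Add (Load (Const (reg_addr x))) (Const 1)) m
     + len (reg_addr x) + len (fst s x + 1) \<le> U"
    if "rep m s" "bnd B s" for m s
  proof -
    have cx: "exp_cost (compile_exp (Var x)) m \<le> exp_weight (Var x) * len B"
      "len (hval (Var x) s) \<le> exp_weight (Var x) * len B"
      using compile_exp_cost[OF that, of "Var x"] by auto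
    have "1 + len (reg_addr x) \<le> exp_weight (Var x) * len B"
      using wx by linarith
    moreover have "len 1 \<le> 2" by (simp add: len_def floorlog_def)
    moreover have "2 \<le> exp_weight (Var x) * len B"
      using wx by linarith
    moreover have "m (reg_addr x) = fst s x" using that(1) by (simp add: rep_def)
    moreover note len_add[of "fst s x" 1]
    moreover have "10 * (exp_weight (Var x) * len B) \<le> U"
      using Ux by (simp add: algebra_simps del: exp_weight.simps)
    ultimately show ?thesis using cx
      by (simp del: exp_weight.simps)
  qed
  \<comment> \<open>Induction on the number k of remaining rounds; the 2 extra units pay for the
    final test, which fails.\<close>
  have loop: "tri (While ?test (Seq (compile p) ?inc)) m ((k * (b + 5) + 2) * U) ?Q"
    if "rep m s" "bnd B s" "I (n - k) s" "fst s x = int (n - k)" "k \<le> n" for k m s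
    using that
  proof (induction k arbitrary: m s)
    case 0
    have "val ?test m = 0"
      using 0 val_compile_exp[OF 0(1) w(1)] e[of n s] by (simp add: rep_def)
    moreover have "?Q m" using Q[of s] 0 by auto
    moreover have "safe B e s" using e[of n s] 0 by auto
    ultimately show ?case
      using test[OF 0(1,2)] U1
      by (intro tri_mono[OF tri_While[where T = 0 and Q = ?Q]]) auto
  next
    case (Suc k)
    let ?i = "n - Suc k"
    have i: "?i < n" "Suc ?i = n - k" using Suc.prems by auto
    have safe: "safe B e s" using e[of ?i s] Suc.prems by auto
    have 1: "tri (compile p) m (b * U)
      (\<lambda>m'. \<exists>s'. rep m' s' \<and> bnd B s' \<and> fst s' x = int ?i \<and>
          I (Suc ?i) ((fst s')(x := int ?i + 1), snd s'))"
      using htriD[OF body[OF i(1) Suc.prems(3,4,2)] w(2) Up Suc.prems(2,1)] .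
    have 2: "tri ?inc m' U (\<lambda>m'. \<exists>s'. rep m' s' \<and> bnd B s' \<and> I (n - k) s' \<and> fst s' x = int (n - k))"
      if "\<exists>s'. rep m' s' \<and> bnd B s' \<and> fst s' x = int ?i \<and>
          I (Suc ?i) ((fst s')(x := int ?i + 1), snd s')" for m'
    proof -
      from that obtain s' where s': "rep m' s'" "bnd B s'" "fst s' x = int ?i"
        "I (Suc ?i) ((fst s')(x := int ?i + 1), snd s')" by blast
      have v: "val (Add (Load (Const (reg_addr x))) (Const 1)) m' = int ?i + 1"
        using s'(1,3) by (simp add: rep_def)
      have "bnd B ((fst s')(x := int ?i + 1), snd s')"
        using s'(2) n i by (intro bnd_reg_upd) auto
      moreover note rep_reg_upd[OF s'(1), of x "int ?i + 1"]
      moreover have "int ?i + 1 = int (n - k)" using i by simp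
      ultimately show ?thesis
        using inc[OF s'(1,2)] s'(3,4) v i
        by (intro tri_mono[OF tri_Store[where Q = "\<lambda>m'. \<exists>s'. rep m' s' \<and> bnd B s' \<and> I (n - k) s' \<and> fst s' x = int (n - k)"]])
           (auto intro!: exI[of _ "(fst s')(x := int (n - k))"])
    qed
    have 3: "tri (While ?test (Seq (compile p) ?inc)) m' ((k * (b + 5) + 2) * U) ?Q"
      if "\<exists>s'. rep m' s' \<and> bnd B s' \<and> I (n - k) s' \<and> fst s' x = int (n - k)" for m'
      using that Suc.IH Suc.prems(5) by auto
    have 4: "tri (Seq (Seq (compile p) ?inc) (While ?test (Seq (compile p) ?inc))) m
        ((b * U + 1 + U) + 1 + (k * (b + 5) + 2) * U) ?Q"
      by (rule tri_Seq[OF tri_Seq[OF 1 2] 3])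
    have nz: "val ?test m \<noteq> 0"
      using Suc.prems i e[of ?i s] val_compile_exp[OF Suc.prems(1) w(1)] by (simp add: rep_def)
    show ?case
    proof (rule tri_mono[OF tri_While[where Q = ?Q, OF 4]])
      show "1 + (exp_cost ?test m + len (val ?test m) + (b * U + 1 + U + 1 + (k * (b + 5) + 2) * U))
        \<le> (Suc k * (b + 5) + 2) * U"
        using test[OF Suc.prems(1,2) safe] U1 by (simp add: algebra_simps del: exp_cost.simps val.simps)
    qed (use nz in auto)
  qed
  let ?s0 = "((fst s)(x := 0), snd s)"
  have init: "tri (Store (Const (reg_addr x)) (Const 0)) m U
      (\<lambda>m'. m' = m(reg_addr x := 0))"
  proof -
    note wx
    moreover have "len 0 \<le> 1" by (simp add: len_def floorlog_def)
    moreover have "10 * (exp_weight (Var x) * len B) \<le> U"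
      using Ux by (simp add: algebra_simps del: exp_weight.simps)
    ultimately show ?thesis
      by (intro tri_mono[OF tri_Store[where Q = "\<lambda>m'. m' = m(reg_addr x := 0)"]])
         (auto simp del: exp_weight.simps)
  qed
  have "0 \<le> B" using bs unfolding bnd_def by (meson abs_ge_zero order_trans)
  then have "bnd B ?s0" using bs by (intro bnd_reg_upd) auto
  from loop[OF rep_reg_upd[OF r] this, of n] I0
  have "tri (While ?test (Seq (compile p) ?inc)) (m(reg_addr x := 0)) ((n * (b + 5) + 2) * U) ?Q"
    by simp
  then have "tri (compile (For x e p)) m (U + 1 + (n * (b + 5) + 2) * U) ?Q"
    unfolding compile.simps by (intro tri_Seq[OF init]) auto
  then show "tri (compile (For x e p)) m ((n * (b + 5) + 4) * U) ?Q"
    by (rule tri_mono) (use U1 in \<open>auto simp: algebra_simps\<close>)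
qed

lemma hcan_For:
  assumes I0: "I 0 ((fst s)(x := 0), snd s)"
    and body: "\<And>i s. i < n \<Longrightarrow> I i s \<Longrightarrow> fst s x = int i \<Longrightarrow> bnd B s \<Longrightarrow>
      hcan B U p s (\<lambda>s'. fst s' x = int i \<and> I (Suc i) ((fst s')(x := int i + 1), snd s'))"
    and e: "\<And>i s. i \<le> n \<Longrightarrow> I i s \<Longrightarrow> bnd B s \<Longrightarrow> hval e s = int n"
    and n: "int n \<le> B"
    and Q: "\<And>s'. I n s' \<Longrightarrow> fst s' x = int n \<Longrightarrow> bnd B s' \<Longrightarrow> Q s'"
  shows "hcan B U (For x e p) s Q"
  unfolding hcan_def
proof (intro impI allI)
  fix m assume wf: "wf_com (For x e p)" and U: "weight (For x e p) * len B \<le> U" and bs: "bnd B s"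
    and r: "rep m s"
  have w: "wf_exp e" "wf_com p" using wf by auto
  have Up: "weight p * len B \<le> U" using weight_len_le(1)[OF U[unfolded weight.simps]] .
  let ?test = "Less (Load (Const (reg_addr x))) (compile_exp e)"
  let ?inc = "Store (Const (reg_addr x)) (Add (Load (Const (reg_addr x))) (Const 1))"
  let ?Q = "\<lambda>m'. \<exists>s'. rep m' s' \<and> bnd B s' \<and> Q s'"
  let ?W = "While ?test (Seq (compile p) ?inc)"
  have loop: "\<exists>t m'. steps (?W, m) t (Skip, m') \<and> ?Q m'"
    if "rep m s" "bnd B s" "I (n - k) s" "fst s x = int (n - k)" "k \<le> n" for k m s
    using that
  proof (induction k arbitrary: m s)
    case 0
    have "val ?test m = 0"
      using 0 val_compile_exp[OF 0(1) w(1)] e[of n s] by (simp add: rep_def)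
    moreover have "?Q m" using Q[of s] 0 by auto
    ultimately show ?case
      using steps.step[OF step.While steps.step[OF step.If_False steps.refl]] by blast
  next
    case (Suc k)
    let ?i = "n - Suc k"
    have i: "?i < n" "Suc ?i = n - k" using Suc.prems by auto
    obtain t1 m1 s1 where 1: "steps (compile p, m) t1 (Skip, m1)" "rep m1 s1" "bnd B s1"
       "fst s1 x = int ?i" "I (Suc ?i) ((fst s1)(x := int ?i + 1), snd s1)"
      using body[OF i(1) Suc.prems(3,4,2)] w(2) Up Suc.prems(2,1) unfolding hcan_def by blast
    let ?s2 = "((fst s1)(x := int ?i + 1), snd s1)" and ?m2 = "m1(reg_addr x := int ?i + 1)"
    have v: "val (Add (Load (Const (reg_addr x))) (Const 1)) m1 = int ?i + 1"
      using 1(2,4) by (simp add: rep_def)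
    have 2: "\<exists>t2. steps (?inc, m1) t2 (Skip, ?m2)"
      using steps_single[OF step.Store[of "Const (reg_addr x)" "Add (Load (Const (reg_addr x))) (Const 1)" m1]]
      unfolding v val.simps(1) by blast
    have "bnd B ?s2" using 1(3) n i by (intro bnd_reg_upd) auto
    from Suc.IH[OF rep_reg_upd[OF 1(2)] this] obtain t3 m3 where
      3: "steps (?W, ?m2) t3 (Skip, m3)" "?Q m3" using 1(5) i by fastforce
    obtain t4 where 4: "steps (Seq (Seq (compile p) ?inc) ?W, m) t4 (Skip, m3)"
      using steps_SeqI[OF steps_SeqI[OF 1(1)] 3(1)] 2 by blast
    have nz: "val ?test m \<noteq> 0"
      using Suc.prems i e[of ?i s] val_compile_exp[OF Suc.prems(1) w(1)] by (simp add: rep_def)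
    show ?case
      using steps.step[OF step.While steps.step[OF step.If_True[OF nz] 4]] 3(2) by blast
  qed
  let ?s0 = "((fst s)(x := 0), snd s)"
  have init: "\<exists>t. steps (Store (Const (reg_addr x)) (Const 0), m) t (Skip, m(reg_addr x := 0))"
    using steps_single[OF step.Store[of "Const (reg_addr x)" "Const 0" m]] unfolding val.simps by blast
  have "0 \<le> B" using bs unfolding bnd_def by (meson abs_ge_zero order_trans)
  then have "bnd B ?s0" using bs by (intro bnd_reg_upd) auto
  from loop[OF rep_reg_upd[OF r] this, of n] I0
  obtain t m' where "steps (?W, m(reg_addr x := 0)) t (Skip, m')" "?Q m'" by auto
  then show "\<exists>t m' s'. steps (compile (For x e p), m) t (Skip, m') \<and> rep m' s' \<and> bnd B s' \<and> Q s'"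
    using init steps_SeqI unfolding compile.simps by blast
qed

text \<open>Weakest preconditions of straight-line code, to be discharged by simplification. Loops
  and foreign calls are mapped to \<open>False\<close> and treated by their own rules. Between two
  commands the bound on the data may be assumed again.\<close>

fun vc :: "int \<Rightarrow> hcom \<Rightarrow> (hstate \<Rightarrow> bool) \<Rightarrow> hstate \<Rightarrow> bool" where
  "vc B HSkip Q s = Q s"
| "vc B (Asg x e) Q s =
     (safe B e s \<and> \<bar>hval e s\<bar> \<le> B \<and> Q ((fst s)(x := hval e s), snd s))"
| "vc B (Upd r e1 e2) Q s =
     (safe B e1 s \<and> safe B e2 s \<and> (4 \<le> r \<longrightarrow> \<bar>hval e2 s\<bar> \<le> B) \<and>
      Q (fst s, (snd s)(r := (snd s r)(hval e1 s := hval e2 s))))"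
| "vc B (Flip x) Q s = (1 \<le> B \<and> (\<forall>b\<in>{0, 1}. Q ((fst s)(x := b), snd s)))"
| "vc B (p ;; q) Q s = vc B p (\<lambda>s'. bnd B s' \<longrightarrow> vc B q Q s') s"
| "vc B (HIf e p q) Q s =
     (safe B e s \<and> (if hval e s \<noteq> 0 then vc B p Q s else vc B q Q s))"
| "vc B (For x e p) Q s = False"
| "vc B (Foreign r c) Q s = False"

fun ticks :: "hcom \<Rightarrow> nat" where
  "ticks (p ;; q) = ticks p + ticks q + 1"
| "ticks (HIf e p q) = max (ticks p) (ticks q) + 1"
| "ticks HSkip = 0"
| "ticks p = 1"

lemma htri_vc: "vc B p Q s \<Longrightarrow> htri B U p s (ticks p) Q"
proof (induction p arbitrary: Q s)
  case (HSeq p1 p2)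
  show ?case
    unfolding ticks.simps using HSeq.prems
    by (intro htri_HSeq[OF HSeq.IH(1)[where Q = "\<lambda>s'. bnd B s' \<longrightarrow> vc B p2 Q s'"]] HSeq.IH(2)) auto
next
  case (HIf e p1 p2)
  show ?case
    unfolding ticks.simps using HIf.prems
    by (intro htri_HIf htri_mono[OF HIf.IH(1)] htri_mono[OF HIf.IH(2)]) auto
qed (auto intro!: htri_HSkip htri_Asg htri_Upd htri_Flip simp del: One_nat_def)

section \<open>Decision procedures and transducers\<close>

definition eqE :: "hexp \<Rightarrow> hexp \<Rightarrow> hexp" where
  "eqE a b = Bop Minus (Bop Minus (Num 1) (Bop Lt a b)) (Bop Lt b a)"

definition notE :: "hexp \<Rightarrow> hexp" where
  "notE a = eqE a (Num 0)"

definition andE :: "hexp \<Rightarrow> hexp \<Rightarrow> hexp" where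
  "andE a b = notE (notE (Bop Times a b))"

definition modE :: "hexp \<Rightarrow> hexp \<Rightarrow> hexp" where
  "modE a b = Bop Minus a (Bop Times b (Bop Div a b))"

text \<open>Turns a constant list into program text. The rules of the fixed grammar are stored this
  way, so that looking one up takes constantly many operations.\<close>

fun tabE :: "int list \<Rightarrow> hexp \<Rightarrow> hexp" where
  "tabE [] e = Num 0"
| "tabE (k # ks) e = Bop Plus (Bop Times (Num k) (eqE e (Num 0))) (tabE ks (Bop Minus e (Num 1)))"

lemma hval_eqE [simp]: "hval (eqE a b) s = of_bool (hval a s = hval b s)"
  by (simp add: eqE_def)

lemma hval_notE [simp]: "hval (notE a) s = of_bool (hval a s = 0)"
  by (simp add: notE_def)

lemma hval_andE [simp]: "hval (andE a b) s = of_bool (hval a s \<noteq> 0 \<and> hval b s \<noteq> 0)"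
  by (simp add: andE_def)

lemma hval_modE [simp]: "hval (modE a b) s = hval a s mod hval b s"
  by (simp add: modE_def minus_mult_div_eq_mod)

lemma hval_tabE:
  "hval (tabE ks e) s =
     (if 0 \<le> hval e s \<and> hval e s < int (length ks) then ks ! nat (hval e s) else 0)"
proof (induction ks arbitrary: e)
  case (Cons k ks)
  show ?case
    unfolding tabE.simps hval.simps Cons.IH
    by (auto simp: nth_Cons' nat_diff_distrib)
qed simp

lemma safe_macros [simp]:
  "safe B (eqE a b) s \<longleftrightarrow> safe B a s \<and> safe B b s"
  "safe B (notE a) s \<longleftrightarrow> safe B a s"
  "safe B (andE a b) s \<longleftrightarrow> safe B a s \<and> safe B b s"
  "safe B (modE a b) s \<longleftrightarrow> safe B a s \<and> safe B b s"
  by (auto simp: eqE_def notE_def andE_def modE_def)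

lemma safe_tabE: "safe B e s \<Longrightarrow> safe B (tabE ks e) s"
  by (induction ks arbitrary: e) auto

lemma wf_exp_macros [simp]:
  "wf_exp (eqE a b) \<longleftrightarrow> wf_exp a \<and> wf_exp b"
  "wf_exp (notE a) \<longleftrightarrow> wf_exp a"
  "wf_exp (andE a b) \<longleftrightarrow> wf_exp a \<and> wf_exp b"
  "wf_exp (modE a b) \<longleftrightarrow> wf_exp a \<and> wf_exp b"
  by (auto simp: eqE_def notE_def andE_def modE_def)

lemma wf_exp_tabE: "wf_exp e \<Longrightarrow> wf_exp (tabE ks e)"
  by (induction ks arbitrary: e) auto

definition mapL :: "nat \<Rightarrow> nat \<Rightarrow> hexp \<Rightarrow> hexp \<Rightarrow> hexp \<Rightarrow> hcom" where
  "mapL x r off l e = For x l (Upd r (Bop Plus off (Var x)) e)"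

text \<open>The expressions are evaluated under an arbitrary content \<open>g\<close> of the target
  array: their values must not depend on what the loop has written so far.\<close>

lemma htri_mapL:
  assumes l: "\<And>i g. i \<le> n \<Longrightarrow> hval l ((fst s)(x := int i), (snd s)(r := g)) = int n \<and>
        safe B l ((fst s)(x := int i), (snd s)(r := g))"
    and off: "\<And>i g. i < n \<Longrightarrow> hval off ((fst s)(x := int i), (snd s)(r := g)) = k \<and>
        safe B off ((fst s)(x := int i), (snd s)(r := g))"
    and e: "\<And>i g. i < n \<Longrightarrow> hval e ((fst s)(x := int i), (snd s)(r := g)) = f i \<and>
        safe B e ((fst s)(x := int i), (snd s)(r := g))"
    and f: "\<And>i. 4 \<le> r \<Longrightarrow> i < n \<Longrightarrow> \<bar>f i\<bar> \<le> B"
    and n: "int n \<le> B"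
    and Q: "Q ((fst s)(x := int n),
        (snd s)(r := \<lambda>a. if k \<le> a \<and> a < k + int n then f (nat (a - k)) else snd s r a))"
  shows "htri B U (mapL x r off l e) s (n * 6 + 4) Q"
proof -
  let ?g = "\<lambda>i a. if k \<le> a \<and> a < k + int i then f (nat (a - k)) else snd s r a"
  define I where "I i s' \<longleftrightarrow> s' = ((fst s)(x := int i), (snd s)(r := ?g i))" for i s'
  have g: "(?g i)(k + int i := f i) = ?g (Suc i)" for i by (auto simp: fun_eq_iff)
  show ?thesis
    unfolding mapL_def
  proof (rule htri_mono[OF htri_For[where I = I and n = n and b = 1]])
    show "I 0 ((fst s)(x := 0), snd s)" by (auto simp: I_def fun_eq_iff)
  next
    fix i s' assume i: "i < n" "I i s'"
    then have s': "s' = ((fst s)(x := int i), (snd s)(r := ?g i))" by (simp add: I_def)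
    show "htri B U (Upd r (Bop Plus off (Var x)) e) s' 1
       (\<lambda>s'. fst s' x = int i \<and> I (Suc i) ((fst s')(x := int i + 1), snd s'))"
    proof (rule htri_Upd)
      show "fst (fst s', (snd s')(r := (snd s' r)(hval (Bop Plus off (Var x)) s' := hval e s'))) x = int i \<and>
        I (Suc i) ((fst (fst s', (snd s')(r := (snd s' r)(hval (Bop Plus off (Var x)) s' := hval e s'))))(x := int i + 1),
           snd (fst s', (snd s')(r := (snd s' r)(hval (Bop Plus off (Var x)) s' := hval e s'))))"
        using off[OF i(1)] e[OF i(1)] g[of i] unfolding s' I_def by (simp add: add.commute)
    qed (use off[OF i(1)] e[OF i(1)] f[OF _ i(1)] in \<open>simp_all add: s'\<close>)
  next
    fix i s' assume i: "i \<le> n" "I i s'"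
    then show "safe B l s' \<and> hval l s' = int n" using l[OF i(1)] by (simp add: I_def)
  qed (use n Q in \<open>auto simp: I_def\<close>)
qed

definition allL :: "nat \<Rightarrow> nat \<Rightarrow> hexp \<Rightarrow> hexp \<Rightarrow> hcom" where
  "allL y x l e = Asg y (Num 1) ;; For x l (HIf e HSkip (Asg y (Num 0)))"

lemma htri_allL:
  assumes l: "\<And>i v. i \<le> n \<Longrightarrow> hval l ((fst s)(y := v, x := int i), snd s) = int n \<and>
        safe B l ((fst s)(y := v, x := int i), snd s)"
    and e: "\<And>i v. i < n \<Longrightarrow> (hval e ((fst s)(y := v, x := int i), snd s) \<noteq> 0 \<longleftrightarrow> P i) \<and>
        safe B e ((fst s)(y := v, x := int i), snd s)"
    and n: "int n \<le> B" and B: "1 \<le> B" and xy: "x \<noteq> y"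
    and Q: "Q ((fst s)(y := of_bool (\<forall>i<n. P i), x := int n), snd s)"
  shows "htri B U (allL y x l e) s (n * 7 + 6) Q"
proof -
  define I where "I i s' \<longleftrightarrow> s' = ((fst s)(y := of_bool (\<forall>j<i. P j), x := int i), snd s)" for i s'
  have loop: "htri B U (For x l (HIf e HSkip (Asg y (Num 0)))) ((fst s)(y := 1), snd s) (n * 7 + 4) Q"
  proof (rule htri_mono[OF htri_For[where I = I and n = n and b = 2]])
    show "I 0 ((fst ((fst s)(y := 1), snd s))(x := 0), snd ((fst s)(y := 1), snd s))"
      by (auto simp: I_def)
  next
    fix i s' assume i: "i < n" "I i s'"
    then have s': "s' = ((fst s)(y := of_bool (\<forall>j<i. P j), x := int i), snd s)" by (simp add: I_def)
    have 1: "(\<forall>j<Suc i. P j) \<longleftrightarrow> (\<forall>j<i. P j) \<and> P i" by (auto simp: less_Suc_eq)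
    have 2: "(fst s)(y := v, x := int i, y := w, x := u) = (fst s)(y := w, x := u)" for v w u
      using xy by (auto simp: fun_eq_iff)
    show "htri B U (HIf e HSkip (Asg y (Num 0))) s' 2
       (\<lambda>s'. fst s' x = int i \<and> I (Suc i) ((fst s')(x := int i + 1), snd s'))"
    proof (rule htri_mono[OF htri_vc, where n' = 2])
      show "vc B (HIf e HSkip (Asg y (Num 0)))
         (\<lambda>s'. fst s' x = int i \<and> I (Suc i) ((fst s')(x := int i + 1), snd s')) s'"
        using e[OF i(1)] xy B 1 2 unfolding s' I_def
        by (auto simp: add.commute fun_upd_same fun_upd_other simp del: fun_upd_apply)
    qed auto
  next
    fix i s' assume i: "i \<le> n" "I i s'"
    then show "safe B l s' \<and> hval l s' = int n" using l[OF i(1)] by (simp add: I_def)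
  qed (use n Q in \<open>auto simp: I_def\<close>)
  show ?thesis
    unfolding allL_def
    by (rule htri_mono[OF htri_HSeq[OF htri_Asg[where Q = "\<lambda>s'. s' = ((fst s)(y := 1), snd s)"]]])
      (use loop B in auto)
qed

text \<open>For the two loops that are written in machine code directly, since they move data
  between the plain memory layout and the residue classes; \<open>k\<close> counts the remaining
  rounds.\<close>

lemma tri_While_count:
  assumes "\<And>k m. I (Suc k) m \<Longrightarrow> val e m \<noteq> 0 \<and> exp_cost e m + len (val e m) \<le> t \<and> tri c m b (I k)"
    and "\<And>m. I 0 m \<Longrightarrow> val e m = 0 \<and> exp_cost e m + len (val e m) \<le> t \<and> Q m"
    and "I k m"
  shows "tri (While e c) m (k * (b + t + 2) + t + 1) Q"
  using assms(3)
proof (induction k arbitrary: m)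
  case 0
  then show ?case
    using assms(2)[OF 0] by (intro tri_mono[OF tri_While[where T = 0 and Q = Q]]) auto
next
  case (Suc k)
  have 1: "val e m \<noteq> 0" "exp_cost e m + len (val e m) \<le> t" "tri c m b (I k)"
    using assms(1)[OF Suc.prems] by auto
  have 2: "tri (Seq c (While e c)) m (b + 1 + (k * (b + t + 2) + t + 1)) Q"
    by (rule tri_Seq[OF 1(3) Suc.IH])
  show ?case
    by (rule tri_mono[OF tri_While[where Q = Q, OF 2]]) (use 1 in auto)
qed

abbreviation (input) "reg x \<equiv> Const (reg_addr x)"

text \<open>The input is moved into the residue class of 1 from its end, so that no entry is
  overwritten before it has been moved.\<close>

definition load_input :: com where
  "load_input =
     Seq (Store (reg 0) (Load (Const 0)))
    (Seq (While (Less (Const (- 1)) (Load (reg 0)))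
           (Seq (Store (Add (Mult (Const 8) (Load (reg 0))) (Const 1)) (Load (Load (reg 0))))
           (Seq (Store (Load (reg 0)) (Const 0))
                (Store (reg 0) (Sub (Load (reg 0)) (Const 1))))))
         (Store (reg 0) (Const 0)))"

definition init_state :: "int list \<Rightarrow> hstate" where
  "init_state xs = (\<lambda>_. 0, (\<lambda>_ _. 0)(1 := init_mem xs))"

lemma len_numerals: "len 0 = 1" "len 1 = 2" "len (-1) = 2" "len 8 = 5" "len (-8) = 5"
  by (simp_all add: len_def compute_floorlog)

lemma tri_load_input:
  assumes x: "int (length xs) \<le> B" "\<And>x. x \<in> set xs \<Longrightarrow> \<bar>x\<bar> \<le> B" and B: "1 \<le> B"
  shows "tri load_input (init_mem xs) ((length xs + 2) * 300 * len B) (\<lambda>m'. rep m' (init_state xs))"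
proof -
  define X where "X = init_mem xs"
  define L where "L = int (length xs)"
  define l where "l = len B"
  have l: "2 \<le> l" unfolding l_def using len_le_bound[of 1 B] B by (simp add: len_numerals)
  have X: "len (X a) \<le> l" for a
    unfolding l_def X_def init_mem_def using x B by (intro len_le_bound) (auto simp: nth_mem)
  have X0: "X a = 0" if "a < 0 \<or> L < a" for a
    using that by (auto simp: X_def L_def init_mem_def)
  have XL: "X 0 = L" by (simp add: X_def L_def init_mem_def)
  \<comment> \<open>The memory when the cells below \<open>k\<close> are still in place and those
    from \<open>k\<close> on have been moved. Register 0, at address -8, contains the next cell to
    be moved.\<close>
  define M where "M k = (\<lambda>a. if a = - 8 then int k - 1 else if 0 \<le> a \<and> a < int k then X a
      else if a mod 8 = 1 \<and> int k \<le> a div 8 then X (a div 8) else 0)" for k :: nat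
  have r0: "reg_addr 0 = - 8" by (simp add: reg_addr_def)
  have lc: "len c \<le> l" if "\<bar>c\<bar> \<le> L + 1 \<and> \<bar>c\<bar> \<le> B" for c
    unfolding l_def using that x(1) by (intro len_le_bound) (auto simp: L_def)
  let ?test = "Less (Const (- 1)) (Load (reg 0))"
  let ?body = "Seq (Store (Add (Mult (Const 8) (Load (reg 0))) (Const 1)) (Load (Load (reg 0))))
           (Seq (Store (Load (reg 0)) (Const 0))
                (Store (reg 0) (Sub (Load (reg 0)) (Const 1))))"
  have body: "tri ?body (M (Suc k)) (100 * l) (\<lambda>m. m = M k)" if k: "int (Suc k) \<le> L + 1" for k
  proof -
    let ?m1 = "(M (Suc k))(8 * int k + 1 := X (int k))"
    let ?m2 = "?m1(int k := 0)"
    have k': "int k \<le> B" using k x(1) by (simp add: L_def)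
    have lk: "len (int k) \<le> l" using k k' by (intro lc) auto
    have lk1: "len (int k - 1) \<le> l" using k k' B by (intro lc) auto
    have lk8: "len (8 * int k) \<le> 5 + l" using len_mult[of 8 "int k"] lk by (simp add: len_numerals)
    have lk81: "len (8 * int k + 1) \<le> 9 + l" using len_affine[of 1 "int k"] lk by simp
    have Mk: "M (Suc k) (- 8) = int k" "M (Suc k) (int k) = X (int k)"
      by (auto simp: M_def)
    have 1: "tri (Store (Add (Mult (Const 8) (Load (reg 0))) (Const 1)) (Load (Load (reg 0)))) (M (Suc k))
       (50 * l) (\<lambda>m. m = ?m1)"
      by (rule tri_mono[OF tri_Store[where Q = "\<lambda>m. m = ?m1"]])
         (use lk lk8 lk81 X[of "int k"] l in \<open>auto simp: r0 Mk len_numerals\<close>)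
    have 2: "tri (Store (Load (reg 0)) (Const 0)) ?m1 (20 * l) (\<lambda>m. m = ?m2)"
      by (rule tri_mono[OF tri_Store[where Q = "\<lambda>m. m = ?m2"]])
         (use lk l in \<open>auto simp: r0 Mk len_numerals\<close>)
    have "?m2(-8 := int k - 1) = M k"
    proof
      fix a :: int
      consider "a = - 8" | "a = 8 * int k + 1" | "a = int k"
        | "a \<noteq> - 8" "a \<noteq> 8 * int k + 1" "a \<noteq> int k" by blast
      then show "(?m2(-8 := int k - 1)) a = M k a"
      proof cases
        case 3
        \<comment> \<open>The cell just erased is not one of the cells \<open>8 * b + 1\<close> with
          \<open>k <= b\<close>, which hold entries already moved.\<close>
        have "int k \<le> int k div 8 \<Longrightarrow> int k = 0" by simp
        then have "\<not> (a mod 8 = 1 \<and> int k \<le> a div 8)" unfolding 3 by auto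
        then show ?thesis using 3 by (auto simp: M_def)
      next
        case 4
        have "a mod 8 = 1 \<Longrightarrow> int (Suc k) \<le> a div 8 \<longleftrightarrow> int k \<le> a div 8"
          using 4(2) by presburger
        moreover have "a < int (Suc k) \<longleftrightarrow> a < int k" using 4(3) by linarith
        moreover have "(?m2(-8 := int k - 1)) a = M (Suc k) a" using 4 by simp
        ultimately show ?thesis using 4(1) unfolding M_def by (simp del: of_nat_Suc cong: if_cong)
      qed (auto simp: M_def)
    qed
    then have 3: "tri (Store (reg 0) (Sub (Load (reg 0)) (Const 1))) ?m2 (20 * l) (\<lambda>m. m = M k)"
      by (intro tri_mono[OF tri_Store[where Q = "\<lambda>m. m = M k"]])
         (use lk lk1 l in \<open>auto simp: r0 Mk len_numerals\<close>)
    have "tri (Seq (Store (Load (reg 0)) (Const 0)) (Store (reg 0) (Sub (Load (reg 0)) (Const 1))))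
        ?m1 (20 * l + 1 + 20 * l) (\<lambda>m. m = M k)"
      by (rule tri_Seq[OF 2]) (use 3 in simp)
    then have "tri ?body (M (Suc k)) (50 * l + 1 + (20 * l + 1 + 20 * l)) (\<lambda>m. m = M k)"
      by (intro tri_Seq[OF 1]) simp
    then show ?thesis by (rule tri_mono) (use l in auto)
  qed
  have loop: "tri (While ?test ?body) (M (Suc (length xs)))
     (Suc (length xs) * (100 * l + 20 * l + 2) + 20 * l + 1) (\<lambda>m. m = M 0)"
  proof (rule tri_While_count[where I = "\<lambda>k m. m = M k \<and> int k \<le> L + 1"])
    fix k m assume *: "m = M (Suc k) \<and> int (Suc k) \<le> L + 1"
    have "len (int k) \<le> l" using * x(1) by (intro lc) (auto simp: L_def)
    then show "val ?test m \<noteq> 0 \<and> exp_cost ?test m + len (val ?test m) \<le> 20 * l \<and>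
       tri ?body m (100 * l) (\<lambda>m. m = M k \<and> int k \<le> L + 1)"
      using * l tri_mono[OF body[of k]] by (auto simp: r0 M_def len_numerals)
  next
    fix m assume *: "m = M 0 \<and> int 0 \<le> L + 1"
    then show "val ?test m = 0 \<and> exp_cost ?test m + len (val ?test m) \<le> 20 * l \<and> m = M 0"
      using l by (auto simp: r0 M_def len_numerals)
  qed (auto simp: L_def)
  have "(init_mem xs)(- 8 := L) = M (Suc (length xs))"
  proof
    fix a :: int
    have "a mod 8 = 1 \<and> L + 1 \<le> a div 8 \<Longrightarrow> L < a div 8" by simp
    moreover have "a \<noteq> -8 \<Longrightarrow> \<not> (0 \<le> a \<and> a < L + 1) \<Longrightarrow> X a = 0" using X0[of a] by auto
    ultimately show "((init_mem xs)(- 8 := L)) a = M (Suc (length xs)) a"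
      using X0[of "a div 8"] X0[of a] unfolding M_def X_def[symmetric] by (auto simp: L_def)
  qed
  then have 1: "tri (Store (reg 0) (Load (Const 0))) (init_mem xs) (20 * l) (\<lambda>m. m = M (Suc (length xs)))"
    using X[of 0] l XL unfolding X_def L_def
    by (intro tri_mono[OF tri_Store[where Q = "\<lambda>m. m = M (Suc (length xs))"]])
       (auto simp: r0 len_numerals)
  have "rep ((M 0)(-8 := 0)) (init_state xs)"
    unfolding rep_def init_state_def
  proof (intro conjI allI impI)
    fix y
    have "\<not> 0 \<le> reg_addr y" "reg_addr y mod 8 = 0" by (auto simp: reg_addr_def)
    then show "((M 0)(-8 := 0)) (reg_addr y) = fst (\<lambda>_. 0, (\<lambda>_ _. 0)(1 := init_mem xs)) y"
      by (simp add: M_def)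
  next
    fix r a assume r: "0 < r" "r < (8::nat)"
    then have 1: "(8 * a + int r) mod 8 = int r" "(8 * a + int r) div 8 = a" "8 * a + int r \<noteq> - 8"
      by (simp_all, presburger)
    show "((M 0)(-8 := 0)) (8 * a + int r) = snd (\<lambda>_. 0, (\<lambda>_ _. 0)(1 := init_mem xs)) r a"
      using 1 r X0[of a] unfolding M_def X_def[symmetric] by auto
  qed
  then have 3: "tri (Store (reg 0) (Const 0)) (M 0) (20 * l) (\<lambda>m'. rep m' (init_state xs))"
    using l by (intro tri_mono[OF tri_Store[where Q = "\<lambda>m'. rep m' (init_state xs)"]])
       (auto simp: r0 len_numerals)
  show ?thesis
    unfolding load_input_def l_def[symmetric]
  proof (rule tri_mono[OF tri_Seq[OF 1 tri_Seq]])
    show "tri (While ?test ?body) m' (Suc (length xs) * (100 * l + 20 * l + 2) + 20 * l + 1) (\<lambda>m. m = M 0)"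
      if "m' = M (Suc (length xs))" for m' using that loop by simp
    show "tri (Store (reg 0) (Const 0)) m' (20 * l) (\<lambda>m'. rep m' (init_state xs))"
      if "m' = M 0" for m' using that 3 by simp
    have "Suc (length xs) * 2 \<le> Suc (length xs) * l" using l by (rule mult_le_mono2)
    then show "20 * l + 1 + (Suc (length xs) * (100 * l + 20 * l + 2) + 20 * l + 1 + 1 + 20 * l)
       \<le> (length xs + 2) * 300 * l" using l by (simp add: algebra_simps)
  qed auto
qed

text \<open>Decision procedures return their answer in register 0.\<close>

definition decider :: "hcom \<Rightarrow> com" where
  "decider p = Seq load_input (Seq (compile p) (Store (Const 0) (Load (reg 0))))"

lemma bnd_init_state: "0 \<le> B \<Longrightarrow> bnd B (init_state xs)"
  by (auto simp: bnd_def init_state_def)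

text \<open>Nondeterministic acceptance needs both judgements: \<open>dem\<close> gives the time
  bound and excludes wrong acceptance on every run, \<open>ang\<close> exhibits an accepting
  run.\<close>

lemma decider_correct:
  assumes x: "int (length xs) \<le> B" "\<And>x. x \<in> set xs \<Longrightarrow> \<bar>x\<bar> \<le> B" and B: "1 \<le> B"
    and p: "wf_com p" "weight p * len B \<le> U"
    and dem: "htri B U p (init_state xs) n (\<lambda>s'. fst s' 0 \<noteq> 0 \<longrightarrow> P)"
    and ang: "P \<Longrightarrow> hcan B U p (init_state xs) (\<lambda>s'. fst s' 0 \<noteq> 0)"
  shows "time_bounded (decider p) xs ((length xs + 3) * 300 * len B + n * U)"
    and "accepts (decider p) xs \<longleftrightarrow> P"
proof -
  let ?post = "Store (Const 0) (Load (reg 0))"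
  have l: "1 \<le> len B" by (rule len_ge_1)
  have b: "bnd B (init_state xs)" using B by (simp add: bnd_init_state)
  have r0: "reg_addr 0 = - 8" by (simp add: reg_addr_def)
  have lm: "len (m (-8)) \<le> len B" if "rep m s'" "bnd B s'" for m s'
    using that r0 by (intro len_le_bound) (metis bnd_def rep_def)
  have post: "tri ?post m (30 * len B) (\<lambda>m'. m' 0 \<noteq> 0 \<longrightarrow> P)"
    if "\<exists>s'. rep m s' \<and> bnd B s' \<and> (fst s' 0 \<noteq> 0 \<longrightarrow> P)" for m
  proof -
    from that obtain s' where s': "rep m s'" "bnd B s'" "fst s' 0 \<noteq> 0 \<longrightarrow> P" by blast
    have "m (-8) = fst s' 0" using s'(1) r0 unfolding rep_def by metis
    then show ?thesis
      using s'(3) lm[OF s'(1,2)] l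
      by (intro tri_mono[OF tri_Store[where Q = "\<lambda>m'. m' 0 \<noteq> 0 \<longrightarrow> P"]])
         (auto simp: r0 len_numerals simp del: len_ge_1)
  qed
  have tri: "tri (decider p) (init_mem xs) ((length xs + 3) * 300 * len B + n * U) (\<lambda>m'. m' 0 \<noteq> 0 \<longrightarrow> P)"
    unfolding decider_def
  proof (rule tri_mono[OF tri_Seq[OF tri_load_input[OF x B] tri_Seq[OF _ post]]])
    show "tri (compile p) m' (n * U) (\<lambda>m'. \<exists>s'. rep m' s' \<and> bnd B s' \<and> (fst s' 0 \<noteq> 0 \<longrightarrow> P))"
      if "rep m' (init_state xs)" for m'
      using htriD[OF dem p b that] .
    show "(length xs + 2) * 300 * len B + 1 + (n * U + 1 + 30 * len B)
      \<le> (length xs + 3) * 300 * len B + n * U" using l by (simp add: algebra_simps del: len_ge_1)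
  qed auto
  then show "time_bounded (decider p) xs ((length xs + 3) * 300 * len B + n * U)"
    unfolding tri_def time_bounded_def by blast
  show "accepts (decider p) xs \<longleftrightarrow> P"
  proof
    show P if "accepts (decider p) xs"
      using that tri unfolding tri_def accepts_def by blast
  next
    assume P
    obtain t1 m1 where 1: "steps (load_input, init_mem xs) t1 (Skip, m1)" "rep m1 (init_state xs)"
      using tri_halts[OF tri_load_input[OF x B]] .
    obtain t2 m2 s2 where 2: "steps (compile p, m1) t2 (Skip, m2)" "rep m2 s2" "fst s2 0 \<noteq> 0"
      using ang[OF \<open>P\<close>] p b 1(2) unfolding hcan_def by blast
    obtain t3 where 3: "steps (?post, m2) t3 (Skip, m2(0 := m2 (- 8)))"
      using steps_single[OF step.Store[of "Const 0" "Load (reg 0)" m2]] by (auto simp: r0)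
    have "m2 (- 8) \<noteq> 0" using 2(2,3) r0 unfolding rep_def by metis
    then show "accepts (decider p) xs"
      using steps_SeqI[OF 1(1) steps_SeqI[OF 2(1) 3]] unfolding accepts_def decider_def
      by (metis fun_upd_same)
  qed
qed

text \<open>Transducers leave their output in array 7 and the number of cells to copy in
  register 1.\<close>

definition transducer :: "hcom \<Rightarrow> com" where
  "transducer p = Seq load_input (Seq (compile p)
     (While (Less (Load (reg 0)) (Load (reg 1)))
       (Seq (Store (Load (reg 0)) (Load (Add (Mult (Const 8) (Load (reg 0))) (Const 7))))
            (Store (reg 0) (Add (Load (reg 0)) (Const 1))))))"

fun det_com :: "hcom \<Rightarrow> bool" where
  "det_com (Flip x) = False"
| "det_com (p ;; q) = (det_com p \<and> det_com q)"
| "det_com (HIf e p q) = (det_com p \<and> det_com q)"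
| "det_com (For x e p) = det_com p"
| "det_com (Foreign r c) = False"
| "det_com p = True"

lemma deterministic_transducer: "det_com p \<Longrightarrow> deterministic (transducer p)"
proof -
  have "det_com p \<Longrightarrow> deterministic (compile p)" by (induction p) auto
  then show "det_com p \<Longrightarrow> deterministic (transducer p)"
    by (simp add: transducer_def load_input_def)
qed

lemma transducer_correct:
  assumes x: "int (length xs) \<le> B" "\<And>x. x \<in> set xs \<Longrightarrow> \<bar>x\<bar> \<le> B" and B: "1 \<le> B"
    and y: "int (length ys) + 1 \<le> B"
    and p: "wf_com p" "weight p * len B \<le> U"
    and run: "htri B U p (init_state xs) n (\<lambda>s'. fst s' 0 = 0 \<and> fst s' 1 = int (length ys) + 1 \<and>
        snd s' 7 0 = int (length ys) \<and> (\<forall>i<length ys. snd s' 7 (int i + 1) = ys ! i))"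
  shows "time_bounded (transducer p) xs ((length xs + length ys + 4) * 300 * len B + n * U)"
    and "computes (transducer p) xs ys"
proof -
  define l where "l = len B"
  have l: "2 \<le> l" unfolding l_def using len_le_bound[of 1 B] B by (simp add: len_numerals)
  have b: "bnd B (init_state xs)" using B by (simp add: bnd_init_state)
  have r0: "reg_addr 0 = - 8" "reg_addr 1 = - 16" "reg_addr (Suc 0) = - 16" by (simp_all add: reg_addr_def)
  have l7: "len 7 \<le> 4" "len (-16) \<le> 6" using len_le_iff[of 7 3] len_le_iff[of "-16" 5] by simp_all
  define N where "N = Suc (length ys)"
  let ?test = "Less (Load (reg 0)) (Load (reg 1))"
  let ?body = "Seq (Store (Load (reg 0)) (Load (Add (Mult (Const 8) (Load (reg 0))) (Const 7))))
            (Store (reg 0) (Add (Load (reg 0)) (Const 1)))"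
  define P where "P s' \<longleftrightarrow> fst s' 0 = 0 \<and> fst s' 1 = int (length ys) + 1 \<and>
        snd s' 7 0 = int (length ys) \<and> (\<forall>i<length ys. snd s' 7 (int i + 1) = ys ! i)" for s' :: hstate
  have copy: "tri (While ?test ?body) m (N * (100 * l + 40 * l + 2) + 40 * l + 1) (\<lambda>m'. holds_output m' ys)"
    if "\<exists>s'. rep m s' \<and> bnd B s' \<and> P s'" for m
  proof -
    from that obtain s' where s': "rep m s'" "bnd B s'" "P s'" by blast
    define Y where "Y = snd s' 7"
    have Y: "len (Y a) \<le> l" for a unfolding l_def Y_def using s'(2) by (intro len_le_bound) (simp add: bnd_def)
    have mY: "m (8 * a + 7) = Y a" for a
    proof -
      have "\<forall>r a. 0 < r \<longrightarrow> r < 8 \<longrightarrow> m (8 * a + int r) = snd s' r a"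
        using s'(1) by (simp add: rep_def)
      from this[rule_format, of 7 a] show ?thesis by (simp add: Y_def)
    qed
    have mr: "m (reg_addr x) = fst s' x" for x using s'(1) by (simp add: rep_def)
    have m0: "m (-8) = 0" "m (-16) = int N"
      using mr[of 0] mr[of 1] s'(3) by (simp_all add: r0[unfolded One_nat_def] P_def N_def)
    \<comment> \<open>Copying upwards is safe: the source \<open>8 * c + 7\<close> lies above the
      cells \<open>< c\<close> overwritten so far, and the registers have negative
      addresses.\<close>
    define M where "M c = (\<lambda>a. if a = - 8 then int c else if 0 \<le> a \<and> a < int c then Y a else m a)" for c :: nat
    have lc: "len (int c) \<le> l" if "c \<le> N" for c
      unfolding l_def using that y by (intro len_le_bound) (auto simp: N_def)
    have body: "tri ?body (M c) (100 * l) (\<lambda>m. m = M (Suc c))" if c: "c < N" for c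
    proof -
      let ?m1 = "(M c)(int c := Y (int c))"
      have lk: "len (int c) \<le> l" "len (int c + 1) \<le> l" using lc[of c] lc[of "Suc c"] c by (simp_all add: add.commute)
      have lk8: "len (8 * int c) \<le> 5 + l" using len_mult[of 8 "int c"] lk by (simp add: len_numerals)
      have lk81: "len (8 * int c + 7) \<le> 9 + l" using len_affine[of 7 "int c"] lk by simp
      have Mk: "M c (- 8) = int c" "M c (8 * int c + 7) = Y (int c)"
        using mY[of "int c"] by (auto simp: M_def)
      have 1: "tri (Store (Load (reg 0)) (Load (Add (Mult (Const 8) (Load (reg 0))) (Const 7)))) (M c)
         (60 * l) (\<lambda>m. m = ?m1)"
        by (rule tri_mono[OF tri_Store[where Q = "\<lambda>m. m = ?m1"]])
           (use lk lk8 lk81 Y[of "int c"] l l7 in \<open>auto simp: r0 Mk len_numerals\<close>)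
      have "?m1(-8 := int c + 1) = M (Suc c)" unfolding M_def by (auto simp: fun_eq_iff)
      then have 2: "tri (Store (reg 0) (Add (Load (reg 0)) (Const 1))) ?m1 (30 * l) (\<lambda>m. m = M (Suc c))"
        by (intro tri_mono[OF tri_Store[where Q = "\<lambda>m. m = M (Suc c)"]])
           (use lk l in \<open>auto simp: r0 Mk len_numerals\<close>)
      have "tri ?body (M c) (60 * l + 1 + 30 * l) (\<lambda>m. m = M (Suc c))"
        by (rule tri_Seq[OF 1]) (use 2 in simp)
      then show ?thesis by (rule tri_mono) (use l in auto)
    qed
    show ?thesis
    proof (rule tri_While_count[where I = "\<lambda>k m. m = M (N - k) \<and> k \<le> N"])
      fix k m' assume *: "m' = M (N - Suc k) \<and> Suc k \<le> N"
      then have "Suc k \<le> N" by blast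
      then have S: "Suc (N - Suc k) = N - k" "N - Suc k < N" by linarith+
      have "M (N - Suc k) (- 16) = int N" "M (N - Suc k) (- 8) = int (N - Suc k)" using m0 by (auto simp: M_def)
      then show "val ?test m' \<noteq> 0 \<and> exp_cost ?test m' + len (val ?test m') \<le> 40 * l \<and>
         tri ?body m' (100 * l) (\<lambda>m. m = M (N - k) \<and> k \<le> N)"
        using * l l7 lc[of "N - Suc k"] lc[of N] tri_mono[OF body[of "N - Suc k"]]
        by (auto simp: r0 len_numerals S simp del: of_nat_diff)
    next
      fix m' assume *: "m' = M (N - 0) \<and> 0 \<le> N"
      have "M N (- 16) = int N" "M N (- 8) = int N" using m0 by (auto simp: M_def)
      moreover have "holds_output (M N) ys" using s'(3)
        by (auto simp: holds_output_def M_def P_def Y_def N_def)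
      ultimately show "val ?test m' = 0 \<and> exp_cost ?test m' + len (val ?test m') \<le> 40 * l \<and> holds_output m' ys"
        using * l l7 lc[of N] by (auto simp: r0 len_numerals)
    next
      show "m = M (N - N) \<and> N \<le> N" using m0 by (auto simp: M_def fun_eq_iff)
    qed
  qed
  have tri: "tri (transducer p) (init_mem xs) ((length xs + length ys + 4) * 300 * l + n * U) (\<lambda>m'. holds_output m' ys)"
    unfolding transducer_def
  proof (rule tri_mono[OF tri_Seq[OF tri_load_input[OF x B] tri_Seq[OF _ copy]]])
    show "tri (compile p) m' (n * U) (\<lambda>m'. \<exists>s'. rep m' s' \<and> bnd B s' \<and> P s')"
      if "rep m' (init_state xs)" for m'
      using htriD[OF run p b that] unfolding P_def .
    have "N * 2 \<le> N * l" using l by (rule mult_le_mono2)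
    then show "(length xs + 2) * 300 * len B + 1 + (n * U + 1 + (N * (100 * l + 40 * l + 2) + 40 * l + 1))
      \<le> (length xs + length ys + 4) * 300 * l + n * U" using l unfolding l_def[symmetric] N_def
      by (simp add: algebra_simps)
  qed auto
  then show "time_bounded (transducer p) xs ((length xs + length ys + 4) * 300 * len B + n * U)"
    "computes (transducer p) xs ys"
    unfolding tri_def time_bounded_def computes_def l_def by blast+
qed

section \<open>Positions in flattened matrices and three-dimensional arrays\<close>

lemma length_concat_const:
  assumes "\<And>u. u < n \<Longrightarrow> length (f u) = L"
  shows "length (concat (map f [0..<n])) = n * L"
  using assms by (induction n) auto

lemma nth_concat_const:
  assumes "\<And>u. u < n \<Longrightarrow> length (f u) = L" "u < n" "j < L"
  shows "concat (map f [0..<n]) ! (u * L + j) = f u ! j"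
  using assms
proof (induction n)
  case (Suc n)
  have l: "length (concat (map f [0..<n])) = n * L"
    by (rule length_concat_const) (use Suc.prems in auto)
  show ?case
  proof (cases "u = n")
    case True
    then show ?thesis by (simp add: nth_append l)
  next
    case False
    then have "u < n" using Suc.prems by simp
    then have "u * L + j < Suc u * L" "Suc u * L \<le> n * L"
      using Suc.prems by (auto simp del: mult_Suc intro!: mult_le_mono1) simp
    then have "u * L + j < n * L" by linarith
    then show ?thesis using Suc \<open>u < n\<close> by (simp add: nth_append l)
  qed
qed simp

lemma pair_index_less: "u < n \<Longrightarrow> v < m \<Longrightarrow> u * m + v < n * (m :: nat)"
proof -
  assume "u < n" "v < m"
  then have "u * m + v < Suc u * m" "Suc u * m \<le> n * m" by (simp, intro mult_le_mono1, simp)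
  then show ?thesis by linarith
qed

lemma pair_index_eq_iff:
  fixes n :: nat
  assumes "v < n" "v' < n"
  shows "u * n + v = u' * n + v' \<longleftrightarrow> u = u' \<and> v = v'"
  using assms by (metis add.commute div_mult_self3 div_less mod_mult_self3 mod_less add.right_neutral less_nat_zero_code)

definition code :: "nat \<Rightarrow> nat \<Rightarrow> nat \<Rightarrow> nat \<Rightarrow> nat" where
  "code n i u v = (i * n + u) * n + v"

lemma code_less: "i < q \<Longrightarrow> u < n \<Longrightarrow> v < n \<Longrightarrow> code n i u v < q * n * n"
  unfolding code_def by (intro pair_index_less)

lemma code_eq_iff:
  "u < n \<Longrightarrow> v < n \<Longrightarrow> u' < n \<Longrightarrow> v' < n \<Longrightarrow>
   code n i u v = code n i' u' v' \<longleftrightarrow> i = i' \<and> u = u' \<and> v = v'"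
  unfolding code_def by (simp add: pair_index_eq_iff)

lemma code_split:
  assumes "x < q * n * n"
  obtains i u v where "i < q" "u < n" "v < n" "x = code n i u v"
proof
  have n: "n > 0" using assms by (cases n) auto
  show "x div n div n < q" using assms by (simp add: less_mult_imp_div_less)
  show "x div n mod n < n" "x mod n < n" using n by auto
  show "x = code n (x div n div n) (x div n mod n) (x mod n)" by (simp add: code_def)
qed

lemma code_div:
  assumes "u < n" "v < n"
  shows "code n i u v div n div n = i" "code n i u v div n mod n = u" "code n i u v mod n = v"
  using assms by (auto simp: code_def)

text \<open>To be read as: item \<open>i\<close> derives the label word of some path from
  \<open>u\<close> to \<open>v\<close>. It is defined outside the locales because both the
  certificate checkers and the binarisation of grammars refer to it.\<close>

inductive fact :: "(nat \<times> nat \<times> nat) list \<Rightarrow> nat \<Rightarrow> (nat \<times> nat \<times> nat) set \<Rightarrow> nat \<Rightarrow>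
    nat \<Rightarrow> nat \<Rightarrow> nat \<Rightarrow> bool" for rs t E n where
  edge: "(u, a, v) \<in> E \<Longrightarrow> fact rs t E n a u v"
| eps: "u < n \<Longrightarrow> fact rs t E n t u u"
| rule: "(i, j, k) \<in> set rs \<Longrightarrow> fact rs t E n i u w \<Longrightarrow> fact rs t E n j w v \<Longrightarrow> fact rs t E n k u v"

section \<open>Binary grammars\<close>

text \<open>A context-free grammar in binary form: items \<open>i < q\<close>, of which the first \<open>t\<close> are the
  terminals and \<open>t\<close> is the empty word, rules \<open>(i, j, k)\<close> for \<open>k \<rightarrow> i j\<close>, and a start item.\<close>

locale binary_grammar =
  fixes t q :: nat and rs :: "(nat \<times> nat \<times> nat) list" and \<sigma> :: nat
  assumes t_less: "t < q" and start_less: "\<sigma> < q"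
    and rules_less: "(i, j, k) \<in> set rs \<Longrightarrow> i < q \<and> j < q \<and> k < q"
begin

definition base :: "(nat \<times> nat \<times> nat) set \<Rightarrow> nat \<Rightarrow> nat \<Rightarrow> nat \<Rightarrow> bool" where
  "base E i u v \<longleftrightarrow> (i < t \<and> (u, i, v) \<in> E) \<or> (i = t \<and> u = v)"

definition facts :: "(nat \<times> nat \<times> nat) set \<Rightarrow> nat \<Rightarrow> (nat \<times> nat \<times> nat) set" where
  "facts E n = {(i, u, v). fact rs t E n i u v}"

definition universe :: "nat \<Rightarrow> (nat \<times> nat \<times> nat) set" where
  "universe n = {0..<q} \<times> {0..<n} \<times> {0..<n}"

definition repM :: "nat \<Rightarrow> (int \<Rightarrow> int) \<Rightarrow> (nat \<times> nat \<times> nat) set \<Rightarrow> bool" where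
  "repM n M S \<longleftrightarrow> S \<subseteq> universe n \<and>
     (\<forall>i<q. \<forall>u<n. \<forall>v<n. M (int (code n i u v)) \<noteq> 0 \<longleftrightarrow> (i, u, v) \<in> S)"

definition wfE :: "(nat \<times> nat \<times> nat) set \<Rightarrow> nat \<Rightarrow> bool" where
  "wfE E n \<longleftrightarrow> E \<subseteq> {0..<n} \<times> {0..<t} \<times> {0..<n}"

lemma facts_universe: "wfE E n \<Longrightarrow> facts E n \<subseteq> universe n"
proof -
  assume E: "wfE E n"
  have "i < q \<and> u < n \<and> v < n" if "fact rs t E n i u v" for i u v
    using that
  proof induction
    case (edge u a v)
    then show ?case using E t_less by (auto simp: wfE_def)
  qed (use t_less rules_less in auto)
  then show ?thesis by (auto simp: facts_def universe_def)
qed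

lemma base_facts: "u < n \<Longrightarrow> base E i u v \<Longrightarrow> (i, u, v) \<in> facts E n"
  by (auto simp: base_def facts_def intro: fact.intros)

lemma facts_least:
  assumes "wfE E n"
    and "\<And>i u v. i < q \<Longrightarrow> u < n \<Longrightarrow> v < n \<Longrightarrow> base E i u v \<Longrightarrow> (i, u, v) \<in> S"
    and "\<And>i j k u w v. (i, j, k) \<in> set rs \<Longrightarrow> (i, u, w) \<in> S \<Longrightarrow> (j, w, v) \<in> S \<Longrightarrow> (k, u, v) \<in> S"
  shows "facts E n \<subseteq> S"
proof -
  have "(i, u, v) \<in> S" if "fact rs t E n i u v" for i u v
    using that
  proof induction
    case (edge u a v)
    then show ?case using assms(1) t_less by (intro assms(2)) (auto simp: wfE_def base_def)
  next
    case (eps u)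
    then show ?case using t_less by (intro assms(2)) (auto simp: base_def)
  next
    case (rule i j k u w v)
    then show ?case using assms(3) by blast
  qed
  then show ?thesis by (auto simp: facts_def)
qed

abbreviation "R \<equiv> length rs"

text \<open>The cell of the first entry of the adjacency matrix: cell 0 is the length of the list,
  cell 1 the number of vertices, and the s-t version has the two vertices in cells 2 and 3.\<close>

definition offs :: "bool \<Rightarrow> int" where
  "offs st = (if st then 4 else 2)"

text \<open>The flag \<open>st\<close> tells the s-t version of the problem from the all-pairs version, which ignores
  \<open>x\<close> and \<open>y\<close>.\<close>

definition input_ok ::
  "bool \<Rightarrow> nat \<Rightarrow> (nat \<times> nat \<times> nat) set \<Rightarrow> nat \<Rightarrow> nat \<Rightarrow> int \<Rightarrow> (int \<Rightarrow> int) \<Rightarrow> bool" where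
  "input_ok st n E x y B A \<longleftrightarrow> wfE E n \<and> A 1 = int n \<and> \<bar>A 0\<bar> \<le> B \<and> 1 \<le> B \<and>
     (st \<longrightarrow> x < n \<and> y < n \<and> A 2 = int x \<and> A 3 = int y) \<and>
     (\<forall>u<n. \<forall>v<n. \<forall>a<t. A (offs st + int ((u * n + v) * t + a)) = of_bool ((u, a, v) \<in> E))"

definition hits :: "bool \<Rightarrow> nat \<Rightarrow> nat \<Rightarrow> nat \<Rightarrow> (nat \<times> nat \<times> nat) set \<Rightarrow> bool" where
  "hits st n x y S \<longleftrightarrow>
     (if st then (\<sigma>, x, y) \<in> S else \<forall>u<n. \<forall>v<n. (\<sigma>, u, v) \<in> S)"

text \<open>A crude common bound on the numbers handled by both checkers: array indices, the size of
  the input of the matrix product, and guessed numbers, which are below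
  \<open>8 * (n + 1) ^ 3 * 2 ^ R\<close>. Only its logarithm enters the running time.\<close>

definition cfl_bound :: "nat \<Rightarrow> nat" where
  "cfl_bound n = 16 * (q + 1) * (R + 1)\<^sup>2 * 2 ^ R * (n + 1) ^ 3"

abbreviation "nE \<equiv> Var 20"
abbreviation "nnE \<equiv> Bop Times nE nE"

definition ix :: "hexp \<Rightarrow> hexp \<Rightarrow> hexp \<Rightarrow> hexp" where
  "ix a b d = Bop Plus (Bop Times (Bop Plus (Bop Times a nE) b) nE) d"

lemma hval_ix:
  "fst s 20 = int n \<Longrightarrow> hval a s = int i \<Longrightarrow> hval b s = int u \<Longrightarrow> hval d s = int v \<Longrightarrow>
   hval (ix a b d) s = int (code n i u v)"
  by (simp add: ix_def code_def)

lemma safe_ix [simp]: "safe B (ix a b d) s \<longleftrightarrow> safe B a s \<and> safe B b s \<and> safe B d s"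
  by (auto simp: ix_def)

lemma wf_exp_ix [simp]: "wf_exp (ix a b d) \<longleftrightarrow> wf_exp a \<and> wf_exp b \<and> wf_exp d"
  by (auto simp: ix_def)

text \<open>Below the guard \<open>i < t\<close> the address is replaced by 0, since beyond the
  input the contents of array 2 are arbitrarily large.\<close>

definition baseE :: "bool \<Rightarrow> hexp" where
  "baseE st = (let i = Bop Div (Bop Div (Var 25) nE) nE; u = modE (Bop Div (Var 25) nE) nE;
                   v = modE (Var 25) nE; g = Bop Lt i (Num (int t)) in
     Bop Plus
       (Bop Times g (Arr 2 (Bop Times g (Bop Plus (Num (offs st))
          (Bop Plus (Bop Times (Bop Plus (Bop Times u nE) v) (Num (int t))) i)))))
       (Bop Times (eqE i (Num (int t))) (eqE u v)))"

lemma baseE: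
  assumes A: "input_ok st n E x y B A" and s: "fst s 20 = int n" "snd s 2 = A"
    "fst s 25 = int (code n i u v)" and iuv: "i < q" "u < n" "v < n"
  shows "hval (baseE st) s = of_bool (base E i u v)" "safe B (baseE st) s"
proof -
  let ?x = "int (code n i u v)"
  have d: "?x div int n div int n = int i" "?x div int n mod int n = int u" "?x mod int n = int v"
    using code_div[OF iuv(2,3), of i] by (metis of_nat_div of_nat_mod)+
  have A': "A (offs st + ((int u * int n + int v) * int t + int i)) = of_bool ((u, i, v) \<in> E)"
    if "i < t"
    using A that iuv unfolding input_ok_def by (metis of_nat_add of_nat_mult)
  have A0: "\<bar>A 0\<bar> \<le> B" "1 \<le> B" using A by (simp_all add: input_ok_def)
  show "hval (baseE st) s = of_bool (base E i u v)"
    using s A' by (auto simp: baseE_def Let_def d base_def)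
  show "safe B (baseE st) s"
    using s A' A0 by (auto simp: baseE_def Let_def d)
qed


lemma wf_exp_baseE [simp]: "wf_exp (baseE st)"
  by (simp add: baseE_def Let_def)

lemma cfl_bound:
  "n \<le> cfl_bound n" "q * n * n \<le> cfl_bound n" "R * n * n \<le> cfl_bound n"
  "2 * (R * n) * (R * n) + 2 \<le> cfl_bound n" "8 * (n + 1) ^ 3 * 2 ^ R \<le> cfl_bound n"
  "3 * n + R \<le> cfl_bound n" "8 \<le> cfl_bound n"
proof -
  define a where "a = q + 1"
  define b where "b = (R + 1)\<^sup>2"
  define p where "p = (2 :: nat) ^ R"
  define m where "m = (n + 1) ^ 3"
  have c: "cfl_bound n = 16 * a * b * p * m"
    by (simp add: cfl_bound_def a_def b_def p_def m_def)
  have pos: "1 \<le> a" "1 \<le> b" "1 \<le> p" "1 \<le> m"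
    by (simp_all add: a_def b_def p_def m_def)
  have m2: "(n + 1)\<^sup>2 \<le> m" unfolding m_def by (rule power_increasing) auto
  have nm: "n \<le> m" "n * n \<le> m" using m2 by (simp_all add: power2_eq_square)
  have qa: "q \<le> a" "R \<le> b" "R * R \<le> b" by (simp_all add: a_def b_def power2_eq_square)
  \<comment> \<open>Each claim is obtained by comparing with the product
    \<open>16 * a * b * p * m\<close> factor by factor.\<close>
  have lower: "x \<le> cfl_bound n" if "x \<le> k * a' * b' * p' * m'" "k \<le> 16" "a' \<le> a" "b' \<le> b" "p' \<le> p" "m' \<le> m"
    for x k a' b' p' m'
    unfolding c by (rule order_trans[OF that(1)]) (intro mult_le_mono that)
  show "n \<le> cfl_bound n" by (rule lower[of _ 1 1 1 1 n]) (use pos nm in auto)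
  show "q * n * n \<le> cfl_bound n" by (rule lower[of _ 1 q 1 1 "n * n"]) (use pos nm qa in auto)
  show "R * n * n \<le> cfl_bound n" by (rule lower[of _ 1 1 R 1 "n * n"]) (use pos nm qa in auto)
  show "8 * (n + 1) ^ 3 * 2 ^ R \<le> cfl_bound n"
    by (rule lower[of _ 8 1 1 p m]) (use pos in \<open>auto simp: m_def p_def\<close>)
  show "8 \<le> cfl_bound n" by (rule lower[of _ 8 1 1 1 1]) (use pos in auto)
  have "2 * (R * n) * (R * n) + 2 \<le> 4 * b * m"
  proof -
    have "R * R * (n * n) \<le> b * m" "1 * 1 \<le> b * m"
      by (rule mult_le_mono[OF qa(3) nm(2)], rule mult_le_mono[OF pos(2,4)])
    moreover have "2 * (R * n) * (R * n) = 2 * (R * R * (n * n))" by simp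
    ultimately show ?thesis by linarith
  qed
  then show "2 * (R * n) * (R * n) + 2 \<le> cfl_bound n"
    by (intro lower[of _ 4 1 b 1 m]) (use pos in auto)
  have "3 * n + R \<le> 4 * b * m"
    using mult_le_mono[OF pos(2) nm(1)] mult_le_mono[OF qa(2) pos(4)] by simp
  then show "3 * n + R \<le> cfl_bound n"
    by (intro lower[of _ 4 1 b 1 m]) (use pos in auto)
qed

lemma cfl_bound_int:
  assumes "int (cfl_bound n) \<le> B"
  shows "int n \<le> B" "int q * int n * int n \<le> B" "int R * int n * int n \<le> B"
    "2 * (int R * int n) * (int R * int n) + 2 \<le> B" "8 * (int n + 1) ^ 3 * 2 ^ R \<le> B"
    "3 * int n + int R \<le> B" "8 \<le> B"
  using assms cfl_bound[of n, THEN of_nat_mono[where 'a = int]] by (simp_all add: algebra_simps)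

section \<open>Program pieces of the certificate checkers\<close>

definition env :: "bool \<Rightarrow> nat \<Rightarrow> (nat \<times> nat \<times> nat) set \<Rightarrow> nat \<Rightarrow> nat \<Rightarrow> int \<Rightarrow> hstate \<Rightarrow> bool" where
  "env st n E x y B s \<longleftrightarrow> input_ok st n E x y B (snd s 2) \<and> fst s 20 = int n \<and>
     (st \<longrightarrow> fst s 21 = int x \<and> fst s 23 = int y)"

definition readP :: "bool \<Rightarrow> hcom" where
  "readP st = Asg 20 (Arr 2 (Num 1)) ;;
     (if st then Asg 21 (Arr 2 (Num 2)) ;; Asg 23 (Arr 2 (Num 3)) else HSkip)"

lemma htri_readP:
  assumes "input_ok st n E x y B (snd s 2)" "int n \<le> B"
  shows "htri B U (readP st) s 5 (\<lambda>s'. env st n E x y B s' \<and> snd s' = snd s)"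
  by (rule htri_mono[OF htri_vc])
     (use assms in \<open>auto simp: readP_def env_def input_ok_def\<close>)

definition finalP :: "bool \<Rightarrow> hcom" where
  "finalP st = (if st then Asg 26 (Arr 6 (ix (Num (int \<sigma>)) (Var 21) (Var 23)))
     else allL 26 25 nnE (Arr 6 (Bop Plus (Bop Times (Num (int \<sigma>)) nnE) (Var 25))))"

lemma htri_finalP:
  assumes env: "env st n E x y B s" and M: "repM n (snd s 6) S" and B: "int (cfl_bound n) \<le> B"
  shows "htri B U (finalP st) s (n * n * 7 + 6)
    (\<lambda>s'. (fst s' 26 \<noteq> 0 \<longleftrightarrow> hits st n x y S) \<and> (\<forall>z. z \<notin> {25, 26} \<longrightarrow> fst s' z = fst s z))"
proof (rule htri_bnd)
  assume b: "bnd B s"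
  show ?thesis
  proof (cases st)
    case True
    have "hval (ix (Num (int \<sigma>)) (Var 21) (Var 23)) s = int (code n \<sigma> x y)"
      using env True by (intro hval_ix) (auto simp: env_def)
    moreover have "finalP st = Asg 26 (Arr 6 (ix (Num (int \<sigma>)) (Var 21) (Var 23)))"
      using True by (simp add: finalP_def)
    ultimately show ?thesis
      using True env M b start_less
      by (simp only:, intro htri_mono[OF htri_Asg[where
            Q = "\<lambda>s'. (fst s' 26 \<noteq> 0 \<longleftrightarrow> hits True n x y S) \<and> (\<forall>z. z \<notin> {25, 26} \<longrightarrow> fst s' z = fst s z)"]])
         (auto simp: hits_def repM_def env_def input_ok_def bnd_def)
  next
    case False
    have n: "fst s 20 = int n" using env by (simp add: env_def)
    have eq: "(\<forall>i<n * n. snd s 6 (int (\<sigma> * n * n + i)) \<noteq> 0) \<longleftrightarrow> (\<forall>u<n. \<forall>v<n. (\<sigma>, u, v) \<in> S)"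
    proof -
      have "(\<forall>i<n * n. snd s 6 (int (\<sigma> * n * n + i)) \<noteq> 0) \<longleftrightarrow>
          (\<forall>u<n. \<forall>v<n. snd s 6 (int (\<sigma> * n * n + (u * n + v))) \<noteq> 0)"
      proof (intro iffI allI impI)
        fix i assume *: "\<forall>u<n. \<forall>v<n. snd s 6 (int (\<sigma> * n * n + (u * n + v))) \<noteq> 0" and i: "i < n * n"
        then have "n > 0" by (cases n) auto
        then show "snd s 6 (int (\<sigma> * n * n + i)) \<noteq> 0"
          using *[rule_format, of "i div n" "i mod n"] i by (simp add: less_mult_imp_div_less)
      qed (use pair_index_less in blast)
      also have "\<dots> \<longleftrightarrow> (\<forall>u<n. \<forall>v<n. (\<sigma>, u, v) \<in> S)"
      proof -
        have "\<sigma> * n * n + (u * n + v) = code n \<sigma> u v" for u v by (simp add: code_def algebra_simps)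
        then show ?thesis using M start_less by (simp add: repM_def)
      qed
      finally show ?thesis .
    qed
    show ?thesis
      unfolding finalP_def using False
    proof (simp, intro htri_mono[OF htri_allL[where n = "n * n" and P = "\<lambda>i. snd s 6 (int (\<sigma> * n * n + i)) \<noteq> 0"
          and Q = "\<lambda>s'. (fst s' 26 \<noteq> 0 \<longleftrightarrow> hits st n x y S) \<and> (\<forall>z. z \<notin> {25, 26} \<longrightarrow> fst s' z = fst s z)"]])
      have "1 * (n * n) \<le> q * (n * n)" using t_less by (intro mult_le_mono1) auto
      then have "int (n * n) \<le> int (q * (n * n))" by (simp only: of_nat_le_iff)
      then show "int (n * n) \<le> B" using cfl_bound_int(2)[OF B] by (simp add: mult.assoc)
      show "1 \<le> B" using cfl_bound_int(7)[OF B] by simp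
    qed (use False n eq in \<open>simp_all add: hits_def algebra_simps\<close>)
  qed
qed

text \<open>Horner's scheme on guessed bits, most significant bit first; register 27 holds the
  number of bits.\<close>

definition guessP :: hcom where
  "guessP = Asg 29 (Num 0) ;; For 31 (Var 27)
     (Flip 30 ;; Asg 29 (Bop Plus (Bop Times (Num 2) (Var 29)) (Var 30)))"

text \<open>For soundness it is enough that the guess is a natural number: \<open>execP\<close>
  itself tests whether it names an applicable rule instance.\<close>

lemma htri_guessP:
  assumes l: "fst s 27 = int l" and B: "2 ^ l \<le> B" "int l \<le> B" "1 \<le> B"
  shows "htri B U guessP s (l * 8 + 6)
    (\<lambda>s'. 0 \<le> fst s' 29 \<and> (\<forall>x. x \<notin> {29, 30, 31} \<longrightarrow> fst s' x = fst s x) \<and> snd s' = snd s)"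
proof -
  define I where "I i s' \<longleftrightarrow> 0 \<le> fst s' 29 \<and> fst s' 29 < 2 ^ i \<and>
    (\<forall>x. x \<notin> {29, 30, 31} \<longrightarrow> fst s' x = fst s x) \<and> snd s' = snd s" for i and s' :: hstate
  have "htri B U (For 31 (Var 27) (Flip 30 ;; Asg 29 (Bop Plus (Bop Times (Num 2) (Var 29)) (Var 30))))
      ((fst s)(29 := 0), snd s) (l * (3 + 5) + 4)
    (\<lambda>s'. 0 \<le> fst s' 29 \<and> (\<forall>x. x \<notin> {29, 30, 31} \<longrightarrow> fst s' x = fst s x) \<and> snd s' = snd s)"
  proof (rule htri_For[where I = I])
    fix i s' assume i: "i < l" "I i s'" "fst s' 31 = int i"
    have "(2::int) ^ Suc i \<le> 2 ^ l" using i(1) by (intro power_increasing) auto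
    then have "2 * 2 ^ i \<le> B" using B by simp
    then show "htri B U (Flip 30 ;; Asg 29 (Bop Plus (Bop Times (Num 2) (Var 29)) (Var 30))) s' 3
       (\<lambda>s'. fst s' 31 = int i \<and> I (Suc i) ((fst s')(31 := int i + 1), snd s'))"
      using i B by (intro htri_mono[OF htri_vc]) (auto simp: I_def)
  qed (use l B in \<open>auto simp: I_def\<close>)
  then show ?thesis
    unfolding guessP_def using B
    by (intro htri_mono[OF htri_HSeq[OF htri_Asg[where Q = "\<lambda>s'. s' = ((fst s)(29 := 0), snd s)"]]]) auto
qed

lemma hcan_guessP:
  assumes l: "fst s 27 = int l" and B: "2 ^ l \<le> B" "int l \<le> B" "1 \<le> B" and z: "z < 2 ^ l"
  shows "hcan B U guessP s
    (\<lambda>s'. fst s' 29 = int z \<and> (\<forall>x. x \<notin> {29, 30, 31} \<longrightarrow> fst s' x = fst s x) \<and> snd s' = snd s)"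
proof -
  \<comment> \<open>The register contains the \<open>i\<close> leading ones of the \<open>l\<close>
    binary digits of \<open>z\<close>.\<close>
  define I where "I i s' \<longleftrightarrow> fst s' 29 = int (z div 2 ^ (l - i)) \<and>
    (\<forall>x. x \<notin> {29, 30, 31} \<longrightarrow> fst s' x = fst s x) \<and> snd s' = snd s" for i and s' :: hstate
  have "hcan B U (For 31 (Var 27) (Flip 30 ;; Asg 29 (Bop Plus (Bop Times (Num 2) (Var 29)) (Var 30))))
      ((fst s)(29 := 0), snd s)
    (\<lambda>s'. fst s' 29 = int z \<and> (\<forall>x. x \<notin> {29, 30, 31} \<longrightarrow> fst s' x = fst s x) \<and> snd s' = snd s)"
  proof (rule hcan_For[where I = I])
    fix i s' assume i: "i < l" "I i s'" "fst s' 31 = int i"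
    let ?b = "z div 2 ^ (l - Suc i) mod 2"
    have S: "l - i = Suc (l - Suc i)" using i by simp
    have e: "2 * (z div 2 ^ (l - i)) + ?b = z div 2 ^ (l - Suc i)"
      unfolding S power_Suc mult.commute[of 2] div_mult2_eq by simp
    have "z div 2 ^ (l - Suc i) \<le> z" by simp
    then have zB: "int (z div 2 ^ (l - Suc i)) \<le> B" using z B(1)
      by (metis (mono_tags, lifting) le_trans less_imp_le numeral_power_eq_of_nat_cancel_iff of_nat_le_iff order_trans)
    have Q2: "htri B U (Asg 29 (Bop Plus (Bop Times (Num 2) (Var 29)) (Var 30))) ((fst s')(30 := int ?b), snd s') 1
       (\<lambda>s'. fst s' 31 = int i \<and> I (Suc i) ((fst s')(31 := int i + 1), snd s'))"
      by (rule htri_Asg) (use i zB e in \<open>auto simp: I_def simp flip: of_nat_mult of_nat_add simp del: of_nat_mod of_nat_div\<close>)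
    show "hcan B U (Flip 30 ;; Asg 29 (Bop Plus (Bop Times (Num 2) (Var 29)) (Var 30))) s'
       (\<lambda>s'. fst s' 31 = int i \<and> I (Suc i) ((fst s')(31 := int i + 1), snd s'))"
      by (rule hcan_HSeq[OF hcan_Flip[OF B(3), where b = "int ?b" and Q = "\<lambda>t. t = ((fst s')(30 := int ?b), snd s')"]])
         (use hcan_if_htri[OF Q2] in auto)
  qed (use l B z in \<open>auto simp: I_def\<close>)
  then show ?thesis
    unfolding guessP_def using B
    by (intro hcan_HSeq[OF hcan_if_htri[OF htri_Asg[where Q = "\<lambda>s'. s' = ((fst s)(29 := 0), snd s)"]]]) auto
qed

definition lhsT :: "hexp \<Rightarrow> hexp" where "lhsT e = tabE (map (\<lambda>(i, j, k). int k) rs) e"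
definition fstT :: "hexp \<Rightarrow> hexp" where "fstT e = tabE (map (\<lambda>(i, j, k). int i) rs) e"
definition sndT :: "hexp \<Rightarrow> hexp" where "sndT e = tabE (map (\<lambda>(i, j, k). int j) rs) e"

lemma hval_tables:
  assumes "hval e s = int \<rho>" "\<rho> < R" "rs ! \<rho> = (i, j, k)"
  shows "hval (lhsT e) s = int k" "hval (fstT e) s = int i" "hval (sndT e) s = int j"
  using assms by (simp_all add: lhsT_def fstT_def sndT_def hval_tabE)

lemma safe_tables [simp]:
  "safe B e s \<Longrightarrow> safe B (lhsT e) s" "safe B e s \<Longrightarrow> safe B (fstT e) s" "safe B e s \<Longrightarrow> safe B (sndT e) s"
  by (simp_all add: lhsT_def fstT_def sndT_def safe_tabE)

lemma wf_exp_tables [simp]: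
  "wf_exp e \<Longrightarrow> wf_exp (lhsT e)" "wf_exp e \<Longrightarrow> wf_exp (fstT e)" "wf_exp e \<Longrightarrow> wf_exp (sndT e)"
  by (simp_all add: lhsT_def fstT_def sndT_def wf_exp_tabE)

text \<open>A number \<open>z\<close> names the instance of rule \<open>\<rho>\<close> at the vertices \<open>u, w, v\<close>, where
  \<open>z = ((\<rho> n + u) n + w) n + v\<close>.\<close>

definition sat_step :: "nat \<Rightarrow> nat \<Rightarrow> (nat \<times> nat \<times> nat) set \<Rightarrow> (nat \<times> nat \<times> nat) set" where
  "sat_step n z S = (let \<rho> = z div n div n div n; u = z div n div n mod n; w = z div n mod n; v = z mod n in
     if \<rho> < R \<and> (case rs ! \<rho> of (i, j, k) \<Rightarrow> (i, u, w) \<in> S \<and> (j, w, v) \<in> S)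
     then insert (case rs ! \<rho> of (i, j, k) \<Rightarrow> k, u, v) S else S)"

definition execP :: hcom where
  "execP = (let \<rho> = Bop Div (Bop Div (Bop Div (Var 29) nE) nE) nE;
     u = modE (Bop Div (Bop Div (Var 29) nE) nE) nE; w = modE (Bop Div (Var 29) nE) nE; v = modE (Var 29) nE in
     HIf (andE (Bop Lt \<rho> (Num (int R))) (andE (Arr 6 (ix (fstT \<rho>) u w)) (Arr 6 (ix (sndT \<rho>) w v))))
       (Upd 6 (ix (lhsT \<rho>) u v) (Num 1)) HSkip)"

lemma repM_insert:
  assumes "repM n M S" "k < q" "u < n" "v < n"
  shows "repM n (M(int (code n k u v) := 1)) (insert (k, u, v) S)"
  using assms by (auto simp: repM_def universe_def code_eq_iff)

lemma htri_execP:
  assumes n: "fst s 20 = int n" "0 < n" and z: "fst s 29 = int z" and M: "repM n (snd s 6) S" and B: "1 \<le> B"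
  shows "htri B U execP s 2 (\<lambda>s'. fst s' = fst s \<and> repM n (snd s' 6) (sat_step n z S) \<and>
    (\<forall>r. r \<noteq> 6 \<longrightarrow> snd s' r = snd s r))"
proof -
  define \<rho> u w v where "\<rho> = z div n div n div n" and "u = z div n div n mod n"
    and "w = z div n mod n" and "v = z mod n"
  note defs = \<rho>_def u_def w_def v_def
  let ?\<rho> = "Bop Div (Bop Div (Bop Div (Var 29) nE) nE) nE"
  let ?u = "modE (Bop Div (Bop Div (Var 29) nE) nE) nE"
  let ?w = "modE (Bop Div (Var 29) nE) nE"
  let ?v = "modE (Var 29) nE"
  have v: "hval ?\<rho> s = int \<rho>" "hval ?u s = int u" "hval ?w s = int w" "hval ?v s = int v"
    using n z by (simp_all add: defs of_nat_div of_nat_mod)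
  have uvw: "u < n" "w < n" "v < n" using n(2) by (simp_all add: defs)
  let ?Q = "\<lambda>s'. fst s' = fst s \<and> repM n (snd s' 6) (sat_step n z S) \<and>
    (\<forall>r. r \<noteq> 6 \<longrightarrow> snd s' r = snd s r)"
  obtain i j k where r: "\<rho> < R \<Longrightarrow> rs ! \<rho> = (i, j, k)" by (metis prod_cases3)
  have "vc B execP ?Q s"
  proof (cases "\<rho> < R")
    case True
    note r = r[OF True]
    have ijk: "i < q" "j < q" "k < q" using rules_less[of i j k] True r by (metis nth_mem)+
    note T = hval_tables[OF v(1) True r]
    have 1: "hval (ix (fstT ?\<rho>) ?u ?w) s = int (code n i u w)"
      "hval (ix (sndT ?\<rho>) ?w ?v) s = int (code n j w v)"
      "hval (ix (lhsT ?\<rho>) ?u ?v) s = int (code n k u v)"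
      using n v T by (intro hval_ix; simp)+
    have S: "sat_step n z S = (if (i, u, w) \<in> S \<and> (j, w, v) \<in> S then insert (k, u, v) S else S)"
      using True r by (simp add: sat_step_def Let_def defs)
    have "snd s 6 (int (code n i u w)) \<noteq> 0 \<longleftrightarrow> (i, u, w) \<in> S"
      "snd s 6 (int (code n j w v)) \<noteq> 0 \<longleftrightarrow> (j, w, v) \<in> S"
      using M ijk uvw by (simp_all add: repM_def)
    moreover have "repM n ((snd s 6)(int (code n k u v) := 1)) (insert (k, u, v) S)"
      by (rule repM_insert[OF M ijk(3) uvw(1,3)])
    ultimately show ?thesis
      using 1 True v M B unfolding execP_def Let_def S by auto
  next
    case False
    then have "sat_step n z S = S" by (simp add: sat_step_def Let_def defs)
    then show ?thesis
      using False v M unfolding execP_def Let_def by auto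
  qed
  from htri_vc[OF this] show ?thesis by (rule htri_mono) (auto simp: execP_def Let_def)
qed

lemma sat_step_bounds:
  assumes "S \<subseteq> facts E n"
  shows "S \<subseteq> sat_step n z S" "sat_step n z S \<subseteq> facts E n"
proof -
  show "S \<subseteq> sat_step n z S" by (auto simp: sat_step_def Let_def)
  define \<rho> u w v where "\<rho> = z div n div n div n" and "u = z div n div n mod n"
    and "w = z div n mod n" and "v = z mod n"
  obtain i j k where r: "rs ! \<rho> = (i, j, k)" by (metis prod_cases3)
  have S: "sat_step n z S = (if \<rho> < R \<and> (i, u, w) \<in> S \<and> (j, w, v) \<in> S then insert (k, u, v) S else S)"
    unfolding sat_step_def Let_def by (simp flip: \<rho>_def u_def w_def v_def add: r)
  have "(k, u, v) \<in> facts E n" if "\<rho> < R" "(i, u, w) \<in> S" "(j, w, v) \<in> S"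
  proof -
    have "(i, j, k) \<in> set rs" using r that(1) by (metis nth_mem)
    then show ?thesis using that assms unfolding facts_def by (auto intro: fact.rule)
  qed
  then show "sat_step n z S \<subseteq> facts E n" using assms S by auto
qed

text \<open>If no rule instance gave anything new, \<open>S\<close> would be closed under the rules
  and so, by \<open>facts_least\<close>, contain all facts. The number of a productive instance is
  the required \<open>z\<close>.\<close>

lemma sat_step_new:
  assumes E: "wfE E n" and S: "S \<subseteq> facts E n"
    and base: "\<And>i u v. i < q \<Longrightarrow> u < n \<Longrightarrow> v < n \<Longrightarrow> base E i u v \<Longrightarrow> (i, u, v) \<in> S"
    and ne: "\<not> facts E n \<subseteq> S"
  obtains z where "z < R * n * n * n" "card (sat_step n z S) = Suc (card S)"
proof -
  have "\<exists>i j k u w v. (i, j, k) \<in> set rs \<and> (i, u, w) \<in> S \<and> (j, w, v) \<in> S \<and> (k, u, v) \<notin> S"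
    using facts_least[OF E base] ne by blast
  then obtain i j k u w v where 1: "(i, j, k) \<in> set rs" "(i, u, w) \<in> S" "(j, w, v) \<in> S" "(k, u, v) \<notin> S"
    by blast
  obtain \<rho> where \<rho>: "\<rho> < R" "rs ! \<rho> = (i, j, k)" using 1(1) by (metis in_set_conv_nth)
  have uvw: "u < n" "w < n" "v < n"
    using 1(2,3) S facts_universe[OF E] by (auto simp: universe_def)
  define z where "z = ((\<rho> * n + u) * n + w) * n + v"
  have "z < R * n * n * n" unfolding z_def using \<rho> uvw by (intro pair_index_less)
  moreover have "z div n = (\<rho> * n + u) * n + w" "z mod n = v" using uvw by (simp_all add: z_def)
  then have "sat_step n z S = insert (k, u, v) S"
    using uvw 1 \<rho> by (simp add: sat_step_def)
  moreover have "finite S"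
    using S facts_universe[OF E] by (rule finite_subset[OF order_trans]) (auto simp: universe_def)
  ultimately show thesis using that 1(4) by simp
qed

text \<open>The number of bits of a guess. Doubling gives the least j with n <= 2^j, in n guarded
  rounds since all loops are counted; then 3 j + R bits suffice, because R n^3 <= 2^R *
  (2^j)^3.\<close>

definition logP :: hcom where
  "logP = Asg 28 (Num 1) ;; Asg 27 (Num 0) ;;
     For 25 nE (HIf (Bop Lt (Var 28) nE)
       (Asg 28 (Bop Times (Num 2) (Var 28)) ;; Asg 27 (Bop Plus (Var 27) (Num 1))) HSkip) ;;
     Asg 27 (Bop Plus (Bop Times (Num 3) (Var 27)) (Num (int R)))"

text \<open>The first condition puts every rule instance within reach of a guess, the second makes
  the guess logarithmic, and the other two keep all numbers below \<open>cfl_bound\<close>.\<close>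

definition log_ok :: "nat \<Rightarrow> nat \<Rightarrow> bool" where
  "log_ok n l \<longleftrightarrow> R * n * n * n \<le> 2 ^ l \<and> l \<le> 3 * len (int n) + R \<and>
     2 ^ l \<le> 8 * (n + 1) ^ 3 * 2 ^ R \<and> l \<le> 3 * n + R"

lemma htri_logP:
  assumes n: "fst s 20 = int n" and B: "int (cfl_bound n) \<le> B"
  shows "htri B U logP s (n * 9 + 14) (\<lambda>s'. (\<exists>l. log_ok n l \<and> fst s' 27 = int l) \<and>
    (\<forall>x. x \<notin> {25, 27, 28} \<longrightarrow> fst s' x = fst s x) \<and> snd s' = snd s)"
proof -
  note Bs = cfl_bound_int[OF B]
  \<comment> \<open>Either doubling has stopped or it took place in every round so far,
    \<open>j = i\<close>. The last condition on \<open>j\<close> records that it did not run too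
    long, which bounds \<open>2 ^ j\<close> by about \<open>2 * n\<close>.\<close>
  define I where "I i s' \<longleftrightarrow> (\<exists>j. fst s' 27 = int j \<and> fst s' 28 = 2 ^ j \<and> j \<le> i \<and>
     (n \<le> 2 ^ j \<or> j = i) \<and> (j = 0 \<or> 2 ^ (j - 1) < n)) \<and>
     (\<forall>x. x \<notin> {25, 27, 28} \<longrightarrow> fst s' x = fst s x) \<and> snd s' = snd s" for i and s' :: hstate
  let ?body = "HIf (Bop Lt (Var 28) nE)
       (Asg 28 (Bop Times (Num 2) (Var 28)) ;; Asg 27 (Bop Plus (Var 27) (Num 1))) HSkip"
  let ?J = "\<lambda>s'. (\<exists>j. fst s' 27 = int j \<and> j \<le> n \<and> n \<le> 2 ^ j \<and> (j = 0 \<or> 2 ^ (j - 1) < n)) \<and>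
     (\<forall>x. x \<notin> {25, 27, 28} \<longrightarrow> fst s' x = fst s x) \<and> snd s' = snd s"
  have loop: "htri B U (For 25 nE ?body) s' (n * (4 + 5) + 4) ?J"
    if "s' = ((fst s)(28 := 1, 27 := 0), snd s)" for s'
  proof (rule htri_For[where I = I])
    show "I 0 ((fst s')(25 := 0), snd s')" unfolding that I_def by (auto intro!: exI[of _ 0])
  next
    fix i s' assume i: "i < n" "I i s'" "fst s' 25 = int i"
    then obtain j where j: "fst s' 27 = int j" "fst s' 28 = 2 ^ j" "j \<le> i" "n \<le> 2 ^ j \<or> j = i"
      "j = 0 \<or> 2 ^ (j - 1) < n" and fr: "\<forall>x. x \<notin> {25, 27, 28} \<longrightarrow> fst s' x = fst s x" "snd s' = snd s"
      unfolding I_def by blast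
    have n': "fst s' 20 = int n" using fr n by simp
    have c: "(2::int) ^ j < int n \<longleftrightarrow> 2 ^ j < n" by (metis of_nat_less_iff of_nat_numeral of_nat_power)
    have B1: "2 * int n \<le> B" "int n + 1 \<le> B"
      using Bs i(1) by linarith+
    show "htri B U ?body s' 4 (\<lambda>s'. fst s' 25 = int i \<and> I (Suc i) ((fst s')(25 := int i + 1), snd s'))"
    proof (cases "2 ^ j < n")
      case True
      then have ji: "j = i" using j(4) by simp
      have "2 * 2 ^ j \<le> B" using True c B1 by linarith
      moreover have "int j + 1 \<le> B" using ji i(1) B1 by linarith
      ultimately show ?thesis
        using True c i j fr n' ji
        by (intro htri_mono[OF htri_vc]) (auto simp: I_def intro!: exI[of _ "Suc i"])
    next
      case False
      then show ?thesis
        using c i j fr n' by (intro htri_mono[OF htri_vc]) (auto simp: I_def intro!: exI[of _ j])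
    qed
  next
    fix s' assume "I n s'"
    moreover have "n \<le> 2 ^ n" by (simp add: less_imp_le)
    ultimately show "?J s'" unfolding I_def by fastforce
  qed (use n Bs in \<open>auto simp: I_def\<close>)
  have fin: "htri B U (Asg 27 (Bop Plus (Bop Times (Num 3) (Var 27)) (Num (int R)))) s' 1
      (\<lambda>s'. (\<exists>l. log_ok n l \<and> fst s' 27 = int l) \<and>
    (\<forall>x. x \<notin> {25, 27, 28} \<longrightarrow> fst s' x = fst s x) \<and> snd s' = snd s)" if J: "?J s'" for s'
  proof -
    obtain j where j: "fst s' 27 = int j" "j \<le> n" "n \<le> 2 ^ j" "j = 0 \<or> 2 ^ (j - 1) < n"
      using J by blast
    have 1: "2 ^ j \<le> 2 * (n + 1)"
      using j(4) by (cases j) auto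
    have "R * n * n * n \<le> 2 ^ R * 2 ^ j * 2 ^ j * 2 ^ j"
      by (intro mult_le_mono j) (simp add: less_imp_le)
    also have "\<dots> = 2 ^ (3 * j + R)" by (simp flip: power_add)
    finally have a: "R * n * n * n \<le> 2 ^ (3 * j + R)" .
    have "2 ^ (3 * j + R) = (2 ^ j) ^ 3 * (2::nat) ^ R" by (simp add: power_add power_mult[symmetric] mult.commute)
    also have "\<dots> \<le> (2 * (n + 1)) ^ 3 * 2 ^ R" by (intro mult_le_mono1 power_mono 1) auto
    also have "\<dots> = 8 * (n + 1) ^ 3 * 2 ^ R" unfolding power_mult_distrib by simp
    finally have b: "2 ^ (3 * j + R) \<le> 8 * (n + 1) ^ 3 * 2 ^ R" .
    have d: "j \<le> len (int n)"
    proof (cases j)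
      case (Suc j')
      have "\<not> len (int n) \<le> Suc j'"
        using Suc j(4) unfolding len_le_iff by (metis abs_of_nat diff_Suc_1 nat.distinct(1) not_less_iff_gr_or_eq of_nat_less_iff of_nat_numeral of_nat_power)
      then show ?thesis using Suc by simp
    qed simp
    have "log_ok n (3 * j + R)" using a b d j(2) unfolding log_ok_def by simp
    moreover have "\<bar>3 * int j + int R\<bar> \<le> B" using Bs j(2) by simp
    ultimately show ?thesis
      using J j(1) by (intro htri_Asg) (auto intro!: exI[of _ "3 * j + R"])
  qed
  show ?thesis
    unfolding logP_def
    apply (rule htri_mono[OF htri_HSeq[OF htri_Asg[where Q = "\<lambda>s'. s' = ((fst s)(28 := 1), snd s)"]
        htri_HSeq[OF htri_Asg[where Q = "\<lambda>s'. s' = ((fst s)(28 := 1, 27 := 0), snd s)"]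
          htri_HSeq[OF loop fin]]]])
    using Bs by auto
qed


end

section \<open>Certificates for reachability\<close>

context binary_grammar begin

definition qnnE :: hexp where
  "qnnE = Bop Times (Num (int q)) nnE"

lemma qnnE [simp]: "wf_exp qnnE" "safe B qnnE s" "hval qnnE s = int q * (fst s 20 * fst s 20)"
  by (simp_all add: qnnE_def)

definition base_in :: "nat \<Rightarrow> (nat \<times> nat \<times> nat) set \<Rightarrow> (nat \<times> nat \<times> nat) set \<Rightarrow> bool" where
  "base_in n E S \<longleftrightarrow> (\<forall>i<q. \<forall>u<n. \<forall>v<n. base E i u v \<longrightarrow> (i, u, v) \<in> S)"

text \<open>Each of the \<open>q n\<^sup>2\<close> facts costs one guess of the index \<open>z\<close> of a rule instance, of
  \<open>O(log n)\<close> bits.\<close>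

definition posP :: "bool \<Rightarrow> hcom" where
  "posP st = readP st ;; mapL 25 6 (Num 0) qnnE (baseE st) ;; logP ;;
     For 25 qnnE (guessP ;; execP) ;; finalP st ;; Asg 0 (Var 26)"

text \<open>\<open>S\<close> is the set of facts found so far. It always lies between the base facts
  and all facts, so an accepting answer is sound at any stage.\<close>

definition posI where
  "posI st n E x y B l S s \<longleftrightarrow> env st n E x y B s \<and> fst s 27 = int l \<and> repM n (snd s 6) S \<and>
     base_in n E S \<and> S \<subseteq> facts E n"

lemma posI_cong:
  "posI st n E x y B l S s \<Longrightarrow> snd s' = snd s \<Longrightarrow> fst s' 20 = fst s 20 \<Longrightarrow> fst s' 21 = fst s 21 \<Longrightarrow>
   fst s' 23 = fst s 23 \<Longrightarrow> fst s' 27 = fst s 27 \<Longrightarrow> posI st n E x y B l S s'"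
  by (simp add: posI_def env_def)

lemma htri_base_map:
  assumes env: "env st n E x y B s" and B: "int (cfl_bound n) \<le> B"
  shows "htri B U (mapL 25 6 (Num 0) qnnE (baseE st)) s (q * n * n * 6 + 4)
    (\<lambda>s'. env st n E x y B s' \<and> repM n (snd s' 6) {(i, u, v) \<in> universe n. base E i u v} \<and>
      (\<forall>r. r \<noteq> 6 \<longrightarrow> snd s' r = snd s r))"
proof (rule htri_mapL)
  let ?f = "\<lambda>x. of_bool (base E (x div n div n) (x div n mod n) (x mod n)) :: int"
  have n: "fst s 20 = int n" using env by (simp add: env_def)
  fix i :: nat and g
  {
    assume i: "i < q * n * n"
    let ?s = "((fst s)(25 := int i), (snd s)(6 := g))"
    obtain a u v where auv: "a < q" "u < n" "v < n" "i = code n a u v" using code_split[OF i] .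
    have "input_ok st n E x y B (snd ?s 2)" using env by (simp add: env_def)
    note baseE[OF this _ HOL.refl _ auv(1-3)]
    then show "hval (baseE st) ?s = ?f i \<and> safe B (baseE st) ?s"
      using n auv code_div[OF auv(2,3), of a] by simp
  }
  show "int (q * n * n) \<le> B" using cfl_bound_int(2)[OF B] by simp
  show "\<bar>?f i\<bar> \<le> B" using cfl_bound_int(7)[OF B] by simp
  let ?s' = "((fst s)(25 := int (q * n * n)),
      (snd s)(6 := \<lambda>a. if 0 \<le> a \<and> a < 0 + int (q * n * n) then ?f (nat (a - 0)) else snd s 6 a))"
  have "repM n (snd ?s' 6) {(i, u, v) \<in> universe n. base E i u v}"
    unfolding repM_def
  proof (intro conjI allI impI)
    fix i u v assume *: "i < q" "u < n" "v < n"
    have "int (code n i u v) < int (q * n * n)" using code_less[OF *] by (simp only: of_nat_less_iff)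
    then show "snd ?s' 6 (int (code n i u v)) \<noteq> 0 \<longleftrightarrow> (i, u, v) \<in> {(i, u, v) \<in> universe n. base E i u v}"
      using * code_div[OF *(2,3), of i] by (simp add: universe_def del: of_nat_mult)
  qed auto
  then show "env st n E x y B ?s' \<and> repM n (snd ?s' 6) {(i, u, v) \<in> universe n. base E i u v} \<and>
      (\<forall>r. r \<noteq> 6 \<longrightarrow> snd ?s' r = snd s r)"
    using env by (simp add: env_def)
qed (use env in \<open>auto simp: env_def\<close>)

lemma log_ok_bounds:
  assumes "log_ok n l" "int (cfl_bound n) \<le> B"
  shows "2 ^ l \<le> B" "int l \<le> B" "1 \<le> B"
proof -
  note Bs = cfl_bound_int[OF assms(2)]
  have "(2 :: nat) ^ l \<le> 8 * (n + 1) ^ 3 * 2 ^ R" using assms(1) by (simp add: log_ok_def)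
  then have "int (2 ^ l) \<le> int (8 * (n + 1) ^ 3 * 2 ^ R)" by (simp only: of_nat_le_iff)
  then show "2 ^ l \<le> B" using Bs(5) by (simp add: algebra_simps)
  show "int l \<le> B" "1 \<le> B" using Bs assms(1) by (auto simp: log_ok_def)
qed

lemma htri_pos_body:
  assumes I: "posI st n E x y B l S s" and n: "0 < n" and l: "log_ok n l" and B: "int (cfl_bound n) \<le> B"
  shows "htri B U (guessP ;; execP) s (l * 8 + 9)
    (\<lambda>s'. fst s' 25 = fst s 25 \<and> (\<exists>z. posI st n E x y B l (sat_step n z S) s'))"
proof -
  note Bs = log_ok_bounds[OF l B]
  have "htri B U (guessP ;; execP) s ((l * 8 + 6) + 2 + 1)
    (\<lambda>s'. fst s' 25 = fst s 25 \<and> (\<exists>z. posI st n E x y B l (sat_step n z S) s'))"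
  proof (rule htri_HSeq[OF htri_guessP[OF _ Bs]])
    show "fst s 27 = int l" using I by (simp add: posI_def)
    fix s' assume s': "0 \<le> fst s' 29 \<and> (\<forall>x. x \<notin> {29, 30, 31} \<longrightarrow> fst s' x = fst s x) \<and> snd s' = snd s"
    then obtain z where z: "fst s' 29 = int z" by (metis nonneg_int_cases)
    have M: "repM n (snd s' 6) S" and n': "fst s' 20 = int n" using I s' by (auto simp: posI_def env_def)
    show "htri B U execP s' 2
      (\<lambda>s'. fst s' 25 = fst s 25 \<and> (\<exists>z. posI st n E x y B l (sat_step n z S) s'))"
    proof (rule htri_mono[OF htri_execP[OF n' n z M Bs(3)]])
      fix s'' assume s'': "fst s'' = fst s' \<and> repM n (snd s'' 6) (sat_step n z S) \<and>
        (\<forall>r. r \<noteq> 6 \<longrightarrow> snd s'' r = snd s' r)"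
      have "posI st n E x y B l (sat_step n z S) s''"
        using I s' s'' sat_step_bounds[of S E n z] by (auto simp: posI_def env_def base_in_def)
      then show "fst s'' 25 = fst s 25 \<and> (\<exists>z. posI st n E x y B l (sat_step n z S) s'')"
        using s' s'' by auto
    qed simp
  qed
  then show ?thesis by (simp add: add.commute)
qed

lemma hcan_pos_body:
  assumes I: "posI st n E x y B l S s" and n: "0 < n" and l: "log_ok n l" and B: "int (cfl_bound n) \<le> B"
    and z: "z < R * n * n * n"
  shows "hcan B U (guessP ;; execP) s
    (\<lambda>s'. fst s' 25 = fst s 25 \<and> posI st n E x y B l (sat_step n z S) s')"
proof -
  note Bs = log_ok_bounds[OF l B]
  have zl: "z < 2 ^ l" using z l by (simp add: log_ok_def)
  show ?thesis
  proof (rule hcan_HSeq[OF hcan_guessP[OF _ Bs zl]])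
    show "fst s 27 = int l" using I by (simp add: posI_def)
    fix s' assume s': "fst s' 29 = int z \<and> (\<forall>x. x \<notin> {29, 30, 31} \<longrightarrow> fst s' x = fst s x) \<and> snd s' = snd s"
    have M: "repM n (snd s' 6) S" and n': "fst s' 20 = int n" and z': "fst s' 29 = int z"
      using I s' by (auto simp: posI_def env_def)
    show "hcan B U execP s' (\<lambda>s'. fst s' 25 = fst s 25 \<and> posI st n E x y B l (sat_step n z S) s')"
    proof (rule hcan_mono[OF hcan_if_htri[OF htri_execP[OF n' n z' M Bs(3)]]])
      fix s'' assume s'': "fst s'' = fst s' \<and> repM n (snd s'' 6) (sat_step n z S) \<and>
        (\<forall>r. r \<noteq> 6 \<longrightarrow> snd s'' r = snd s' r)"
      have "posI st n E x y B l (sat_step n z S) s''"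
        using I s' s'' sat_step_bounds[of S E n z] by (auto simp: posI_def env_def base_in_def)
      then show "fst s'' 25 = fst s 25 \<and> posI st n E x y B l (sat_step n z S) s''"
        using s' s'' by auto
    qed
  qed
qed

lemma hits_mono: "S \<subseteq> S' \<Longrightarrow> hits st n x y S \<Longrightarrow> hits st n x y S'"
  by (auto simp: hits_def split: if_splits)

text \<open>Eight ticks for each of at most \<open>3 * len n + R\<close> guessed bits give the terms
  \<open>24 * len n + 8 * R\<close> of a round.\<close>

definition pos_ticks :: "nat \<Rightarrow> nat" where
  "pos_ticks n = q * n * n * (24 * len (int n) + 8 * R + 30) + n * n * 7 + 9 * n + 60"

text \<open>The pieces around the guessing loop, with a parameter \<open>P\<close> for what is known
  of the final set: it is contained in the facts in the soundness proof and equal to them in the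
  completeness proof.\<close>

lemma pos_parts:
  assumes A: "input_ok st n E x y B (snd s 2)" and B: "int (cfl_bound n) \<le> B"
  shows "htri B U (readP st) s 5 (\<lambda>s'. env st n E x y B s')"
    and "\<And>s. env st n E x y B s \<Longrightarrow>
       htri B U (mapL 25 6 (Num 0) qnnE (baseE st)) s (q * n * n * 6 + 4)
         (\<lambda>s'. env st n E x y B s' \<and> repM n (snd s' 6) {(i, u, v) \<in> universe n. base E i u v})"
    and "\<And>s. env st n E x y B s \<and> repM n (snd s 6) {(i, u, v) \<in> universe n. base E i u v} \<Longrightarrow>
       htri B U logP s (n * 9 + 14) (\<lambda>s'. \<exists>l S. log_ok n l \<and> posI st n E x y B l S s')"
    and "\<And>s. \<exists>S. env st n E x y B s \<and> repM n (snd s 6) S \<and> P S \<Longrightarrow>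
       htri B U (finalP st) s (n * n * 7 + 6) (\<lambda>s'. \<exists>S. (fst s' 26 \<noteq> 0 \<longleftrightarrow> hits st n x y S) \<and> P S)"
    and "\<And>s. \<exists>S. (fst s 26 \<noteq> 0 \<longleftrightarrow> hits st n x y S) \<and> P S \<Longrightarrow>
       htri B U (Asg 0 (Var 26)) s 1 (\<lambda>s'. \<exists>S. (fst s' 0 \<noteq> 0 \<longleftrightarrow> hits st n x y S) \<and> P S)"
proof -
  note Bs = cfl_bound_int[OF B]
  show "htri B U (readP st) s 5 (\<lambda>s'. env st n E x y B s')"
    by (rule htri_mono[OF htri_readP[OF A Bs(1)]]) auto
  show "htri B U (mapL 25 6 (Num 0) qnnE (baseE st)) s (q * n * n * 6 + 4)
         (\<lambda>s'. env st n E x y B s' \<and> repM n (snd s' 6) {(i, u, v) \<in> universe n. base E i u v})"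
    if "env st n E x y B s" for s
    by (rule htri_mono[OF htri_base_map[OF that B]]) auto
  show "htri B U logP s (n * 9 + 14) (\<lambda>s'. \<exists>l S. log_ok n l \<and> posI st n E x y B l S s')"
    if s: "env st n E x y B s \<and> repM n (snd s 6) {(i, u, v) \<in> universe n. base E i u v}" for s
  proof (rule htri_mono[OF htri_logP[OF _ B]])
    show "fst s 20 = int n" using s by (simp add: env_def)
    fix s' assume s': "(\<exists>l. log_ok n l \<and> fst s' 27 = int l) \<and>
      (\<forall>x. x \<notin> {25, 27, 28} \<longrightarrow> fst s' x = fst s x) \<and> snd s' = snd s"
    then obtain l where "log_ok n l" "fst s' 27 = int l" by blast
    moreover have "{(i, u, v) \<in> universe n. base E i u v} \<subseteq> facts E n"
      by (auto simp: universe_def intro: base_facts)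
    ultimately show "\<exists>l S. log_ok n l \<and> posI st n E x y B l S s'"
      using s s' by (intro exI[of _ l] exI[of _ "{(i, u, v) \<in> universe n. base E i u v}"])
        (auto simp: posI_def env_def base_in_def universe_def)
  qed simp
  show "htri B U (finalP st) s (n * n * 7 + 6) (\<lambda>s'. \<exists>S. (fst s' 26 \<noteq> 0 \<longleftrightarrow> hits st n x y S) \<and> P S)"
    if s: "\<exists>S. env st n E x y B s \<and> repM n (snd s 6) S \<and> P S" for s
  proof -
    from s obtain S where "env st n E x y B s" "repM n (snd s 6) S" "P S" by blast
    then show ?thesis by (intro htri_mono[OF htri_finalP[OF _ _ B]]) auto
  qed
  show "htri B U (Asg 0 (Var 26)) s 1 (\<lambda>s'. \<exists>S. (fst s' 0 \<noteq> 0 \<longleftrightarrow> hits st n x y S) \<and> P S)"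
    if s: "\<exists>S. (fst s 26 \<noteq> 0 \<longleftrightarrow> hits st n x y S) \<and> P S" for s
    by (rule htri_bnd, rule htri_Asg) (use s in \<open>auto simp: bnd_def\<close>)
qed

lemma htri_posP:
  assumes A: "input_ok st n E x y B (snd s 2)" and B: "int (cfl_bound n) \<le> B"
  shows "htri B U (posP st) s (pos_ticks n) (\<lambda>s'. fst s' 0 \<noteq> 0 \<longrightarrow> hits st n x y (facts E n))"
proof -
  note Bs = cfl_bound_int[OF B]
  let ?P = "\<lambda>S. S \<subseteq> facts E n"
  let ?J = "\<lambda>s. \<exists>S. env st n E x y B s \<and> repM n (snd s 6) S \<and> ?P S"
  have loop: "htri B U (For 25 qnnE (guessP ;; execP)) s (q * n * n * ((24 * len (int n) + 8 * R + 9) + 5) + 4) ?J"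
    if s: "\<exists>l S. log_ok n l \<and> posI st n E x y B l S s" for s
  proof -
    from s obtain l S0 where l: "log_ok n l" and S0: "posI st n E x y B l S0 s" by blast
    show ?thesis
    proof (rule htri_For[where I = "\<lambda>i s. \<exists>S. posI st n E x y B l S s"])
      show "\<exists>S. posI st n E x y B l S ((fst s)(25 := 0), snd s)"
        using S0 by (auto intro!: exI[of _ S0] posI_cong[OF S0])
    next
      fix i s' assume i: "i < q * n * n" "\<exists>S. posI st n E x y B l S s'" "fst s' 25 = int i"
      then obtain S where S: "posI st n E x y B l S s'" by blast
      have n: "0 < n" using i(1) by (cases n) auto
      show "htri B U (guessP ;; execP) s' (24 * len (int n) + 8 * R + 9)
        (\<lambda>s'. fst s' 25 = int i \<and> (\<exists>S. posI st n E x y B l S ((fst s')(25 := int i + 1), snd s')))"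
      proof (rule htri_mono[OF htri_pos_body[OF S n l B]])
        show "l * 8 + 9 \<le> 24 * len (int n) + 8 * R + 9" using l by (simp add: log_ok_def)
        fix s'' assume s'': "fst s'' 25 = fst s' 25 \<and> (\<exists>z. posI st n E x y B l (sat_step n z S) s'')"
        then obtain z where "posI st n E x y B l (sat_step n z S) s''" by blast
        then have "posI st n E x y B l (sat_step n z S) ((fst s'')(25 := int i + 1), snd s'')"
          by (rule posI_cong) auto
        then show "fst s'' 25 = int i \<and> (\<exists>S. posI st n E x y B l S ((fst s'')(25 := int i + 1), snd s''))"
          using s'' i by auto
      qed
    next
      show "int (q * n * n) \<le> B" using Bs(2) by simp
    qed (auto simp: posI_def env_def)
  qed
  note parts = pos_parts(1-3)[OF A B] pos_parts(4,5)[OF A B, where P = ?P]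
  show ?thesis
    unfolding posP_def
    by (rule htri_mono[OF htri_HSeq[OF parts(1) htri_HSeq[OF parts(2) htri_HSeq[OF parts(3)
          htri_HSeq[OF loop htri_HSeq[OF parts(4) parts(5)]]]]]])
       (auto simp: pos_ticks_def algebra_simps dest: hits_mono)
qed

lemma finite_universe: "finite (universe n)" and card_universe: "card (universe n) = q * n * n"
  by (simp_all add: universe_def card_cartesian_product)

text \<open>As long as a fact is missing, a suitable guess enlarges the set by one element. The
  number of rounds is the size of the universe, so in the end no fact is missing.\<close>

lemma hcan_posP:
  assumes A: "input_ok st n E x y B (snd s 2)" and B: "int (cfl_bound n) \<le> B"
    and hit: "hits st n x y (facts E n)"
  shows "hcan B U (posP st) s (\<lambda>s'. fst s' 0 \<noteq> 0)"
proof -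
  note Bs = cfl_bound_int[OF B]
  have E: "wfE E n" using A by (simp add: input_ok_def)
  let ?P = "\<lambda>S. S = facts E n"
  let ?J = "\<lambda>s. \<exists>S. env st n E x y B s \<and> repM n (snd s 6) S \<and> ?P S"
  have loop: "hcan B U (For 25 qnnE (guessP ;; execP)) s ?J"
    if s: "\<exists>l S. log_ok n l \<and> posI st n E x y B l S s" for s
  proof -
    from s obtain l S0 where l: "log_ok n l" and S0: "posI st n E x y B l S0 s" by blast
    let ?I = "\<lambda>i s. \<exists>S. posI st n E x y B l S s \<and> (facts E n \<subseteq> S \<or> i \<le> card S)"
    show ?thesis
    proof (rule hcan_For[where I = ?I])
      show "?I 0 ((fst s)(25 := 0), snd s)"
        using posI_cong[OF S0] by (intro exI[of _ S0]) simp
    next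
      fix i s' assume i: "i < q * n * n" "?I i s'" "fst s' 25 = int i"
      then obtain S where S: "posI st n E x y B l S s'" "facts E n \<subseteq> S \<or> i \<le> card S" by blast
      have n: "0 < n" using i(1) by (cases n) auto
      show "hcan B U (guessP ;; execP) s'
        (\<lambda>s'. fst s' 25 = int i \<and> ?I (Suc i) ((fst s')(25 := int i + 1), snd s'))"
      proof (cases "facts E n \<subseteq> S")
        \<comment> \<open>All facts have been found, and now any guess will do because
          \<open>sat_step\<close> never removes an element.\<close>
        case True
        show ?thesis
        proof (rule hcan_mono[OF hcan_if_htri[OF htri_pos_body[OF S(1) n l B]]])
          fix s'' assume s'': "fst s'' 25 = fst s' 25 \<and> (\<exists>z. posI st n E x y B l (sat_step n z S) s'')"
          then obtain z where z: "posI st n E x y B l (sat_step n z S) s''" by blast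
          have "facts E n \<subseteq> sat_step n z S"
            using True sat_step_bounds(1)[of S E n z] S(1) by (auto simp: posI_def)
          moreover have "posI st n E x y B l (sat_step n z S) ((fst s'')(25 := int i + 1), snd s'')"
            using z by (rule posI_cong) auto
          ultimately show "fst s'' 25 = int i \<and> ?I (Suc i) ((fst s'')(25 := int i + 1), snd s'')"
            using s'' i by auto
        qed
      next
        case False
        have "base_in n E S" "S \<subseteq> facts E n" using S(1) by (auto simp: posI_def)
        then obtain z where z: "z < R * n * n * n" "card (sat_step n z S) = Suc (card S)"
          using sat_step_new[OF E _ _ False] unfolding base_in_def by metis
        show ?thesis
        proof (rule hcan_mono[OF hcan_pos_body[OF S(1) n l B z(1)]])
          fix s'' assume s'': "fst s'' 25 = fst s' 25 \<and> posI st n E x y B l (sat_step n z S) s''"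
          then have "posI st n E x y B l (sat_step n z S) ((fst s'')(25 := int i + 1), snd s'')"
            by (elim conjE posI_cong) auto
          moreover have "Suc i \<le> card (sat_step n z S)" using S(2) False z(2) by simp
          ultimately show "fst s'' 25 = int i \<and> ?I (Suc i) ((fst s'')(25 := int i + 1), snd s'')"
            using s'' i by auto
        qed
      qed
    next
      show "int (q * n * n) \<le> B" using Bs(2) by simp
    next
      fix s' assume "?I (q * n * n) s'"
      then obtain S where S: "posI st n E x y B l S s'" "facts E n \<subseteq> S \<or> q * n * n \<le> card S" by blast
      have SU: "S \<subseteq> facts E n" "S \<subseteq> universe n" using S(1) facts_universe[OF E] by (auto simp: posI_def)
      have "facts E n \<subseteq> S"
      proof (rule ccontr)
        assume ne: "\<not> facts E n \<subseteq> S"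
        then have "card (universe n) \<le> card S" using S(2) card_universe by simp
        then have "S = universe n" using SU(2) finite_universe card_seteq by blast
        then show False using ne facts_universe[OF E] by blast
      qed
      then show "?J s'" using S(1) SU(1) by (auto simp: posI_def)
    qed (auto simp: posI_def env_def)
  qed
  note parts = pos_parts(1-3)[OF A B] pos_parts(4,5)[OF A B, where P = ?P]
  show ?thesis
    unfolding posP_def
    by (rule hcan_mono[OF hcan_HSeq[OF hcan_if_htri[OF parts(1)] hcan_HSeq[OF hcan_if_htri[OF parts(2)]
          hcan_HSeq[OF hcan_if_htri[OF parts(3)] hcan_HSeq[OF loop
            hcan_HSeq[OF hcan_if_htri[OF parts(4)] hcan_if_htri[OF parts(5)]]]]]]])
       (use hit in auto)
qed

end

section \<open>Certificates for unreachability\<close>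

definition mult_input :: "nat \<Rightarrow> int mat \<Rightarrow> int mat \<Rightarrow> int list" where
  "mult_input n A B = int n # concat (mat_to_list A) @ concat (mat_to_list B)"

definition mult_program :: "com \<Rightarrow> (nat \<Rightarrow> nat) \<Rightarrow> bool" where
  "mult_program P T \<longleftrightarrow> (\<forall>n. \<forall>A\<in>carrier_mat n n. \<forall>B\<in>carrier_mat n n.
     (\<forall>i<n. \<forall>j<n. A $$ (i, j) \<in> {0, 1} \<and> B $$ (i, j) \<in> {0, 1}) \<longrightarrow>
     time_bounded P (mult_input n A B) (T n) \<and>
     computes P (mult_input n A B) (concat (mat_to_list (A * B))))"

lemma length_concat_mat_to_list: "A \<in> carrier_mat n m \<Longrightarrow> length (concat (mat_to_list A)) = n * m"
  by (auto simp: mat_to_list_def intro!: length_concat_const)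

lemma nth_concat_mat_to_list:
  assumes "A \<in> carrier_mat n m" "i < n" "j < m"
  shows "concat (mat_to_list A) ! (i * m + j) = A $$ (i, j)"
proof -
  have "concat (mat_to_list A) ! (i * m + j) = map (\<lambda>j. A $$ (i, j)) [0..<m] ! j"
    using assms unfolding mat_to_list_def by (subst nth_concat_const[where L = m]) auto
  then show ?thesis using assms by simp
qed

context binary_grammar
begin

definition rule_closed :: "(nat \<times> nat \<times> nat) set \<Rightarrow> bool" where
  "rule_closed S \<longleftrightarrow>
     (\<forall>(i, j, k)\<in>set rs. \<forall>u w v. (i, u, w) \<in> S \<longrightarrow> (j, w, v) \<in> S \<longrightarrow> (k, u, v) \<in> S)"

definition closed :: "nat \<Rightarrow> (nat \<times> nat \<times> nat) set \<Rightarrow> (nat \<times> nat \<times> nat) set \<Rightarrow> bool" where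
  "closed n E S \<longleftrightarrow> base_in n E S \<and> rule_closed S"

lemma closed_facts: "wfE E n \<Longrightarrow> closed n E (facts E n)"
  by (auto simp: closed_def rule_closed_def base_in_def intro: base_facts)
    (auto simp: facts_def intro: fact.rule)

text \<open>This makes any guessed closed set a valid certificate: it contains all facts, so what it
  misses is underivable. Completeness guesses the set of facts itself, which is closed by
  \<open>closed_facts\<close>.\<close>

lemma facts_subset_closed: "wfE E n \<Longrightarrow> closed n E S \<Longrightarrow> facts E n \<subseteq> S"
  by (rule facts_least) (auto simp: closed_def rule_closed_def base_in_def)

text \<open>All rules are checked by one product of block diagonal matrices, with a block of size
  \<open>n\<close> for every rule.\<close>

definition blockA :: "nat \<Rightarrow> (nat \<times> nat \<times> nat) set \<Rightarrow> int mat" where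
  "blockA n S = mat (R * n) (R * n) (\<lambda>(a, b). of_bool (a div n = b div n \<and>
     (fst (rs ! (a div n)), a mod n, b mod n) \<in> S))"

definition blockB :: "nat \<Rightarrow> (nat \<times> nat \<times> nat) set \<Rightarrow> int mat" where
  "blockB n S = mat (R * n) (R * n) (\<lambda>(a, b). of_bool (a div n = b div n \<and>
     (fst (snd (rs ! (a div n))), a mod n, b mod n) \<in> S))"

lemma block_carrier [simp]:
  "blockA n S \<in> carrier_mat (R * n) (R * n)" "blockB n S \<in> carrier_mat (R * n) (R * n)"
  by (simp_all add: blockA_def blockB_def)

text \<open>The blocks off the diagonal vanish, so an entry in block \<open>\<rho>\<close> counts
  the vertices \<open>w\<close> through which rule \<open>\<rho>\<close> can derive something from
  \<open>u\<close> to \<open>v\<close>. The upper bound is there because the entries are later read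
  from a shared array.\<close>

lemma block_product:
  assumes "\<rho> < R" "u < n" "v < n" "rs ! \<rho> = (i, j, k)"
  shows "(blockA n S * blockB n S) $$ (\<rho> * n + u, \<rho> * n + v) \<noteq> 0 \<longleftrightarrow>
           (\<exists>w<n. (i, u, w) \<in> S \<and> (j, w, v) \<in> S)"
    and "\<bar>(blockA n S * blockB n S) $$ (\<rho> * n + u, \<rho> * n + v)\<bar> \<le> int (R * n)"
proof -
  let ?a = "\<rho> * n + u" and ?b = "\<rho> * n + v"
  have ab: "?a < R * n" "?b < R * n" using assms by (intro pair_index_less; simp)+
  have dm: "?a div n = \<rho>" "?a mod n = u" "?b div n = \<rho>" "?b mod n = v" using assms by simp_all
  define f where "f c = (of_bool (c div n = \<rho> \<and> (i, u, c mod n) \<in> S \<and> (j, c mod n, v) \<in> S) :: int)" for c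
  have prod: "(blockA n S * blockB n S) $$ (?a, ?b) = (\<Sum>c<R * n. f c)"
  proof -
    have "(blockA n S * blockB n S) $$ (?a, ?b) =
        (\<Sum>c\<in>{0..<R * n}. blockA n S $$ (?a, c) * blockB n S $$ (c, ?b))"
      using ab by (simp add: scalar_prod_def blockA_def blockB_def)
    also have "\<dots> = (\<Sum>c\<in>{0..<R * n}. f c)"
    proof (rule sum.cong)
      fix c assume "c \<in> {0..<R * n}"
      then show "blockA n S $$ (?a, c) * blockB n S $$ (c, ?b) = f c"
        using ab dm assms(4) by (auto simp: blockA_def blockB_def f_def simp del: div_mult_self3 mod_mult_self3)
    qed simp
    finally show ?thesis by (simp add: atLeast0LessThan)
  qed
  have "(\<Sum>c<R * n. f c) = 0 \<longleftrightarrow> (\<forall>c<R * n. f c = 0)"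
    by (subst sum_nonneg_eq_0_iff) (auto simp: f_def)
  moreover have "(\<exists>c<R * n. f c \<noteq> 0) \<longleftrightarrow> (\<exists>w<n. (i, u, w) \<in> S \<and> (j, w, v) \<in> S)"
  proof
    assume "\<exists>c<R * n. f c \<noteq> 0"
    then obtain c where "(i, u, c mod n) \<in> S \<and> (j, c mod n, v) \<in> S" by (auto simp: f_def)
    moreover have "c mod n < n" using assms by simp
    ultimately show "\<exists>w<n. (i, u, w) \<in> S \<and> (j, w, v) \<in> S" by blast
  next
    assume "\<exists>w<n. (i, u, w) \<in> S \<and> (j, w, v) \<in> S"
    then obtain w where "w < n" "(i, u, w) \<in> S" "(j, w, v) \<in> S" by blast
    then show "\<exists>c<R * n. f c \<noteq> 0"
      using assms(1) by (intro exI[of _ "\<rho> * n + w"]) (auto simp: f_def pair_index_less)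
  qed
  ultimately show "(blockA n S * blockB n S) $$ (?a, ?b) \<noteq> 0 \<longleftrightarrow>
           (\<exists>w<n. (i, u, w) \<in> S \<and> (j, w, v) \<in> S)"
    unfolding prod by blast
  have "\<bar>\<Sum>c<R * n. f c\<bar> \<le> (\<Sum>c<R * n. 1)"
    by (rule order_trans[OF sum_abs sum_mono]) (auto simp: f_def)
  then show "\<bar>(blockA n S * blockB n S) $$ (?a, ?b)\<bar> \<le> int (R * n)"
    unfolding prod by simp
qed

definition guessM :: hcom where
  "guessM = For 25 qnnE (Flip 30 ;; Upd 6 (Var 25) (Var 30))"

lemma htri_guessM:
  assumes env: "env st n E x y B s" and B: "int (cfl_bound n) \<le> B"
  shows "htri B U guessM s (q * n * n * 8 + 4)
    (\<lambda>s'. env st n E x y B s' \<and> (\<exists>S. repM n (snd s' 6) S) \<and> snd s' 3 = snd s 3)"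
  unfolding guessM_def
proof (rule htri_mono[OF htri_For[where n = "q * n * n" and b = 3 and
        I = "\<lambda>i s'. env st n E x y B s' \<and> snd s' 3 = snd s 3"]])
  note Bs = cfl_bound_int[OF B]
  show "int (q * n * n) \<le> B" using Bs(2) by simp
  show "env st n E x y B ((fst s)(25 := 0), snd s) \<and> snd ((fst s)(25 := 0), snd s) 3 = snd s 3"
    using env by (simp add: env_def)
  fix i s' assume s': "env st n E x y B s' \<and> snd s' 3 = snd s 3" "fst s' 25 = int i"
  then show "htri B U (Flip 30 ;; Upd 6 (Var 25) (Var 30)) s' 3
     (\<lambda>s'. fst s' 25 = int i \<and> env st n E x y B ((fst s')(25 := int i + 1), snd s') \<and>
        snd ((fst s')(25 := int i + 1), snd s') 3 = snd s 3)"
    using Bs by (intro htri_mono[OF htri_vc]) (auto simp: env_def)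
next
  fix s' :: hstate
  assume "env st n E x y B s' \<and> snd s' 3 = snd s 3"
  moreover have "repM n (snd s' 6) {(i, u, v) \<in> universe n. snd s' 6 (int (code n i u v)) \<noteq> 0}"
    by (auto simp: repM_def universe_def)
  ultimately show "env st n E x y B s' \<and> (\<exists>S. repM n (snd s' 6) S) \<and> snd s' 3 = snd s 3" by blast
qed (auto simp: env_def)

lemma hcan_guessM:
  assumes env: "env st n E x y B s" and B: "int (cfl_bound n) \<le> B" and S: "S \<subseteq> universe n"
  shows "hcan B U guessM s
    (\<lambda>s'. env st n E x y B s' \<and> repM n (snd s' 6) S \<and> snd s' 3 = snd s 3)"
  unfolding guessM_def
proof -
  note Bs = cfl_bound_int[OF B]
  define f where "f x = (of_bool ((x div n div n, x div n mod n, x mod n) \<in> S) :: int)" for x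
  let ?I = "\<lambda>i s'. env st n E x y B s' \<and> snd s' 3 = snd s 3 \<and> (\<forall>j<i. snd s' 6 (int j) = f j)"
  show "hcan B U (For 25 qnnE (Flip 30 ;; Upd 6 (Var 25) (Var 30))) s
    (\<lambda>s'. env st n E x y B s' \<and> repM n (snd s' 6) S \<and> snd s' 3 = snd s 3)"
  proof (rule hcan_For[where n = "q * n * n" and I = ?I])
    show "int (q * n * n) \<le> B" using Bs(2) by simp
    show "?I 0 ((fst s)(25 := 0), snd s)" using env by (simp add: env_def)
    fix i s' assume s': "?I i s'" "fst s' 25 = int i"
    let ?s = "((fst s')(30 := f i), snd s')"
    show "hcan B U (Flip 30 ;; Upd 6 (Var 25) (Var 30)) s'
       (\<lambda>s'. fst s' 25 = int i \<and> ?I (Suc i) ((fst s')(25 := int i + 1), snd s'))"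
    proof (rule hcan_HSeq[OF hcan_Flip[where b = "f i" and Q = "\<lambda>t. t = ?s"]])
      show "hcan B U (Upd 6 (Var 25) (Var 30)) t
       (\<lambda>s'. fst s' 25 = int i \<and> ?I (Suc i) ((fst s')(25 := int i + 1), snd s'))" if "t = ?s" for t
        unfolding that using s' Bs
        by (intro hcan_if_htri[OF htri_Upd]) (auto simp: env_def f_def less_Suc_eq)
    qed (use Bs in \<open>auto simp: f_def\<close>)
  next
    fix s' assume s': "?I (q * n * n) s'"
    have "repM n (snd s' 6) S"
      unfolding repM_def
    proof (intro conjI allI impI S)
      fix i u v assume *: "i < q" "u < n" "v < n"
      then show "snd s' 6 (int (code n i u v)) \<noteq> 0 \<longleftrightarrow> (i, u, v) \<in> S"
        using s' code_less[OF *] code_div[OF *(2,3)] by (simp add: f_def)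
    qed
    then show "env st n E x y B s' \<and> repM n (snd s' 6) S \<and> snd s' 3 = snd s 3" using s' by blast
  qed (auto simp: env_def)
qed

text \<open>Only the diagonal blocks of the product are inspected, one entry per triple
  \<open>(\<rho>, u, v)\<close>. Register 33 holds the dimension \<open>R * n\<close>, and the
  summand 1 skips the length cell of the output list.\<close>

definition checkE :: hexp where
  "checkE = (let \<rho> = Bop Div (Bop Div (Var 25) nE) nE; u = modE (Bop Div (Var 25) nE) nE; v = modE (Var 25) nE in
     notE (andE
       (Arr 3 (Bop Plus (Num 1) (Bop Plus
          (Bop Times (Bop Plus (Bop Times \<rho> nE) u) (Var 33)) (Bop Plus (Bop Times \<rho> nE) v))))
       (notE (Arr 6 (ix (lhsT \<rho>) u v)))))"

definition blockE :: "(hexp \<Rightarrow> hexp) \<Rightarrow> hexp" where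
  "blockE f = (let a = Bop Div (Var 25) (Var 33); b = modE (Var 25) (Var 33) in
     andE (eqE (Bop Div a nE) (Bop Div b nE))
       (Arr 6 (ix (f (Bop Div a nE)) (modE a nE) (modE b nE))))"

text \<open>The multiplication program expects exactly the memory \<open>init_mem\<close> of its
  input. Hence the length cell, the dimension and both matrices are written into array 3, which has
  to be zero everywhere else.\<close>

definition prepMult :: hcom where
  "prepMult = (Asg 33 (Bop Times (Num (int R)) nE) ;; Asg 34 (Bop Times (Var 33) (Var 33)) ;;
     Upd 3 (Num 0) (Bop Plus (Bop Times (Num 2) (Var 34)) (Num 1)) ;; Upd 3 (Num 1) (Var 33)) ;;
     mapL 25 3 (Num 2) (Var 34) (blockE fstT) ;;
     mapL 25 3 (Bop Plus (Num 2) (Var 34)) (Var 34) (blockE sndT)"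

definition negP :: "bool \<Rightarrow> com \<Rightarrow> hcom" where
  "negP st P = readP st ;; guessM ;;
     allL 32 25 qnnE (notE (andE (baseE st) (notE (Arr 6 (Var 25))))) ;;
     prepMult ;; Foreign 3 P ;;
     allL 35 25 (Bop Times (Num (int R)) nnE) checkE ;;
     finalP st ;; Asg 0 (andE (andE (Var 32) (Var 35)) (notE (Var 26)))"

definition negI where
  "negI st n E x y B S s \<longleftrightarrow> env st n E x y B s \<and> repM n (snd s 6) S"

lemma negI_cong:
  "negI st n E x y B S s \<Longrightarrow> snd s' 2 = snd s 2 \<Longrightarrow> snd s' 6 = snd s 6 \<Longrightarrow>
   fst s' 20 = fst s 20 \<Longrightarrow> fst s' 21 = fst s 21 \<Longrightarrow> fst s' 23 = fst s 23 \<Longrightarrow> negI st n E x y B S s'"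
  by (simp add: negI_def env_def)

lemma htri_baseCheck:
  assumes I: "negI st n E x y B S s" and B: "int (cfl_bound n) \<le> B"
  shows "htri B U (allL 32 25 qnnE (notE (andE (baseE st) (notE (Arr 6 (Var 25)))))) s (q * n * n * 7 + 6)
    (\<lambda>s'. negI st n E x y B S s' \<and> snd s' 3 = snd s 3 \<and> fst s' 32 = of_bool (base_in n E S))"
proof -
  note Bs = cfl_bound_int[OF B]
  have env: "env st n E x y B s" and M: "repM n (snd s 6) S" using I by (auto simp: negI_def)
  have n: "fst s 20 = int n" using env by (simp add: env_def)
  define P where "P x \<longleftrightarrow> (base E (x div n div n) (x div n mod n) (x mod n) \<longrightarrow> snd s 6 (int x) \<noteq> 0)" for x
  have all: "(\<forall>i<q * n * n. P i) \<longleftrightarrow> base_in n E S"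
  proof
    assume a: "\<forall>i<q * n * n. P i"
    show "base_in n E S" unfolding base_in_def
    proof (intro allI impI)
      fix i u v assume *: "i < q" "u < n" "v < n" "base E i u v"
      have "P (code n i u v)" using a code_less[OF *(1-3)] by blast
      then show "(i, u, v) \<in> S" using M * code_div[OF *(2,3), of i] by (simp add: P_def repM_def)
    qed
  next
    assume a: "base_in n E S"
    show "\<forall>i<q * n * n. P i"
    proof (intro allI impI)
      fix z assume "z < q * n * n"
      then obtain i u v where *: "i < q" "u < n" "v < n" "z = code n i u v" by (rule code_split)
      then show "P z" using M a code_div[OF *(2,3), of i] by (simp add: P_def repM_def base_in_def)
    qed
  qed
  show ?thesis
  proof (rule htri_allL[where P = P])
    fix i v assume i: "i < q * n * n"
    let ?s = "((fst s)(32 := v, 25 := int i), snd s)"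
    obtain a u w where *: "a < q" "u < n" "w < n" "i = code n a u w" using i by (rule code_split)
    have "input_ok st n E x y B (snd ?s 2)" using env by (simp add: env_def)
    note b = baseE[OF this _ HOL.refl _ *(1-3)]
    show "(hval (notE (andE (baseE st) (notE (Arr 6 (Var 25))))) ?s \<noteq> 0) = P i \<and>
        safe B (notE (andE (baseE st) (notE (Arr 6 (Var 25))))) ?s"
      using b n * code_div[OF *(2,3), of a] by (simp add: P_def)
  next
    show "int (q * n * n) \<le> B" "1 \<le> B" using Bs by simp_all
    show "negI st n E x y B S ((fst s)(32 := of_bool (\<forall>i<q * n * n. P i), 25 := int (q * n * n)), snd s) \<and>
      snd ((fst s)(32 := of_bool (\<forall>i<q * n * n. P i), 25 := int (q * n * n)), snd s) 3 = snd s 3 \<and>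
      fst ((fst s)(32 := of_bool (\<forall>i<q * n * n. P i), 25 := int (q * n * n)), snd s) 32 = of_bool (base_in n E S)"
      using I by (auto simp: all intro!: negI_cong[OF I])
  qed (use n in auto)
qed

lemma hval_blockE:
  assumes n: "fst s 20 = int n" "fst s 33 = int (R * n)" and M: "repM n (snd s 6) S"
    and z: "fst s 25 = int z" "z < (R * n) * (R * n)"
    and f: "\<And>e \<rho>. hval e s = int \<rho> \<Longrightarrow> \<rho> < R \<Longrightarrow> hval (f e) s = int (g (rs ! \<rho>))"
    and g: "\<And>\<rho>. \<rho> < R \<Longrightarrow> g (rs ! \<rho>) < q"
  shows "hval (blockE f) s = of_bool (z div (R * n) div n = z mod (R * n) div n \<and>
     (g (rs ! (z div (R * n) div n)), z div (R * n) mod n, z mod (R * n) mod n) \<in> S)"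
proof -
  define a b where "a = z div (R * n)" and "b = z mod (R * n)"
  have pos: "0 < R * n" using z(2) by (cases "R * n") auto
  have a: "a div n < R" "a mod n < n" "b mod n < n"
    using z(2) pos by (auto simp: a_def less_mult_imp_div_less)
  have v: "hval (Bop Div (Var 25) (Var 33)) s = int a" "hval (modE (Var 25) (Var 33)) s = int b"
    using n z by (simp_all add: a_def b_def of_nat_div of_nat_mod)
  have d: "hval (Bop Div (Bop Div (Var 25) (Var 33)) nE) s = int (a div n)"
    "hval (modE (Bop Div (Var 25) (Var 33)) nE) s = int (a mod n)"
    "hval (Bop Div (modE (Var 25) (Var 33)) nE) s = int (b div n)"
    "hval (modE (modE (Var 25) (Var 33)) nE) s = int (b mod n)"
    using v n by (simp_all add: of_nat_div of_nat_mod)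
  have "hval (ix (f (Bop Div (Bop Div (Var 25) (Var 33)) nE)) (modE (Bop Div (Var 25) (Var 33)) nE)
     (modE (modE (Var 25) (Var 33)) nE)) s = int (code n (g (rs ! (a div n))) (a mod n) (b mod n))"
    using n f[OF d(1) a(1)] d by (intro hval_ix) auto
  then have "hval (blockE f) s = of_bool (int (a div n) = int (b div n) \<and>
      snd s 6 (int (code n (g (rs ! (a div n))) (a mod n) (b mod n))) \<noteq> 0)"
    unfolding blockE_def Let_def using d by simp
  then show ?thesis using M a g[OF a(1)] by (simp add: repM_def flip: a_def b_def)
qed

lemma hval_tables':
  assumes "hval e s = int \<rho>" "\<rho> < R"
  shows "hval (fstT e) s = int (fst (rs ! \<rho>))" "hval (sndT e) s = int (fst (snd (rs ! \<rho>)))"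
  using hval_tables[OF assms] by (cases "rs ! \<rho>"; simp)+

lemma htri_prepMult:
  assumes I: "negI st n E x y B S s" and B: "int (cfl_bound n) \<le> B" and z: "snd s 3 = (\<lambda>_. 0)"
  shows "htri B U prepMult s (2 * (R * n * (R * n) * 6 + 4) + 9)
    (\<lambda>s'. negI st n E x y B S s' \<and> snd s' 3 = init_mem (mult_input (R * n) (blockA n S) (blockB n S)) \<and>
      fst s' 32 = fst s 32 \<and> fst s' 33 = int (R * n))"
proof -
  note Bs = cfl_bound_int[OF B]
  define D where "D = R * n"
  define fA fB where "fA z = concat (mat_to_list (blockA n S)) ! z" and
    "fB z = concat (mat_to_list (blockB n S)) ! z" for z
  have fA: "fA z = of_bool (z div D div n = z mod D div n \<and>
     (fst (rs ! (z div D div n)), z div D mod n, z mod D mod n) \<in> S)"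
   and fB: "fB z = of_bool (z div D div n = z mod D div n \<and>
     (fst (snd (rs ! (z div D div n))), z div D mod n, z mod D mod n) \<in> S)" if "z < D * D" for z
  proof -
    have D: "0 < D" using that by (cases D) auto
    have zz: "z = z div D * D + z mod D" "z div D < D" "z mod D < D"
      using that D by (simp_all add: less_mult_imp_div_less)
    have "fA z = blockA n S $$ (z div D, z mod D)"
      unfolding fA_def by (subst zz(1), subst nth_concat_mat_to_list[of _ D D]) (use zz in \<open>auto simp: D_def\<close>)
    then show "fA z = of_bool (z div D div n = z mod D div n \<and>
     (fst (rs ! (z div D div n)), z div D mod n, z mod D mod n) \<in> S)"
      using zz by (simp add: blockA_def D_def)
    have "fB z = blockB n S $$ (z div D, z mod D)"
      unfolding fB_def by (subst zz(1), subst nth_concat_mat_to_list[of _ D D]) (use zz in \<open>auto simp: D_def\<close>)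
    then show "fB z = of_bool (z div D div n = z mod D div n \<and>
     (fst (snd (rs ! (z div D div n))), z div D mod n, z mod D mod n) \<in> S)"
      using zz by (simp add: blockB_def D_def)
  qed
  have g: "fst (rs ! \<rho>) < q" "fst (snd (rs ! \<rho>)) < q" if "\<rho> < R" for \<rho>
    using nth_mem[OF that] rules_less by (metis prod.collapse)+
  have DB: "int D \<le> B" "int (D * D) \<le> B" "2 * int (D * D) + 1 \<le> B"
  proof -
    have "2 * int (D * D) + 2 \<le> B" using Bs(4) by (simp add: D_def mult.assoc)
    then show "int (D * D) \<le> B" "2 * int (D * D) + 1 \<le> B" by linarith+
    moreover have "D \<le> D * D" by (cases D) auto
    then have "int D \<le> int (D * D)" by (simp only: of_nat_le_iff)
    ultimately show "int D \<le> B" by linarith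
  qed
  have n: "fst s 20 = int n" using I by (simp add: negI_def env_def)
  let ?s0 = "\<lambda>s'. negI st n E x y B S s' \<and> fst s' 32 = fst s 32 \<and> fst s' 33 = int D \<and> fst s' 34 = int (D * D)"
  let ?m0 = "(\<lambda>_. 0)(0 := 2 * int (D * D) + 1, 1 := int D)"
  let ?m1 = "\<lambda>a. if 2 \<le> a \<and> a < 2 + int (D * D) then fA (nat (a - 2)) else ?m0 a"
  let ?m2 = "\<lambda>a. if 2 + int (D * D) \<le> a \<and> a < 2 + int (D * D) + int (D * D)
     then fB (nat (a - (2 + int (D * D)))) else ?m1 a"
  have head: "htri B U (Asg 33 (Bop Times (Num (int R)) nE) ;; Asg 34 (Bop Times (Var 33) (Var 33)) ;;
     Upd 3 (Num 0) (Bop Plus (Bop Times (Num 2) (Var 34)) (Num 1)) ;; Upd 3 (Num 1) (Var 33)) s 7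
     (\<lambda>s'. ?s0 s' \<and> snd s' 3 = ?m0)"
    by (rule htri_mono[OF htri_vc])
       (use DB n z I in \<open>auto simp: D_def fun_eq_iff intro!: negI_cong[OF I]\<close>)
  have m1: "htri B U (mapL 25 3 (Num 2) (Var 34) (blockE fstT)) s' (D * D * 6 + 4)
     (\<lambda>s'. ?s0 s' \<and> snd s' 3 = ?m1)" if s': "?s0 s' \<and> snd s' 3 = ?m0" for s'
  proof (rule htri_mapL)
    fix i h assume i: "i < D * D"
    have "hval (blockE fstT) ((fst s')(25 := int i), (snd s')(3 := h)) = fA i"
      unfolding fA[OF i] D_def
      by (rule hval_blockE)
         (use s' i g in \<open>auto simp: negI_def env_def D_def intro!: hval_tables'\<close>)
    then show "hval (blockE fstT) ((fst s')(25 := int i), (snd s')(3 := h)) = fA i \<and>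
      safe B (blockE fstT) ((fst s')(25 := int i), (snd s')(3 := h))"
      by (simp add: blockE_def Let_def)
  next
    show "?s0 ((fst s')(25 := int (D * D)), (snd s')
         (3 := \<lambda>a. if 2 \<le> a \<and> a < 2 + int (D * D) then fA (nat (a - 2)) else snd s' 3 a)) \<and>
       snd ((fst s')(25 := int (D * D)), (snd s')
         (3 := \<lambda>a. if 2 \<le> a \<and> a < 2 + int (D * D) then fA (nat (a - 2)) else snd s' 3 a)) 3 = ?m1"
      using s' by (auto intro: negI_cong)
  qed (use s' DB in auto)
  have m2: "htri B U (mapL 25 3 (Bop Plus (Num 2) (Var 34)) (Var 34) (blockE sndT)) s' (D * D * 6 + 4)
     (\<lambda>s'. ?s0 s' \<and> snd s' 3 = ?m2)" if s': "?s0 s' \<and> snd s' 3 = ?m1" for s'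
  proof (rule htri_mapL)
    fix i h assume i: "i < D * D"
    have "hval (blockE sndT) ((fst s')(25 := int i), (snd s')(3 := h)) = fB i"
      unfolding fB[OF i] D_def
      by (rule hval_blockE[where g = "\<lambda>r. fst (snd r)"])
         (use s' i g in \<open>auto simp: negI_def env_def D_def intro!: hval_tables'\<close>)
    then show "hval (blockE sndT) ((fst s')(25 := int i), (snd s')(3 := h)) = fB i \<and>
      safe B (blockE sndT) ((fst s')(25 := int i), (snd s')(3 := h))"
      by (simp add: blockE_def Let_def)
  next
    show "?s0 ((fst s')(25 := int (D * D)), (snd s')
         (3 := \<lambda>a. if 2 + int (D * D) \<le> a \<and> a < 2 + int (D * D) + int (D * D)
           then fB (nat (a - (2 + int (D * D)))) else snd s' 3 a)) \<and>
       snd ((fst s')(25 := int (D * D)), (snd s')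
         (3 := \<lambda>a. if 2 + int (D * D) \<le> a \<and> a < 2 + int (D * D) + int (D * D)
           then fB (nat (a - (2 + int (D * D)))) else snd s' 3 a)) 3 = ?m2"
      using s' by (auto intro: negI_cong)
  qed (use s' DB in auto)
  have mem: "?m2 = init_mem (mult_input D (blockA n S) (blockB n S))"
  proof
    fix a :: int
    let ?xs = "mult_input D (blockA n S) (blockB n S)"
    have lA: "length (concat (mat_to_list (blockA n S))) = D * D"
      and lB: "length (concat (mat_to_list (blockB n S))) = D * D"
      by (simp_all add: length_concat_mat_to_list D_def)
    have L: "int (length ?xs) = 2 * int (D * D) + 1" by (simp add: mult_input_def lA lB)
    consider "a < 0 \<or> 2 + 2 * int (D * D) \<le> a" | "a = 0" | "a = 1"
      | "2 \<le> a" "a < 2 + int (D * D)" | "2 + int (D * D) \<le> a" "a < 2 + 2 * int (D * D)"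
      by linarith
    then show "?m2 a = init_mem ?xs a"
    proof cases
      case 1
      have "0 \<le> int (D * D)" by (rule of_nat_0_le_iff)
      then show ?thesis using 1 L by (auto simp: init_mem_def simp del: of_nat_mult)
    next
      case 3
      then show ?thesis using L by (simp add: init_mem_def mult_input_def)
    next
      case 4
      then obtain i where i: "a = int i + 2" "i < D * D"
        by (metis add.commute diff_add_cancel nonneg_int_cases diff_ge_0_iff_ge add_less_cancel_left of_nat_less_iff)
      have "?xs ! nat (a - 1) = fA i" using i lA by (simp add: mult_input_def nth_append fA_def nat_add_distrib)
      then show ?thesis using 4 L i by (auto simp: init_mem_def simp del: of_nat_mult)
    next
      case 5
      define i where "i = nat (a - (2 + int (D * D)))"
      have ii: "int i = a - (2 + int (D * D))" using 5 by (simp add: i_def del: of_nat_mult)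
      then have "int i < int (D * D)" using 5 by linarith
      then have i: "a = int i + 2 + int (D * D)" "i < D * D"
        using ii by (simp_all only: of_nat_less_iff)
      have "a - 1 = int (Suc (D * D + i))" using i by simp
      then have "nat (a - 1) = Suc (D * D + i)" by (simp only: nat_int)
      then have "?xs ! nat (a - 1) = fB i" using i lA by (simp add: mult_input_def nth_append fB_def)
      then show ?thesis using 5 L i by (auto simp: init_mem_def simp del: of_nat_mult)
    qed (use L in \<open>auto simp: init_mem_def\<close>)
  qed
  show ?thesis
    unfolding prepMult_def
  proof (rule htri_mono[OF htri_HSeq[OF head htri_HSeq[OF m1 m2]]])
    fix s' assume "?s0 s' \<and> snd s' 3 = ?m2"
    then show "negI st n E x y B S s' \<and>
      snd s' 3 = init_mem (mult_input (R * n) (blockA n S) (blockB n S)) \<and>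
      fst s' 32 = fst s 32 \<and> fst s' 33 = int (R * n)"
      unfolding mem by (simp add: D_def)
  qed (auto simp: D_def)
qed

lemma htri_mult:
  assumes I: "negI st n E x y B S s" and P: "mult_program P T"
    and inp: "snd s 3 = init_mem (mult_input (R * n) (blockA n S) (blockB n S))"
  shows "htri B U (Foreign 3 P) s (30 * T (R * n))
    (\<lambda>s'. negI st n E x y B S s' \<and> fst s' = fst s \<and>
      holds_output (snd s' 3) (concat (mat_to_list (blockA n S * blockB n S))))"
proof -
  have "\<forall>i<R * n. \<forall>j<R * n. blockA n S $$ (i, j) \<in> {0, 1} \<and> blockB n S $$ (i, j) \<in> {0, 1}"
    by (simp add: blockA_def blockB_def)
  then have P': "time_bounded P (mult_input (R * n) (blockA n S) (blockB n S)) (T (R * n))"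
    "computes P (mult_input (R * n) (blockA n S) (blockB n S)) (concat (mat_to_list (blockA n S * blockB n S)))"
    using P block_carrier unfolding mult_program_def by blast+
  show ?thesis
  proof (rule htri_Foreign[OF inp P'(1)])
    fix t m' assume "steps (P, init_mem (mult_input (R * n) (blockA n S) (blockB n S))) t (Skip, m')"
    then have "holds_output m' (concat (mat_to_list (blockA n S * blockB n S)))"
      using P'(2) unfolding computes_def by blast
    then show "negI st n E x y B S (fst s, (snd s)(3 := m')) \<and> fst (fst s, (snd s)(3 := m')) = fst s \<and>
      holds_output (snd (fst s, (snd s)(3 := m')) 3) (concat (mat_to_list (blockA n S * blockB n S)))"
      by (auto intro!: negI_cong[OF I])
  qed simp
qed

lemma htri_ruleCheck:
  assumes I: "negI st n E x y B S s" and B: "int (cfl_bound n) \<le> B"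
    and out: "holds_output (snd s 3) (concat (mat_to_list (blockA n S * blockB n S)))"
    and D: "fst s 33 = int (R * n)"
  shows "htri B U (allL 35 25 (Bop Times (Num (int R)) nnE) checkE) s (R * n * n * 7 + 6)
    (\<lambda>s'. negI st n E x y B S s' \<and> fst s' 32 = fst s 32 \<and>
      fst s' 35 = of_bool (rule_closed S))"
proof -
  note Bs = cfl_bound_int[OF B]
  have M: "repM n (snd s 6) S" and n: "fst s 20 = int n" using I by (auto simp: negI_def env_def)
  have SU: "S \<subseteq> universe n" using M by (simp add: repM_def)
  let ?C = "blockA n S * blockB n S"
  have C: "?C \<in> carrier_mat (R * n) (R * n)" by (rule mult_carrier_mat[OF block_carrier])
  define P where "P z \<longleftrightarrow> (?C $$ (z div n, z div n div n * n + z mod n) \<noteq> 0 \<longrightarrow>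
    (snd (snd (rs ! (z div n div n))), z div n mod n, z mod n) \<in> S)" for z
  \<comment> \<open>The product is left in a shared array by a foreign program; reading it safely
    rests on the bound \<open>R * n\<close> of \<open>block_product\<close>.\<close>
  have DB: "int (R * n) \<le> B"
  proof -
    have "2 * int (R * n * (R * n)) + 2 \<le> B" using Bs(4) by (simp add: mult.assoc)
    moreover have "R * n \<le> R * n * (R * n)" by (cases "R * n") auto
    then have "int (R * n) \<le> int (R * n * (R * n))" by (simp only: of_nat_le_iff)
    ultimately show ?thesis by linarith
  qed
  have Pcode: "P (code n \<rho> u v) \<longleftrightarrow>
      ((\<exists>w<n. (i, u, w) \<in> S \<and> (j, w, v) \<in> S) \<longrightarrow> (k, u, v) \<in> S)"
    if "\<rho> < R" "u < n" "v < n" "rs ! \<rho> = (i, j, k)" for \<rho> u v i j k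
  proof -
    have "code n \<rho> u v div n = \<rho> * n + u" using that by (simp add: code_def)
    then show ?thesis
      using block_product(1)[OF that] code_div[OF that(2,3), of \<rho>] that(4) by (simp add: P_def)
  qed
  have all: "(\<forall>z<R * n * n. P z) \<longleftrightarrow>
     rule_closed S"
  proof
    assume a: "\<forall>z<R * n * n. P z"
    have "(k, u, v) \<in> S" if "(i, j, k) \<in> set rs" "(i, u, w) \<in> S" "(j, w, v) \<in> S" for i j k u w v
    proof -
      obtain \<rho> where \<rho>: "\<rho> < R" "rs ! \<rho> = (i, j, k)" using \<open>(i, j, k) \<in> set rs\<close> by (metis in_set_conv_nth)
      have uvw: "u < n" "w < n" "v < n" using that SU by (auto simp: universe_def)
      show ?thesis
        using Pcode[OF \<rho>(1) uvw(1,3) \<rho>(2)] a code_less[OF \<rho>(1) uvw(1,3)] that uvw by blast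
    qed
    then show "rule_closed S" unfolding rule_closed_def by blast
  next
    assume a: "rule_closed S"
    show "\<forall>z<R * n * n. P z"
    proof (intro allI impI)
      fix z assume "z < R * n * n"
      then obtain \<rho> u v where *: "\<rho> < R" "u < n" "v < n" "z = code n \<rho> u v" by (rule code_split)
      obtain i j k where r: "rs ! \<rho> = (i, j, k)" by (metis prod_cases3)
      then have "(i, j, k) \<in> set rs" using * by (metis nth_mem)
      then show "P z" unfolding *(4) Pcode[OF *(1-3) r] using a unfolding rule_closed_def by blast
    qed
  qed
  show ?thesis
  proof (rule htri_allL[where P = P])
    fix z v' assume "z < R * n * n"
    then obtain \<rho> u v where *: "\<rho> < R" "u < n" "v < n" "z = code n \<rho> u v" by (rule code_split)
    obtain i j k where r: "rs ! \<rho> = (i, j, k)" by (metis prod_cases3)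
    then have "(i, j, k) \<in> set rs" using * by (metis nth_mem)
    then have kq: "k < q" using rules_less by blast
    let ?s = "((fst s)(35 := v', 25 := int z), snd s)"
    let ?\<rho> = "Bop Div (Bop Div (Var 25) nE) nE"
    let ?u = "modE (Bop Div (Var 25) nE) nE"
    let ?v = "modE (Var 25) nE"
    have d: "int z div int n div int n = int \<rho>" "int z div int n mod int n = int u" "int z mod int n = int v"
      using code_div[OF *(2,3), of \<rho>] *(4) by (metis of_nat_div of_nat_mod)+
    have h: "hval ?\<rho> ?s = int \<rho>" "hval ?u ?s = int u" "hval ?v ?s = int v" using n d by simp_all
    have ix: "hval (ix (lhsT ?\<rho>) ?u ?v) ?s = int (code n k u v)"
      using hval_tables(1)[OF h(1) *(1) r] h n by (intro hval_ix) auto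
    have ab: "\<rho> * n + u < R * n" "\<rho> * n + v < R * n" using * by (intro pair_index_less; simp)+
    have "(\<rho> * n + u) * (R * n) + (\<rho> * n + v) < length (concat (mat_to_list ?C))"
      unfolding length_concat_mat_to_list[OF C] using ab by (rule pair_index_less)
    then have "snd s 3 (int ((\<rho> * n + u) * (R * n) + (\<rho> * n + v)) + 1) = ?C $$ (\<rho> * n + u, \<rho> * n + v)"
      using out nth_concat_mat_to_list[OF C ab] unfolding holds_output_def by metis
    then have o: "snd s 3 (1 + ((int \<rho> * int n + int u) * (int R * int n) + (int \<rho> * int n + int v))) =
       ?C $$ (\<rho> * n + u, \<rho> * n + v)" by (simp add: add.commute)
    have "\<bar>?C $$ (\<rho> * n + u, \<rho> * n + v)\<bar> \<le> B"
      using block_product(2)[OF *(1-3) r, of S] DB by linarith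
    moreover have "P z \<longleftrightarrow> (?C $$ (\<rho> * n + u, \<rho> * n + v) \<noteq> 0 \<longrightarrow> (k, u, v) \<in> S)"
      unfolding *(4) Pcode[OF *(1-3) r] block_product(1)[OF *(1-3) r] ..
    moreover have "snd s 6 (int (code n k u v)) \<noteq> 0 \<longleftrightarrow> (k, u, v) \<in> S"
      using M kq * by (simp add: repM_def)
    ultimately show "(hval checkE ?s \<noteq> 0) = P z \<and> safe B checkE ?s"
      unfolding checkE_def Let_def using ix h o D n by simp
  next
    show "int (R * n * n) \<le> B" "1 \<le> B" using Bs by simp_all
    let ?s' = "((fst s)(35 := of_bool (\<forall>i<R * n * n. P i), 25 := int (R * n * n)), snd s)"
    show "negI st n E x y B S ?s' \<and> fst ?s' 32 = fst s 32 \<and>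
      fst ?s' 35 = of_bool (rule_closed S)"
      by (auto simp: all intro!: negI_cong[OF I])
  qed (use n in auto)
qed

definition neg_ticks :: "(nat \<Rightarrow> nat) \<Rightarrow> nat \<Rightarrow> nat" where
  "neg_ticks T n = q * n * n * 15 + 12 * (R * n * (R * n)) + 30 * T (R * n) + R * n * n * 7 + n * n * 7 + 70"

text \<open>The part of \<open>negP\<close> after the guess of the set. It decides exactly whether
  the guessed set is a certificate, so one lemma about it serves soundness as well as
  completeness.\<close>

definition checkP :: "bool \<Rightarrow> com \<Rightarrow> hcom" where
  "checkP st P = allL 32 25 qnnE (notE (andE (baseE st) (notE (Arr 6 (Var 25))))) ;;
     prepMult ;; Foreign 3 P ;;
     allL 35 25 (Bop Times (Num (int R)) nnE) checkE ;;
     finalP st ;; Asg 0 (andE (andE (Var 32) (Var 35)) (notE (Var 26)))"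

lemma htri_checkP:
  assumes I: "negI st n E x y B S s" and B: "int (cfl_bound n) \<le> B" and P: "mult_program P T"
    and z: "snd s 3 = (\<lambda>_. 0)"
  shows "htri B U (checkP st P) s
     (q * n * n * 7 + 12 * (R * n * (R * n)) + 30 * T (R * n) + R * n * n * 7 + n * n * 7 + 50)
    (\<lambda>s'. fst s' 0 \<noteq> 0 \<longleftrightarrow> closed n E S \<and> \<not> hits st n x y S)"
proof -
  let ?b = "of_bool (base_in n E S) :: int"
  let ?r = "of_bool (rule_closed S) :: int"
  have 1: "htri B U (allL 32 25 qnnE (notE (andE (baseE st) (notE (Arr 6 (Var 25)))))) s (q * n * n * 7 + 6)
    (\<lambda>s'. negI st n E x y B S s' \<and> snd s' 3 = (\<lambda>_. 0) \<and> fst s' 32 = ?b)"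
    by (rule htri_mono[OF htri_baseCheck[OF I B]]) (use z in auto)
  have 2: "htri B U prepMult s' (2 * (R * n * (R * n) * 6 + 4) + 9)
    (\<lambda>s'. negI st n E x y B S s' \<and> snd s' 3 = init_mem (mult_input (R * n) (blockA n S) (blockB n S)) \<and>
      fst s' 32 = ?b \<and> fst s' 33 = int (R * n))"
    if "negI st n E x y B S s' \<and> snd s' 3 = (\<lambda>_. 0) \<and> fst s' 32 = ?b" for s'
    using that by (intro htri_mono[OF htri_prepMult[OF _ B]]) auto
  have 3: "htri B U (Foreign 3 P) s' (30 * T (R * n))
    (\<lambda>s'. negI st n E x y B S s' \<and> holds_output (snd s' 3) (concat (mat_to_list (blockA n S * blockB n S))) \<and>
      fst s' 32 = ?b \<and> fst s' 33 = int (R * n))"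
    if "negI st n E x y B S s' \<and> snd s' 3 = init_mem (mult_input (R * n) (blockA n S) (blockB n S)) \<and>
      fst s' 32 = ?b \<and> fst s' 33 = int (R * n)" for s'
    using that by (intro htri_mono[OF htri_mult[OF _ P]]) auto
  have 4: "htri B U (allL 35 25 (Bop Times (Num (int R)) nnE) checkE) s' (R * n * n * 7 + 6)
    (\<lambda>s'. negI st n E x y B S s' \<and> fst s' 32 = ?b \<and> fst s' 35 = ?r)"
    if "negI st n E x y B S s' \<and> holds_output (snd s' 3) (concat (mat_to_list (blockA n S * blockB n S))) \<and>
      fst s' 32 = ?b \<and> fst s' 33 = int (R * n)" for s'
    using that by (intro htri_mono[OF htri_ruleCheck[OF _ B]]) auto
  have 5: "htri B U (finalP st) s' (n * n * 7 + 6)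
    (\<lambda>s'. (fst s' 26 \<noteq> 0 \<longleftrightarrow> hits st n x y S) \<and> fst s' 32 = ?b \<and> fst s' 35 = ?r)"
    if "negI st n E x y B S s' \<and> fst s' 32 = ?b \<and> fst s' 35 = ?r" for s'
    using that by (intro htri_mono[OF htri_finalP[OF _ _ B]]) (auto simp: negI_def)
  have 6: "htri B U (Asg 0 (andE (andE (Var 32) (Var 35)) (notE (Var 26)))) s' 1
     (\<lambda>s'. fst s' 0 \<noteq> 0 \<longleftrightarrow> closed n E S \<and> \<not> hits st n x y S)"
    if "(fst s' 26 \<noteq> 0 \<longleftrightarrow> hits st n x y S) \<and> fst s' 32 = ?b \<and> fst s' 35 = ?r" for s'
    using that cfl_bound_int(7)[OF B] by (intro htri_Asg) (auto simp: closed_def)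
  show ?thesis
    unfolding checkP_def
    by (rule htri_mono[OF htri_HSeq[OF 1 htri_HSeq[OF 2 htri_HSeq[OF 3 htri_HSeq[OF 4 htri_HSeq[OF 5 6]]]]]])
       auto
qed

lemma neg_read:
  assumes A: "input_ok st n E x y B (snd s 2)" and B: "int (cfl_bound n) \<le> B" and z: "snd s 3 = (\<lambda>_. 0)"
  shows "htri B U (readP st) s 5 (\<lambda>s'. env st n E x y B s' \<and> snd s' 3 = (\<lambda>_. 0))"
  by (rule htri_mono[OF htri_readP[OF A cfl_bound_int(1)[OF B]]]) (use z in auto)

lemma htri_negP:
  assumes A: "input_ok st n E x y B (snd s 2)" and B: "int (cfl_bound n) \<le> B" and P: "mult_program P T"
    and z: "snd s 3 = (\<lambda>_. 0)"
  shows "htri B U (negP st P) s (neg_ticks T n) (\<lambda>s'. fst s' 0 \<noteq> 0 \<longrightarrow> \<not> hits st n x y (facts E n))"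
proof -
  have E: "wfE E n" using A by (simp add: input_ok_def)
  let ?J = "\<lambda>s'. env st n E x y B s' \<and> (\<exists>S. repM n (snd s' 6) S) \<and> snd s' 3 = (\<lambda>_. 0)"
  have 1: "htri B U guessM s' (q * n * n * 8 + 4) ?J"
    if "env st n E x y B s' \<and> snd s' 3 = (\<lambda>_. 0)" for s'
    using that by (intro htri_mono[OF htri_guessM[OF _ B]]) auto
  have 2: "htri B U (checkP st P) s'
     (q * n * n * 7 + 12 * (R * n * (R * n)) + 30 * T (R * n) + R * n * n * 7 + n * n * 7 + 50)
    (\<lambda>s'. fst s' 0 \<noteq> 0 \<longrightarrow> \<not> hits st n x y (facts E n))" if s': "?J s'" for s'
  proof -
    from s' obtain S where "negI st n E x y B S s'" "snd s' 3 = (\<lambda>_. 0)" by (auto simp: negI_def)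
    from htri_checkP[OF this(1) B P this(2)] show ?thesis
      by (rule htri_mono) (auto dest: hits_mono[OF facts_subset_closed[OF E]])
  qed
  show ?thesis
    unfolding negP_def checkP_def[symmetric]
    by (rule htri_mono[OF htri_HSeq[OF neg_read[OF A B z] htri_HSeq[OF 1 2]]]) (auto simp: neg_ticks_def)
qed

lemma hcan_negP:
  assumes A: "input_ok st n E x y B (snd s 2)" and B: "int (cfl_bound n) \<le> B" and P: "mult_program P T"
    and z: "snd s 3 = (\<lambda>_. 0)" and hit: "\<not> hits st n x y (facts E n)"
  shows "hcan B U (negP st P) s (\<lambda>s'. fst s' 0 \<noteq> 0)"
proof -
  have E: "wfE E n" using A by (simp add: input_ok_def)
  have 1: "hcan B U guessM s' (\<lambda>s'. negI st n E x y B (facts E n) s' \<and> snd s' 3 = (\<lambda>_. 0))"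
    if "env st n E x y B s' \<and> snd s' 3 = (\<lambda>_. 0)" for s'
    using that facts_universe[OF E] by (intro hcan_mono[OF hcan_guessM[OF _ B]]) (auto simp: negI_def)
  have 2: "hcan B U (checkP st P) s' (\<lambda>s'. fst s' 0 \<noteq> 0)"
    if s': "negI st n E x y B (facts E n) s' \<and> snd s' 3 = (\<lambda>_. 0)" for s'
  proof -
    from s' have I: "negI st n E x y B (facts E n) s'" "snd s' 3 = (\<lambda>_. 0)" by auto
    show ?thesis
      by (rule hcan_mono[OF hcan_if_htri[OF htri_checkP[OF I(1) B P I(2)]]])
         (use closed_facts[OF E] hit in auto)
  qed
  show ?thesis
    unfolding negP_def checkP_def[symmetric]
    by (rule hcan_HSeq[OF hcan_if_htri[OF neg_read[OF A B z]] hcan_HSeq[OF 1 2]])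
qed

end

section \<open>From formulas to triangle problems\<close>

text \<open>Reductions from satisfiability. The variables are split into three parts of \<open>h\<close> variables
  each; colour \<open>b = p 2\<^sup>h + a\<close> stands for the assignment \<open>a\<close> to part \<open>p\<close>. A vertex is a colour together
  with a number \<open>j\<close>. If \<open>j = 8 c + \<tau>\<close> then it claims that precisely the parts in \<open>\<tau>\<close> satisfy
  clause \<open>c\<close>, and it is isolated if the claim is wrong for its own part. Hence a triple of
  colours, one from each part, has one triangle for every clause, and \<open>\<tau> = 0\<close> for the
  falsified ones. For Triangle Collection only the triangles with \<open>\<tau> = 0\<close> are kept, and the
  last three values of \<open>j\<close> provide triangles for the triples that miss part \<open>j - 8 m\<close>. For
  Matching Triangles those with \<open>\<tau> \<noteq> 0\<close> are kept, and all \<open>m\<close> clauses must be hit.\<close>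

locale sat_graph =
  fixes k n :: nat and F :: cnf and dmt :: bool
  assumes kcnf: "is_kcnf k n F"
begin

text \<open>Rounded up so that three parts cover all variables, \<open>n <= 3 * h\<close>, and
  positive even for \<open>n = 0\<close>.\<close>

definition h :: nat where "h = n div 3 + 1"
definition H :: nat where "H = 2 ^ h"
definition m :: nat where "m = length F"
definition J :: nat where "J = 8 * m + 3"
definition N :: nat where "N = 3 * H * J"

text \<open>The variable of \<open>l\<close> is bit \<open>(|l| - 1) mod h\<close> of part
  \<open>(|l| - 1) div h\<close>. A literal from a part other than that of \<open>b\<close> counts
  as not satisfied.\<close>

definition lit_sat :: "nat \<Rightarrow> int \<Rightarrow> bool" where
  "lit_sat b l \<longleftrightarrow> nat (\<bar>l\<bar> - 1) div h = b div H \<and>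
     (odd (b mod H div 2 ^ (nat (\<bar>l\<bar> - 1) mod h)) \<longleftrightarrow> 0 < l)"

definition clause_sat :: "nat \<Rightarrow> int list \<Rightarrow> bool" where
  "clause_sat b C \<longleftrightarrow> (\<exists>l\<in>set C. lit_sat b l)"

definition claim :: "nat \<Rightarrow> nat \<Rightarrow> nat \<Rightarrow> bool" where
  "claim b c \<tau> \<longleftrightarrow> (odd (\<tau> div 2 ^ (b div H)) \<longleftrightarrow> clause_sat b (F ! c))"

definition edge :: "nat \<Rightarrow> nat \<Rightarrow> bool" where
  "edge u v \<longleftrightarrow> u mod J = v mod J \<and>
    (let j = u mod J; b = u div J; b' = v div J in
     if j < 8 * m
     then b div H \<noteq> b' div H \<and> claim b (j div 8) (j mod 8) \<and> claim b' (j div 8) (j mod 8) \<and>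
          (j mod 8 = 0) \<noteq> dmt
     else \<not> dmt \<and> b \<noteq> b' \<and> b div H \<noteq> j - 8 * m \<and> b' div H \<noteq> j - 8 * m)"

definition graph :: cgraph where
  "graph = \<lparr>verts_num = N, adj = {(u, v). u < N \<and> v < N \<and> edge u v}, color = (\<lambda>v. v div J)\<rparr>"

definition cnf_code :: "int list" where
  "cnf_code = int n # int m # concat (map (\<lambda>C. int (length C) # C) F)"

text \<open>The offset of clause \<open>c\<close> in the code, counted behind the two header
  entries; every clause is preceded by its length.\<close>

definition pos :: "nat \<Rightarrow> nat" where
  "pos c = sum_list (map (\<lambda>C. Suc (length C)) (take c F))"

lemma H_pos: "0 < H" and h_pos: "0 < h" and J_pos: "0 < J"
  by (simp_all add: H_def h_def J_def)

lemma size_bounds: "n \<le> N" "h \<le> N" "H \<le> N" "3 * H \<le> N" "J \<le> N" "m \<le> N" "8 * m + 3 \<le> N" "18 \<le> N"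
proof -
  have hH: "h < H" unfolding H_def by (rule less_exp)
  have H2: "2 \<le> H" using power_increasing[of 1 h "2::nat"] h_pos by (simp add: H_def)
  have "3 * H * 3 \<le> N" unfolding N_def by (rule mult_le_mono2) (simp add: J_def)
  moreover have "6 * J \<le> N" unfolding N_def using H2 by (intro mult_le_mono1) simp
  moreover have "n \<le> 3 * h" unfolding h_def by presburger
  ultimately show "n \<le> N" "h \<le> N" "H \<le> N" "3 * H \<le> N" "J \<le> N" "m \<le> N" "8 * m + 3 \<le> N" "18 \<le> N"
    using hH H2 J_def by linarith+
qed

lemma pos_Suc: "c < m \<Longrightarrow> pos (Suc c) = pos c + Suc (length (F ! c))"
  by (simp add: pos_def take_Suc_conv_app_nth m_def)

lemma length_concat_clauses:
  "length (concat (map (\<lambda>C. int (length C) # C) G)) = sum_list (map (\<lambda>C. Suc (length C)) G)"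
  for G :: cnf
  by (induction G) auto

lemma length_cnf_code: "length cnf_code = 2 + pos m"
  unfolding cnf_code_def pos_def m_def by (simp add: length_concat_clauses)

lemma pos_le: "c \<le> m \<Longrightarrow> pos c \<le> c * (k + 1)"
proof (induction c)
  case 0
  then show ?case by (simp add: pos_def)
next
  case (Suc c)
  then have "length (F ! c) \<le> k" using kcnf by (auto simp: is_kcnf_def m_def)
  then show ?case using Suc by (simp add: pos_Suc)
qed

lemma pos_mono: "c \<le> c' \<Longrightarrow> pos c \<le> pos c'"
proof -
  assume "c \<le> c'"
  then have "take c' F = take c F @ take (c' - c) (drop c F)"
    by (metis le_add_diff_inverse take_add)
  then show ?thesis by (simp add: pos_def)
qed

lemma cnf_code_nth:
  assumes "c < m"
  shows "cnf_code ! (2 + pos c) = int (length (F ! c))"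
    and "j < length (F ! c) \<Longrightarrow> cnf_code ! (2 + (pos c + Suc j)) = F ! c ! j"
proof -
  let ?f = "\<lambda>C. int (length C) # C"
  have len: "length (concat (map ?f (take c F))) = pos c"
    unfolding pos_def by (rule length_concat_clauses)
  have F: "F = take c F @ F ! c # drop (Suc c) F" using assms unfolding m_def by (rule id_take_nth_drop)
  have "concat (map ?f F) = concat (map ?f (take c F @ F ! c # drop (Suc c) F))"
    by (simp only: F[symmetric])
  then have "concat (map ?f F) = concat (map ?f (take c F)) @ ?f (F ! c) @ concat (map ?f (drop (Suc c) F))"
    by simp
  then have "concat (map ?f F) ! (pos c + i) = (?f (F ! c) @ concat (map ?f (drop (Suc c) F))) ! i" for i
    by (simp add: nth_append len)
  from this[of 0] this[of "Suc j"]
  show "cnf_code ! (2 + pos c) = int (length (F ! c))"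
    "j < length (F ! c) \<Longrightarrow> cnf_code ! (2 + (pos c + Suc j)) = F ! c ! j"
    by (simp_all add: cnf_code_def nth_append)
qed

section \<open>The program that constructs the coloured graph\<close>

definition litP :: hcom where
  "litP = Asg 13 (Arr 1 (Bop Plus (Bop Plus (Var 8) (Num 1)) (Var 12))) ;;
     Asg 16 (Bop Minus (Bop Times (Bop Minus (Num 1) (Bop Times (Num 2) (Bop Lt (Var 13) (Num 0)))) (Var 13)) (Num 1)) ;;
     HIf (andE (eqE (Bop Div (Var 16) (Var 3)) (Bop Div (Var 10) (Var 4)))
        (eqE (modE (Bop Div (modE (Var 10) (Var 4)) (Arr 4 (modE (Var 16) (Var 3)))) (Num 2))
          (Bop Lt (Num 0) (Var 13))))
       (Asg 11 (Num 1)) HSkip"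

text \<open>For the current clause and colour, array 5 receives the truth of the claim for each of
  the eight \<open>\<tau>\<close>. With this table every adjacency is later decided by constantly
  many operations.\<close>

definition colP :: hcom where
  "colP = Asg 11 (Num 0) ;; For 12 (Var 9) litP ;;
     mapL 14 5 (Bop Plus (Bop Times (Var 10) (Var 5)) (Bop Times (Num 8) (Var 7))) (Num 8)
       (eqE (modE (Bop Div (Var 14) (tabE [1, 2, 4] (Bop Div (Var 10) (Var 4)))) (Num 2)) (Var 11))"

definition clauseP :: hcom where
  "clauseP = Asg 9 (Arr 1 (Var 8)) ;; For 10 (Bop Times (Num 3) (Var 4)) colP ;;
     Asg 8 (Bop Plus (Bop Plus (Var 8) (Num 1)) (Var 9))"

definition edgeE :: hexp where
  "edgeE = (let u = Bop Div (Var 15) (Var 6); v = modE (Var 15) (Var 6);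
     j = modE u (Var 5); b = Bop Div u (Var 5); b' = Bop Div v (Var 5);
     p = Bop Div b (Var 4); p' = Bop Div b' (Var 4);
     l = Bop Lt j (Bop Times (Num 8) (Var 2)); r = Bop Minus j (Bop Times (Num 8) (Var 2)) in
     andE (eqE j (modE v (Var 5)))
       (Bop Plus
         (andE l (andE (notE (eqE p p')) (andE (andE (Arr 5 u) (Arr 5 v))
           (eqE (eqE (modE j (Num 8)) (Num 0)) (Num (of_bool (\<not> dmt)))))))
         (andE (andE (notE l) (Num (of_bool (\<not> dmt))))
           (andE (notE (eqE b b')) (andE (notE (eqE p r)) (notE (eqE p' r)))))))"

text \<open>The cell of the vertex count, which for Matching Triangles comes after the
  threshold.\<close>

definition outpos :: int where "outpos = (if dmt then 2 else 1)"

text \<open>The graph is laid out in array 2 as the initial memory of the reduction, which then runs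
  there. Cell 1 first receives \<open>m\<close>, the threshold for Matching Triangles; for Triangle
  Collection \<open>outpos\<close> is 1 and the vertex count overwrites it.\<close>

definition satP :: hcom where
  "satP = (Asg 1 (Arr 1 (Num 1)) ;; Asg 2 (Arr 1 (Num 2)) ;;
      Asg 3 (Bop Plus (Bop Div (Var 1) (Num 3)) (Num 1)) ;; Upd 4 (Num 0) (Num 1)) ;;
    For 15 (Var 3) (Upd 4 (Bop Plus (Var 15) (Num 1)) (Bop Times (Num 2) (Arr 4 (Var 15)))) ;;
    (Asg 4 (Arr 4 (Var 3)) ;; Asg 5 (Bop Plus (Bop Times (Num 8) (Var 2)) (Num 3)) ;;
      Asg 6 (Bop Times (Bop Times (Num 3) (Var 4)) (Var 5)) ;; Asg 8 (Num 3)) ;;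
    For 7 (Var 2) clauseP ;;
    (Upd 2 (Num 1) (Var 2) ;; Upd 2 (Num outpos) (Var 6) ;;
      Upd 2 (Num 0) (Bop Plus (Num outpos) (Bop Plus (Var 6) (Bop Times (Var 6) (Var 6))))) ;;
    mapL 15 2 (Num (outpos + 1)) (Var 6) (Bop Div (Var 15) (Var 5)) ;;
    mapL 15 2 (Bop Plus (Num (outpos + 1)) (Var 6)) (Bop Times (Var 6) (Var 6)) edgeE"

definition bounds :: "int \<Rightarrow> bool" where
  "bounds B \<longleftrightarrow> int (length cnf_code) + 5 \<le> B \<and> int (N * N + N + 2) \<le> B"

lemma boundsD:
  assumes "bounds B"
  shows "int (pos m) + 7 \<le> B" "int N * int N + int N + 2 \<le> B" "int n \<le> B" "int h \<le> B" "int H \<le> B"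
    "3 * int H \<le> B" "int J \<le> B" "int m \<le> B" "8 * int m + 3 \<le> B" "int N \<le> B" "18 \<le> B"
    "int N * int N \<le> B"
proof -
  note S = size_bounds[THEN of_nat_mono[where 'a = int]]
  show B: "int (pos m) + 7 \<le> B" "int N * int N + int N + 2 \<le> B"
    using assms by (simp_all add: bounds_def length_cnf_code)
  have "0 \<le> int N * int N" by simp
  then have NB: "int N + 2 \<le> B" and "int N * int N \<le> B" using B(2) by linarith+
  then show "int n \<le> B" "int h \<le> B" "int H \<le> B" "3 * int H \<le> B" "int J \<le> B" "int m \<le> B"
    "8 * int m + 3 \<le> B" "int N \<le> B" "18 \<le> B" "int N * int N \<le> B"
    using size_bounds by linarith+
qed

text \<open>Arrays 2 and 3 must be blank when the graph and, later, the input of the matrix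
  multiplication are written into them.\<close>

definition ctx :: "hstate \<Rightarrow> bool" where
  "ctx s \<longleftrightarrow> fst s 1 = int n \<and> fst s 2 = int m \<and> fst s 3 = int h \<and> fst s 4 = int H \<and> fst s 5 = int J \<and>
     fst s 6 = int N \<and> snd s 1 = init_mem cnf_code \<and> (\<forall>i\<le>h. snd s 4 (int i) = 2 ^ i) \<and>
     snd s 2 = (\<lambda>_. 0) \<and> snd s 3 = (\<lambda>_. 0)"

definition slot :: "nat \<Rightarrow> nat \<Rightarrow> nat \<Rightarrow> nat" where
  "slot b c \<tau> = b * J + (8 * c + \<tau>)"

lemma slot_eq_iff:
  assumes "c < m" "\<tau> < 8" "c' < m" "\<tau>' < 8"
  shows "slot b c \<tau> = slot b' c' \<tau>' \<longleftrightarrow> b = b' \<and> c = c' \<and> \<tau> = \<tau>'"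
proof -
  have 1: "8 * c + \<tau> < J" "8 * c' + \<tau>' < J" using assms by (simp_all add: J_def)
  then have "slot b c \<tau> = slot b' c' \<tau>' \<longleftrightarrow> b = b' \<and> 8 * c + \<tau> = 8 * c' + \<tau>'"
    unfolding slot_def by (rule pair_index_eq_iff)
  also have "8 * c + \<tau> = 8 * c' + \<tau>' \<longleftrightarrow> c = c' \<and> \<tau> = \<tau>'"
    using pair_index_eq_iff[of \<tau> 8 \<tau>' c c'] assms by (simp add: mult.commute)
  finally show ?thesis .
qed

definition filled :: "(int \<Rightarrow> int) \<Rightarrow> nat \<Rightarrow> nat \<Rightarrow> bool" where
  "filled A c b \<longleftrightarrow> (\<forall>c'<m. \<forall>b'<3 * H. c' < c \<or> c' = c \<and> b' < b \<longrightarrow>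
     (\<forall>\<tau><8. A (int (slot b' c' \<tau>)) = of_bool (claim b' c' \<tau>)))"

definition clauseI :: "nat \<Rightarrow> nat \<Rightarrow> hstate \<Rightarrow> bool" where
  "clauseI c b s \<longleftrightarrow> ctx s \<and> fst s 8 = 3 + int (pos c) \<and> filled (snd s 5) c b"

lemma clauseI_cong:
  "clauseI c b s \<Longrightarrow> snd s' = snd s \<Longrightarrow> (\<And>x. x \<in> {1, 2, 3, 4, 5, 6, 8} \<Longrightarrow> fst s' x = fst s x) \<Longrightarrow>
   clauseI c b s'"
  by (simp add: clauseI_def ctx_def)

text \<open>The 3 comes from the cells 0 to 2, which hold the length of the list, \<open>n\<close>
  and \<open>m\<close>.\<close>

lemma init_mem_cnf_code:
  assumes "c < m"
  shows "init_mem cnf_code (3 + int (pos c)) = int (length (F ! c))"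
    and "j < length (F ! c) \<Longrightarrow> init_mem cnf_code (3 + int (pos c) + 1 + int j) = F ! c ! j"
    and "j < length (F ! c) \<Longrightarrow> F ! c ! j \<noteq> 0 \<and> \<bar>F ! c ! j\<bar> \<le> int n"
    and "pos c + Suc (length (F ! c)) \<le> pos m" "length (F ! c) \<le> k"
proof -
  have p: "pos (Suc c) \<le> pos m" using assms by (intro pos_mono) simp
  then show p': "pos c + Suc (length (F ! c)) \<le> pos m" using pos_Suc[OF assms] by simp
  have "nat (3 + int (pos c) - 1) = 2 + pos c" by simp
  then show "init_mem cnf_code (3 + int (pos c)) = int (length (F ! c))"
    using p' cnf_code_nth(1)[OF assms] by (simp add: init_mem_def length_cnf_code)
  assume j: "j < length (F ! c)"
  have "nat (3 + int (pos c) + 1 + int j - 1) = 2 + (pos c + Suc j)" by simp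
  then show "init_mem cnf_code (3 + int (pos c) + 1 + int j) = F ! c ! j"
    using p' j cnf_code_nth(2)[OF assms j] by (simp add: init_mem_def length_cnf_code)
  show "F ! c ! j \<noteq> 0 \<and> \<bar>F ! c ! j\<bar> \<le> int n"
    using kcnf nth_mem[OF j] nth_mem[of c F] assms by (auto simp: is_kcnf_def m_def)
next
  show "length (F ! c) \<le> k" using kcnf assms by (auto simp: is_kcnf_def m_def)
qed

lemma hval_pow_tab:
  assumes "hval e s = int x" "x < 3"
  shows "hval (tabE [1, 2, 4] e) s = 2 ^ x"
proof -
  consider "x = 0" | "x = 1" | "x = 2" using assms(2) by linarith
  then show ?thesis using assms(1) by cases (auto simp: hval_tabE simp del: tabE.simps)
qed

text \<open>Register 16 obtains \<open>|l| - 1\<close> by multiplying with the sign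
  \<open>1 - 2 * [l < 0]\<close>. Bits are extracted by dividing by powers of two from the table in
  array 4, since the machine has no shifts.\<close>

lemma htri_litP:
  assumes I: "clauseI c b s" and c: "c < m" and B: "bounds B" and j: "j < length (F ! c)"
    and s: "fst s 10 = int b" "fst s 12 = int j" "fst s 11 = of_bool P"
  shows "htri B U litP s 6 (\<lambda>s'. (\<forall>x. x \<notin> {11, 13, 16} \<longrightarrow> fst s' x = fst s x) \<and> snd s' = snd s \<and>
    fst s' 11 = of_bool (P \<or> lit_sat b (F ! c ! j)))"
proof -
  note Bs = boundsD[OF B] and F = init_mem_cnf_code[OF c]
  let ?l = "F ! c ! j"
  define y where "y = nat (\<bar>?l\<bar> - 1)"
  have l: "?l \<noteq> 0" "\<bar>?l\<bar> \<le> int n" using F(3)[OF j] by auto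
  have y: "\<bar>?l\<bar> - 1 = int y" using l by (simp add: y_def)
  have yB: "int y \<le> B" using y l Bs by linarith
  have ctx: "ctx s" and p: "fst s 8 = 3 + int (pos c)" using I by (auto simp: clauseI_def)
  have "y mod h \<le> h" using h_pos by (simp add: less_imp_le)
  then have pw: "snd s 4 (int y mod int h) = 2 ^ (y mod h)" using ctx unfolding ctx_def by (metis of_nat_mod)
  have d: "int y div int h = int b div int H \<longleftrightarrow> y div h = b div H" by (metis of_nat_div of_nat_eq_iff)
  have o: "(int b mod int H div 2 ^ (y mod h) mod 2 = (if 0 < ?l then 1 else 0)) \<longleftrightarrow>
      (odd (b mod H div 2 ^ (y mod h)) \<longleftrightarrow> 0 < ?l)"
  proof -
    have "int b mod int H div 2 ^ (y mod h) mod 2 = int (b mod H div 2 ^ (y mod h) mod 2)"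
      by (simp add: of_nat_div of_nat_mod)
    then show ?thesis by (simp add: odd_iff_mod_2_eq_one)
  qed
  have ls: "lit_sat b ?l \<longleftrightarrow> y div h = b div H \<and> (odd (b mod H div 2 ^ (y mod h)) \<longleftrightarrow> 0 < ?l)"
    by (simp add: lit_sat_def y_def)
  have r: "fst s 3 = int h" "fst s 4 = int H" "snd s 1 = init_mem cnf_code" using ctx by (auto simp: ctx_def)
  let ?f = "\<lambda>s'. (\<forall>x. x \<notin> {11, 13, 16} \<longrightarrow> fst s' x = fst s x) \<and> snd s' = snd s \<and> fst s' 13 = ?l \<and>
    fst s' 11 = of_bool P"
  have lB: "\<bar>?l\<bar> \<le> B" using l Bs by linarith
  have 1: "htri B U (Asg 13 (Arr 1 (Bop Plus (Bop Plus (Var 8) (Num 1)) (Var 12)))) s 1 ?f"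
    by (rule htri_Asg) (use s p r F(2)[OF j] lB in auto)
  have 2: "htri B U (Asg 16 (Bop Minus (Bop Times (Bop Minus (Num 1) (Bop Times (Num 2)
      (Bop Lt (Var 13) (Num 0)))) (Var 13)) (Num 1))) s' 1 (\<lambda>s'. ?f s' \<and> fst s' 16 = int y)"
    if s': "?f s'" for s'
  proof (rule htri_Asg)
    have "hval (Bop Minus (Bop Times (Bop Minus (Num 1) (Bop Times (Num 2)
      (Bop Lt (Var 13) (Num 0)))) (Var 13)) (Num 1)) s' = int y" (is "hval ?e s' = _")
      using s' y by auto
    then show "\<bar>hval ?e s'\<bar> \<le> B" "?f ((fst s')(16 := hval ?e s'), snd s') \<and>
        fst ((fst s')(16 := hval ?e s'), snd s') 16 = int y"
      using s' yB by auto
  qed simp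
  let ?test = "andE (eqE (Bop Div (Var 16) (Var 3)) (Bop Div (Var 10) (Var 4)))
        (eqE (modE (Bop Div (modE (Var 10) (Var 4)) (Arr 4 (modE (Var 16) (Var 3)))) (Num 2))
          (Bop Lt (Num 0) (Var 13)))"
  have 3: "htri B U (HIf ?test (Asg 11 (Num 1)) HSkip) s' 2
      (\<lambda>s'. (\<forall>x. x \<notin> {11, 13, 16} \<longrightarrow> fst s' x = fst s x) \<and> snd s' = snd s \<and>
      fst s' 11 = of_bool (P \<or> lit_sat b ?l))" if s': "?f s' \<and> fst s' 16 = int y" for s'
  proof -
    have rs: "fst s' 3 = int h" "fst s' 4 = int H" "fst s' 10 = int b" "fst s' 13 = ?l" "fst s' 16 = int y"
      "snd s' = snd s"
      using s' r s by auto
    have "hval ?test s' = of_bool (lit_sat b ?l)"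
      unfolding hval_andE hval_eqE hval_modE hval.simps aop_val.simps rs pw d o ls by auto
    then show ?thesis
      using s' Bs by (intro htri_mono[OF htri_vc]) auto
  qed
  show ?thesis
    unfolding litP_def by (rule htri_mono[OF htri_HSeq[OF 1 htri_HSeq[OF 2 3]]]) auto
qed

lemma htri_colP:
  assumes I: "clauseI c b s" and c: "c < m" and b: "b < 3 * H" and B: "bounds B"
    and s: "fst s 7 = int c" "fst s 9 = int (length (F ! c))" "fst s 10 = int b"
  shows "htri B U colP s (11 * k + 59) (\<lambda>s'. clauseI c (Suc b) s' \<and> fst s' 7 = int c \<and>
    fst s' 9 = int (length (F ! c)) \<and> fst s' 10 = int b)"
proof -
  note Bs = boundsD[OF B] and F = init_mem_cnf_code[OF c]
  let ?C = "F ! c"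
  let ?I = "\<lambda>j s'. clauseI c b s' \<and> fst s' 7 = int c \<and> fst s' 9 = int (length ?C) \<and> fst s' 10 = int b \<and>
     fst s' 11 = of_bool (\<exists>j'<j. lit_sat b (?C ! j'))"
  have 1: "htri B U (Asg 11 (Num 0)) s 1 (?I 0)"
    by (rule htri_Asg) (use s Bs in \<open>auto intro!: clauseI_cong[OF I]\<close>)
  have 2: "htri B U (For 12 (Var 9) litP) s' (length ?C * (6 + 5) + 4) (?I (length ?C))"
    if s': "?I 0 s'" for s'
  proof (rule htri_For[where I = ?I])
    show "?I 0 ((fst s')(12 := 0), snd s')" using s' by (auto intro: clauseI_cong)
  next
    fix j t assume j: "j < length ?C" "?I j t" "fst t 12 = int j"
    have ex: "(\<exists>j'<Suc j. lit_sat b (?C ! j')) \<longleftrightarrow> (\<exists>j'<j. lit_sat b (?C ! j')) \<or> lit_sat b (?C ! j)"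
      by (auto simp: less_Suc_eq)
    show "htri B U litP t 6 (\<lambda>s'. fst s' 12 = int j \<and> ?I (Suc j) ((fst s')(12 := int j + 1), snd s'))"
    proof (rule htri_mono[OF htri_litP[OF _ c B j(1) _ j(3)]])
      show "clauseI c b t" "fst t 10 = int b" "fst t 11 = of_bool (\<exists>j'<j. lit_sat b (?C ! j'))"
        using j(2) by auto
      fix t' assume t': "(\<forall>x. x \<notin> {11, 13, 16} \<longrightarrow> fst t' x = fst t x) \<and> snd t' = snd t \<and>
        fst t' 11 = of_bool ((\<exists>j'<j. lit_sat b (?C ! j')) \<or> lit_sat b (?C ! j))"
      have "clauseI c b ((fst t')(12 := int j + 1), snd t')"
        by (rule clauseI_cong[of _ _ t]) (use j(2) t' in auto)
      then show "fst t' 12 = int j \<and> ?I (Suc j) ((fst t')(12 := int j + 1), snd t')"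
        using j t' unfolding ex by auto
    qed simp
  next
    show "int (length ?C) \<le> B" using F(4) Bs by linarith
  qed auto
  let ?E = "eqE (modE (Bop Div (Var 14) (tabE [1, 2, 4] (Bop Div (Var 10) (Var 4)))) (Num 2)) (Var 11)"
  have 3: "htri B U (mapL 14 5 (Bop Plus (Bop Times (Var 10) (Var 5)) (Bop Times (Num 8) (Var 7))) (Num 8) ?E)
      s' (8 * 6 + 4) (\<lambda>s'. clauseI c (Suc b) s' \<and> fst s' 7 = int c \<and>
    fst s' 9 = int (length (F ! c)) \<and> fst s' 10 = int b)" if s': "?I (length ?C) s'" for s'
  proof (rule htri_mapL)
    have ctx: "ctx s'" and fl: "filled (snd s' 5) c b" using s' by (auto simp: clauseI_def)
    have r: "fst s' 4 = int H" "fst s' 5 = int J" using ctx by (auto simp: ctx_def)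
    have sat: "clause_sat b ?C \<longleftrightarrow> (\<exists>j'<length ?C. lit_sat b (?C ! j'))"
      unfolding clause_sat_def by (metis in_set_conv_nth)
    have p: "b div H < 3" using b by (simp add: less_mult_imp_div_less)
    fix i :: nat and g :: "int \<Rightarrow> int"
    let ?t = "((fst s')(14 := int i), (snd s')(5 := g))"
    have "hval (Bop Div (Var 10) (Var 4)) ?t = int (b div H)" using s' r by (simp add: of_nat_div)
    then have t: "hval (tabE [1, 2, 4] (Bop Div (Var 10) (Var 4))) ?t = 2 ^ (b div H)"
      using p by (rule hval_pow_tab)
    have "int i div 2 ^ (b div H) mod 2 = int (i div 2 ^ (b div H) mod 2)" by (simp add: of_nat_div of_nat_mod)
    then have "(int i div 2 ^ (b div H) mod 2 = of_bool (clause_sat b ?C)) \<longleftrightarrow> claim b c i"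
      by (simp add: claim_def odd_iff_mod_2_eq_one of_bool_def)
    then show "hval ?E ?t = of_bool (claim b c i) \<and> safe B ?E ?t"
      using t s' sat by (simp add: safe_tabE del: tabE.simps)
    show "hval (Bop Plus (Bop Times (Var 10) (Var 5)) (Bop Times (Num 8) (Var 7))) ?t = int (slot b c 0) \<and>
        safe B (Bop Plus (Bop Times (Var 10) (Var 5)) (Bop Times (Num 8) (Var 7))) ?t"
      using s' r by (simp add: slot_def)
    show "hval (Num 8) ?t = int 8 \<and> safe B (Num 8) ?t" by simp
    show "int 8 \<le> B" "\<bar>of_bool (claim b c i) :: int\<bar> \<le> B" using Bs by auto
    let ?A = "\<lambda>a. if int (slot b c 0) \<le> a \<and> a < int (slot b c 0) + int 8
      then of_bool (claim b c (nat (a - int (slot b c 0)))) else snd s' 5 a"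
    let ?s = "((fst s')(14 := int 8), (snd s')(5 := ?A))"
    have "filled ?A c (Suc b)"
      unfolding filled_def
    proof (intro allI impI)
      fix c' b' \<tau> :: nat assume c': "c' < m" "b' < 3 * H" "c' < c \<or> c' = c \<and> b' < Suc b" "\<tau> < 8"
      show "?A (int (slot b' c' \<tau>)) = of_bool (claim b' c' \<tau>)"
      proof (cases "b' = b \<and> c' = c")
        case True
        then show ?thesis using c'(4) by (simp add: slot_def)
      next
        case False
        have "\<not> (slot b c 0 \<le> slot b' c' \<tau> \<and> slot b' c' \<tau> < slot b c 0 + 8)"
        proof
          assume *: "slot b c 0 \<le> slot b' c' \<tau> \<and> slot b' c' \<tau> < slot b c 0 + 8"
          then have "slot b' c' \<tau> = slot b c (slot b' c' \<tau> - slot b c 0)" by (simp add: slot_def)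
          then show False using slot_eq_iff[OF c'(1,4) c] False * by auto
        qed
        then have "?A (int (slot b' c' \<tau>)) = snd s' 5 (int (slot b' c' \<tau>))" by auto
        then show ?thesis using fl c' False unfolding filled_def by auto
      qed
    qed
    then show "clauseI c (Suc b) ?s \<and> fst ?s 7 = int c \<and> fst ?s 9 = int (length (F ! c)) \<and> fst ?s 10 = int b"
      using s' by (simp add: clauseI_def ctx_def)
  qed
  show ?thesis
    unfolding colP_def
    by (rule htri_mono[OF htri_HSeq[OF 1 htri_HSeq[OF 2 3]]]) (use F(5) in auto)
qed

lemma htri_clauseP:
  assumes I: "clauseI c 0 s" and c: "c < m" and B: "bounds B" and s: "fst s 7 = int c"
  shows "htri B U clauseP s (3 * H * (11 * k + 64) + 8) (\<lambda>s'. clauseI (Suc c) 0 s' \<and> fst s' 7 = int c)"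
proof -
  note Bs = boundsD[OF B] and F = init_mem_cnf_code[OF c]
  let ?I = "\<lambda>b s'. clauseI c b s' \<and> fst s' 7 = int c \<and> fst s' 9 = int (length (F ! c))"
  have lB: "int (length (F ! c)) \<le> B" "3 + int (pos c) + 1 + int (length (F ! c)) \<le> B"
    using F(4) Bs(1) by linarith+
  have ctx: "ctx s" "fst s 8 = 3 + int (pos c)" using I by (auto simp: clauseI_def)
  have 1: "htri B U (Asg 9 (Arr 1 (Var 8))) s 1 (?I 0)"
    by (rule htri_Asg) (use s F(1) lB ctx in \<open>auto simp: ctx_def intro!: clauseI_cong[OF I]\<close>)
  have 2: "htri B U (For 10 (Bop Times (Num 3) (Var 4)) colP) s' (3 * H * ((11 * k + 59) + 5) + 4) (?I (3 * H))"
    if s': "?I 0 s'" for s'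
  proof (rule htri_For[where I = ?I])
    show "?I 0 ((fst s')(10 := 0), snd s')" using s' by (auto intro: clauseI_cong)
  next
    fix b t assume b: "b < 3 * H" "?I b t" "fst t 10 = int b"
    show "htri B U colP t (11 * k + 59) (\<lambda>s'. fst s' 10 = int b \<and> ?I (Suc b) ((fst s')(10 := int b + 1), snd s'))"
      by (rule htri_mono[OF htri_colP[OF _ c b(1) B _ _ b(3)]])
         (use b in \<open>auto intro: clauseI_cong\<close>)
  next
    show "safe B (Bop Times (Num 3) (Var 4)) t \<and> hval (Bop Times (Num 3) (Var 4)) t = int (3 * H)"
      if "?I b t" for b t using that by (simp add: clauseI_def ctx_def)
  qed (use Bs in auto)
  have 3: "htri B U (Asg 8 (Bop Plus (Bop Plus (Var 8) (Num 1)) (Var 9))) s' 1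
      (\<lambda>s'. clauseI (Suc c) 0 s' \<and> fst s' 7 = int c)" if s': "?I (3 * H) s'" for s'
  proof (rule htri_Asg)
    have "filled (snd s' 5) (Suc c) 0"
      using s' unfolding clauseI_def filled_def by (auto simp: less_Suc_eq)
    then show "clauseI (Suc c) 0 ((fst s')(8 := hval (Bop Plus (Bop Plus (Var 8) (Num 1)) (Var 9)) s'), snd s') \<and>
      fst ((fst s')(8 := hval (Bop Plus (Bop Plus (Var 8) (Num 1)) (Var 9)) s'), snd s') 7 = int c"
      using s' pos_Suc[OF c] by (auto simp: clauseI_def ctx_def)
  qed (use s' lB in \<open>auto simp: clauseI_def\<close>)
  show ?thesis
    unfolding clauseP_def
    by (rule htri_mono[OF htri_HSeq[OF 1 htri_HSeq[OF 2 3]]]) auto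
qed

lemma hval_edgeE:
  assumes ctx: "fst s 2 = int m" "fst s 4 = int H" "fst s 5 = int J" "fst s 6 = int N"
    and fl: "filled (snd s 5) m 0" and z: "fst s 15 = int z" "z < N * N"
  shows "hval edgeE s = of_bool (edge (z div N) (z mod N))"
proof -
  define u v where "u = z div N" and "v = z mod N"
  have N: "0 < N" using size_bounds(8) by linarith
  have uv: "u < N" "v < N" using z N by (simp_all add: u_def v_def less_mult_imp_div_less)
  have tab: "snd s 5 (int w) = of_bool (claim (w div J) (w mod J div 8) (w mod J mod 8))"
    if "w < N" "w mod J < 8 * m" for w
  proof -
    have "w div J < 3 * H" using that(1) by (simp add: N_def less_mult_imp_div_less)
    moreover have "w mod J div 8 < m" using that(2) by (simp add: less_mult_imp_div_less mult.commute)
    moreover have "slot (w div J) (w mod J div 8) (w mod J mod 8) = w" by (simp add: slot_def)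
    ultimately show ?thesis
      using fl unfolding filled_def
      by (metis mod_less_divisor zero_less_numeral)
  qed
  have v: "int z div int N = int u" "int z mod int N = int v"
    "int u div int J = int (u div J)" "int v div int J = int (v div J)"
    "int u mod int J = int (u mod J)" "int v mod int J = int (v mod J)"
    "int (u div J) div int H = int (u div J div H)" "int (v div J) div int H = int (v div J div H)"
    "int (u mod J) mod 8 = int (u mod J mod 8)"
    by (simp_all add: u_def v_def of_nat_div of_nat_mod)
  have m8: "int (u mod J) < 8 * int m \<longleftrightarrow> u mod J < 8 * m" by linarith
  have r: "int p = int (u mod J) - 8 * int m \<longleftrightarrow> p = u mod J - 8 * m" if "\<not> u mod J < 8 * m" for p
    using that by linarith
  have hv: "hval edgeE s = of_bool (u mod J = v mod J \<and> of_bool (u mod J < 8 * m \<and>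
      u div J div H \<noteq> v div J div H \<and> snd s 5 (int u) \<noteq> 0 \<and> snd s 5 (int v) \<noteq> 0 \<and>
      (u mod J mod 8 = 0 \<longleftrightarrow> \<not> dmt)) +
     of_bool (\<not> u mod J < 8 * m \<and> \<not> dmt \<and> u div J \<noteq> v div J \<and>
      int (u div J div H) \<noteq> int (u mod J) - 8 * int m \<and> int (v div J div H) \<noteq> int (u mod J) - 8 * int m)
     \<noteq> (0 :: int))"
    unfolding edgeE_def Let_def hval_andE hval_eqE hval_modE hval_notE hval.simps aop_val.simps ctx z v
    by (auto simp: m8)
  show ?thesis
  proof (cases "u mod J < 8 * m")
    case True
    then show ?thesis
      using tab[OF uv(1) True] tab[OF uv(2)]
      unfolding hv edge_def Let_def u_def[symmetric] v_def[symmetric] by auto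
  next
    case False
    then show ?thesis
      unfolding hv edge_def Let_def u_def[symmetric] v_def[symmetric] r[OF False] by auto
  qed
qed

definition out_code :: "int list" where
  "out_code = (if dmt then [int m] else []) @ encode_cgraph graph"

definition sat_ticks :: nat where
  "sat_ticks = m * (3 * H * (11 * k + 64) + 13) + 6 * h + 6 * N + 6 * (N * N) + 70"

lemma length_output: "length out_code = nat outpos + N + N * N"
  unfolding out_code_def encode_cgraph_def outpos_def
  by (simp add: graph_def length_concat_const[where L = N])

lemma output_nth:
  shows "dmt \<Longrightarrow> out_code ! 0 = int m"
    and "out_code ! (nat outpos - 1) = int N"
    and "v < N \<Longrightarrow> out_code ! (nat outpos + v) = int (v div J)"
    and "z < N * N \<Longrightarrow> out_code ! (nat outpos + N + z) = of_bool (edge (z div N) (z mod N))"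
proof -
  let ?cs = "map (\<lambda>v. int (v div J)) [0..<N]"
  let ?es = "concat (map (\<lambda>u. map (\<lambda>v. if (u, v) \<in> adj graph then 1 else 0) [0..<N]) [0..<N]) :: int list"
  have enc: "encode_cgraph graph = int N # ?cs @ ?es"
    by (simp add: encode_cgraph_def graph_def)
  define pre where "pre = (if dmt then [int m] else [])"
  have pre: "nat outpos = Suc (length pre)" by (simp add: pre_def outpos_def)
  have out: "out_code = pre @ int N # ?cs @ ?es" by (simp add: out_code_def pre_def enc)
  show "dmt \<Longrightarrow> out_code ! 0 = int m" unfolding out_code_def by simp
  show "out_code ! (nat outpos - 1) = int N" unfolding out pre by (simp add: nth_append)
  show "v < N \<Longrightarrow> out_code ! (nat outpos + v) = int (v div J)"
    unfolding out pre by (simp add: nth_append)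
  assume z: "z < N * N"
  have N: "0 < N" using size_bounds(8) by linarith
  have zz: "z div N < N" "z mod N < N" using z N by (simp_all add: less_mult_imp_div_less)
  have "?es ! z = ?es ! (z div N * N + z mod N)" by (simp only: div_mult_mod_eq)
  also have "\<dots> = map (\<lambda>v. if (z div N, v) \<in> adj graph then 1 else 0) [0..<N] ! (z mod N)"
    by (rule nth_concat_const) (use zz in auto)
  also have "\<dots> = of_bool (edge (z div N) (z mod N))" using zz by (simp add: graph_def)
  finally have "?es ! z = of_bool (edge (z div N) (z mod N))" .
  then show "out_code ! (nat outpos + N + z) = of_bool (edge (z div N) (z mod N))"
    unfolding out pre by (simp add: nth_append)
qed

text \<open>Equality with \<open>init_mem\<close> is required at every address, including the zeros
  outside the list, because the reduction starts on this very array.\<close>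

lemma output_mem:
  "(\<lambda>a. if outpos + 1 + int N \<le> a \<and> a < outpos + 1 + int N + int (N * N)
      then of_bool (edge (nat (a - (outpos + 1 + int N)) div N) (nat (a - (outpos + 1 + int N)) mod N))
      else if outpos + 1 \<le> a \<and> a < outpos + 1 + int N then int (nat (a - (outpos + 1)) div J)
      else ((\<lambda>_. 0)(1 := int m, outpos := int N, 0 := outpos + (int N + int N * int N))) a)
   = init_mem out_code" (is "?f = _")
proof
  fix a :: int
  have op: "1 \<le> outpos" "outpos \<le> 2" by (simp_all add: outpos_def)
  define M where "M = N * N"
  have L: "int (length out_code) = outpos + int N + int M" using op by (simp add: length_output M_def)
  have M: "int N * int N = int M" by (simp add: M_def)
  consider "a < 0 \<or> outpos + int N + int M < a" | "a = 0" | "0 < a" "a < outpos" | "a = outpos"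
    | "outpos < a" "a \<le> outpos + int N" | "outpos + int N < a" "a \<le> outpos + int N + int M"
    by linarith
  then show "?f a = init_mem out_code a"
  proof cases
    case 1
    then show ?thesis using L op unfolding M_def[symmetric] by (auto simp: init_mem_def)
  next
    case 2
    then show ?thesis using L op unfolding M_def[symmetric] M by (auto simp: init_mem_def)
  next
    case 3
    then have "a = 1" "dmt" using op by (auto simp: outpos_def split: if_splits)
    then show ?thesis using L op 3 output_nth(1) unfolding M_def[symmetric] by (auto simp: init_mem_def)
  next
    case 4
    have "nat (a - 1) = nat outpos - 1" using 4 op by (simp add: nat_diff_distrib)
    then show ?thesis using L op 4 output_nth(2) unfolding M_def[symmetric] by (auto simp: init_mem_def)
  next
    case 5
    define v where "v = nat (a - (outpos + 1))"
    have "int v = a - (outpos + 1)" using 5 by (simp add: v_def)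
    then have v: "v < N" "a = outpos + 1 + int v" using 5 by linarith+
    have "a - 1 = int (nat outpos + v)" using v op by simp
    then have "nat (a - 1) = nat outpos + v" by (simp only: nat_int)
    then have "init_mem out_code a = int (v div J)"
      using L op 5 output_nth(3)[OF v(1)] by (auto simp: init_mem_def)
    moreover have "?f a = int (v div J)" using 5 unfolding v_def by simp
    ultimately show ?thesis by simp
  next
    case 6
    define z where "z = nat (a - (outpos + 1 + int N))"
    have "int z = a - (outpos + 1 + int N)" using 6 by (simp add: z_def)
    then have z: "z < M" "a = outpos + 1 + int N + int z" using 6 by linarith+
    have "a - 1 = int (nat outpos + N + z)" using z op by simp
    then have "nat (a - 1) = nat outpos + N + z" by (simp only: nat_int)
    then have "init_mem out_code a = of_bool (edge (z div N) (z mod N))"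
      using L op 6 output_nth(4)[of z] z(1) by (auto simp: init_mem_def M_def)
    moreover have "?f a = of_bool (edge (z div N) (z mod N))"
      using 6 unfolding z_def M_def[symmetric] by simp
    ultimately show ?thesis by simp
  qed
qed

lemma htri_satP:
  assumes B: "bounds B"
  shows "htri B U satP (init_state cnf_code) sat_ticks (\<lambda>s'. snd s' 2 = init_mem out_code \<and> snd s' 3 = (\<lambda>_. 0))"
proof -
  note Bs = boundsD[OF B]
  have in12: "init_mem cnf_code 1 = int n" "init_mem cnf_code 2 = int m"
    using Bs by (simp_all add: init_mem_def length_cnf_code) (simp_all add: cnf_code_def)
  let ?A = "\<lambda>i (s :: hstate). fst s 1 = int n \<and> fst s 2 = int m \<and> fst s 3 = int h \<and> snd s 1 = init_mem cnf_code \<and>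
     (\<forall>j\<le>i. snd s 4 (int j) = 2 ^ j) \<and> snd s 2 = (\<lambda>_. 0) \<and> snd s 3 = (\<lambda>_. 0)"
  have hh: "int n div 3 + 1 = int h" by (simp add: h_def of_nat_div)
  have 1: "htri B U (Asg 1 (Arr 1 (Num 1)) ;; Asg 2 (Arr 1 (Num 2)) ;;
      Asg 3 (Bop Plus (Bop Div (Var 1) (Num 3)) (Num 1)) ;; Upd 4 (Num 0) (Num 1)) (init_state cnf_code) 7 (?A 0)"
    by (rule htri_mono[OF htri_vc]) (use in12 Bs hh in \<open>auto simp: init_state_def\<close>)
  have 2: "htri B U (For 15 (Var 3) (Upd 4 (Bop Plus (Var 15) (Num 1)) (Bop Times (Num 2) (Arr 4 (Var 15)))))
      s (h * (1 + 5) + 4) (?A h)" if s: "?A 0 s" for s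
  proof (rule htri_For[where I = ?A])
    fix i t assume i: "i < h" "?A i t" "fst t 15 = int i"
    have "(2::nat) ^ Suc i \<le> H" unfolding H_def using i(1) by (intro power_increasing) auto
    then have "int (2 ^ Suc i) \<le> int H" by (simp only: of_nat_le_iff)
    then have "2 * 2 ^ i \<le> B" using Bs by simp
    then show "htri B U (Upd 4 (Bop Plus (Var 15) (Num 1)) (Bop Times (Num 2) (Arr 4 (Var 15)))) t 1
       (\<lambda>s'. fst s' 15 = int i \<and> ?A (Suc i) ((fst s')(15 := int i + 1), snd s'))"
      using i by (intro htri_Upd) (auto simp: le_Suc_eq)
  qed (use s Bs in auto)
  have 3: "htri B U (Asg 4 (Arr 4 (Var 3)) ;; Asg 5 (Bop Plus (Bop Times (Num 8) (Var 2)) (Num 3)) ;;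
      Asg 6 (Bop Times (Bop Times (Num 3) (Var 4)) (Var 5)) ;; Asg 8 (Num 3)) s 7 (clauseI 0 0)"
    if s: "?A h s" for s
  proof (rule htri_mono[OF htri_vc])
    have "2 ^ h = H" "8 * int m + 3 = int J" "3 * 2 ^ h * int J = int N"
      by (simp_all add: H_def J_def N_def)
    moreover have "(2 :: int) ^ h \<le> B" using Bs(5) by (simp add: H_def)
    ultimately show "vc B (Asg 4 (Arr 4 (Var 3)) ;; Asg 5 (Bop Plus (Bop Times (Num 8) (Var 2)) (Num 3)) ;;
      Asg 6 (Bop Times (Bop Times (Num 3) (Var 4)) (Var 5)) ;; Asg 8 (Num 3)) (clauseI 0 0) s"
      using s Bs by (auto simp: clauseI_def ctx_def filled_def pos_def)
  qed auto
  have 4: "htri B U (For 7 (Var 2) clauseP) s (m * ((3 * H * (11 * k + 64) + 8) + 5) + 4) (clauseI m 0)"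
    if s: "clauseI 0 0 s" for s
  proof (rule htri_For[where I = "\<lambda>c. clauseI c 0"])
    show "clauseI 0 0 ((fst s)(7 := 0), snd s)" by (rule clauseI_cong[OF s]) auto
  next
    fix c t assume c: "c < m" "clauseI c 0 t" "fst t 7 = int c"
    show "htri B U clauseP t (3 * H * (11 * k + 64) + 8)
       (\<lambda>s'. fst s' 7 = int c \<and> clauseI (Suc c) 0 ((fst s')(7 := int c + 1), snd s'))"
      by (rule htri_mono[OF htri_clauseP[OF c(2,1) B c(3)]]) (auto intro: clauseI_cong)
  next
    show "safe B (Var 2) t \<and> hval (Var 2) t = int m" if "clauseI c 0 t" for c t
      using that by (simp add: clauseI_def ctx_def)
  qed (use Bs in auto)
  let ?m0 = "(\<lambda>_. 0)(1 := int m, outpos := int N, 0 := outpos + (int N + int N * int N))"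
  let ?E = "\<lambda>s :: hstate. fst s 2 = int m \<and> fst s 4 = int H \<and> fst s 5 = int J \<and> fst s 6 = int N \<and>
     filled (snd s 5) m 0 \<and> snd s 3 = (\<lambda>_. 0)"
  have 5: "htri B U (Upd 2 (Num 1) (Var 2) ;; Upd 2 (Num outpos) (Var 6) ;;
      Upd 2 (Num 0) (Bop Plus (Num outpos) (Bop Plus (Var 6) (Bop Times (Var 6) (Var 6))))) s 5
      (\<lambda>s. ?E s \<and> snd s 2 = ?m0)" if s: "clauseI m 0 s" for s
    by (rule htri_mono[OF htri_vc]) (use s in \<open>auto simp: clauseI_def ctx_def\<close>)
  let ?m1 = "\<lambda>a. if outpos + 1 \<le> a \<and> a < outpos + 1 + int N then int (nat (a - (outpos + 1)) div J) else ?m0 a"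
  have 6: "htri B U (mapL 15 2 (Num (outpos + 1)) (Var 6) (Bop Div (Var 15) (Var 5))) s (N * 6 + 4)
      (\<lambda>s. ?E s \<and> snd s 2 = ?m1)" if s: "?E s \<and> snd s 2 = ?m0" for s
    by (rule htri_mapL[where k = "outpos + 1" and f = "\<lambda>i. int (i div J)"])
       (use s Bs in \<open>auto simp: of_nat_div\<close>)
  have 7: "htri B U (mapL 15 2 (Bop Plus (Num (outpos + 1)) (Var 6)) (Bop Times (Var 6) (Var 6)) edgeE) s
      (N * N * 6 + 4) (\<lambda>s'. snd s' 2 = init_mem out_code \<and> snd s' 3 = (\<lambda>_. 0))"
    if s: "?E s \<and> snd s 2 = ?m1" for s
  proof (rule htri_mapL[where k = "outpos + 1 + int N" and f = "\<lambda>i. of_bool (edge (i div N) (i mod N))"])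
    have E: "?E s" using s by blast
    fix i g assume i: "i < N * N"
    have "hval edgeE ((fst s)(15 := int i), (snd s)(2 := g)) = of_bool (edge (i div N) (i mod N))"
      by (rule hval_edgeE) (use E i in auto)
    moreover have "safe B edgeE ((fst s)(15 := int i), (snd s)(2 := g))"
      by (simp add: edgeE_def Let_def)
    ultimately show "hval edgeE ((fst s)(15 := int i), (snd s)(2 := g)) = of_bool (edge (i div N) (i mod N)) \<and>
        safe B edgeE ((fst s)(15 := int i), (snd s)(2 := g))" ..
  next
    let ?m2 = "\<lambda>a. if outpos + 1 + int N \<le> a \<and> a < outpos + 1 + int N + int (N * N)
      then of_bool (edge (nat (a - (outpos + 1 + int N)) div N) (nat (a - (outpos + 1 + int N)) mod N))
      else snd s 2 a"
    have s2: "snd s 2 = ?m1" using s by blast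
    have "?m2 = init_mem out_code" unfolding s2 by (rule output_mem)
    then show "snd ((fst s)(15 := int (N * N)), (snd s)(2 := ?m2)) 2 = init_mem out_code \<and>
      snd ((fst s)(15 := int (N * N)), (snd s)(2 := ?m2)) 3 = (\<lambda>_. 0)"
      using s by simp
  next
    have E: "?E s" using s by blast
    show "int (N * N) \<le> B" using Bs by simp
    fix i g
    show "hval (Bop Times (Var 6) (Var 6)) ((fst s)(15 := int i), (snd s)(2 := g)) = int (N * N) \<and>
        safe B (Bop Times (Var 6) (Var 6)) ((fst s)(15 := int i), (snd s)(2 := g))"
      "hval (Bop Plus (Num (outpos + 1)) (Var 6)) ((fst s)(15 := int i), (snd s)(2 := g)) = outpos + 1 + int N \<and>
        safe B (Bop Plus (Num (outpos + 1)) (Var 6)) ((fst s)(15 := int i), (snd s)(2 := g))"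
      using E by simp_all
  qed simp
  have ticks: "7 + (h * (1 + 5) + 4 + (7 + ((x + 4) + (5 + (N * 6 + 4 + (y * 6 + 4) + 1) + 1) + 1) + 1) + 1) + 1
      \<le> x + 6 * h + 6 * N + 6 * y + 70" for x y by simp
  show ?thesis
    unfolding satP_def
  proof (rule htri_mono[OF htri_HSeq[OF 1 htri_HSeq[OF 2 htri_HSeq[OF 3 htri_HSeq[OF 4
        htri_HSeq[OF 5 htri_HSeq[OF 6 7]]]]]]])
    have "3 * H * (11 * k + 64) + 8 + 5 = 3 * H * (11 * k + 64) + 13" by simp
    with ticks[of "m * (3 * H * (11 * k + 64) + 13)" "N * N"]
    show "7 + (h * (1 + 5) + 4 + (7 + (m * (3 * H * (11 * k + 64) + 8 + 5) + 4 +
        (5 + (N * 6 + 4 + (N * N * 6 + 4) + 1) + 1) + 1) + 1) + 1) + 1 \<le> sat_ticks"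
      unfolding sat_ticks_def by (simp only:)
  qed
qed

end

section \<open>Correctness of the coloured graph\<close>

lemma ex_bits: "\<exists>a :: nat. a < 2 ^ h \<and> (\<forall>i<h. odd (a div 2 ^ i) \<longleftrightarrow> P i)" for h :: nat
proof (induction h arbitrary: P)
  case 0
  show ?case by (rule exI[of _ 0]) simp
next
  case (Suc h)
  from Suc.IH[of "\<lambda>i. P (Suc i)"]
  obtain a :: nat where a: "a < 2 ^ h" "\<forall>i<h. odd (a div 2 ^ i) \<longleftrightarrow> P (Suc i)" by blast
  let ?a = "2 * a + of_bool (P 0)"
  have "?a div 2 ^ Suc i = a div 2 ^ i" for i
    unfolding power_Suc div_mult2_eq by (cases "P 0") simp_all
  then have "odd (?a div 2 ^ i) \<longleftrightarrow> P i" if "i < Suc h" for i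
    using a(2) that by (cases i) (auto simp del: power_Suc)
  moreover have "?a < 2 ^ Suc h" using a(1) by (cases "P 0") simp_all
  ultimately show ?case by blast
qed

text \<open>For a given clause, three colours from different parts determine all three bits of a
  correct claim. So they span at most one triangle per clause.\<close>

lemma three_bits_eq:
  assumes "\<And>p. p < 3 \<Longrightarrow> odd (\<tau> div 2 ^ p) \<longleftrightarrow> odd (\<tau>' div 2 ^ p)" "\<tau> < 8" "\<tau>' < (8 :: nat)"
  shows "\<tau> = \<tau>'"
proof -
  have *: "x = x mod 2 + 2 * (x div 2 mod 2) + 4 * (x div 4 mod 2)" if x: "x < 8" for x :: nat
  proof -
    consider "x = 0" | "x = 1" | "x = 2" | "x = 3" | "x = 4" | "x = 5" | "x = 6" | "x = 7"
      using x by linarith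
    then show ?thesis by cases simp_all
  qed
  have "\<tau> mod 2 = \<tau>' mod 2" "\<tau> div 2 mod 2 = \<tau>' div 2 mod 2" "\<tau> div 4 mod 2 = \<tau>' div 4 mod 2"
    using assms(1)[of 0] assms(1)[of 1] assms(1)[of 2] by (simp_all add: mod2_eq_if)
  then show ?thesis using *[OF assms(2)] *[OF assms(3)] by simp
qed

context sat_graph
begin

lemma edge_sym: "edge u v \<Longrightarrow> edge v u"
  by (auto simp: edge_def Let_def split: if_splits)

lemma wf_graph: "wf_cgraph graph"
proof -
  have "\<not> edge u u" for u by (auto simp: edge_def Let_def)
  moreover have "v div J < N" if "v < N" for v using that by (meson div_le_dividend le_less_trans)
  ultimately show ?thesis
    using edge_sym by (auto simp: wf_cgraph_def graph_def intro!: symI irreflI)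
qed

lemma lit_sat_iff:
  assumes "a < H"
  shows "lit_sat (p * H + a) l \<longleftrightarrow> nat (\<bar>l\<bar> - 1) div h = p \<and>
     (odd (a div 2 ^ (nat (\<bar>l\<bar> - 1) mod h)) \<longleftrightarrow> 0 < l)"
  using assms by (simp add: lit_sat_def)

text \<open>Cutting an assignment into three parts loses nothing: the variable of a true literal
  lies in one part, and conversely three numbers are glued together bit by bit to an
  assignment.\<close>

lemma satisfiable_iff:
  "satisfiable F \<longleftrightarrow>
     (\<exists>a. (\<forall>p<3. a p < H) \<and> (\<forall>c<m. \<exists>p<3. clause_sat (p * H + a p) (F ! c)))"
proof
  assume "satisfiable F"
  then obtain \<alpha> where \<alpha>: "\<And>C. C \<in> set F \<Longrightarrow> \<exists>l\<in>set C. lit_true \<alpha> l" by (auto simp: satisfiable_def)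
  have "\<exists>a. a < H \<and> (\<forall>i<h. odd (a div 2 ^ i) \<longleftrightarrow> \<alpha> (p * h + i + 1))" for p
    using ex_bits[of h "\<lambda>i. \<alpha> (p * h + i + 1)"] unfolding H_def by blast
  then obtain a where a: "\<And>p. a p < H" "\<And>p i. i < h \<Longrightarrow> odd (a p div 2 ^ i) \<longleftrightarrow> \<alpha> (p * h + i + 1)"
    by metis
  have "\<exists>p<3. clause_sat (p * H + a p) (F ! c)" if c: "c < m" for c
  proof -
    have C: "F ! c \<in> set F" using c by (simp add: m_def)
    obtain l where l: "l \<in> set (F ! c)" "lit_true \<alpha> l" using \<alpha>[OF C] by blast
    have ln: "l \<noteq> 0" "\<bar>l\<bar> \<le> int n" using kcnf C l(1) by (auto simp: is_kcnf_def)
    define x where "x = nat (\<bar>l\<bar> - 1)"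
    have x: "nat \<bar>l\<bar> = x + 1" "x < n" using ln by (auto simp: x_def)
    have "n \<le> 3 * h" unfolding h_def by presburger
    then have p: "x div h < 3" using x(2) by (simp add: less_mult_imp_div_less mult.commute)
    have "odd (a (x div h) div 2 ^ (x mod h)) \<longleftrightarrow> \<alpha> (nat \<bar>l\<bar>)"
      using a(2)[of "x mod h" "x div h"] h_pos x(1) by simp
    then have "odd (a (x div h) div 2 ^ (x mod h)) \<longleftrightarrow> 0 < l"
      using l(2) ln(1) by (auto simp: lit_true_def split: if_splits)
    then have "lit_sat (x div h * H + a (x div h)) l"
      unfolding lit_sat_iff[OF a(1)] x_def[symmetric] by simp
    then show ?thesis using l(1) p unfolding clause_sat_def by blast
  qed
  then show "\<exists>a. (\<forall>p<3. a p < H) \<and> (\<forall>c<m. \<exists>p<3. clause_sat (p * H + a p) (F ! c))"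
    using a(1) by blast
next
  assume "\<exists>a. (\<forall>p<3. a p < H) \<and> (\<forall>c<m. \<exists>p<3. clause_sat (p * H + a p) (F ! c))"
  then obtain a where a: "\<forall>p<3. a p < H" "\<And>c. c < m \<Longrightarrow> \<exists>p<3. clause_sat (p * H + a p) (F ! c)" by blast
  define \<alpha> where "\<alpha> v \<longleftrightarrow> odd (a ((v - 1) div h) div 2 ^ ((v - 1) mod h))" for v
  have "\<exists>l\<in>set C. lit_true \<alpha> l" if C: "C \<in> set F" for C
  proof -
    obtain c where c: "c < m" "C = F ! c" using C by (metis in_set_conv_nth m_def)
    obtain p l where p: "p < 3" "l \<in> set C" "lit_sat (p * H + a p) l"
      using a(2)[OF c(1)] c(2) by (auto simp: clause_sat_def)
    have l: "l \<noteq> 0" using kcnf C p(2) by (auto simp: is_kcnf_def)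
    have "nat \<bar>l\<bar> - 1 = nat (\<bar>l\<bar> - 1)" by (simp add: nat_diff_distrib)
    then have "\<alpha> (nat \<bar>l\<bar>) \<longleftrightarrow> 0 < l"
      using p(3) a(1) p(1) unfolding \<alpha>_def by (simp add: lit_sat_iff)
    then have "lit_true \<alpha> l" using l by (auto simp: lit_true_def)
    then show ?thesis using p(2) by blast
  qed
  then show "satisfiable F" by (auto simp: satisfiable_def)
qed

lemma slot_less: "b < 3 * H \<Longrightarrow> j < J \<Longrightarrow> b * J + j < N"
  unfolding N_def by (rule pair_index_less)

lemma vertex_div_mod: "j < J \<Longrightarrow> (b * J + j) div J = b" "j < J \<Longrightarrow> (b * J + j) mod J = j"
  by simp_all

lemma colors_graph: "colors graph = {0..<3 * H}"
proof -
  have "b \<in> (\<lambda>v. v div J) ` {0..<N}" if "b < 3 * H" for b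
    using slot_less[OF that J_pos] vertex_div_mod(1)[OF J_pos, of b] by (intro image_eqI[of _ _ "b * J + 0"]) auto
  moreover have "v div J < 3 * H" if "v < N" for v
    using that by (simp add: N_def less_mult_imp_div_less)
  ultimately show ?thesis by (auto simp: colors_def graph_def)
qed

text \<open>Edges join only vertices with the same number \<open>j\<close>, so a triangle is given
  by its colours and one \<open>j\<close>. Triangles can thus be counted by their
  \<open>j\<close>.\<close>

lemma colored_triangle_iff:
  "X \<in> colored_triangles graph b1 b2 b3 \<longleftrightarrow> b1 < 3 * H \<and> b2 < 3 * H \<and> b3 < 3 * H \<and>
     (\<exists>j<J. X = {b1 * J + j, b2 * J + j, b3 * J + j} \<and> edge (b1 * J + j) (b2 * J + j) \<and>
       edge (b2 * J + j) (b3 * J + j) \<and> edge (b1 * J + j) (b3 * J + j))"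
proof
  assume "X \<in> colored_triangles graph b1 b2 b3"
  then obtain x y z where X: "X = {x, y, z}" "x < N" "y < N" "z < N" "edge x y" "edge y z" "edge x z"
    "x div J = b1" "y div J = b2" "z div J = b3"
    by (auto simp: colored_triangles_def graph_def)
  have j: "y mod J = x mod J" "z mod J = x mod J" using X(5,7) by (auto simp: edge_def)
  have "x = b1 * J + x mod J" "y = b2 * J + x mod J" "z = b3 * J + x mod J"
    using X(8-10) j by (metis div_mult_mod_eq)+
  moreover have "b1 < 3 * H" "b2 < 3 * H" "b3 < 3 * H" using X unfolding N_def by (metis less_mult_imp_div_less)+
  moreover have "x mod J < J" using J_pos by simp
  ultimately show "b1 < 3 * H \<and> b2 < 3 * H \<and> b3 < 3 * H \<and>
     (\<exists>j<J. X = {b1 * J + j, b2 * J + j, b3 * J + j} \<and> edge (b1 * J + j) (b2 * J + j) \<and>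
       edge (b2 * J + j) (b3 * J + j) \<and> edge (b1 * J + j) (b3 * J + j))"
    using X(1,5-7) by metis
next
  assume a: "b1 < 3 * H \<and> b2 < 3 * H \<and> b3 < 3 * H \<and>
     (\<exists>j<J. X = {b1 * J + j, b2 * J + j, b3 * J + j} \<and> edge (b1 * J + j) (b2 * J + j) \<and>
       edge (b2 * J + j) (b3 * J + j) \<and> edge (b1 * J + j) (b3 * J + j))"
  then obtain j where j: "j < J" "X = {b1 * J + j, b2 * J + j, b3 * J + j}" "edge (b1 * J + j) (b2 * J + j)"
       "edge (b2 * J + j) (b3 * J + j)" "edge (b1 * J + j) (b3 * J + j)" by blast
  show "X \<in> colored_triangles graph b1 b2 b3"
    unfolding colored_triangles_def mem_Collect_eq
  proof (intro exI conjI)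
    show "X = {b1 * J + j, b2 * J + j, b3 * J + j}" by (fact j(2))
  qed (use a j slot_less[of b1 j] slot_less[of b2 j] slot_less[of b3 j] in \<open>simp_all add: graph_def\<close>)
qed

lemma edge_slot:
  assumes "c < m" "\<tau> < 8"
  shows "edge (b * J + (8 * c + \<tau>)) (b' * J + (8 * c + \<tau>)) \<longleftrightarrow>
    b div H \<noteq> b' div H \<and> claim b c \<tau> \<and> claim b' c \<tau> \<and> (\<tau> = 0) \<noteq> dmt"
proof -
  have j: "8 * c + \<tau> < J" "8 * c + \<tau> < 8 * m" using assms by (simp_all add: J_def)
  have "(8 * c + \<tau>) div 8 = c" "(8 * c + \<tau>) mod 8 = \<tau>" using assms by simp_all
  then show ?thesis
    unfolding edge_def Let_def vertex_div_mod[OF j(1)] using j(2) by simp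
qed

lemma edge_gadget:
  assumes "r < 3"
  shows "edge (b * J + (8 * m + r)) (b' * J + (8 * m + r)) \<longleftrightarrow>
    \<not> dmt \<and> b \<noteq> b' \<and> b div H \<noteq> r \<and> b' div H \<noteq> r"
proof -
  have j: "8 * m + r < J" using assms by (simp add: J_def)
  show ?thesis unfolding edge_def Let_def vertex_div_mod[OF j] by simp
qed

lemma index_cases:
  assumes "j < J"
  obtains (slot) c \<tau> where "c < m" "\<tau> < 8" "j = 8 * c + \<tau>" | (gadget) r where "r < 3" "j = 8 * m + r"
proof (cases "j < 8 * m")
  case True
  then have "j div 8 < m" by (simp add: less_mult_imp_div_less mult.commute)
  then show ?thesis using slot[of "j div 8" "j mod 8"] by simp
next
  case False
  then show ?thesis using gadget[of "j - 8 * m"] assms by (simp add: J_def)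
qed

lemma claim_0 [simp]: "claim b c 0 \<longleftrightarrow> \<not> clause_sat b (F ! c)"
  by (simp add: claim_def)

text \<open>Three colours from different parts are a partial assignment for each part.\<close>

lemma assignment_of_colors:
  assumes "b1 < 3 * H" "b2 < 3 * H" "b3 < 3 * H"
    and "b1 div H \<noteq> b2 div H" "b2 div H \<noteq> b3 div H" "b1 div H \<noteq> b3 div H"
  obtains a where "\<forall>p<3. a p < H" "\<And>p. p < 3 \<Longrightarrow> p * H + a p \<in> {b1, b2, b3}"
    "\<And>b. b \<in> {b1, b2, b3} \<Longrightarrow> b div H * H + a (b div H) = b"
proof
  define b where "b p = (if p = b1 div H then b1 else if p = b2 div H then b2 else b3)" for p
  have lt: "b1 div H < 3" "b2 div H < 3" "b3 div H < 3" using assms(1-3) by (simp_all add: less_mult_imp_div_less)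
  have bp: "b p div H = p" "b p \<in> {b1, b2, b3}" if "p < 3" for p
    using that lt assms(4-6) unfolding b_def by auto
  show "\<forall>p<3. b p mod H < H" using H_pos by simp
  show "p * H + b p mod H \<in> {b1, b2, b3}" if "p < 3" for p
    using bp[OF that] by (metis div_mult_mod_eq)
  fix c assume "c \<in> {b1, b2, b3}"
  then have "b (c div H) = c" using assms(4-6) by (auto simp: b_def)
  then show "c div H * H + b (c div H) mod H = c" by simp
qed

text \<open>Each gadget value excludes one part, so a triple with a colour from every part has
  triangles only at \<open>8 * c\<close> for clauses \<open>c\<close> that all three falsify. Such a
  triple is covered iff its assignment falsifies the formula; any other triple misses a part and is
  covered by a gadget.\<close>

lemma Triangle_Collection_graph:
  assumes "\<not> dmt"
  shows "yes Triangle_Collection graph \<longleftrightarrow> \<not> satisfiable F"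
proof -
  have yes: "yes Triangle_Collection graph \<longleftrightarrow> (\<forall>b1<3 * H. \<forall>b2<3 * H. \<forall>b3<3 * H.
      distinct [b1, b2, b3] \<longrightarrow> (\<exists>X. X \<in> colored_triangles graph b1 b2 b3))"
    unfolding Triangle_Collection_def by (auto simp: colors_graph ex_in_conv)
  show ?thesis
  proof
    assume y: "yes Triangle_Collection graph"
    show "\<not> satisfiable F"
    proof
      assume "satisfiable F"
      then obtain a where a: "\<forall>p<3. a p < H" "\<And>c. c < m \<Longrightarrow> \<exists>p<3. clause_sat (p * H + a p) (F ! c)"
        unfolding satisfiable_iff by blast
      define b where "b p = p * H + a p" for p
      have bd: "b p div H = p" "b p < 3 * H" if "p < 3" for p
        using a(1) that by (auto simp: b_def pair_index_less)
      have "distinct [b 0, b 1, b 2]" using bd(1)[of 0] bd(1)[of 1] bd(1)[of 2] by auto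
      then obtain X where "X \<in> colored_triangles graph (b 0) (b 1) (b 2)"
        using y bd(2) unfolding yes by fastforce
      then obtain j where j: "j < J" "edge (b 0 * J + j) (b 1 * J + j)" "edge (b 1 * J + j) (b 2 * J + j)"
        unfolding colored_triangle_iff by blast
      from j(1) show False
      proof (cases rule: index_cases)
        case (slot c \<tau>)
        then have "\<tau> = 0" "claim (b 0) c \<tau>" "claim (b 1) c \<tau>" "claim (b 2) c \<tau>"
          using j(2,3) assms unfolding slot(3) edge_slot[OF slot(1,2)] by blast+
        then have "\<not> clause_sat (b p) (F ! c)" if p: "p < 3" for p
        proof -
          consider "p = 0" | "p = 1" | "p = 2" using p by linarith
          then show ?thesis using \<open>\<tau> = 0\<close> \<open>claim (b 0) c \<tau>\<close> \<open>claim (b 1) c \<tau>\<close> \<open>claim (b 2) c \<tau>\<close>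
            by cases auto
        qed
        then show False using a(2)[OF slot(1)] unfolding b_def by blast
      next
        case (gadget r)
        then have "b 0 div H \<noteq> r" "b 1 div H \<noteq> r" "b 2 div H \<noteq> r"
          using j(2,3) unfolding gadget(2) edge_gadget[OF gadget(1)] by blast+
        then show False using bd(1)[of 0] bd(1)[of 1] bd(1)[of 2] gadget(1) by auto
      qed
    qed
  next
    assume u: "\<not> satisfiable F"
    show "yes Triangle_Collection graph"
      unfolding yes
    proof (intro allI impI)
      fix b1 b2 b3 assume b: "b1 < 3 * H" "b2 < 3 * H" "b3 < 3 * H" "distinct [b1, b2, b3]"
      show "\<exists>X. X \<in> colored_triangles graph b1 b2 b3"
      proof (cases "b1 div H \<noteq> b2 div H \<and> b2 div H \<noteq> b3 div H \<and> b1 div H \<noteq> b3 div H")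
        case True
        then obtain a where a: "\<forall>p<3. a p < H"
          "\<And>b. b \<in> {b1, b2, b3} \<Longrightarrow> b div H * H + a (b div H) = b"
          using assignment_of_colors[OF b(1-3)] by metis
        obtain c where c: "c < m" "\<And>p. p < 3 \<Longrightarrow> \<not> clause_sat (p * H + a p) (F ! c)"
          using u a(1) unfolding satisfiable_iff by blast
        have ns: "\<not> clause_sat b (F ! c)" if "b \<in> {b1, b2, b3}" for b
          using c(2)[of "b div H"] a(2)[OF that] that b by (auto simp: less_mult_imp_div_less)
        have "0 < (8 :: nat)" by simp
        have "edge (b1 * J + (8 * c + 0)) (b2 * J + (8 * c + 0))" "edge (b2 * J + (8 * c + 0)) (b3 * J + (8 * c + 0))"
          "edge (b1 * J + (8 * c + 0)) (b3 * J + (8 * c + 0))"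
          unfolding edge_slot[OF c(1) \<open>0 < 8\<close>] claim_0 using True assms ns by blast+
        moreover have "8 * c + 0 < J" using c(1) by (simp add: J_def)
        ultimately show ?thesis unfolding colored_triangle_iff using b by blast
      next
        case False
        \<comment> \<open>Pigeonhole: two of the colours share a part, so at most two of the three
          parts are hit.\<close>
        then have "\<exists>r<3. r \<noteq> b1 div H \<and> r \<noteq> b2 div H \<and> r \<noteq> b3 div H"
        proof -
          have "card {b1 div H, b2 div H, b3 div H} < card {0..<3 :: nat}"
            using False by (auto simp: card_insert_if)
          then have "\<not> {0..<3} \<subseteq> {b1 div H, b2 div H, b3 div H}"
            using card_mono[of "{b1 div H, b2 div H, b3 div H}" "{0..<3}"] by auto
          then show ?thesis by auto
        qed
        then obtain r where r: "r < 3" "r \<noteq> b1 div H" "r \<noteq> b2 div H" "r \<noteq> b3 div H" by blast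
        then have "edge (b1 * J + (8 * m + r)) (b2 * J + (8 * m + r))" "edge (b2 * J + (8 * m + r)) (b3 * J + (8 * m + r))"
          "edge (b1 * J + (8 * m + r)) (b3 * J + (8 * m + r))"
          unfolding edge_gadget[OF r(1)] using assms b(4) by auto
        moreover have "8 * m + r < J" using r by (simp add: J_def)
        ultimately show ?thesis unfolding colored_triangle_iff using b by blast
      qed
    qed
  qed
qed

text \<open>A satisfying assignment gives each clause its own triangle, at the nonzero
  \<open>\<tau>\<close> of the parts that satisfy it. Conversely there is at most one triangle per
  clause, so \<open>m\<close> triangles hit every clause, and a nonzero \<open>\<tau>\<close> names
  a part that satisfies it.\<close>

lemma Delta_Matching_Triangles_graph:
  assumes dmt
  shows "yes Delta_Matching_Triangles (graph, int m) \<longleftrightarrow> satisfiable F"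
proof -
  have yes: "yes Delta_Matching_Triangles (graph, int m) \<longleftrightarrow> (\<exists>b1<3 * H. \<exists>b2<3 * H. \<exists>b3<3 * H.
      m \<le> card (colored_triangles graph b1 b2 b3))"
    unfolding Delta_Matching_Triangles_def by (auto simp: colors_graph Bex_def)
  let ?tri = "\<lambda>b1 b2 b3 j. {b1 * J + j, b2 * J + j, b3 * J + j}"
  show ?thesis
  proof
    assume "satisfiable F"
    then obtain a where a: "\<forall>p<3. a p < H" "\<And>c. c < m \<Longrightarrow> \<exists>p<3. clause_sat (p * H + a p) (F ! c)"
      unfolding satisfiable_iff by blast
    define b where "b p = p * H + a p" for p
    have bd: "b p div H = p" "b p < 3 * H" if "p < 3" for p
      using a(1) that by (auto simp: b_def pair_index_less)
    have "\<forall>c. \<exists>\<tau> :: nat. \<tau> < 8 \<and> (\<forall>p<3. odd (\<tau> div 2 ^ p) \<longleftrightarrow> clause_sat (b p) (F ! c))"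
      using ex_bits[of 3 "\<lambda>p. clause_sat (b p) (F ! c)" for c] by simp
    from choice[OF this] obtain \<tau> where \<tau>: "\<And>c. \<tau> c < (8 :: nat)"
      "\<And>c p. p < 3 \<Longrightarrow> odd (\<tau> c div 2 ^ p) \<longleftrightarrow> clause_sat (b p) (F ! c)"
      by blast
    have cl: "claim (b p) c (\<tau> c)" if "p < 3" for p c using \<tau>(2)[OF that] bd(1)[OF that] by (simp add: claim_def)
    \<comment> \<open>Some part satisfies clause \<open>c\<close>, and its bit in
      \<open>\<tau> c\<close> is set.\<close>
    have nz: "\<tau> c \<noteq> 0" if "c < m" for c
      using a(2)[OF that] \<tau>(2)[of _ c] unfolding b_def[symmetric] by (metis div_0 even_zero)
    let ?f = "\<lambda>c. ?tri (b 0) (b 1) (b 2) (8 * c + \<tau> c)"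
    have sub: "?f ` {0..<m} \<subseteq> colored_triangles graph (b 0) (b 1) (b 2)"
    proof
      fix X assume "X \<in> ?f ` {0..<m}"
      then obtain c where c: "c < m" "X = ?f c" by auto
      have j: "8 * c + \<tau> c < J" using c(1) \<tau>(1)[of c] by (simp add: J_def)
      have "edge (b 0 * J + (8 * c + \<tau> c)) (b 1 * J + (8 * c + \<tau> c))"
        "edge (b 1 * J + (8 * c + \<tau> c)) (b 2 * J + (8 * c + \<tau> c))"
        "edge (b 0 * J + (8 * c + \<tau> c)) (b 2 * J + (8 * c + \<tau> c))"
        using nz[OF c(1)] bd(1)[of 0] bd(1)[of 1] bd(1)[of 2] cl assms
        by (subst edge_slot[OF c(1) \<tau>(1)]; simp)+
      then show "X \<in> colored_triangles graph (b 0) (b 1) (b 2)"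
        unfolding colored_triangle_iff using bd(2) j c(2) by auto
    qed
    have inj: "inj_on ?f {0..<m}"
    proof (rule inj_onI)
      fix c c' assume c: "c \<in> {0..<m}" "c' \<in> {0..<m}" "?f c = ?f c'"
      have j: "8 * c + \<tau> c < J" "8 * c' + \<tau> c' < J"
        using c \<tau>(1)[of c] \<tau>(1)[of c'] by (auto simp: J_def)
      \<comment> \<open>All three vertices have the same residue modulo \<open>J\<close>, so the
        index can be read off the vertex set.\<close>
      have "(\<lambda>v. v mod J) ` ?f c = {8 * c + \<tau> c}" "(\<lambda>v. v mod J) ` ?f c' = {8 * c' + \<tau> c'}"
        using j by auto
      then have "8 * c + \<tau> c = 8 * c' + \<tau> c'" using c(3) by (metis singleton_inject)
      then show "c = c'" using \<tau>(1)[of c] \<tau>(1)[of c'] by linarith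
    qed
    have "finite (colored_triangles graph (b 0) (b 1) (b 2))"
    proof (rule finite_subset)
      show "colored_triangles graph (b 0) (b 1) (b 2) \<subseteq> ?tri (b 0) (b 1) (b 2) ` {0..<J}"
      proof
        fix X assume "X \<in> colored_triangles graph (b 0) (b 1) (b 2)"
        then obtain j where "j < J" "X = ?tri (b 0) (b 1) (b 2) j" unfolding colored_triangle_iff by blast
        then show "X \<in> ?tri (b 0) (b 1) (b 2) ` {0..<J}" by auto
      qed
    qed simp
    from card_inj_on_le[OF inj sub this]
    have "m \<le> card (colored_triangles graph (b 0) (b 1) (b 2))" by simp
    moreover have "b 0 < 3 * H" "b 1 < 3 * H" "b 2 < 3 * H" using bd(2) by simp_all
    ultimately show "yes Delta_Matching_Triangles (graph, int m)"
      unfolding yes by blast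
  next
    assume "yes Delta_Matching_Triangles (graph, int m)"
    then obtain b1 b2 b3 where b: "b1 < 3 * H" "b2 < 3 * H" "b3 < 3 * H"
      "m \<le> card (colored_triangles graph b1 b2 b3)" unfolding yes by blast
    define D where "D c \<tau> \<longleftrightarrow> \<tau> < 8 \<and> \<tau> \<noteq> 0 \<and> claim b1 c \<tau> \<and> claim b2 c \<tau> \<and> claim b3 c \<tau>" for c \<tau>
    have tri: "b1 div H \<noteq> b2 div H \<and> b2 div H \<noteq> b3 div H \<and> b1 div H \<noteq> b3 div H \<and>
        (\<exists>c<m. \<exists>\<tau>. D c \<tau> \<and> X = ?tri b1 b2 b3 (8 * c + \<tau>))"
      if X: "X \<in> colored_triangles graph b1 b2 b3" for X
    proof -
      from X obtain j where j: "j < J" "X = ?tri b1 b2 b3 j" "edge (b1 * J + j) (b2 * J + j)"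
         "edge (b2 * J + j) (b3 * J + j)" "edge (b1 * J + j) (b3 * J + j)"
        unfolding colored_triangle_iff by blast
      from j(1) show ?thesis
      proof (cases rule: index_cases)
        case (slot c \<tau>)
        then show ?thesis
          using j(2-5) assms unfolding slot(3) edge_slot[OF slot(1,2)] D_def by blast
      next
        case (gadget r)
        then show ?thesis using j(3) assms unfolding gadget(2) edge_gadget[OF gadget(1)] by blast
      qed
    qed
    show "satisfiable F"
    \<comment> \<open>With threshold 0 the colours are arbitrary and there may be no triangle from
      which to derive that they lie in different parts.\<close>
    proof (cases "m = 0")
      case True
      then show ?thesis unfolding satisfiable_iff using H_pos by auto
    next
      case False
      then obtain X where "X \<in> colored_triangles graph b1 b2 b3"
        using b(4) by (metis card.empty ex_in_conv le_zero_eq)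
      from tri[OF this] have parts: "b1 div H \<noteq> b2 div H" "b2 div H \<noteq> b3 div H" "b1 div H \<noteq> b3 div H" by auto
      obtain a where a: "\<forall>p<3. a p < H" "\<And>p. p < 3 \<Longrightarrow> p * H + a p \<in> {b1, b2, b3}"
        "\<And>b. b \<in> {b1, b2, b3} \<Longrightarrow> b div H * H + a (b div H) = b"
        using assignment_of_colors[OF b(1-3) parts] by metis
      have claimD: "odd (\<tau> div 2 ^ p) \<longleftrightarrow> clause_sat (p * H + a p) (F ! c)" if "D c \<tau>" "p < 3" for c \<tau> p
      proof -
        have "claim (p * H + a p) c \<tau>" using a(2)[OF that(2)] that(1) unfolding D_def by auto
        moreover have "a p < H" using a(1) that(2) by blast
        then have "(p * H + a p) div H = p" by simp
        ultimately show ?thesis by (simp add: claim_def)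
      qed
      have uniq: "\<tau> = \<tau>'" if "D c \<tau>" "D c \<tau>'" for c \<tau> \<tau>'
      proof (rule three_bits_eq)
        show "odd (\<tau> div 2 ^ p) \<longleftrightarrow> odd (\<tau>' div 2 ^ p)" if "p < 3" for p
          using claimD[OF \<open>D c \<tau>\<close> that] claimD[OF \<open>D c \<tau>'\<close> that] by blast
      qed (use that in \<open>simp_all add: D_def\<close>)
      let ?C = "{c. c < m \<and> (\<exists>\<tau>. D c \<tau>)}"
      \<comment> \<open>By uniqueness \<open>SOME\<close> returns the \<open>\<tau>\<close> of the
        triangle, so that triangles are indexed by clauses alone.\<close>
      have "colored_triangles graph b1 b2 b3 \<subseteq> (\<lambda>c. ?tri b1 b2 b3 (8 * c + (SOME \<tau>. D c \<tau>))) ` ?C"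
      proof
        fix X assume "X \<in> colored_triangles graph b1 b2 b3"
        then obtain c \<tau> where c: "c < m" "D c \<tau>" "X = ?tri b1 b2 b3 (8 * c + \<tau>)" using tri by blast
        have "(SOME \<tau>. D c \<tau>) = \<tau>" using uniq c(2) by blast
        then show "X \<in> (\<lambda>c. ?tri b1 b2 b3 (8 * c + (SOME \<tau>. D c \<tau>))) ` ?C" using c by blast
      qed
      then have "card (colored_triangles graph b1 b2 b3) \<le> card ?C"
        by (rule surj_card_le[rotated]) simp
      then have "card {0..<m} \<le> card ?C" using b(4) by simp
      then have "?C = {0..<m}" by (intro card_seteq) auto
      then have ex: "\<exists>\<tau>. D c \<tau>" if "c < m" for c using that by auto
      have "\<exists>p<3. clause_sat (p * H + a p) (F ! c)" if "c < m" for c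
      proof -
        obtain \<tau> where \<tau>: "D c \<tau>" using ex \<open>c < m\<close> by blast
        show ?thesis
        proof (rule ccontr)
          assume "\<not> ?thesis"
          then have "even (\<tau> div 2 ^ p)" if "p < 3" for p using claimD[OF \<tau> that] that by blast
          then have "\<tau> = 0" using \<tau> by (intro three_bits_eq) (simp_all add: D_def)
          then show False using \<tau> by (simp add: D_def)
        qed
      qed
      then show ?thesis unfolding satisfiable_iff using a(1) by blast
    qed
  qed
qed

end

section \<open>Derivations of the label words of paths\<close>

lemma derives1_append: "derives1 G u v \<Longrightarrow> derives1 G (x @ u @ y) (x @ v @ y)"
proof (induction rule: derives1.induct)
  case (1 A w u v)
  then show ?case using derives1.intros[of A w G "x @ u" "v @ y"] by simp
qed

lemma derives_append: "(derives1 G)\<^sup>*\<^sup>* u v \<Longrightarrow> (derives1 G)\<^sup>*\<^sup>* (x @ u @ y) (x @ v @ y)"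
  by (induction rule: rtranclp_induct) (auto intro: rtranclp.rtrancl_into_rtrancl derives1_append)

lemma path_append: "path E u x w \<Longrightarrow> path E w y v \<Longrightarrow> path E u (x @ y) v"
  by (induction rule: path.induct) (auto intro: path.intros)

definition derives_path :: "'n cfg \<Rightarrow> (nat \<times> nat \<times> nat) set \<Rightarrow> 'n sym list \<Rightarrow> nat \<Rightarrow> nat \<Rightarrow> bool" where
  "derives_path G E w u v \<longleftrightarrow> (\<exists>x. (derives1 G)\<^sup>*\<^sup>* w (map Tm x) \<and> path E u x v)"

lemma derives_path_append:
  assumes "derives_path G E w1 u z" "derives_path G E w2 z v"
  shows "derives_path G E (w1 @ w2) u v"
proof -
  from assms obtain x1 x2 where x: "(derives1 G)\<^sup>*\<^sup>* w1 (map Tm x1)" "path E u x1 z"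
    "(derives1 G)\<^sup>*\<^sup>* w2 (map Tm x2)" "path E z x2 v"
    unfolding derives_path_def by blast
  have "(derives1 G)\<^sup>*\<^sup>* (w1 @ w2) (map Tm x1 @ w2)" using derives_append[OF x(1), of "[]" w2] by simp
  also have "(derives1 G)\<^sup>*\<^sup>* (map Tm x1 @ w2) (map Tm x1 @ map Tm x2)"
    using derives_append[OF x(3), of "map Tm x1" "[]"] by simp
  finally show ?thesis
    using path_append[OF x(2,4)] unfolding derives_path_def by (metis map_append)
qed

lemma derives_path_prod:
  assumes "(A, w) \<in> prods G" "derives_path G E w u v"
  shows "derives_path G E [Nt A] u v"
proof -
  have "derives1 G [Nt A] w" using derives1.intros[OF assms(1), of "[]" "[]"] by simp
  then show ?thesis
    using assms(2) unfolding derives_path_def by (meson converse_rtranclp_into_rtranclp)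
qed

section \<open>Binarisation of grammars\<close>

text \<open>The items of the binary form are the suffixes of right-hand sides and the words of length one.\<close>

locale item_numbering =
  fixes G :: "'n cfg" and W :: "'n sym list set" and nm :: "'n sym list \<Rightarrow> nat" and q :: nat
    and rs :: "(nat \<times> nat \<times> nat) list"
  assumes inj: "inj_on nm W" and nm_less: "\<And>w. w \<in> W \<Longrightarrow> nm w < q"
    and Nil_W: "[] \<in> W" and nm_Nil: "nm [] = num_terms G"
    and Tm_W: "\<And>a. a < num_terms G \<Longrightarrow> [Tm a] \<in> W" and nm_Tm: "\<And>a. a < num_terms G \<Longrightarrow> nm [Tm a] = a"
    and start_W: "[Nt (start G)] \<in> W"
    and suffix_W: "\<And>A u v. (A, u @ v) \<in> prods G \<Longrightarrow> v \<in> W"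
    and symbol_W: "\<And>A u X v. (A, u @ X # v) \<in> prods G \<Longrightarrow> [X] \<in> W"
    and lhs_W: "\<And>A w. (A, w) \<in> prods G \<Longrightarrow> [Nt A] \<in> W"
    and rs: "set rs = {(nm [X], nm v, nm (X # v)) | X v. \<exists>A u. (A, u @ X # v) \<in> prods G} \<union>
      {(nm w, nm [], nm [Nt A]) | A w. (A, w) \<in> prods G}"
begin

abbreviation "t \<equiv> num_terms G"

lemma binary: "binary_grammar t q rs (nm [Nt (start G)])"
proof
  show "t < q" using nm_less[OF Nil_W] nm_Nil by simp
  show "nm [Nt (start G)] < q" by (rule nm_less[OF start_W])
  fix i j k assume "(i, j, k) \<in> set rs"
  then consider A u X v where "(A, u @ X # v) \<in> prods G" "i = nm [X]" "j = nm v" "k = nm (X # v)"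
    | A w where "(A, w) \<in> prods G" "i = nm w" "j = nm []" "k = nm [Nt A]"
    unfolding rs by blast
  then show "i < q \<and> j < q \<and> k < q"
  proof cases
    case 1
    then show ?thesis
      using nm_less symbol_W[OF 1(1)] suffix_W[OF 1(1)] suffix_W[of A "u @ [X]" v] by simp
  next
    case 2
    then show ?thesis using nm_less suffix_W[of A "[]" w] Nil_W lhs_W[OF 2(1)] by simp
  qed
qed

context
  fixes n :: nat and E :: "(nat \<times> nat \<times> nat) set"
  assumes E: "E \<subseteq> {0..<n} \<times> {0..<t} \<times> {0..<n}"
begin

abbreviation "F \<equiv> fact rs t E n"

text \<open>The two shapes of rules mirror the two ways to build a derivation: concatenating a first
  symbol with a rest, and applying a production. The second is made binary by the item for the empty
  word.\<close>

lemma fact_sound: "F i u v \<Longrightarrow> w \<in> W \<Longrightarrow> nm w = i \<Longrightarrow> derives_path G E w u v"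
proof (induction arbitrary: w rule: fact.induct)
  case (edge u a v)
  then have a: "a < t" using E by auto
  then have "w = [Tm a]" using edge.prems inj Tm_W[OF a] nm_Tm[OF a] by (auto dest: inj_onD)
  moreover have "path E u [a] v" using edge.hyps by (auto intro: path.intros)
  ultimately show ?case unfolding derives_path_def by (intro exI[of _ "[a]"]) auto
next
  case (eps u)
  then have "w = []" using inj_onD[OF inj, of w "[]"] Nil_W nm_Nil by simp
  then show ?case unfolding derives_path_def by (intro exI[of _ "[]"]) (auto intro: path.intros)
next
  case (rule i j k u z v)
  from rule.hyps(1) consider A u' X v' where "(A, u' @ X # v') \<in> prods G" "i = nm [X]" "j = nm v'" "k = nm (X # v')"
    | A w' where "(A, w') \<in> prods G" "i = nm w'" "j = nm []" "k = nm [Nt A]"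
    unfolding rs by blast
  then show ?case
  proof cases
    case 1
    have "derives_path G E [X] u z" using rule.IH(1) symbol_W[OF 1(1)] 1(2) by simp
    moreover have "derives_path G E v' z v"
      using rule.IH(2) suffix_W[of A "u' @ [X]" v'] 1 by simp
    ultimately have "derives_path G E ([X] @ v') u v" by (rule derives_path_append)
    moreover have "w = X # v'"
      using rule.prems 1(4) suffix_W[OF 1(1)] inj by (auto dest: inj_onD)
    ultimately show ?thesis by simp
  next
    case 2
    have "derives_path G E w' u z" using rule.IH(1) suffix_W[of A "[]" w'] 2 by simp
    moreover have "derives_path G E [] z v" using rule.IH(2) Nil_W 2 by simp
    ultimately have "derives_path G E (w' @ []) u v" by (rule derives_path_append)
    then have "derives_path G E [Nt A] u v" using derives_path_prod[OF 2(1)] by simp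
    moreover have "w = [Nt A]" using rule.prems 2(4) lhs_W[OF 2(1)] inj by (auto dest: inj_onD)
    ultimately show ?thesis by simp
  qed
qed

lemma fact_less: "F i u v \<Longrightarrow> u < n \<and> v < n"
  by (induction rule: fact.induct) (use E in auto)

text \<open>Sentential forms are not items, so for completeness a path is cut symbol by symbol
  instead, with a fact for each symbol.\<close>

fun chain :: "'n sym list \<Rightarrow> nat \<Rightarrow> nat \<Rightarrow> bool" where
  "chain [] u v \<longleftrightarrow> u = v \<and> u < n"
| "chain (X # w) u v \<longleftrightarrow> (\<exists>z. F (nm [X]) u z \<and> chain w z v)"

lemma chain_less: "chain w u v \<Longrightarrow> u < n \<and> v < n"
  by (induction w arbitrary: u) (auto dest: fact_less)

lemma chain_append: "chain (w1 @ w2) u v \<longleftrightarrow> (\<exists>z. chain w1 u z \<and> chain w2 z v)"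
proof (induction w1 arbitrary: u)
  case Nil
  then show ?case using chain_less by auto
qed auto

text \<open>The premise is there because items exist only for suffixes of right-hand sides. The
  facts of a chain are combined from the right end, starting with the empty word.\<close>

lemma chain_fact: "(A, u' @ w) \<in> prods G \<Longrightarrow> chain w u v \<Longrightarrow> F (nm w) u v"
proof (induction w arbitrary: u u')
  case Nil
  then show ?case using nm_Nil by (auto intro: fact.eps)
next
  case (Cons X w)
  then obtain z where z: "F (nm [X]) u z" "chain w z v" by auto
  have "F (nm w) z v" using Cons.IH[of "u' @ [X]"] Cons.prems(1) z(2) by simp
  moreover have "(nm [X], nm w, nm (X # w)) \<in> set rs" unfolding rs using Cons.prems(1) by blast
  ultimately show ?case using z(1) fact.rule by blast
qed

lemma path_chain: "path E u x v \<Longrightarrow> u < n \<Longrightarrow> chain (map Tm x) u v"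
proof (induction rule: path.induct)
  case (Cons u a v w x)
  then have "a < t" "v < n" using E by auto
  moreover have "F a u v" using Cons.hyps(1) by (rule fact.edge)
  ultimately show ?case using Cons.IH nm_Tm by auto
qed simp

text \<open>Induction backwards along the derivation: the terminal word is a chain along its own
  path, and undoing a production contracts the chain of the right-hand side to a single fact for the
  nonterminal.\<close>

lemma chain_complete:
  assumes "(derives1 G)\<^sup>*\<^sup>* w (map Tm x)" "path E u x v" "u < n"
  shows "chain w u v"
  using assms(1)
proof (induction rule: converse_rtranclp_induct)
  case base
  show ?case by (rule path_chain[OF assms(2,3)])
next
  case (step w w')
  from step(1) obtain A r l y where A: "(A, r) \<in> prods G" "w = l @ [Nt A] @ y" "w' = l @ r @ y"
    by (auto elim: derives1.cases)
  obtain z1 z2 where z: "chain l u z1" "chain r z1 z2" "chain y z2 v"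
    using step(3) unfolding A(3) chain_append by blast
  have "F (nm r) z1 z2" using chain_fact[of A "[]" r] A(1) z(2) by simp
  moreover have z2: "z2 < n" using chain_less[OF z(3)] by simp
  then have "F (nm []) z2 z2" unfolding nm_Nil by (rule fact.eps)
  moreover have "(nm r, nm [], nm [Nt A]) \<in> set rs" unfolding rs using A(1) by blast
  ultimately have "F (nm [Nt A]) z1 z2" by (blast intro: fact.rule)
  then have "chain [Nt A] z1 z2" using z2 by simp
  then show ?case unfolding A(2) chain_append using z by blast
qed

lemma fact_start_iff: "u < n \<Longrightarrow> F (nm [Nt (start G)]) u v \<longleftrightarrow> S_reachable G (n, E) u v"
proof
  assume "F (nm [Nt (start G)]) u v"
  from fact_sound[OF this start_W] show "S_reachable G (n, E) u v"
    by (auto simp: derives_path_def S_reachable_def cfg_language_def)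
next
  assume u: "u < n" and "S_reachable G (n, E) u v"
  then obtain x where "(derives1 G)\<^sup>*\<^sup>* [Nt (start G)] (map Tm x)" "path E u x v"
    by (auto simp: S_reachable_def cfg_language_def)
  from chain_complete[OF this u] show "F (nm [Nt (start G)]) u v" by auto
qed

end

end

text \<open>Only the numbers of the terminals and of the empty word are prescribed. The remaining
  items form a finite set and are numbered above these by an arbitrary bijection
  \<open>g\<close>.\<close>

lemma ex_item_numbering:
  fixes G :: "'n cfg"
  assumes "wf_cfg G"
  shows "\<exists>W nm q rs. item_numbering G W nm q rs"
proof -
  let ?t = "num_terms G"
  have fin: "finite (prods G)" using assms by (simp add: wf_cfg_def)
  define Suf where "Suf = (\<Union>(A, w)\<in>prods G. set (map (\<lambda>i. drop i w) [0..<Suc (length w)]))"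
  define Sy where "Sy = (\<Union>(A, w)\<in>prods G. (\<lambda>X. [X]) ` set w)"
  define T :: "'n sym list set" where "T = insert [] ((\<lambda>a. [Tm a]) ` {0..<?t})"
  define W where "W = T \<union> Suf \<union> Sy \<union> insert [Nt (start G)] ((\<lambda>(A, w). [Nt A]) ` prods G)"
  have finW: "finite W" unfolding W_def Suf_def Sy_def T_def using fin by auto
  obtain g where g: "bij_betw g (W - T) {0..<card (W - T)}"
    using ex_bij_betw_finite_nat[of "W - T"] finW by auto
  \<comment> \<open>The value 0 for a nonterminal head is a default that no element of
    \<open>T\<close> attains.\<close>
  define nm where "nm w = (if w = [] then ?t else if w \<in> T then (case hd w of Tm a \<Rightarrow> a | Nt _ \<Rightarrow> 0) else ?t + 1 + g w)" for w
  define q where "q = ?t + 1 + card (W - T)"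
  have nmT: "nm [Tm a] = a" if "a < ?t" for a using that by (auto simp: nm_def T_def)
  have nmT_le: "w \<in> T \<Longrightarrow> nm w \<le> ?t" for w by (auto simp: nm_def T_def)
  have nmR: "nm w = ?t + 1 + g w" if "w \<in> W - T" for w using that by (auto simp: nm_def T_def)
  have gl: "g w < card (W - T)" if "w \<in> W - T" for w
    using bij_betwE[OF g] that by auto
  have injT: "inj_on nm T"
    by (rule inj_onI) (auto simp: nm_def T_def split: if_splits)
  have inj: "inj_on nm W"
  proof (rule inj_onI)
    fix w w' assume w: "w \<in> W" "w' \<in> W" "nm w = nm w'"
    show "w = w'"
    proof (cases "w \<in> T"; cases "w' \<in> T")
      assume "w \<in> T" "w' \<in> T"
      then show ?thesis using injT w(3) by (auto dest: inj_onD)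
    next
      assume "w \<in> T" "w' \<notin> T"
      then show ?thesis using nmT_le[of w] nmR[of w'] w by simp
    next
      assume "w \<notin> T" "w' \<in> T"
      then show ?thesis using nmT_le[of w'] nmR[of w] w by simp
    next
      assume "w \<notin> T" "w' \<notin> T"
      then show ?thesis using nmR[of w] nmR[of w'] w bij_betw_imp_inj_on[OF g] by (auto dest: inj_onD)
    qed
  qed
  let ?R = "(\<lambda>(X, v). (nm [X], nm v, nm (X # v))) ` {(X, v). \<exists>A u. (A, u @ X # v) \<in> prods G} \<union>
      (\<lambda>(A, w). (nm w, nm [], nm [Nt A])) ` prods G"
  have suf: "v \<in> Suf" if "(A, u @ v) \<in> prods G" for A u v
  proof -
    have "v = drop (length u) (u @ v)" "length u \<in> {0..<Suc (length (u @ v))}" by simp_all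
    then have "v \<in> set (map (\<lambda>i. drop i (u @ v)) [0..<Suc (length (u @ v))])"
      unfolding set_map set_upt by (rule image_eqI)
    then show ?thesis unfolding Suf_def by (intro UN_I[OF that]) (simp only: prod.case)
  qed
  \<comment> \<open>Such a pair is the head and tail of a suffix, and there are only finitely many
    suffixes.\<close>
  have "finite {(X, v). \<exists>A u. (A, u @ X # v) \<in> prods G}"
  proof (rule finite_subset)
    show "{(X, v). \<exists>A u. (A, u @ X # v) \<in> prods G} \<subseteq> (\<lambda>w. (hd w, tl w)) ` Suf"
    proof clarify
      fix X v A u assume "(A, u @ X # v) \<in> prods G"
      from suf[OF this] show "(X, v) \<in> (\<lambda>w. (hd w, tl w)) ` Suf"
        by (rule image_eqI[rotated]) simp
    qed
    have "finite Suf" unfolding Suf_def using fin by auto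
    then show "finite ((\<lambda>w. (hd w, tl w)) ` Suf)" by (rule finite_imageI)
  qed
  then have finR: "finite ?R" using fin by (intro finite_UnI finite_imageI)
  obtain rs where rs: "set rs = ?R" by (rule exE[OF finite_list[OF finR]])
  have "item_numbering G W nm q rs"
  proof
    show "nm w < q" if "w \<in> W" for w
      using that nmT_le[of w] nmR[of w] gl[of w] unfolding q_def by (cases "w \<in> T") auto
    show "[] \<in> W" "nm [] = ?t" "[Nt (start G)] \<in> W" by (auto simp: W_def T_def nm_def)
    show "[Tm a] \<in> W" if "a < ?t" for a using that by (auto simp: W_def T_def)
    show "v \<in> W" if "(A, u @ v) \<in> prods G" for A u v using suf[OF that] by (simp add: W_def)
    show "[X] \<in> W" if "(A, u @ X # v) \<in> prods G" for A u X v
      using that unfolding W_def Sy_def by force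
    show "[Nt A] \<in> W" if "(A, w) \<in> prods G" for A w using that unfolding W_def by force
    show "set rs = {(nm [X], nm v, nm (X # v)) | X v. \<exists>A u. (A, u @ X # v) \<in> prods G} \<union>
      {(nm w, nm [], nm [Nt A]) | A w. (A, w) \<in> prods G}"
      unfolding rs by (auto simp: image_def split_paired_Ex)
  qed (use inj nmT in auto)
  then show ?thesis by blast
qed

section \<open>Encoded reachability instances as input of the checkers\<close>

lemma encode_lgraph_nth:
  assumes "u < n" "v < n" "a < num_terms G"
  shows "length (encode_lgraph G (n, E)) = n * (n * num_terms G)"
    and "encode_lgraph G (n, E) ! ((u * n + v) * num_terms G + a) = of_bool ((u, a, v) \<in> E)"
proof -
  let ?t = "num_terms G"
  let ?row = "\<lambda>u v. map (\<lambda>a. if (u, a, v) \<in> E then 1 else 0) [0..<?t] :: int list"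
  have enc: "encode_lgraph G (n, E) = concat (map (\<lambda>u. concat (map (?row u) [0..<n])) [0..<n])"
    by (simp add: encode_lgraph_def)
  have len: "length (concat (map (?row u) [0..<n])) = n * ?t" for u by (rule length_concat_const) simp
  show "length (encode_lgraph G (n, E)) = n * (n * ?t)" unfolding enc by (rule length_concat_const) (rule len)
  have "(u * n + v) * ?t + a = u * (n * ?t) + (v * ?t + a)" by (simp add: algebra_simps)
  moreover have "v * ?t + a < n * ?t" using assms by (intro pair_index_less)
  then have "concat (map (\<lambda>u. concat (map (?row u) [0..<n])) [0..<n]) ! (u * (n * ?t) + (v * ?t + a)) =
      concat (map (?row u) [0..<n]) ! (v * ?t + a)"
    by (rule nth_concat_const[OF len assms(1)])
  ultimately have "encode_lgraph G (n, E) ! ((u * n + v) * ?t + a) = concat (map (?row u) [0..<n]) ! (v * ?t + a)"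
    unfolding enc by metis
  also have "\<dots> = ?row u v ! a" by (rule nth_concat_const) (use assms in auto)
  finally show "encode_lgraph G (n, E) ! ((u * n + v) * ?t + a) = of_bool ((u, a, v) \<in> E)"
    using assms by simp
qed

lemma length_encode_lgraph: "length (encode_lgraph G (n, E)) = n * (n * num_terms G)"
  unfolding encode_lgraph_def
  by (simp add: length_concat_const[where L = "n * num_terms G"] length_concat_const[where L = "num_terms G"])

text \<open>After the reduction only the cells of its output list are known. Everything that the
  checker reads lies among them, and the lower bound on \<open>B\<close> keeps the length in cell 0
  readable as well.\<close>

lemma (in item_numbering) st_input:
  assumes I: "((n, E), x, y) \<in> instances (st_CFL_reachability G)"
    and out: "holds_output m (encode (st_CFL_reachability G) ((n, E), x, y))"
    and B: "int (n * (n * num_terms G)) + 3 \<le> B"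
  shows "binary_grammar.input_ok t True n E x y B m"
    and "binary_grammar.hits (nm [Nt (start G)]) True n x y (binary_grammar.facts t rs E n) \<longleftrightarrow>
      yes (st_CFL_reachability G) ((n, E), x, y)"
proof -
  interpret binary_grammar t q rs "nm [Nt (start G)]" by (rule binary)
  have E: "E \<subseteq> {0..<n} \<times> {0..<t} \<times> {0..<n}" and xy: "x < n" "y < n"
    using I by (auto simp: st_CFL_reachability_def wf_lgraph_def)
  let ?ys = "int n # int x # int y # encode_lgraph G (n, E)"
  have ys: "encode (st_CFL_reachability G) ((n, E), x, y) = ?ys" by (simp add: st_CFL_reachability_def)
  have m: "m (int i + 1) = ?ys ! i" if "i < length ?ys" for i
    using out that unfolding ys holds_output_def by blast
  have m0: "m 0 = int (length ?ys)" using out unfolding ys holds_output_def by blast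
  have e: "m (4 + int ((u * n + v) * t + a)) = of_bool ((u, a, v) \<in> E)" if "u < n" "v < n" "a < t" for u v a
  proof -
    have "(u * n + v) * t + a < n * n * t" using that by (intro pair_index_less)
    then have "(u * n + v) * t + a + 3 < length ?ys" by (simp add: length_encode_lgraph mult.assoc)
    from m[OF this] show ?thesis using encode_lgraph_nth(2)[OF that] by (simp add: add.commute)
  qed
  have "m 1 = int n" "m 2 = int x" "m 3 = int y" using m[of 0] m[of 1] m[of 2] by simp_all
  moreover have "\<bar>m 0\<bar> \<le> B" using B by (simp add: m0 length_encode_lgraph)
  moreover have "1 \<le> B" using B of_nat_0_le_iff[of "n * (n * t)"] by linarith
  ultimately show "input_ok True n E x y B m"
    unfolding input_ok_def wfE_def offs_def using E xy e by simp
  show "hits True n x y (facts E n) \<longleftrightarrow> yes (st_CFL_reachability G) ((n, E), x, y)"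
    using fact_start_iff[OF E xy(1)] by (simp add: hits_def facts_def st_CFL_reachability_def)
qed

lemma (in item_numbering) all_pairs_input:
  assumes I: "(n, E) \<in> instances (all_pairs_CFL_reachability G)"
    and out: "holds_output m (encode (all_pairs_CFL_reachability G) (n, E))"
    and B: "int (n * (n * num_terms G)) + 3 \<le> B"
  shows "binary_grammar.input_ok t False n E 0 0 B m"
    and "binary_grammar.hits (nm [Nt (start G)]) False n 0 0 (binary_grammar.facts t rs E n) \<longleftrightarrow>
      yes (all_pairs_CFL_reachability G) (n, E)"
proof -
  interpret binary_grammar t q rs "nm [Nt (start G)]" by (rule binary)
  have E: "E \<subseteq> {0..<n} \<times> {0..<t} \<times> {0..<n}"
    using I by (auto simp: all_pairs_CFL_reachability_def wf_lgraph_def)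
  let ?ys = "int n # encode_lgraph G (n, E)"
  have ys: "encode (all_pairs_CFL_reachability G) (n, E) = ?ys" by (simp add: all_pairs_CFL_reachability_def)
  have m: "m (int i + 1) = ?ys ! i" if "i < length ?ys" for i
    using out that unfolding ys holds_output_def by blast
  have m0: "m 0 = int (length ?ys)" using out unfolding ys holds_output_def by blast
  have e: "m (2 + int ((u * n + v) * t + a)) = of_bool ((u, a, v) \<in> E)" if "u < n" "v < n" "a < t" for u v a
  proof -
    have "(u * n + v) * t + a < n * n * t" using that by (intro pair_index_less)
    then have "(u * n + v) * t + a + 1 < length ?ys" by (simp add: length_encode_lgraph mult.assoc)
    from m[OF this] show ?thesis using encode_lgraph_nth(2)[OF that] by (simp add: add.commute)
  qed
  have "m 1 = int n" using m[of 0] by simp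
  moreover have "\<bar>m 0\<bar> \<le> B" using B by (simp add: m0 length_encode_lgraph)
  moreover have "1 \<le> B" using B of_nat_0_le_iff[of "n * (n * t)"] by linarith
  ultimately show "input_ok False n E 0 0 B m"
    unfolding input_ok_def wfE_def offs_def using E e by simp
  show "hits False n 0 0 (facts E n) \<longleftrightarrow> yes (all_pairs_CFL_reachability G) (n, E)"
    using fact_start_iff[OF E] by (simp add: hits_def facts_def all_pairs_CFL_reachability_def)
qed

section \<open>Matrix multiplication in exponent 2\<close>

lemma len_power: "len (x ^ k) \<le> k * len x + 2"
proof (induction k)
  case (Suc k)
  then show ?case using len_mult[of x "x ^ k"] by simp
qed (simp add: len_numerals)

lemma len_int_le: "len (int n) \<le> n + 1"
  using len_le_iff[of "int n" n] by (simp add: less_exp)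

definition mult_loop :: hcom where
  "mult_loop = Asg 6 (Num 0) ;;
     For 7 (Var 2) (Asg 6 (Bop Plus (Var 6) (Bop Times
       (Arr 1 (Bop Plus (Num 2) (Bop Plus (Bop Times (Bop Div (Var 5) (Var 2)) (Var 2)) (Var 7))))
       (Arr 1 (Bop Plus (Bop Plus (Num 2) (Bop Times (Var 2) (Var 2)))
          (Bop Plus (Bop Times (Var 7) (Var 2)) (modE (Var 5) (Var 2)))))))) ;;
     Upd 7 (Bop Plus (Var 5) (Num 1)) (Var 6)"

definition schoolbook :: hcom where
  "schoolbook = Asg 2 (Arr 1 (Num 1)) ;; Upd 7 (Num 0) (Bop Times (Var 2) (Var 2)) ;;
     For 5 (Bop Times (Var 2) (Var 2)) mult_loop ;;
     Asg 1 (Bop Plus (Bop Times (Var 2) (Var 2)) (Num 1))"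

lemma init_mem_mult_input:
  assumes "A \<in> carrier_mat n n" "C \<in> carrier_mat n n" "i < n" "j < n"
  shows "init_mem (mult_input n A C) 1 = int n"
    and "init_mem (mult_input n A C) (2 + int (i * n + j)) = A $$ (i, j)"
    and "init_mem (mult_input n A C) (2 + int (n * n) + int (i * n + j)) = C $$ (i, j)"
proof -
  let ?xs = "mult_input n A C"
  have l: "length (concat (mat_to_list A)) = n * n" "length (concat (mat_to_list C)) = n * n"
    using assms by (simp_all add: length_concat_mat_to_list)
  have L: "length ?xs = 1 + n * n + n * n" by (simp add: mult_input_def l)
  have ij: "i * n + j < n * n" using assms by (intro pair_index_less)
  have *: "init_mem ?xs (int p + 1) = ?xs ! p" if "p < length ?xs" for p
    using that by (simp add: init_mem_def)
  show "init_mem ?xs 1 = int n" using *[of 0] by (simp add: mult_input_def)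
  have "init_mem ?xs (int (1 + (i * n + j)) + 1) = ?xs ! (1 + (i * n + j))"
    by (rule *) (use ij L in linarith)
  also have "?xs ! (1 + (i * n + j)) = A $$ (i, j)"
    using ij nth_concat_mat_to_list[OF assms(1,3,4)] by (simp add: mult_input_def nth_append l)
  finally show "init_mem ?xs (2 + int (i * n + j)) = A $$ (i, j)" by (simp add: algebra_simps)
  have "init_mem ?xs (int (1 + (n * n + (i * n + j))) + 1) = ?xs ! (1 + (n * n + (i * n + j)))"
    by (rule *) (use ij L in linarith)
  also have "?xs ! (1 + (n * n + (i * n + j))) = C $$ (i, j)"
    using ij nth_concat_mat_to_list[OF assms(2-4)] by (simp add: mult_input_def nth_append l)
  finally show "init_mem ?xs (2 + int (n * n) + int (i * n + j)) = C $$ (i, j)"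
    by (simp add: algebra_simps)
qed

lemma htri_schoolbook:
  assumes A: "A \<in> carrier_mat n n" "C \<in> carrier_mat n n"
    and small: "\<And>i j. i < n \<Longrightarrow> j < n \<Longrightarrow> \<bar>A $$ (i, j)\<bar> \<le> M \<and> \<bar>C $$ (i, j)\<bar> \<le> M"
    and B: "int n * (M * M) \<le> B" "M \<le> B" "int (n * n) + 1 \<le> B" "1 \<le> B"
  shows "htri B U schoolbook (init_state (mult_input n A C)) (n * n * (6 * n + 13) + 10)
    (\<lambda>s'. fst s' 0 = 0 \<and> fst s' 1 = int (n * n) + 1 \<and> snd s' 7 0 = int (n * n) \<and>
      (\<forall>i<n * n. snd s' 7 (int i + 1) = concat (mat_to_list (A * C)) ! i))"
proof -
  let ?xs = "mult_input n A C"
  note in_mem = init_mem_mult_input[OF A]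
  have in1: "init_mem ?xs 1 = int n"
    by (simp add: init_mem_def mult_input_def)
  have AC: "A * C \<in> carrier_mat n n" using A by simp
  have out: "concat (mat_to_list (A * C)) ! z = (\<Sum>w<n. A $$ (z div n, w) * C $$ (w, z mod n))"
    if z: "z < n * n" for z
  proof -
    have zz: "z div n < n" "z mod n < n" using z by (cases n; simp add: less_mult_imp_div_less)+
    have "concat (mat_to_list (A * C)) ! (z div n * n + z mod n) = (A * C) $$ (z div n, z mod n)"
      by (rule nth_concat_mat_to_list[OF AC zz])
    also have "\<dots> = (\<Sum>w<n. A $$ (z div n, w) * C $$ (w, z mod n))"
      using A zz by (simp add: scalar_prod_def atLeast0LessThan)
    finally show ?thesis by (simp only: div_mult_mod_eq)
  qed
  have nB: "int n \<le> B"
  proof -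
    have "n \<le> n * n" by (cases n) auto
    then have "int n \<le> int (n * n)" by (simp only: of_nat_le_iff)
    then show ?thesis using B(3) by linarith
  qed
  let ?I = "\<lambda>z (s :: hstate). fst s 0 = 0 \<and> fst s 2 = int n \<and> snd s 1 = init_mem ?xs \<and> snd s 7 0 = int (n * n) \<and>
      (\<forall>i<z. snd s 7 (int i + 1) = concat (mat_to_list (A * C)) ! i)"
  have body: "htri B U mult_loop s (6 * n + 8)
      (\<lambda>s'. fst s' 5 = int z \<and> ?I (Suc z) ((fst s')(5 := int z + 1), snd s'))"
    if z: "z < n * n" and s: "?I z s" "fst s 5 = int z" for z s
  proof -
    define i j where "i = z div n" and "j = z mod n"
    have ij: "i < n" "j < n" using z unfolding i_def j_def by (cases n; simp add: less_mult_imp_div_less)+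
    define S where "S w = (\<Sum>w'<w. A $$ (i, w') * C $$ (w', j))" for w
    have SB: "\<bar>S w\<bar> \<le> B" if "w \<le> n" for w
    proof -
      have "\<bar>S w\<bar> \<le> (\<Sum>w'<w. M * M)"
        unfolding S_def
      proof (rule order_trans[OF sum_abs sum_mono])
        fix w' assume "w' \<in> {..<w}"
        then have "w' < n" using that by simp
        then show "\<bar>A $$ (i, w') * C $$ (w', j)\<bar> \<le> M * M"
          unfolding abs_mult using small[of i w'] small[of w' j] ij by (intro mult_mono) auto
      qed
      also have "\<dots> = int w * (M * M)" by simp
      also have "\<dots> \<le> int n * (M * M)" using that by (intro mult_right_mono) auto
      finally show ?thesis using B(1) by linarith
    qed
    let ?J = "\<lambda>w (s :: hstate). ?I z s \<and> fst s 5 = int z \<and> fst s 6 = S w"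
    have 1: "htri B U (Asg 6 (Num 0)) s 1 (?J 0)"
      by (rule htri_Asg) (use s B in \<open>auto simp: S_def\<close>)
    have 2: "htri B U (For 7 (Var 2) (Asg 6 (Bop Plus (Var 6) (Bop Times
       (Arr 1 (Bop Plus (Num 2) (Bop Plus (Bop Times (Bop Div (Var 5) (Var 2)) (Var 2)) (Var 7))))
       (Arr 1 (Bop Plus (Bop Plus (Num 2) (Bop Times (Var 2) (Var 2)))
          (Bop Plus (Bop Times (Var 7) (Var 2)) (modE (Var 5) (Var 2)))))))))
       s' (n * (1 + 5) + 4) (?J n)" (is "htri B U (For 7 (Var 2) (Asg 6 ?e)) _ _ _") if s': "?J 0 s'" for s'
    proof (rule htri_For[where I = ?J])
      fix w s assume w: "w < n" "?J w s" "fst s 7 = int w"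
      have a1: "snd s 1 (2 + (int z div int n * int n + int w)) = A $$ (i, w)"
        using in_mem(2)[OF ij(1) w(1)] w(2) unfolding i_def by (simp add: of_nat_div)
      have a2: "snd s 1 (2 + int n * int n + (int w * int n + int z mod int n)) = C $$ (w, j)"
        using in_mem(3)[OF w(1) ij(2)] w(2) unfolding j_def by (simp add: of_nat_mod)
      have ab: "\<bar>A $$ (i, w)\<bar> \<le> B" "\<bar>C $$ (w, j)\<bar> \<le> B"
        using small[of i w] small[of w j] ij w(1) B(2) by auto
      have v: "hval ?e s = S (Suc w)"
        using w a1 a2 by (simp add: S_def)
      have "safe B ?e s" using w a1 a2 ab by simp
      then show "htri B U (Asg 6 ?e) s 1
          (\<lambda>s'. fst s' 7 = int w \<and> ?J (Suc w) ((fst s')(7 := int w + 1), snd s'))"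
        by (rule htri_Asg) (use v w SB[of "Suc w"] in auto)
    qed (use s' nB in auto)
    have 3: "htri B U (Upd 7 (Bop Plus (Var 5) (Num 1)) (Var 6)) s' 1
      (\<lambda>s'. fst s' 5 = int z \<and> ?I (Suc z) ((fst s')(5 := int z + 1), snd s'))" if s': "?J n s'" for s'
      by (rule htri_Upd) (use s' SB[of n] out[OF z] in \<open>auto simp: S_def i_def j_def less_Suc_eq\<close>)
    show ?thesis
      unfolding mult_loop_def by (rule htri_mono[OF htri_HSeq[OF 1 htri_HSeq[OF 2 3]]]) auto
  qed
  have 1: "htri B U (Asg 2 (Arr 1 (Num 1))) (init_state ?xs) 1
      (\<lambda>s. fst s 0 = 0 \<and> fst s 2 = int n \<and> snd s 1 = init_mem ?xs)"
    by (rule htri_Asg) (use nB in1 in \<open>auto simp: init_state_def\<close>)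
  have 2: "htri B U (Upd 7 (Num 0) (Bop Times (Var 2) (Var 2))) s 1 (?I 0)"
    if s: "fst s 0 = 0 \<and> fst s 2 = int n \<and> snd s 1 = init_mem ?xs" for s
    by (rule htri_Upd) (use s B in auto)
  have 3: "htri B U (For 5 (Bop Times (Var 2) (Var 2)) mult_loop) s (n * n * ((6 * n + 8) + 5) + 4) (?I (n * n))"
    if s: "?I 0 s" for s
  proof (rule htri_For[where I = ?I])
    show "htri B U mult_loop t (6 * n + 8) (\<lambda>s'. fst s' 5 = int z \<and> ?I (Suc z) ((fst s')(5 := int z + 1), snd s'))"
      if "z < n * n" "?I z t" "fst t 5 = int z" for z t using body[OF that] .
    show "int (n * n) \<le> B" using B by simp
  qed (use s in auto)
  have 4: "htri B U (Asg 1 (Bop Plus (Bop Times (Var 2) (Var 2)) (Num 1))) s 1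
    (\<lambda>s'. fst s' 0 = 0 \<and> fst s' 1 = int (n * n) + 1 \<and> snd s' 7 0 = int (n * n) \<and>
      (\<forall>i<n * n. snd s' 7 (int i + 1) = concat (mat_to_list (A * C)) ! i))"
    if s: "?I (n * n) s" for s
    by (rule htri_Asg) (use s B in auto)
  show ?thesis
    unfolding schoolbook_def
    by (rule htri_mono[OF htri_HSeq[OF 1 htri_HSeq[OF 2 htri_HSeq[OF 3 4]]]]) auto
qed

text \<open>The exponent is 4 instead of 3 because the lengths of the numbers are estimated by a
  multiple of n + 1 instead of log n. It only matters that some exponent is attained.\<close>

lemma matmul_in_time_4: "matmul_in_time 4"
  unfolding matmul_in_time_def
proof (intro allI)
  fix d :: nat
  \<comment> \<open>The summands bound the partial sums of n products, the entries, and the lengths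
    of input and output.\<close>
  define B where "B n = int n ^ (2 * d + 1) + int n ^ d + (2 * (int n * int n) + 2)" for n
  define w where "w = weight schoolbook"
  define T where "T n = (3 * (n * n) + 5) * 300 * len (B n) + (n * n * (6 * n + 13) + 10) * (w * len (B n))" for n
  have "time_bounded (transducer schoolbook) (mult_input n A C) (T n) \<and>
      computes (transducer schoolbook) (mult_input n A C) (concat (mat_to_list (A * C)))"
    if AC: "A \<in> carrier_mat n n" "C \<in> carrier_mat n n"
      and small: "\<forall>i<n. \<forall>j<n. \<bar>A $$ (i, j)\<bar> \<le> int n ^ d \<and> \<bar>C $$ (i, j)\<bar> \<le> int n ^ d" for n A C
  proof -
    let ?xs = "mult_input n A C" and ?ys = "concat (mat_to_list (A * C))"
    have p: "0 \<le> int n ^ (2 * d + 1)" "0 \<le> int n ^ d" "0 \<le> int n * int n" by simp_all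
    have Bn: "int n ^ d \<le> B n" "int n ^ (2 * d + 1) \<le> B n" "2 * (int n * int n) + 2 \<le> B n"
      unfolding B_def using p by linarith+
    have B1: "1 \<le> B n" using Bn(3) p(3) by linarith
    have prod: "int n * (int n ^ d * int n ^ d) \<le> B n"
      using Bn(2) by (simp add: mult_2 power_add)
    have lA: "length (concat (mat_to_list A)) = n * n" "length (concat (mat_to_list C)) = n * n"
      "length ?ys = n * n"
      using AC by (simp_all add: length_concat_mat_to_list)
    have lx: "length ?xs = 2 * (n * n) + 1" by (simp add: mult_input_def lA)
    have sq: "int n \<le> int n * int n"
    proof -
      have "n \<le> n * n" by (cases n) auto
      then have "int n \<le> int (n * n)" by (simp only: of_nat_le_iff)
      then show ?thesis by simp
    qed
    have entry: "\<bar>x\<bar> \<le> int n ^ d" if x: "x \<in> set (concat (mat_to_list X))"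
      and X: "X \<in> carrier_mat n n" "\<And>i j. i < n \<Longrightarrow> j < n \<Longrightarrow> \<bar>X $$ (i, j)\<bar> \<le> int n ^ d" for x X
      using x X by (auto simp: mat_to_list_def)
    have x2: "\<bar>x\<bar> \<le> B n" if x: "x \<in> set ?xs" for x
    proof -
      consider "x = int n" | "x \<in> set (concat (mat_to_list A))" | "x \<in> set (concat (mat_to_list C))"
        using x unfolding mult_input_def list.set set_append by blast
      then show ?thesis
      proof cases
        case 1
        then show ?thesis using Bn(3) sq p(3) by linarith
      next
        case 2
        have "\<bar>x\<bar> \<le> int n ^ d" by (rule entry[OF 2 AC(1)]) (use small in blast)
        then show ?thesis using Bn(1) by linarith
      next
        case 3
        have "\<bar>x\<bar> \<le> int n ^ d" by (rule entry[OF 3 AC(2)]) (use small in blast)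
        then show ?thesis using Bn(1) by linarith
      qed
    qed
    have x1: "int (length ?xs) \<le> B n" and y1: "int (length ?ys) + 1 \<le> B n" and z1: "int (n * n) + 1 \<le> B n"
      unfolding lx lA using Bn(3) p(3) by (simp_all, linarith+)
    have wf: "wf_com schoolbook" by (simp add: schoolbook_def mult_loop_def)
    have wU: "weight schoolbook * len (B n) \<le> w * len (B n)" by (simp add: w_def)
    have run: "htri (B n) (w * len (B n)) schoolbook (init_state ?xs) (n * n * (6 * n + 13) + 10)
      (\<lambda>s'. fst s' 0 = 0 \<and> fst s' 1 = int (length ?ys) + 1 \<and> snd s' 7 0 = int (length ?ys) \<and>
        (\<forall>i<length ?ys. snd s' 7 (int i + 1) = ?ys ! i))"
      unfolding lA(3) by (rule htri_schoolbook[OF AC _ prod Bn(1) z1 B1]) (use small in blast)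
    have len: "(length ?xs + length ?ys + 4) * 300 * len (B n) + (n * n * (6 * n + 13) + 10) * (w * len (B n)) = T n"
      unfolding T_def lx lA by (simp add: algebra_simps)
    show ?thesis
      using transducer_correct[OF x1 x2 B1 y1 wf wU run] unfolding len by blast
  qed
  then have run: "\<forall>n. \<forall>A\<in>carrier_mat n n. \<forall>C\<in>carrier_mat n n.
           (\<forall>i<n. \<forall>j<n. \<bar>A $$ (i, j)\<bar> \<le> int n ^ d \<and> \<bar>C $$ (i, j)\<bar> \<le> int n ^ d) \<longrightarrow>
           (let xs = int n # concat (mat_to_list A) @ concat (mat_to_list C)
            in time_bounded (transducer schoolbook) xs (T n) \<and>
               computes (transducer schoolbook) xs (concat (mat_to_list (A * C))))"
    unfolding Let_def mult_input_def by blast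
  have det: "deterministic (transducer schoolbook)"
    by (rule deterministic_transducer) (simp add: schoolbook_def mult_loop_def)
  define c where "c = 3 * d + 13"
  have lenB: "len (B n) \<le> c * (n + 1)" for n
  proof -
    have "len (B n) \<le> len (int n ^ (2 * d + 1)) + len (int n ^ d) + (len (2 * (int n * int n)) + len 2)"
      unfolding B_def by (intro order_trans[OF len_add] add_mono order_refl len_add)
    also have "\<dots> \<le> ((2 * d + 1) * len (int n) + 2) + (d * len (int n) + 2) + ((len 2 + (len (int n) + len (int n))) + len 2)"
      by (intro add_mono len_power order_refl order_trans[OF len_mult] len_mult)
    also have "\<dots> \<le> ((2 * d + 1) * (n + 1) + 2) + (d * (n + 1) + 2) + ((3 + ((n + 1) + (n + 1))) + 3)"
      using len_le_iff[of 2 2] by (intro add_mono mult_le_mono len_int_le order_refl) auto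
    also have "\<dots> \<le> c * (n + 1)" by (simp add: c_def algebra_simps)
    finally show ?thesis .
  qed
  have T: "T n \<le> (1500 * c + 13 * (w * c)) * (n + 1) ^ 4" for n
  proof -
    have 1: "3 * (n * n) + 5 \<le> 5 * (n + 1) ^ 3" by (simp add: power3_eq_cube algebra_simps)
    have 2: "n * n * (6 * n + 13) + 10 \<le> 13 * (n + 1) ^ 3" by (simp add: power3_eq_cube algebra_simps)
    have "T n \<le> (5 * (n + 1) ^ 3) * 300 * (c * (n + 1)) + (13 * (n + 1) ^ 3) * (w * (c * (n + 1)))"
      unfolding T_def by (intro add_mono mult_le_mono 1 2 lenB order_refl)
    also have "\<dots> = (1500 * c + 13 * (w * c)) * ((n + 1) ^ 3 * (n + 1))" by (simp only: algebra_simps)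
    also have "(n + 1) ^ 3 * (n + 1) = (n + 1) ^ 4" by (simp add: numeral_eq_Suc)
    finally show ?thesis .
  qed
  have bigo: "(\<lambda>n. real (T n)) \<in> O(\<lambda>n. real n powr 4)"
  proof (rule bigoI)
    show "eventually (\<lambda>n. norm (real (T n)) \<le> real ((1500 * c + 13 * (w * c)) * 16) * norm (real n powr 4)) at_top"
      using eventually_ge_at_top[of 1]
    proof eventually_elim
      case (elim n)
      have "(n + 1) ^ 4 \<le> (2 * n) ^ 4" using elim by (intro power_mono) auto
      also have "\<dots> = 16 * n ^ 4" by (simp add: power_mult_distrib)
      finally have "T n \<le> (1500 * c + 13 * (w * c)) * (16 * n ^ 4)"
        using T[of n] mult_le_mono2 order_trans by blast
      then have "real (T n) \<le> real ((1500 * c + 13 * (w * c)) * (16 * n ^ 4))" by (simp only: of_nat_le_iff)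
      then show ?case using elim by (simp add: algebra_simps)
    qed
  qed
  show "\<exists>P T. deterministic P \<and>
        (\<forall>n. \<forall>A\<in>carrier_mat n n. \<forall>B\<in>carrier_mat n n.
           (\<forall>i<n. \<forall>j<n. \<bar>A $$ (i, j)\<bar> \<le> int n ^ d \<and> \<bar>B $$ (i, j)\<bar> \<le> int n ^ d) \<longrightarrow>
           (let xs = int n # concat (mat_to_list A) @ concat (mat_to_list B)
            in time_bounded P xs (T n) \<and> computes P xs (concat (mat_to_list (A * B))))) \<and>
        (\<lambda>n. real (T n)) \<in> O(\<lambda>n. real n powr 4)"
    using run det bigo by blast
qed

text \<open>The infimum of the empty set is unspecified, so the schoolbook algorithm is needed here.\<close>

lemma ex_mult_program:
  assumes "matmul_exponent = 2" "0 < \<eta>"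
  shows "\<exists>P T C. mult_program P T \<and> 0 \<le> C \<and> (\<forall>n. real (T n) \<le> C * (real n + 1) powr (2 + \<eta>))"
proof -
  have "\<exists>c. matmul_in_time c \<and> c < 2 + \<eta>"
  proof (rule ccontr)
    assume "\<not> ?thesis"
    then have "2 + \<eta> \<le> Inf {c. matmul_in_time c}"
      using matmul_in_time_4 by (intro cInf_greatest) (auto simp: not_less)
    then show False using assms by (simp add: matmul_exponent_def)
  qed
  then obtain c where c: "matmul_in_time c" "c < 2 + \<eta>" by blast
  \<comment> \<open>The bound n^1 on the entries admits 0 and 1, since n is positive as soon as
    there is an entry.\<close>
  from c(1)[unfolded matmul_in_time_def, rule_format, of 1] obtain P T where
    P: "\<And>n A B. A \<in> carrier_mat n n \<Longrightarrow> B \<in> carrier_mat n n \<Longrightarrow>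
           (\<forall>i<n. \<forall>j<n. \<bar>A $$ (i, j)\<bar> \<le> int n ^ 1 \<and> \<bar>B $$ (i, j)\<bar> \<le> int n ^ 1) \<Longrightarrow>
           time_bounded P (mult_input n A B) (T n) \<and> computes P (mult_input n A B) (concat (mat_to_list (A * B)))"
    and T: "(\<lambda>n. real (T n)) \<in> O(\<lambda>n. real n powr c)"
    unfolding Let_def mult_input_def by blast
  have "mult_program P T"
    unfolding mult_program_def
  proof (intro allI ballI impI)
    fix n and A B :: "int mat"
    assume AB: "A \<in> carrier_mat n n" "B \<in> carrier_mat n n"
      and e: "\<forall>i<n. \<forall>j<n. A $$ (i, j) \<in> {0, 1} \<and> B $$ (i, j) \<in> {0, 1}"
    have "\<bar>A $$ (i, j)\<bar> \<le> int n ^ 1 \<and> \<bar>B $$ (i, j)\<bar> \<le> int n ^ 1" if "i < n" "j < n" for i j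
      using e that by fastforce
    then show "time_bounded P (mult_input n A B) (T n) \<and> computes P (mult_input n A B) (concat (mat_to_list (A * B)))"
      using P[OF AB] by blast
  qed
  moreover obtain K where K: "K > 0" "eventually (\<lambda>n. norm (real (T n)) \<le> K * norm (real n powr c)) at_top"
    using T by (rule landau_o.bigE)
  then obtain n0 where n0: "\<And>n. n \<ge> n0 \<Longrightarrow> real (T n) \<le> K * real n powr c"
    by (auto simp: eventually_at_top_linorder)
  \<comment> \<open>The sum covers the finitely many dimensions below \<open>n0\<close>.\<close>
  define C where "C = K + (\<Sum>n<n0. real (T n))"
  have "real (T n) \<le> C * (real n + 1) powr (2 + \<eta>)" for n
  proof -
    have p1: "1 \<le> (real n + 1) powr (2 + \<eta>)" using assms(2) by (intro ge_one_powr_ge_zero) auto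
    have C0: "0 \<le> (\<Sum>n<n0. real (T n))" by (intro sum_nonneg) auto
    show ?thesis
    proof (cases "n < n0")
      case True
      then have "real (T n) \<le> (\<Sum>n<n0. real (T n))" by (intro member_le_sum) auto
      also have "\<dots> \<le> C * 1" using K(1) by (simp add: C_def)
      also have "\<dots> \<le> C * (real n + 1) powr (2 + \<eta>)" using p1 C0 K(1) by (intro mult_left_mono) (auto simp: C_def)
      finally show ?thesis .
    next
      case False
      then have "real (T n) \<le> K * real n powr c" using n0 by simp
      also have "real n powr c \<le> (real n + 1) powr (2 + \<eta>)"
      proof (cases "n = 0")
        case False
        then have "real n powr c \<le> real n powr (2 + \<eta>)" using c(2) by (intro powr_mono) auto
        also have "\<dots> \<le> (real n + 1) powr (2 + \<eta>)" using assms(2) by (intro powr_mono2) auto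
        finally show ?thesis .
      qed simp
      finally have "real (T n) \<le> K * (real n + 1) powr (2 + \<eta>)" using K(1) by simp
      also have "\<dots> \<le> C * (real n + 1) powr (2 + \<eta>)" using C0 by (intro mult_right_mono) (auto simp: C_def)
      finally show ?thesis .
    qed
  qed
  moreover have "0 \<le> C" using K(1) by (auto simp: C_def intro!: add_nonneg_nonneg sum_nonneg)
  ultimately show ?thesis by blast
qed

section \<open>Nondeterministic algorithms for unsatisfiability\<close>

text \<open>Unfolds the filter: the estimate is uniform over all instances of sufficiently large
  size. The positive constant demanded by \<open>bigo\<close> is recovered as
  \<open>max C 1\<close>.\<close>

lemma in_bigo_time_iff:
  "in_bigo_time P f g \<longleftrightarrow>
     (\<exists>C n0. \<forall>I\<in>instances P. n0 \<le> isize P I \<longrightarrow> \<bar>f I\<bar> \<le> C * \<bar>g I\<bar>)"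
proof -
  have ev: "eventually Q ((isize P) going_to at_top within instances P) \<longleftrightarrow>
      (\<exists>n0. \<forall>I\<in>instances P. n0 \<le> isize P I \<longrightarrow> Q I)" for Q
    unfolding going_to_within_def eventually_inf_principal eventually_filtercomap eventually_at_top_linorder
    by blast
  show ?thesis
    unfolding in_bigo_time_def bigo_def mem_Collect_eq ev real_norm_def
  proof
    assume "\<exists>C n0. \<forall>I\<in>instances P. n0 \<le> isize P I \<longrightarrow> \<bar>f I\<bar> \<le> C * \<bar>g I\<bar>"
    then obtain C n0 where C: "\<And>I. I \<in> instances P \<Longrightarrow> n0 \<le> isize P I \<Longrightarrow> \<bar>f I\<bar> \<le> C * \<bar>g I\<bar>" by blast
    have "\<bar>f I\<bar> \<le> max C 1 * \<bar>g I\<bar>" if "I \<in> instances P" "n0 \<le> isize P I" for I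
      using C[OF that] mult_right_mono[of C "max C 1" "\<bar>g I\<bar>"] by simp
    then show "\<exists>c>0. \<exists>n0. \<forall>I\<in>instances P. n0 \<le> isize P I \<longrightarrow> \<bar>f I\<bar> \<le> c * \<bar>g I\<bar>"
      by (intro exI[of _ "max C 1"]) auto
  qed blast
qed

text \<open>The inequality ln x <= x powr \<open>\<eta>\<close> / \<open>\<eta>\<close> turns a
  logarithm into an arbitrarily small power.\<close>

lemma len_powr:
  assumes "0 < \<eta>"
  shows "\<exists>C\<ge>0. \<forall>x. real (len (int x)) \<le> C * (real x + 1) powr \<eta>"
proof (intro exI conjI allI)
  let ?C = "2 + 1 / (\<eta> * ln 2)"
  show "0 \<le> ?C" using assms by simp
  fix x :: nat
  have one: "1 \<le> (real x + 1) powr \<eta>" using assms by (intro ge_one_powr_ge_zero) auto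
  show "real (len (int x)) \<le> ?C * (real x + 1) powr \<eta>"
  proof (cases "x = 0")
    case True
    then show ?thesis using assms by (simp add: len_numerals)
  next
    case False
    then have "real (len (int x)) = 2 + real (nat \<lfloor>log 2 (real x)\<rfloor>)"
      by (simp add: len_def floorlog_def)
    also have "\<dots> \<le> 2 + log 2 (real x)" using False by simp
    also have "log 2 (real x) = ln (real x) / ln 2" by (simp add: log_def)
    also have "\<dots> \<le> ((real x) powr \<eta> / \<eta>) / ln 2"
      using ln_powr_bound[of "real x" \<eta>] False assms by (intro divide_right_mono) auto
    also have "\<dots> \<le> ((real x + 1) powr \<eta> / \<eta>) / ln 2"
      using assms by (intro divide_right_mono powr_mono2) auto
    also have "2 + \<dots> \<le> 2 * (real x + 1) powr \<eta> + ((real x + 1) powr \<eta> / \<eta>) / ln 2"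
      using one by simp
    also have "\<dots> = ?C * (real x + 1) powr \<eta>" by (simp add: field_simps)
    finally show ?thesis by simp
  qed
qed

text \<open>From ln y <= y - 1 at y = d * (n + 1), where d is chosen such that a * d = e * ln 2. The
  constant collects what does not depend on n.\<close>

lemma powr_le_exponential:
  assumes "0 < a" "0 < e"
  shows "\<exists>C\<ge>0. \<forall>n. (real n + 1) powr a \<le> C * 2 powr (e * real n)"
proof (intro exI conjI allI)
  define d where "d = e * ln 2 / a"
  have d: "0 < d" using assms by (simp add: d_def)
  let ?C = "exp (a * d - a - a * ln d)"
  show "0 \<le> ?C" by simp
  fix n :: nat
  have "ln (d * (real n + 1)) \<le> d * (real n + 1) - 1" using d by (intro ln_le_minus_one) auto
  then have "ln (real n + 1) \<le> d * (real n + 1) - 1 - ln d" using d by (simp add: ln_mult)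
  then have "a * ln (real n + 1) \<le> a * (d * (real n + 1) - 1 - ln d)"
    using assms(1) by (intro mult_left_mono) auto
  also have "\<dots> = (a * d - a - a * ln d) + a * d * real n" by (simp add: algebra_simps)
  also have "a * d = e * ln 2" using assms(1) by (simp add: d_def)
  finally have "exp (a * ln (real n + 1)) \<le> exp ((e * ln 2 - a - a * ln d) + e * ln 2 * real n)"
    by simp
  also have "\<dots> = ?C * 2 powr (e * real n)"
    using \<open>a * d = e * ln 2\<close> by (simp add: exp_add powr_def mult_ac)
  finally show "(real n + 1) powr a \<le> ?C * 2 powr (e * real n)" by (simp add: powr_def)
qed

lemma sq_le_powr: "0 \<le> \<eta> \<Longrightarrow> real ((n + 1)\<^sup>2) \<le> (real n + 1) powr (2 + \<eta>)"
proof -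
  assume "0 \<le> \<eta>"
  then have "(real n + 1) powr 2 \<le> (real n + 1) powr (2 + \<eta>)" by (intro powr_mono) auto
  then show ?thesis by (simp add: powr_numeral add.commute)
qed

section \<open>Running times of the two certificate checkers\<close>

context binary_grammar
begin

lemma pos_ticks_powr:
  assumes "0 < \<eta>"
  shows "\<exists>C\<ge>0. \<forall>n. real (pos_ticks n) \<le> C * (real n + 1) powr (2 + \<eta>)"
proof -
  obtain C where C: "0 \<le> C" "\<And>x. real (len (int x)) \<le> C * (real x + 1) powr \<eta>"
    using len_powr[OF assms] by blast
  define K where "K = 24 * q + q * (8 * R + 30) + 76"
  have "pos_ticks n \<le> (n + 1)\<^sup>2 * (K * len (int n))" for n
  proof -
    have n2: "n * n \<le> (n + 1)\<^sup>2" "n \<le> (n + 1)\<^sup>2" "1 \<le> (n + 1)\<^sup>2" by (simp_all add: power2_eq_square)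
    have "pos_ticks n = n * n * (q * (24 * len (int n) + 8 * R + 30)) + n * n * 7 + n * 9 + 1 * 60"
      by (simp add: pos_ticks_def)
    also have "\<dots> \<le> (n + 1)\<^sup>2 * (q * (24 * len (int n) + 8 * R + 30)) + (n + 1)\<^sup>2 * 7 + (n + 1)\<^sup>2 * 9 + (n + 1)\<^sup>2 * 60"
      by (intro add_mono mult_le_mono1 n2)
    also have "\<dots> = (n + 1)\<^sup>2 * (24 * q * len (int n) + (q * (8 * R + 30) + 76))" by (simp add: algebra_simps)
    also have "\<dots> \<le> (n + 1)\<^sup>2 * (24 * q * len (int n) + (q * (8 * R + 30) + 76) * len (int n))"
      by (intro mult_le_mono2 add_left_mono le_times_len)
    also have "\<dots> = (n + 1)\<^sup>2 * (K * len (int n))" by (simp add: K_def algebra_simps)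
    finally show ?thesis .
  qed
  then have "real (pos_ticks n) \<le> real ((n + 1)\<^sup>2 * (K * len (int n)))" for n by (simp only: of_nat_le_iff)
  also have "real ((n + 1)\<^sup>2 * (K * len (int n))) \<le> (real n + 1)\<^sup>2 * (real K * (C * (real n + 1) powr \<eta>))" for n
    using C(2)[of n] by (simp add: mult_left_mono add.commute)
  also have "(real n + 1)\<^sup>2 * (real K * (C * (real n + 1) powr \<eta>)) = real K * C * (real n + 1) powr (2 + \<eta>)" for n
    by (simp add: powr_add powr_numeral)
  finally show ?thesis using C(1) by (intro exI[of _ "real K * C"]) auto
qed

lemma neg_ticks_powr:
  assumes "0 < \<eta>" "0 \<le> C" "\<And>n. real (T n) \<le> C * (real n + 1) powr (2 + \<eta>)"
  shows "\<exists>C\<ge>0. \<forall>n. real (neg_ticks T n) \<le> C * (real n + 1) powr (2 + \<eta>)"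
proof (intro exI conjI allI)
  define K where "K = 15 * q + 12 * (R * R) + R * 7 + 77"
  let ?D = "real K + 30 * (C * (real R + 1) powr (2 + \<eta>))"
  show "0 \<le> ?D" using assms(2) by simp
  fix n
  let ?p = "(real n + 1) powr (2 + \<eta>)"
  have "real (T (R * n)) \<le> C * (real (R * n) + 1) powr (2 + \<eta>)" by (rule assms(3))
  \<comment> \<open>The product has dimension \<open>R * n\<close> and not \<open>n\<close>; as the
    grammar is fixed, this costs a constant factor.\<close>
  also have "\<dots> \<le> C * ((real R + 1) * (real n + 1)) powr (2 + \<eta>)"
    using assms by (intro mult_left_mono powr_mono2) (auto simp: algebra_simps)
  also have "\<dots> = C * (real R + 1) powr (2 + \<eta>) * ?p" by (simp add: powr_mult)
  finally have T: "real (T (R * n)) \<le> C * (real R + 1) powr (2 + \<eta>) * ?p" .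
  have n2: "n * n \<le> (n + 1)\<^sup>2" "1 \<le> (n + 1)\<^sup>2" by (simp_all add: power2_eq_square)
  have "neg_ticks T n = n * n * (15 * q + 12 * (R * R) + R * 7 + 7) + 1 * 70 + 30 * T (R * n)"
    by (simp add: neg_ticks_def algebra_simps)
  also have "\<dots> \<le> (n + 1)\<^sup>2 * (15 * q + 12 * (R * R) + R * 7 + 7) + (n + 1)\<^sup>2 * 70 + 30 * T (R * n)"
    by (intro add_mono mult_le_mono1 n2 order_refl)
  also have "\<dots> = K * (n + 1)\<^sup>2 + 30 * T (R * n)" by (simp add: K_def algebra_simps)
  finally have "real (neg_ticks T n) \<le> real (K * (n + 1)\<^sup>2 + 30 * T (R * n))" by (simp only: of_nat_le_iff)
  also have "\<dots> = real K * real ((n + 1)\<^sup>2) + 30 * real (T (R * n))" by simp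
  also have "\<dots> \<le> real K * ?p + 30 * (C * (real R + 1) powr (2 + \<eta>) * ?p)"
    using T sq_le_powr[of \<eta> n] assms(1) by (intro add_mono mult_left_mono) auto
  also have "\<dots> = ?D * ?p" by (simp add: algebra_simps)
  finally show "real (neg_ticks T n) \<le> ?D * ?p" .
qed

text \<open>\<open>dmt\<close> selects the kind of certificate: refuting the formula amounts to
  refuting reachability exactly in the case of Matching Triangles.\<close>

definition cflP :: "bool \<Rightarrow> bool \<Rightarrow> com \<Rightarrow> hcom" where
  "cflP dmt st P = (if dmt then negP st P else posP st)"

definition cfl_ticks :: "bool \<Rightarrow> (nat \<Rightarrow> nat) \<Rightarrow> nat \<Rightarrow> nat" where
  "cfl_ticks dmt T n = (if dmt then neg_ticks T n else pos_ticks n)"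

lemma wf_cflP: "wf_com (cflP dmt st P)"
  by (simp add: cflP_def posP_def negP_def readP_def finalP_def mapL_def allL_def logP_def guessP_def
      execP_def guessM_def prepMult_def blockE_def checkE_def Let_def)

lemma htri_cflP:
  assumes "input_ok st n E x y B (snd s 2)" "int (cfl_bound n) \<le> B" "mult_program P T" "snd s 3 = (\<lambda>_. 0)"
  shows "htri B U (cflP dmt st P) s (cfl_ticks dmt T n) (\<lambda>s'. fst s' 0 \<noteq> 0 \<longrightarrow> hits st n x y (facts E n) \<noteq> dmt)"
proof (cases dmt)
  case True
  then show ?thesis using htri_negP[OF assms] by (simp add: cflP_def cfl_ticks_def)
next
  case False
  then show ?thesis using htri_posP[OF assms(1,2)] by (simp add: cflP_def cfl_ticks_def)
qed

lemma hcan_cflP: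
  assumes "input_ok st n E x y B (snd s 2)" "int (cfl_bound n) \<le> B" "mult_program P T" "snd s 3 = (\<lambda>_. 0)"
    and "hits st n x y (facts E n) \<noteq> dmt"
  shows "hcan B U (cflP dmt st P) s (\<lambda>s'. fst s' 0 \<noteq> 0)"
proof (cases dmt)
  case True
  then show ?thesis using hcan_negP[OF assms(1-4)] assms(5) by (simp add: cflP_def)
next
  case False
  then show ?thesis using hcan_posP[OF assms(1,2)] assms(5) by (simp add: cflP_def)
qed

lemma cfl_ticks_powr:
  assumes "0 < \<eta>" "0 \<le> C" "\<And>n. real (T n) \<le> C * (real n + 1) powr (2 + \<eta>)"
  shows "\<exists>C\<ge>0. \<forall>n. real (cfl_ticks dmt T n) \<le> C * (real n + 1) powr (2 + \<eta>)"
  using pos_ticks_powr[OF assms(1)] neg_ticks_powr[OF assms] by (cases dmt) (simp_all add: cfl_ticks_def)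

end

section \<open>The composed algorithm and the size of its graph\<close>

context sat_graph
begin

lemma wf_satP: "wf_com satP"
  by (simp add: satP_def clauseP_def colP_def litP_def mapL_def edgeE_def Let_def)

lemma length_cnf_code_le: "length cnf_code \<le> (k + 3) * N"
proof -
  have "length cnf_code \<le> 2 + m * (k + 1)" using pos_le[of m] by (simp add: length_cnf_code)
  also have "\<dots> \<le> 2 * N + N * (k + 1)" using size_bounds(6,8) by (intro add_mono mult_le_mono1) auto
  finally show ?thesis by (simp add: algebra_simps)
qed

lemma sat_ticks_le: "sat_ticks \<le> (11 * k + 165) * (N * N)"
proof -
  note S = size_bounds
  have "N * 1 \<le> N * N" using S(8) by (intro mult_le_mono2) simp
  then have NN: "N \<le> N * N" by simp
  have "m * (3 * H) \<le> N" using S unfolding N_def J_def by (simp add: algebra_simps)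
  then have "m * (3 * H) * (11 * k + 64) \<le> N * N * (11 * k + 64)" using NN by (intro mult_le_mono1) linarith
  then have "m * (3 * H * (11 * k + 64)) \<le> (11 * k + 64) * (N * N)" by (simp only: ac_simps)
  moreover have "sat_ticks = m * (3 * H * (11 * k + 64)) + (13 * m + 6 * h + 6 * N + 6 * (N * N) + 70)"
    by (simp add: sat_ticks_def algebra_simps)
  moreover have "13 * m + 6 * h + 6 * N + 6 * (N * N) + 70 \<le> 101 * (N * N)"
    using S(2,6,8) NN by linarith
  moreover have "(11 * k + 165) * (N * N) = (11 * k + 64) * (N * N) + 101 * (N * N)" by (simp add: algebra_simps)
  ultimately show ?thesis by linarith
qed

lemma cnf_code_entries: "x \<in> set cnf_code \<Longrightarrow> \<bar>x\<bar> \<le> int (N + length cnf_code)"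
proof -
  assume "x \<in> set cnf_code"
  then consider "x = int n" | "x = int m" | C where "C \<in> set F" "x = int (length C)"
    | C where "C \<in> set F" "x \<in> set C"
    by (auto simp: cnf_code_def)
  then show ?thesis
  proof cases
    case 3
    then obtain c where c: "c < m" "C = F ! c" by (metis in_set_conv_nth m_def)
    then show ?thesis using init_mem_cnf_code(4)[OF c(1)] 3 by (simp add: length_cnf_code)
  next
    case 4
    then have "\<bar>x\<bar> \<le> int n" using kcnf by (auto simp: is_kcnf_def)
    then show ?thesis using size_bounds(1) by linarith
  qed (use size_bounds in auto)
qed

text \<open>All phases share one memory: \<open>satP\<close> writes the graph into array 2, the
  reduction replaces it there by the encoded CFL instance, and the checker reads that instance.
  \<open>B\<close> has to be large enough for all phases at once.\<close>

lemma algorithm: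
  assumes "binary_grammar t q rs \<sigma>"
    and c2: "time_bounded c2 out_code T2" "computes c2 out_code ys"
    and inp: "\<And>m'. holds_output m' ys \<Longrightarrow> binary_grammar.input_ok t st nJ E x y (int B) m'"
    and hits: "binary_grammar.hits \<sigma> st nJ x y (binary_grammar.facts t rs E nJ) \<longleftrightarrow> (satisfiable F \<longleftrightarrow> dmt)"
    and P: "mult_program P T"
    and B: "N * N + N + 2 + (length cnf_code + 5) \<le> B" "binary_grammar.cfl_bound q rs nJ \<le> B"
  defines "main \<equiv> satP ;; (Foreign 2 c2 ;; binary_grammar.cflP t q rs \<sigma> dmt st P)"
  shows "time_bounded (decider main) cnf_code ((length cnf_code + 3) * 300 * len (int B) +
       (sat_ticks + 30 * T2 + binary_grammar.cfl_ticks q rs dmt T nJ + 2) * (weight main * len (int B)))"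
    and "accepts (decider main) cnf_code \<longleftrightarrow> \<not> satisfiable F"
proof -
  interpret binary_grammar t q rs \<sigma> by fact
  let ?B = "int B" and ?U = "weight main * len (int B)"
  have bnds: "bounds ?B" using B(1) unfolding bounds_def by (simp flip: of_nat_add of_nat_mult)
  have cb: "int (cfl_bound nJ) \<le> ?B" using B(2) by simp
  have wf: "wf_com main" by (simp add: main_def wf_satP wf_cflP)
  have 1: "htri ?B ?U satP (init_state cnf_code) sat_ticks (\<lambda>s'. snd s' 2 = init_mem out_code \<and> snd s' 3 = (\<lambda>_. 0))"
    by (rule htri_satP[OF bnds])
  have 2: "htri ?B ?U (Foreign 2 c2) s (30 * T2) (\<lambda>s'. input_ok st nJ E x y ?B (snd s' 2) \<and> snd s' 3 = (\<lambda>_. 0))"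
    if s: "snd s 2 = init_mem out_code \<and> snd s 3 = (\<lambda>_. 0)" for s
  proof (rule htri_Foreign[OF _ c2(1)])
    fix u m' assume "steps (c2, init_mem out_code) u (Skip, m')"
    then have "holds_output m' ys" using c2(2) unfolding computes_def by blast
    from inp[OF this] show "input_ok st nJ E x y ?B (snd (fst s, (snd s)(2 := m')) 2) \<and>
        snd (fst s, (snd s)(2 := m')) 3 = (\<lambda>_. 0)" using s by simp
  qed (use s in auto)
  have hits': "hits st nJ x y (facts E nJ) \<noteq> dmt \<longleftrightarrow> \<not> satisfiable F" using hits by blast
  have dem: "htri ?B ?U main (init_state cnf_code) (sat_ticks + 30 * T2 + cfl_ticks dmt T nJ + 2)
      (\<lambda>s'. fst s' 0 \<noteq> 0 \<longrightarrow> \<not> satisfiable F)"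
  proof -
    have "htri ?B ?U (satP ;; (Foreign 2 c2 ;; cflP dmt st P)) (init_state cnf_code)
      (sat_ticks + 30 * T2 + cfl_ticks dmt T nJ + 2) (\<lambda>s'. fst s' 0 \<noteq> 0 \<longrightarrow> \<not> satisfiable F)"
      by (rule htri_mono[OF htri_HSeq[OF 1 htri_HSeq[OF 2 htri_cflP[OF _ cb P]]]])
         (use hits' in \<open>(simp; fail) | blast\<close>)+
    then show ?thesis unfolding main_def .
  qed
  have ang: "hcan ?B ?U main (init_state cnf_code) (\<lambda>s'. fst s' 0 \<noteq> 0)" if "\<not> satisfiable F"
  proof -
    have "hcan ?B ?U (satP ;; (Foreign 2 c2 ;; cflP dmt st P)) (init_state cnf_code) (\<lambda>s'. fst s' 0 \<noteq> 0)"
      by (rule hcan_HSeq[OF hcan_if_htri[OF 1] hcan_HSeq[OF hcan_if_htri[OF 2] hcan_cflP[OF _ cb P]]])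
         (use that hits' in blast)+
    then show ?thesis unfolding main_def .
  qed
  have x1: "int (length cnf_code) \<le> ?B" using B(1) by simp
  have x2: "\<bar>x\<bar> \<le> ?B" if "x \<in> set cnf_code" for x
    using cnf_code_entries[OF that] B(1) by linarith
  have x3: "1 \<le> ?B" using B(1) by simp
  show "time_bounded (decider main) cnf_code ((length cnf_code + 3) * 300 * len (int B) +
       (sat_ticks + 30 * T2 + cfl_ticks dmt T nJ + 2) * (weight main * len (int B)))"
    "accepts (decider main) cnf_code \<longleftrightarrow> \<not> satisfiable F"
    using decider_correct[OF x1 x2 x3 wf order_refl dem ang] by blast+
qed

text \<open>Clauses are not repeated, so their number is at most the number of words of length at
  most k over 2 n literals, a polynomial in n. Rounding up the part size costs the factor 2 in
  \<open>H\<close>.\<close>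

lemma N_le:
  "real N \<le> 6 * (8 * ((real k + 1) * (2 * real n + 1) ^ k) + 3) * 2 powr (real n / 3)"
proof -
  let ?A = "{l :: int. l \<noteq> 0 \<and> \<bar>l\<bar> \<le> int n}"
  have A: "?A = {- int n..int n} - {0}" by auto
  have cA: "finite ?A" "card ?A = 2 * n" unfolding A by simp_all
  have "set F \<subseteq> {xs. set xs \<subseteq> ?A \<and> length xs \<le> k}" using kcnf by (auto simp: is_kcnf_def)
  then have "card (set F) \<le> card {xs. set xs \<subseteq> ?A \<and> length xs \<le> k}"
    by (intro card_mono finite_lists_length_le cA)
  also have "\<dots> = (\<Sum>i\<le>k. (2 * n) ^ i)" by (simp add: card_lists_length_le cA)
  also have "\<dots> \<le> (\<Sum>i\<le>k. (2 * n + 1) ^ k)"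
  proof (rule sum_mono)
    fix i assume i: "i \<in> {..k}"
    have "(2 * n) ^ i \<le> (2 * n + 1) ^ i" by (rule power_mono) auto
    also have "\<dots> \<le> (2 * n + 1) ^ k" using i by (intro power_increasing) auto
    finally show "(2 * n) ^ i \<le> (2 * n + 1) ^ k" .
  qed
  finally have "card (set F) \<le> (k + 1) * (2 * n + 1) ^ k" by simp
  then have m: "m \<le> (k + 1) * (2 * n + 1) ^ k"
    using kcnf by (simp add: m_def is_kcnf_def distinct_card)
  have "real m \<le> real ((k + 1) * (2 * n + 1) ^ k)" using m by (simp only: of_nat_le_iff)
  then have m': "real m \<le> (real k + 1) * (2 * real n + 1) ^ k" by (simp add: algebra_simps)
  have "real (n div 3) \<le> real n / 3" using div_times_less_eq_dividend[of n 3] by linarith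
  then have "(2::real) powr real h \<le> 2 powr (real n / 3 + 1)" unfolding h_def by (intro powr_mono) auto
  then have H: "real H \<le> 2 * 2 powr (real n / 3)"
    by (simp add: H_def powr_realpow powr_add mult.commute)
  have "real N = 3 * real H * (8 * real m + 3)" by (simp add: N_def J_def)
  also have "\<dots> \<le> 3 * (2 * 2 powr (real n / 3)) * (8 * ((real k + 1) * (2 * real n + 1) ^ k) + 3)"
    using H m' by (intro mult_mono) auto
  finally show ?thesis by (simp add: algebra_simps)
qed

end

section \<open>From a fine-grained reduction to the failure of NSETH\<close>

context binary_grammar
begin

text \<open>What the algorithm needs of a reduction, with source and target problem hidden behind
  the flags. The program, \<open>\<gamma>\<close> and \<open>\<delta>\<close> are chosen before
  \<open>k\<close>, which is what makes the final saving the same for all \<open>k\<close>.\<close>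

definition reducible ::
  "bool \<Rightarrow> bool \<Rightarrow> real \<Rightarrow> com \<Rightarrow> (nat \<Rightarrow> cnf \<Rightarrow> nat) \<Rightarrow> (nat \<Rightarrow> cnf \<Rightarrow> nat) \<Rightarrow> bool" where
  "reducible dmt st c c2 T2 nJ \<longleftrightarrow>
     (\<forall>k n F. is_kcnf k n F \<longrightarrow> (\<exists>ys E x y.
        time_bounded c2 (sat_graph.out_code n F dmt) (T2 n F) \<and>
        computes c2 (sat_graph.out_code n F dmt) ys \<and>
        (\<forall>m B. holds_output m ys \<longrightarrow> int (nJ n F * (nJ n F * t)) + 3 \<le> B \<longrightarrow>
           input_ok st (nJ n F) E x y B m) \<and>
        (hits st (nJ n F) x y (facts E (nJ n F)) \<longleftrightarrow> (satisfiable F \<longleftrightarrow> dmt)))) \<and>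
     (\<exists>\<gamma>>0. \<exists>C n0. \<forall>k n F. is_kcnf k n F \<longrightarrow> n0 \<le> n \<longrightarrow>
        real (T2 n F) \<le> C * real (sat_graph.N n F) powr (3 * (1 - \<gamma>))) \<and>
     (\<forall>\<epsilon>>0. \<exists>\<delta>>0. \<exists>C n0. \<forall>k n F. is_kcnf k n F \<longrightarrow> n0 \<le> n \<longrightarrow>
        real (nJ n F) powr (c * (1 - \<epsilon>)) \<le> C * real (sat_graph.N n F) powr (3 * (1 - \<delta>)))"

text \<open>All running times are bounded in terms of the number \<open>X\<close> of vertices of the
  graph for the triangle problem, logarithmic factors by small powers of \<open>X\<close>.\<close>

lemma time_bound:
  fixes X \<theta> \<eta> :: real
  assumes X: "1 \<le> X" and \<theta>: "0 < \<theta>" "\<theta> \<le> 1 / 3"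
    and len: "0 \<le> Cl" "\<And>x. real (len (int x)) \<le> Cl * (real x + 1) powr (3 * \<theta> / 22)"
    and nJ: "0 \<le> \<eta>" "0 \<le> Cd" "(real nJ + 1) powr (2 + \<eta>) \<le> Cd * X powr (3 * (1 - \<theta>))"
    and T2: "0 \<le> Ca" "real T2 \<le> Ca * X powr (3 * (1 - \<theta>))"
    and cfl: "0 \<le> Cc" "real ct \<le> Cc * (real nJ + 1) powr (2 + \<eta>)"
    and sat: "real ls \<le> Ks * X\<^sup>2" "real tk \<le> Kt * X\<^sup>2" "0 \<le> Ks" "0 \<le> Kt"
    and B: "real B + 1 \<le> Kb * X\<^sup>2 * (real nJ + 1) ^ 3" "0 \<le> Kb"
  shows "real ((ls + 3) * 300 * len (int B) + (tk + 30 * T2 + ct + 2) * (W * len (int B)))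
     \<le> (300 * (Ks + 3) + real W * (Kt + 30 * Ca + Cc * Cd + 2)) * (Cl * (Kb * Cd ^ 3) powr (3 * \<theta> / 22)) *
        X powr (3 * (1 - \<theta> / 2))"
proof -
  define Z where "Z = X powr (3 * (1 - \<theta>))"
  define L where "L = real (len (int B))"
  have X2: "X\<^sup>2 \<le> Z" "1 \<le> X\<^sup>2"
  proof -
    \<comment> \<open>Here \<open>\<theta> <= 1 / 3\<close> enters: it makes the quadratic time for
      building the graph negligible.\<close>
    have "X powr 2 \<le> X powr (3 * (1 - \<theta>))" using X \<theta> by (intro powr_mono) auto
    then show "X\<^sup>2 \<le> Z" using X by (simp add: Z_def powr_numeral)
    show "1 \<le> X\<^sup>2" using X by simp
  qed
  have L0: "0 \<le> L" by (simp add: L_def)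
  have Z0: "0 \<le> Z" "1 \<le> Z" using X2 by linarith+
  \<comment> \<open>A rough polynomial bound on the size of the CFL instance, good enough under a
    logarithm.\<close>
  have n1: "real nJ + 1 \<le> Cd * X ^ 3"
  proof -
    have "(real nJ + 1) powr 1 \<le> (real nJ + 1) powr (2 + \<eta>)" using nJ(1) by (intro powr_mono) auto
    then have "real nJ + 1 \<le> (real nJ + 1) powr (2 + \<eta>)" by simp
    also have "\<dots> \<le> Cd * X powr (3 * (1 - \<theta>))" by (rule nJ(3))
    also have "\<dots> \<le> Cd * X powr 3" using X \<theta> nJ(2) by (intro mult_left_mono powr_mono) auto
    finally show ?thesis using X by (simp add: powr_numeral)
  qed
  have "real B + 1 \<le> Kb * X\<^sup>2 * (Cd * X ^ 3) ^ 3"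
    by (rule order_trans[OF B(1)]) (intro mult_left_mono power_mono n1, use B(2) in auto)
  \<comment> \<open>11 = 2 + 3 * 3. The exponent \<open>3 * \<theta> / 22\<close> in the bound on
    lengths is chosen such that this becomes \<open>3 * \<theta> / 2\<close>, half of the
    saving.\<close>
  also have "\<dots> = (Kb * Cd ^ 3) * X ^ 11" by (simp add: power_mult_distrib flip: power_mult power_add)
  finally have B': "real B + 1 \<le> (Kb * Cd ^ 3) * X ^ 11" .
  have "L \<le> Cl * (real B + 1) powr (3 * \<theta> / 22)" unfolding L_def by (rule len(2))
  also have "\<dots> \<le> Cl * ((Kb * Cd ^ 3) * X ^ 11) powr (3 * \<theta> / 22)"
    using \<theta> by (intro mult_left_mono powr_mono2 B' len(1)) auto
  also have "\<dots> = Cl * (Kb * Cd ^ 3) powr (3 * \<theta> / 22) * X powr (3 * \<theta> / 2)"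
  proof -
    have "(X ^ 11) powr (3 * \<theta> / 22) = X powr (3 * \<theta> / 2)"
      using X by (simp add: powr_powr flip: powr_numeral)
    then show ?thesis using B(2) nJ(2) X by (simp add: powr_mult)
  qed
  finally have L: "L \<le> Cl * (Kb * Cd ^ 3) powr (3 * \<theta> / 22) * X powr (3 * \<theta> / 2)" .
  have ct: "real ct \<le> Cc * Cd * Z"
    using order_trans[OF cfl(2) mult_left_mono[OF nJ(3) cfl(1)]] by (simp add: Z_def mult.assoc)
  have "real ((ls + 3) * 300 * len (int B) + (tk + 30 * T2 + ct + 2) * (W * len (int B))) =
      ((real ls + 3) * 300 + (real tk + 30 * real T2 + real ct + 2) * real W) * L"
    by (simp add: L_def algebra_simps)
  also have "\<dots> \<le> ((Ks * Z + 3 * Z) * 300 + (Kt * Z + 30 * (Ca * Z) + Cc * Cd * Z + 2 * Z) * real W) * L"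
  proof -
    have "real ls \<le> Ks * Z" using order_trans[OF sat(1) mult_left_mono[OF X2(1) sat(3)]] .
    moreover have "real tk \<le> Kt * Z" using order_trans[OF sat(2) mult_left_mono[OF X2(1) sat(4)]] .
    moreover have "real T2 \<le> Ca * Z" using T2(2) by (simp add: Z_def)
    ultimately show ?thesis
      using Z0 ct L0 by (intro mult_right_mono add_mono) auto
  qed
  also have "\<dots> = (300 * (Ks + 3) + real W * (Kt + 30 * Ca + Cc * Cd + 2)) * (Z * L)"
    by (simp add: algebra_simps)
  also have "\<dots> \<le> (300 * (Ks + 3) + real W * (Kt + 30 * Ca + Cc * Cd + 2)) *
      (Z * (Cl * (Kb * Cd ^ 3) powr (3 * \<theta> / 22) * X powr (3 * \<theta> / 2)))"
    using L Z0 sat(3,4) T2(1) cfl(1) nJ(2) by (intro mult_left_mono) auto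
  also have "Z * (Cl * (Kb * Cd ^ 3) powr (3 * \<theta> / 22) * X powr (3 * \<theta> / 2)) =
      Cl * (Kb * Cd ^ 3) powr (3 * \<theta> / 22) * (Z * X powr (3 * \<theta> / 2))" by (simp add: mult_ac)
  also have "Z * X powr (3 * \<theta> / 2) = X powr (3 * (1 - \<theta> / 2))"
    unfolding Z_def powr_add[symmetric] by (simp add: field_simps)
  finally show ?thesis by (simp only: mult.assoc)
qed

text \<open>N is 2^(n/3) up to a polynomial whose degree depends on k. The power of N thus saves
  \<open>\<theta> / 2\<close> in the exponent of 2, and half of that is given away to absorb the
  polynomial.\<close>

lemma vertices_bound:
  assumes "0 < \<theta>" "\<theta> \<le> 1 / 3"
  shows "\<exists>C\<ge>0. \<forall>n F. is_kcnf k n F \<longrightarrow>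
    real (sat_graph.N n F) powr (3 * (1 - \<theta> / 2)) \<le> C * 2 powr ((1 - \<theta> / 4) * real n)"
proof -
  let ?e = "3 * (1 - \<theta> / 2)"
  have e: "0 \<le> ?e" "?e \<le> 3" using assms by auto
  \<comment> \<open>The outer exponent is at most 3, which gives degree 3 k; the summand 1 keeps the
    exponent positive for k = 0.\<close>
  obtain Cp where Cp: "0 \<le> Cp" "\<And>n. (real n + 1) powr (3 * real k + 1) \<le> Cp * 2 powr (\<theta> / 4 * real n)"
    using powr_le_exponential[of "3 * real k + 1" "\<theta> / 4"] assms by auto
  define Cg where "Cg = 6 * (8 * ((real k + 1) * 2 ^ k) + 3)"
  have Cg: "0 \<le> Cg" by (simp add: Cg_def)
  have main: "real (sat_graph.N n F) powr ?e \<le> (Cg powr ?e * Cp) * 2 powr ((1 - \<theta> / 4) * real n)"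
    if "is_kcnf k n F" for n F
  proof -
    interpret sat_graph k n F False by unfold_locales (rule that)
    have p: "(2 * real n + 1) ^ k \<le> 2 ^ k * (real n + 1) ^ k"
      unfolding power_mult_distrib[symmetric] by (intro power_mono) auto
    have one: "1 \<le> (real n + 1) ^ k" by simp
    have "6 * (8 * ((real k + 1) * (2 * real n + 1) ^ k) + 3)
        \<le> 6 * (8 * ((real k + 1) * (2 ^ k * (real n + 1) ^ k)) + 3 * (real n + 1) ^ k)"
      using p one by (intro mult_left_mono add_mono) auto
    also have "\<dots> = Cg * (real n + 1) ^ k" by (simp add: Cg_def algebra_simps)
    finally have "6 * (8 * ((real k + 1) * (2 * real n + 1) ^ k) + 3) * 2 powr (real n / 3)
        \<le> Cg * (real n + 1) ^ k * 2 powr (real n / 3)" by (intro mult_right_mono) auto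
    then have "real N \<le> Cg * (real n + 1) ^ k * 2 powr (real n / 3)" using N_le by linarith
    then have "real N powr ?e \<le> (Cg * (real n + 1) ^ k * 2 powr (real n / 3)) powr ?e"
      using e by (intro powr_mono2) auto
    also have "\<dots> = Cg powr ?e * ((real n + 1) ^ k) powr ?e * 2 powr (real n / 3 * ?e)"
      using Cg by (simp add: powr_mult powr_powr)
    also have "\<dots> \<le> Cg powr ?e * (Cp * 2 powr (\<theta> / 4 * real n)) * 2 powr (real n / 3 * ?e)"
    proof (intro mult_right_mono mult_left_mono)
      have "((real n + 1) ^ k) powr ?e = (real n + 1) powr (real k * ?e)"
        by (simp add: powr_powr flip: powr_realpow)
      also have "\<dots> \<le> (real n + 1) powr (3 * real k + 1)"
      proof (rule powr_mono)
        have "real k * ?e \<le> real k * 3" using e by (intro mult_left_mono) auto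
        then show "real k * ?e \<le> 3 * real k + 1" by simp
      qed simp
      also have "\<dots> \<le> Cp * 2 powr (\<theta> / 4 * real n)" by (rule Cp(2))
      finally show "((real n + 1) ^ k) powr ?e \<le> Cp * 2 powr (\<theta> / 4 * real n)" .
    qed auto
    also have "\<dots> = (Cg powr ?e * Cp) * (2 powr (\<theta> / 4 * real n) * 2 powr (real n / 3 * ?e))" by simp
    also have "2 powr (\<theta> / 4 * real n) * 2 powr (real n / 3 * ?e) = (2::real) powr ((1 - \<theta> / 4) * real n)"
      unfolding powr_add[symmetric] by (simp add: algebra_simps)
    finally show ?thesis .
  qed
  show ?thesis using main Cp(1) by (intro exI[of _ "Cg powr ?e * Cp"]) auto
qed

text \<open>The slack of the reduction pays for everything: a part makes up for the exponent
  \<open>2 + \<eta>\<close> of the checker, the rest for logarithms and for polynomials in n. The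
  saving \<open>\<theta> / 4\<close> is found before \<open>k\<close> is fixed.\<close>

lemma unsat_solvable:
  assumes red: "reducible dmt st c c2 T2 nJ" and c: "2 < c" and omega: "matmul_exponent = 2"
  shows "\<exists>\<epsilon>>0. \<forall>k. conondet_solvable (kSAT k) (\<lambda>n. 2 powr ((1 - \<epsilon>) * real n))"
proof -
  \<comment> \<open>With \<open>\<epsilon> = (c - 2) / (2 * c)\<close> the size bound of the
    reduction concerns exactly the power \<open>c * (1 - \<epsilon>) = 2 + \<eta>\<close> of the CFL
    instance, which is the time of the checker. This is where \<open>c > 2\<close> enters.\<close>
  define \<eta> where "\<eta> = (c - 2) / 2"
  have \<eta>: "0 < \<eta>" "0 < (c - 2) / (2 * c)" "c * (1 - (c - 2) / (2 * c)) = 2 + \<eta>"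
    using c by (simp_all add: \<eta>_def field_simps)
  from red obtain \<gamma> Ca na where \<gamma>: "0 < \<gamma>" "\<And>k n F. is_kcnf k n F \<Longrightarrow> na \<le> n \<Longrightarrow>
        real (T2 n F) \<le> Ca * real (sat_graph.N n F) powr (3 * (1 - \<gamma>))"
    unfolding reducible_def by metis
  from red \<eta>(2) obtain \<delta> Cb nb where \<delta>: "0 < \<delta>" "\<And>k n F. is_kcnf k n F \<Longrightarrow> nb \<le> n \<Longrightarrow>
        real (nJ n F) powr (2 + \<eta>) \<le> Cb * real (sat_graph.N n F) powr (3 * (1 - \<delta>))"
    unfolding reducible_def \<eta>(3)[symmetric] by metis
  define \<theta> where "\<theta> = min (min \<gamma> \<delta>) (1 / 3)"
  have \<theta>: "0 < \<theta>" "\<theta> \<le> 1 / 3" "\<theta> \<le> \<gamma>" "\<theta> \<le> \<delta>" using \<gamma>(1) \<delta>(1) by (auto simp: \<theta>_def)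
  obtain P Tm Cm where P: "mult_program P Tm" "0 \<le> Cm" "\<And>n. real (Tm n) \<le> Cm * (real n + 1) powr (2 + \<eta>)"
    using ex_mult_program[OF omega \<eta>(1)] by blast
  obtain Cc where Cc: "0 \<le> Cc" "\<And>n. real (cfl_ticks dmt Tm n) \<le> Cc * (real n + 1) powr (2 + \<eta>)"
    using cfl_ticks_powr[OF \<eta>(1) P(2,3)] by blast
  obtain Cl where Cl: "0 \<le> Cl" "\<And>x. real (len (int x)) \<le> Cl * (real x + 1) powr (3 * \<theta> / 22)"
    using len_powr[of "3 * \<theta> / 22"] \<theta>(1) by auto
  define main where "main = sat_graph.satP dmt ;; (Foreign 2 c2 ;; cflP dmt st P)"
  \<comment> \<open>A sum, so that each quantity to be bounded is one of its summands.\<close>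
  define B where "B n F = sat_graph.N n F * sat_graph.N n F + sat_graph.N n F + 2 +
     (length (sat_graph.cnf_code n F) + 5) + cfl_bound (nJ n F) + (nJ n F * (nJ n F * t) + 3)" for n F
  \<comment> \<open>The power of 2 comes from \<open>nJ + 1 <= 2 * nJ\<close>, and the summand 1
    covers \<open>nJ = 0\<close>. The maximum guards against a negative constant.\<close>
  define Cd where "Cd = 2 powr (2 + \<eta>) * max Cb 0 + 1"
  have Cd: "0 \<le> Cd" by (simp add: Cd_def)
  have "conondet_solvable (kSAT k) (\<lambda>n. 2 powr ((1 - \<theta> / 4) * real n))" for k
  proof -
    define T where "T = (\<lambda>(n, F). (length (sat_graph.cnf_code n F) + 3) * 300 * len (int (B n F)) +
       (sat_graph.sat_ticks k n F + 30 * T2 n F + cfl_ticks dmt Tm (nJ n F) + 2) * (weight main * len (int (B n F))))"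
    have alg: "time_bounded (decider main) (sat_graph.cnf_code n F) (T (n, F)) \<and>
        (accepts (decider main) (sat_graph.cnf_code n F) \<longleftrightarrow> \<not> satisfiable F)" if F: "is_kcnf k n F" for n F
    proof -
      interpret sat_graph k n F dmt by unfold_locales (rule F)
      obtain ys E x y where r: "time_bounded c2 out_code (T2 n F)" "computes c2 out_code ys"
        "\<And>m B. holds_output m ys \<Longrightarrow> int (nJ n F * (nJ n F * t)) + 3 \<le> B \<Longrightarrow> input_ok st (nJ n F) E x y B m"
        "hits st (nJ n F) x y (facts E (nJ n F)) \<longleftrightarrow> (satisfiable F \<longleftrightarrow> dmt)"
        using red F unfolding reducible_def by metis
      have b: "int (nJ n F * (nJ n F * t)) + 3 \<le> int (B n F)"
        "N * N + N + 2 + (length cnf_code + 5) \<le> B n F" "cfl_bound (nJ n F) \<le> B n F"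
        by (simp_all add: B_def)
      have inp: "input_ok st (nJ n F) E x y (int (B n F)) m'" if "holds_output m' ys" for m'
        using r(3)[OF that b(1)] .
      show ?thesis
        using algorithm[OF binary_grammar_axioms r(1,2) inp r(4) P(1) b(2,3)]
        unfolding T_def main_def prod.case by blast
    qed
    obtain Cv where Cv: "0 \<le> Cv" "\<And>n F. is_kcnf k n F \<Longrightarrow>
        real (sat_graph.N n F) powr (3 * (1 - \<theta> / 2)) \<le> Cv * 2 powr ((1 - \<theta> / 4) * real n)"
      using vertices_bound[OF \<theta>(1,2)] by blast
    define Kb where "Kb = real (k + 20 + 16 * (q + 1) * (R + 1)\<^sup>2 * 2 ^ R + t)"
    define K where "K = (300 * (real (k + 3) + 3) + real (weight main) * (real (11 * k + 165) + 30 * max Ca 0 + Cc * Cd + 2)) *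
        (Cl * (Kb * Cd ^ 3) powr (3 * \<theta> / 22))"
    have K: "0 \<le> K" unfolding K_def using Cl(1) Cc(1) Cd by (intro mult_nonneg_nonneg add_nonneg_nonneg) auto
    have bound: "real (T (n, F)) \<le> K * Cv * 2 powr ((1 - \<theta> / 4) * real n)"
      if F: "is_kcnf k n F" and n: "max na nb \<le> n" for n F
    proof -
      interpret sat_graph k n F dmt by unfold_locales (rule F)
      have X: "1 \<le> real N" using size_bounds(8) by simp
      have mono: "real N powr (3 * (1 - x)) \<le> real N powr (3 * (1 - \<theta>))" if "\<theta> \<le> x" for x
        using X that by (intro powr_mono) auto
      have t2: "real (T2 n F) \<le> max Ca 0 * real N powr (3 * (1 - \<theta>))"
      proof -
        have "real (T2 n F) \<le> Ca * real N powr (3 * (1 - \<gamma>))" using \<gamma>(2)[OF F] n by simp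
        also have "\<dots> \<le> max Ca 0 * real N powr (3 * (1 - \<gamma>))" by (intro mult_right_mono) auto
        also have "\<dots> \<le> max Ca 0 * real N powr (3 * (1 - \<theta>))" using mono[OF \<theta>(3)] by (intro mult_left_mono) auto
        finally show ?thesis .
      qed
      have Z1: "1 \<le> real N powr (3 * (1 - \<theta>))" using X \<theta>(2) by (intro ge_one_powr_ge_zero) auto
      have nj: "(real (nJ n F) + 1) powr (2 + \<eta>) \<le> Cd * real N powr (3 * (1 - \<theta>))"
      proof (cases "nJ n F = 0")
        case True
        have "1 * 1 \<le> Cd * real N powr (3 * (1 - \<theta>))" using Z1 by (intro mult_mono) (auto simp: Cd_def)
        then show ?thesis using True by simp
      next
        case False
        then have "(real (nJ n F) + 1) powr (2 + \<eta>) \<le> (2 * real (nJ n F)) powr (2 + \<eta>)"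
          using \<eta>(1) by (intro powr_mono2) auto
        also have "\<dots> = 2 powr (2 + \<eta>) * real (nJ n F) powr (2 + \<eta>)" by (simp add: powr_mult)
        also have "\<dots> \<le> 2 powr (2 + \<eta>) * (max Cb 0 * real N powr (3 * (1 - \<theta>)))"
        proof (intro mult_left_mono)
          have "real (nJ n F) powr (2 + \<eta>) \<le> Cb * real N powr (3 * (1 - \<delta>))" using \<delta>(2)[OF F] n by simp
          also have "\<dots> \<le> max Cb 0 * real N powr (3 * (1 - \<delta>))" by (intro mult_right_mono) auto
          also have "\<dots> \<le> max Cb 0 * real N powr (3 * (1 - \<theta>))" using mono[OF \<theta>(4)] by (intro mult_left_mono) auto
          finally show "real (nJ n F) powr (2 + \<eta>) \<le> max Cb 0 * real N powr (3 * (1 - \<theta>))" .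
        qed simp
        also have "\<dots> \<le> Cd * real N powr (3 * (1 - \<theta>))"
          unfolding Cd_def mult.assoc[symmetric] using Z1 by (intro mult_right_mono) auto
        finally show ?thesis .
      qed
      have ls: "real (length cnf_code) \<le> real (k + 3) * (real N)\<^sup>2"
      proof -
        have "length cnf_code \<le> (k + 3) * (N * N)"
          using length_cnf_code_le mult_le_mono2[OF le_square, of "k + 3" N] by (rule order_trans)
        then have "real (length cnf_code) \<le> real ((k + 3) * (N * N))" by (simp only: of_nat_le_iff)
        then show ?thesis by (simp add: power2_eq_square)
      qed
      have tk: "real sat_ticks \<le> real (11 * k + 165) * (real N)\<^sup>2"
      proof -
        have "real sat_ticks \<le> real ((11 * k + 165) * (N * N))" using sat_ticks_le by (simp only: of_nat_le_iff)
        then show ?thesis by (simp add: power2_eq_square)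
      qed
      have bb: "real (B n F) + 1 \<le> Kb * (real N)\<^sup>2 * (real (nJ n F) + 1) ^ 3"
      proof -
        define m3 where "m3 = (nJ n F + 1) ^ 3"
        define NN where "NN = N * N"
        define Kc where "Kc = 16 * (q + 1) * (R + 1)\<^sup>2 * 2 ^ R"
        have m3: "1 \<le> m3" "nJ n F * nJ n F \<le> m3" by (simp_all add: m3_def power3_eq_cube algebra_simps)
        have N1: "1 \<le> N" using size_bounds(8) by simp
        have NN: "1 \<le> NN" "N \<le> NN" using N1 mult_le_mono[OF N1 N1] mult_le_mono2[OF N1, of N] by (simp_all add: NN_def)
        have Nm: "NN \<le> NN * m3" "m3 \<le> NN * m3" using mult_le_mono2[OF m3(1), of NN] mult_le_mono1[OF NN(1), of m3] by simp_all
        have 1: "length cnf_code \<le> (k + 3) * NN"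
          using length_cnf_code_le mult_le_mono2[OF NN(2), of "k + 3"] by (rule order_trans)
        have 2: "cfl_bound (nJ n F) = Kc * m3" by (simp add: cfl_bound_def Kc_def m3_def)
        have 3: "nJ n F * (nJ n F * t) \<le> t * m3" using mult_le_mono1[OF m3(2), of t] by (simp add: mult_ac)
        have "B n F + 1 \<le> NN + NN + 11 * NN + (k + 3) * NN + Kc * m3 + t * m3"
          unfolding B_def NN_def[symmetric] 2 using 1 3 NN by linarith
        also have "\<dots> = (k + 16) * NN + (Kc + t) * m3" by (simp add: algebra_simps)
        also have "\<dots> \<le> (k + 16) * (NN * m3) + (Kc + t) * (NN * m3)" by (intro add_mono mult_le_mono2 Nm)
        also have "\<dots> \<le> (k + 20 + Kc + t) * (NN * m3)" by (simp add: algebra_simps)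
        finally have "real (B n F + 1) \<le> real ((k + 20 + Kc + t) * (NN * m3))" by (simp only: of_nat_le_iff)
        then show ?thesis
          by (simp add: Kb_def Kc_def NN_def m3_def power2_eq_square mult.assoc add.commute)
      qed
      have "real (T (n, F)) \<le> K * real N powr (3 * (1 - \<theta> / 2))"
        unfolding T_def prod.case K_def
        by (rule time_bound[OF X \<theta>(1,2) Cl _ Cd nj _ t2 Cc(1) Cc(2) ls tk _ _ bb])
           (use \<eta>(1) in \<open>auto simp: Kb_def\<close>)
      also have "\<dots> \<le> K * (Cv * 2 powr ((1 - \<theta> / 4) * real n))"
        using Cv(2)[OF F] K by (intro mult_left_mono) auto
      finally show ?thesis by (simp add: mult.assoc)
    qed
    have enc: "encode (kSAT k) (n, F) = sat_graph.cnf_code n F" if "is_kcnf k n F" for n F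
    proof -
      interpret sat_graph k n F dmt by unfold_locales (rule that)
      show ?thesis by (simp add: kSAT_def cnf_code_def m_def)
    qed
    show ?thesis
      unfolding conondet_solvable_def
    proof (intro exI conjI ballI)
      fix I assume "I \<in> instances (kSAT k)"
      then obtain n F where I: "I = (n, F)" "is_kcnf k n F" by (auto simp: kSAT_def)
      show "time_bounded (decider main) (encode (kSAT k) I) (T I)"
        "accepts (decider main) (encode (kSAT k) I) \<longleftrightarrow> \<not> yes (kSAT k) I"
        unfolding I(1) enc[OF I(2)] using alg[OF I(2)] by (simp_all add: kSAT_def)
    next
      show "in_bigo_time (kSAT k) (\<lambda>I. real (T I)) (\<lambda>I. 2 powr ((1 - \<theta> / 4) * real (isize (kSAT k) I)))"
        unfolding in_bigo_time_iff
        using bound by (intro exI[of _ "K * Cv"] exI[of _ "max na nb"]) (auto simp: kSAT_def)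
    qed
  qed
  then show ?thesis using \<theta>(1) by (intro exI[of _ "\<theta> / 4"]) auto
qed

text \<open>The reduction's estimates hold for large triangle instances; they carry over to large n
  because n is at most the number of vertices. The assumption on \<open>Q\<close> is all that has to
  be known of the target problem.\<close>

lemma reducible_if_reduction:
  assumes red: "fine_grained_reduction P (\<lambda>n. real n ^ 3) Q (\<lambda>n. real n powr c)"
    and P: "\<And>k n F. is_kcnf k n F \<Longrightarrow> inst n F \<in> instances P \<and> encode P (inst n F) = sat_graph.out_code n F dmt \<and>
        isize P (inst n F) = sat_graph.N n F \<and> (yes P (inst n F) \<longleftrightarrow> (satisfiable F \<longleftrightarrow> dmt))"
    and Q: "\<And>J. J \<in> instances Q \<Longrightarrow> \<exists>E x y.
        (\<forall>m B. holds_output m (encode Q J) \<longrightarrow> int (isize Q J * (isize Q J * t)) + 3 \<le> B \<longrightarrow>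
           input_ok st (isize Q J) E x y B m) \<and>
        (hits st (isize Q J) x y (facts E (isize Q J)) \<longleftrightarrow> yes Q J)"
  shows "\<exists>c2 T2 nJ. reducible dmt st c c2 T2 nJ"
proof -
  from red obtain c2 f T where
    I: "\<And>I. I \<in> instances P \<Longrightarrow> f I \<in> instances Q \<and> (yes P I \<longleftrightarrow> yes Q (f I)) \<and>
          time_bounded c2 (encode P I) (T I) \<and> computes c2 (encode P I) (encode Q (f I))"
    and size: "\<And>\<epsilon>. \<epsilon> > 0 \<Longrightarrow> \<exists>\<delta>>0. in_bigo_time P (\<lambda>I. (real (isize Q (f I)) powr c) powr (1 - \<epsilon>))
                                    (\<lambda>I. (real (isize P I) ^ 3) powr (1 - \<delta>))"
    and time: "\<exists>\<gamma>>0. in_bigo_time P (\<lambda>I. real (T I)) (\<lambda>I. (real (isize P I) ^ 3) powr (1 - \<gamma>))"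
    unfolding fine_grained_reduction_def by blast
  have pow: "(real n ^ 3) powr e = real n powr (3 * e)" if "n > 0" for n :: nat and e
    using that by (simp add: powr_powr flip: powr_numeral)
  have N: "0 < sat_graph.N n F" "n \<le> sat_graph.N n F" if "is_kcnf k n F" for k n F
  proof -
    interpret sat_graph k n F dmt by unfold_locales (rule that)
    show "0 < N" "n \<le> N" using size_bounds(1,8) by simp_all
  qed
  have transfer: "\<exists>C n0. \<forall>k n F. is_kcnf k n F \<longrightarrow> n0 \<le> n \<longrightarrow> g (inst n F) \<le> C * real (sat_graph.N n F) powr (3 * e)"
    if g: "in_bigo_time P g (\<lambda>I. (real (isize P I) ^ 3) powr e)" for g e
  proof -
    from g obtain C n0 where C: "\<And>I. I \<in> instances P \<Longrightarrow> n0 \<le> isize P I \<Longrightarrow>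
        \<bar>g I\<bar> \<le> C * \<bar>(real (isize P I) ^ 3) powr e\<bar>" unfolding in_bigo_time_iff by blast
    have "g (inst n F) \<le> C * real (sat_graph.N n F) powr (3 * e)" if "is_kcnf k n F" "n0 \<le> n" for k n F
      using C[of "inst n F"] P[OF that(1)] N[OF that(1)] that(2) pow[OF N(1)[OF that(1)], of e] by simp
    then show ?thesis by blast
  qed
  have "reducible dmt st c c2 (\<lambda>n F. T (inst n F)) (\<lambda>n F. isize Q (f (inst n F)))"
    unfolding reducible_def
  proof (intro conjI allI impI)
    fix k n F assume F: "is_kcnf k n F"
    note p = P[OF F] and i = I[of "inst n F"]
    from p i Q[of "f (inst n F)"] obtain E x y where
      "\<forall>m B. holds_output m (encode Q (f (inst n F))) \<longrightarrow>
           int (isize Q (f (inst n F)) * (isize Q (f (inst n F)) * t)) + 3 \<le> B \<longrightarrow>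
           input_ok st (isize Q (f (inst n F))) E x y B m"
      "hits st (isize Q (f (inst n F))) x y (facts E (isize Q (f (inst n F)))) \<longleftrightarrow> yes Q (f (inst n F))"
      by blast
    then show "\<exists>ys E x y. time_bounded c2 (sat_graph.out_code n F dmt) (T (inst n F)) \<and>
        computes c2 (sat_graph.out_code n F dmt) ys \<and>
        (\<forall>m B. holds_output m ys \<longrightarrow>
           int (isize Q (f (inst n F)) * (isize Q (f (inst n F)) * t)) + 3 \<le> B \<longrightarrow>
           input_ok st (isize Q (f (inst n F))) E x y B m) \<and>
        (hits st (isize Q (f (inst n F))) x y (facts E (isize Q (f (inst n F)))) \<longleftrightarrow> (satisfiable F \<longleftrightarrow> dmt))"
      using p i by (intro exI[of _ "encode Q (f (inst n F))"] exI[of _ E] exI[of _ x] exI[of _ y]) auto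
  next
    show "\<exists>\<gamma>>0. \<exists>C n0. \<forall>k n F. is_kcnf k n F \<longrightarrow> n0 \<le> n \<longrightarrow>
        real (T (inst n F)) \<le> C * real (sat_graph.N n F) powr (3 * (1 - \<gamma>))"
      using time transfer[of "\<lambda>I. real (T I)"] by blast
  next
    fix \<epsilon> :: real assume "\<epsilon> > 0"
    from size[OF this] obtain \<delta> where "\<delta> > 0"
      "in_bigo_time P (\<lambda>I. (real (isize Q (f I)) powr c) powr (1 - \<epsilon>)) (\<lambda>I. (real (isize P I) ^ 3) powr (1 - \<delta>))"
      by blast
    from this(1) transfer[OF this(2)] show "\<exists>\<delta>>0. \<exists>C n0. \<forall>k n F. is_kcnf k n F \<longrightarrow> n0 \<le> n \<longrightarrow>
        real (isize Q (f (inst n F))) powr (c * (1 - \<epsilon>)) \<le> C * real (sat_graph.N n F) powr (3 * (1 - \<delta>))"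
      unfolding powr_powr by blast
  qed
  then show ?thesis by blast
qed

end

lemma Triangle_Collection_instance:
  assumes "is_kcnf k n F"
  shows "sat_graph.graph n F False \<in> instances Triangle_Collection \<and>
    encode Triangle_Collection (sat_graph.graph n F False) = sat_graph.out_code n F False \<and>
    isize Triangle_Collection (sat_graph.graph n F False) = sat_graph.N n F \<and>
    (yes Triangle_Collection (sat_graph.graph n F False) \<longleftrightarrow> (satisfiable F \<longleftrightarrow> False))"
proof -
  interpret sat_graph k n F False by unfold_locales (rule assms)
  show ?thesis
    using wf_graph Triangle_Collection_graph
    by (simp add: Triangle_Collection_def out_code_def) (simp add: graph_def)
qed

lemma Delta_Matching_Triangles_instance:
  assumes "is_kcnf k n F"
  shows "(sat_graph.graph n F True, int (sat_graph.m F)) \<in> instances Delta_Matching_Triangles \<and>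
    encode Delta_Matching_Triangles (sat_graph.graph n F True, int (sat_graph.m F)) = sat_graph.out_code n F True \<and>
    isize Delta_Matching_Triangles (sat_graph.graph n F True, int (sat_graph.m F)) = sat_graph.N n F \<and>
    (yes Delta_Matching_Triangles (sat_graph.graph n F True, int (sat_graph.m F)) \<longleftrightarrow> (satisfiable F \<longleftrightarrow> True))"
proof -
  interpret sat_graph k n F True by unfold_locales (rule assms)
  have v: "verts_num graph = N" by (simp add: graph_def)
  \<comment> \<open>The threshold \<open>m\<close> has to respect the cap that instances put on
    \<open>\<Delta>\<close>.\<close>
  have "m \<le> N ^ 1" using size_bounds(6) by simp
  also have "\<dots> \<le> N ^ 3" using size_bounds(8) by (intro power_increasing) auto
  finally have "int m \<le> int (N ^ 3)" by (simp only: of_nat_le_iff)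
  then show ?thesis
    using wf_graph Delta_Matching_Triangles_graph
    by (simp add: Delta_Matching_Triangles_def out_code_def v)
qed

text \<open>The four claims are the four values of the flags \<open>dmt\<close> and
  \<open>st\<close>; each reduction would make unsatisfiability solvable with one saving for all
  \<open>k\<close>.\<close>

lemma (in item_numbering) no_reduction:
  assumes c: "2 < c" and omega: "matmul_exponent = 2" and nseth: NSETH
  shows "\<not> fine_grained_reduction Triangle_Collection (\<lambda>n. real n ^ 3) (st_CFL_reachability G) (\<lambda>n. real n powr c)"
    and "\<not> fine_grained_reduction Triangle_Collection (\<lambda>n. real n ^ 3) (all_pairs_CFL_reachability G) (\<lambda>n. real n powr c)"
    and "\<not> fine_grained_reduction Delta_Matching_Triangles (\<lambda>n. real n ^ 3) (st_CFL_reachability G) (\<lambda>n. real n powr c)"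
    and "\<not> fine_grained_reduction Delta_Matching_Triangles (\<lambda>n. real n ^ 3) (all_pairs_CFL_reachability G) (\<lambda>n. real n powr c)"
proof -
  interpret binary_grammar t q rs "nm [Nt (start G)]" by (rule binary)
  have none: "\<not> reducible dmt st c c2 T2 nJ" for dmt st c2 T2 nJ
    using unsat_solvable[OF _ c omega] nseth unfolding NSETH_def by blast
  have st: "\<exists>E x y. (\<forall>m B. holds_output m (encode (st_CFL_reachability G) J) \<longrightarrow>
        int (isize (st_CFL_reachability G) J * (isize (st_CFL_reachability G) J * t)) + 3 \<le> B \<longrightarrow>
           input_ok True (isize (st_CFL_reachability G) J) E x y B m) \<and>
        (hits True (isize (st_CFL_reachability G) J) x y (facts E (isize (st_CFL_reachability G) J)) \<longleftrightarrow>
          yes (st_CFL_reachability G) J)"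
    if J: "J \<in> instances (st_CFL_reachability G)" for J
  proof -
    obtain n E x y where J': "J = ((n, E), x, y)" by (metis prod.exhaust)
    have sz: "isize (st_CFL_reachability G) J = n" by (simp add: J' st_CFL_reachability_def)
    obtain ys where ys: "ys = encode (st_CFL_reachability G) J" by blast
    \<comment> \<open>The equivalence in \<open>st_input\<close> is independent of the memory but is
      stated for one that holds the encoding; \<open>init_mem\<close> provides it.\<close>
    have h: "holds_output (init_mem ys) ys" by (simp add: holds_output_def init_mem_def nat_add_distrib)
    show ?thesis
      unfolding sz
      using st_input(1)[OF J[unfolded J']] st_input(2)[OF J[unfolded J'] h[unfolded ys J'] order_refl]
      by (intro exI[of _ E] exI[of _ x] exI[of _ y]) (auto simp: J')
  qed
  have ap: "\<exists>E x y. (\<forall>m B. holds_output m (encode (all_pairs_CFL_reachability G) J) \<longrightarrow>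
        int (isize (all_pairs_CFL_reachability G) J * (isize (all_pairs_CFL_reachability G) J * t)) + 3 \<le> B \<longrightarrow>
           input_ok False (isize (all_pairs_CFL_reachability G) J) E x y B m) \<and>
        (hits False (isize (all_pairs_CFL_reachability G) J) x y (facts E (isize (all_pairs_CFL_reachability G) J)) \<longleftrightarrow>
          yes (all_pairs_CFL_reachability G) J)"
    if J: "J \<in> instances (all_pairs_CFL_reachability G)" for J
  proof -
    obtain n E where J': "J = (n, E)" by (metis prod.exhaust)
    have sz: "isize (all_pairs_CFL_reachability G) J = n" by (simp add: J' all_pairs_CFL_reachability_def)
    obtain ys where ys: "ys = encode (all_pairs_CFL_reachability G) J" by blast
    have h: "holds_output (init_mem ys) ys" by (simp add: holds_output_def init_mem_def nat_add_distrib)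
    show ?thesis
      unfolding sz
      using all_pairs_input(1)[OF J[unfolded J']] all_pairs_input(2)[OF J[unfolded J'] h[unfolded ys J'] order_refl]
      by (intro exI[of _ E] exI[of _ 0]) (auto simp: J')
  qed
  show "\<not> fine_grained_reduction Triangle_Collection (\<lambda>n. real n ^ 3) (st_CFL_reachability G) (\<lambda>n. real n powr c)"
  proof
    assume "fine_grained_reduction Triangle_Collection (\<lambda>n. real n ^ 3) (st_CFL_reachability G) (\<lambda>n. real n powr c)"
    then have "\<exists>c2 T2 nJ. reducible False True c c2 T2 nJ" by (rule reducible_if_reduction[OF _ Triangle_Collection_instance st])
    then show False using none by blast
  qed
  show "\<not> fine_grained_reduction Triangle_Collection (\<lambda>n. real n ^ 3) (all_pairs_CFL_reachability G) (\<lambda>n. real n powr c)"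
  proof
    assume "fine_grained_reduction Triangle_Collection (\<lambda>n. real n ^ 3) (all_pairs_CFL_reachability G) (\<lambda>n. real n powr c)"
    then have "\<exists>c2 T2 nJ. reducible False False c c2 T2 nJ" by (rule reducible_if_reduction[OF _ Triangle_Collection_instance ap])
    then show False using none by blast
  qed
  show "\<not> fine_grained_reduction Delta_Matching_Triangles (\<lambda>n. real n ^ 3) (st_CFL_reachability G) (\<lambda>n. real n powr c)"
  proof
    assume "fine_grained_reduction Delta_Matching_Triangles (\<lambda>n. real n ^ 3) (st_CFL_reachability G) (\<lambda>n. real n powr c)"
    then have "\<exists>c2 T2 nJ. reducible True True c c2 T2 nJ" by (rule reducible_if_reduction[OF _ Delta_Matching_Triangles_instance st])
    then show False using none by blast
  qed
  show "\<not> fine_grained_reduction Delta_Matching_Triangles (\<lambda>n. real n ^ 3) (all_pairs_CFL_reachability G) (\<lambda>n. real n powr c)"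
  proof
    assume "fine_grained_reduction Delta_Matching_Triangles (\<lambda>n. real n ^ 3) (all_pairs_CFL_reachability G) (\<lambda>n. real n powr c)"
    then have "\<exists>c2 T2 nJ. reducible True False c c2 T2 nJ" by (rule reducible_if_reduction[OF _ Delta_Matching_Triangles_instance ap])
    then show False using none by blast
  qed
qed

theorem theorem8:
  fixes G :: "'n cfg" and c :: real
  assumes "wf_cfg G"
    and "c > 2"
    and "matmul_exponent = 2"
    and "NSETH"
    and "\<exists>c'>2. fine_grained_reduction
                  (all_pairs_CFL_reachability G) (\<lambda>n. real n powr c)
                  (st_CFL_reachability G) (\<lambda>n. real n powr c')"
  shows "\<not> fine_grained_reduction Triangle_Collection (\<lambda>n. real n ^ 3)
            (st_CFL_reachability G) (\<lambda>n. real n powr c)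
       \<and> \<not> fine_grained_reduction Triangle_Collection (\<lambda>n. real n ^ 3)
            (all_pairs_CFL_reachability G) (\<lambda>n. real n powr c)
       \<and> \<not> fine_grained_reduction Delta_Matching_Triangles (\<lambda>n. real n ^ 3)
            (st_CFL_reachability G) (\<lambda>n. real n powr c)
       \<and> \<not> fine_grained_reduction Delta_Matching_Triangles (\<lambda>n. real n ^ 3)
            (all_pairs_CFL_reachability G) (\<lambda>n. real n powr c)"
proof -
  obtain W nm q rs where "item_numbering G W nm q rs"
    using ex_item_numbering[OF assms(1)] by blast
  then interpret item_numbering G W nm q rs .
  show ?thesis using no_reduction[OF assms(2-4)] by blast
qed

end
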